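(* Let $d\ge 2$, let $\gamma\neq 0$ and $b$ be real numbers satisfying the following conditions: either $\gamma>0$, $b>0$ and $\gamma<\frac{1}{\sqrt{d-1}}$, or $\gamma<0$, $b<-1$ and $|\gamma|<\frac2d$; and in both cases $$1-\sqrt{1-\gamma^2(d-1)}<\gamma b<1+\sqrt{1-\gamma^2(d-1)}.$$ Let $n_0\in L^1(\mathbb{R}^d)$, $n_0\ge 0$ (with $n_0\not\equiv 0$ if $\gamma<0$), let $n(t,x)$ be the solution of $$\frac{\partial n}{\partial t}=\nabla\cdot(n\nabla p)\quad\text{in }(0,\infty)\times\mathbb{R}^d,\qquad p=\operatorname{sign}(\gamma)\,n^\gamma,\qquad n(0,\cdot)=n_0,$$ and set $\alpha=\frac{1}{d\gamma+2}$. Then there exists a constant $C>0$ such that $$\max_x |p(t,x)|^b|\nabla p(t,x)|^2\le C\,t^{-1-\gamma d(b+1)\alpha}\qquad\text{for all }t>0.$$ Moreover, this exponent is sharp in that equality holds for the Barenblatt solution: if $p$ is the pressure of a Barenblatt solution $\mathcal{B}$, then $\max_x|p(t,x)|^b|\nabla p(t,x)|^2= C\,t^{-1-\gamma d(b+1)\alpha}$ for all $t>0$, for some constant $C>0$. Finally, if in addition $n_0\in L^1(\mathbb{R}^d)\cap L^\infty(\mathbb{R}^d)$, then there exists a constant $C>0$ such that $$\max_x |p(t,x)|^b|\nabla p(t,x)|^2\le C\,t^{-1}\qquad\text{for all }t>0.$$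
   Context: The equation is equivalent to $\partial_t n=\frac{|\gamma|}{\gamma+1}\Delta n^{\gamma+1}$ (porous medium equation for $\gamma>0$, fast diffusion equation for $-2/d<\gamma<0$). "The solution" is the unique nonnegative strong solution of the Cauchy problem with initial datum $n_0$ (it is continuous for $t>0$, and smooth where $n>0$; for $-2/d<\gamma<0$ it is $C^\infty$ and strictly positive on $(0,\infty)\times\mathbb{R}^d$). The notation $\max_x$ denotes the supremum over $x$; for $\gamma>0$ it is taken over points where $n(t,x)>0$. The Barenblatt solutions are $\mathcal{B}(t,x)=t^{-\alpha d}F(xt^{-\alpha})$, with $F(\xi)=\left(K-\alpha\frac{|\xi|^2}{2}\right)_+^{1/\gamma}$ if $\gamma>0$ and $F(\xi)=\left(K+\alpha\frac{|\xi|^2}{2}\right)^{1/\gamma}$ if $-2/d<\gamma<0$, where $\alpha=\frac1{d\gamma+2}$ and $K>0$ is a constant; the associated pressure is $\operatorname{sign}(\gamma)\mathcal{B}^\gamma$. *)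

theory Defs
  imports "HOL-Analysis.Analysis"
begin

definition grad :: "('a::real_inner \<Rightarrow> real) \<Rightarrow> 'a \<Rightarrow> 'a" where
  "grad f x = (THE D. GDERIV f x :> D)"

primrec C_k_on :: "nat \<Rightarrow> 'a::real_normed_vector set \<Rightarrow> ('a \<Rightarrow> real) \<Rightarrow> bool" where
  "C_k_on 0 S f \<longleftrightarrow> continuous_on S f"
| "C_k_on (Suc k) S f \<longleftrightarrow> (\<forall>x\<in>S. f differentiable (at x)) \<and>
     (\<forall>v. C_k_on k S (\<lambda>x. frechet_derivative f (at x) v))"

text \<open>Only meaningful on open sets.\<close>
definition smooth_on :: "'a::real_normed_vector set \<Rightarrow> ('a \<Rightarrow> real) \<Rightarrow> bool" where
  "smooth_on S f \<longleftrightarrow> (\<forall>k. C_k_on k S f)"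

text \<open>Points of space-time are pairs of a time and a position.\<close>
definition test_function :: "(real \<times> (real^'d) \<Rightarrow> real) \<Rightarrow> bool" where
  "test_function \<phi> \<longleftrightarrow> smooth_on UNIV \<phi> \<and>
     (\<exists>K. compact K \<and> K \<subseteq> {0<..} \<times> UNIV \<and> (\<forall>z. z \<notin> K \<longrightarrow> \<phi> z = 0))"

definition weak_time_derivative ::
    "(real \<Rightarrow> real^'d \<Rightarrow> real) \<Rightarrow> (real \<times> (real^'d) \<Rightarrow> real) \<Rightarrow> bool" where
  "weak_time_derivative u g \<longleftrightarrow> (\<forall>\<phi>. test_function \<phi> \<longrightarrow>
     (LINT (t, x)|lborel. u t x * deriv (\<lambda>s. \<phi> (s, x)) t) = - (LINT z|lborel. g z * \<phi> z))"

definition weak_divergence ::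
    "(real \<Rightarrow> real^'d \<Rightarrow> real^'d) \<Rightarrow> (real \<times> (real^'d) \<Rightarrow> real) \<Rightarrow> bool" where
  "weak_divergence J g \<longleftrightarrow> (\<forall>\<phi>. test_function \<phi> \<longrightarrow>
     (LINT (t, x)|lborel. J t x \<bullet> grad (\<lambda>y. \<phi> (t, y)) x) = - (LINT z|lborel. g z * \<phi> z))"

definition pressure :: "real \<Rightarrow> (real \<Rightarrow> real^'d \<Rightarrow> real) \<Rightarrow> real \<Rightarrow> real^'d \<Rightarrow> real" where
  "pressure \<gamma> n t x = sgn \<gamma> * n t x powr \<gamma>"

text \<open>The flux \<open>n \<nabla>p\<close>. Where \<open>n = 0\<close> the pressure need not be differentiable, but the
  factor \<open>n\<close> makes the flux vanish there whatever the value of \<open>grad\<close>.\<close>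
definition flux :: "real \<Rightarrow> (real \<Rightarrow> real^'d \<Rightarrow> real) \<Rightarrow> real \<Rightarrow> real^'d \<Rightarrow> real^'d" where
  "flux \<gamma> n t x = n t x *\<^sub>R grad (pressure \<gamma> n t) x"

text \<open>Nonnegative strong \<open>L\<^sup>1\<close> solution of \<open>\<partial>\<^sub>t n = \<nabla>\<cdot>(n \<nabla>p)\<close> with datum \<open>n0\<close>:
  \<open>n \<in> C([0,\<infinity>); L\<^sup>1)\<close>, and \<open>\<partial>\<^sub>t n\<close> and \<open>\<nabla>\<cdot>(n \<nabla>p)\<close>, taken in the sense of distributions on
  \<open>(0,\<infinity>) \<times> \<real>\<^sup>d\<close>, are one and the same function \<open>g\<close> in \<open>L\<^sup>1_loc((0,\<infinity>); L\<^sup>1)\<close>.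
  As usual for the porous medium equation, \<open>n powr (\<gamma> + 1) \<in> L\<^sup>1_loc((0,\<infinity>); L\<^sup>1)\<close> is also required when
  \<open>\<gamma> > 0\<close>; for fast diffusion this integrability fails in general.\<close>
definition strong_solution ::
    "real \<Rightarrow> (real^'d \<Rightarrow> real) \<Rightarrow> (real \<Rightarrow> real^'d \<Rightarrow> real) \<Rightarrow> bool" where
  "strong_solution \<gamma> n0 n \<longleftrightarrow>
     (\<forall>t>0. \<forall>x. 0 \<le> n t x) \<and>
     (AE x in lebesgue. n 0 x = n0 x) \<and>
     (\<forall>t\<ge>0. integrable lebesgue (n t)) \<and>
     (\<forall>s\<ge>0. ((\<lambda>t. LINT x|lebesgue. \<bar>n t x - n s x\<bar>) \<longlongrightarrow> 0) (at s within {0..})) \<and>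
     (\<gamma> > 0 \<longrightarrow> (\<forall>t1 t2. 0 < t1 \<and> t1 < t2 \<longrightarrow>
        set_integrable lborel ({t1..t2} \<times> UNIV) (\<lambda>(t, x). n t x powr (\<gamma> + 1)))) \<and>
     (\<forall>K. compact K \<and> K \<subseteq> {0<..} \<times> UNIV \<longrightarrow>
        set_integrable lborel K (\<lambda>(t, x). flux \<gamma> n t x)) \<and>
     (\<exists>g. (\<forall>t1 t2. 0 < t1 \<and> t1 < t2 \<longrightarrow> set_integrable lborel ({t1..t2} \<times> UNIV) g) \<and>
        weak_time_derivative n g \<and> weak_divergence (flux \<gamma> n) g)"

text \<open>The pointwise regularity of the (unique) strong solution: this selects its continuous
  representative for positive times and gives a meaning to \<open>\<nabla>p\<close> on \<open>{n > 0}\<close>.\<close>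
definition regular_density :: "real \<Rightarrow> (real \<Rightarrow> real^'d \<Rightarrow> real) \<Rightarrow> bool" where
  "regular_density \<gamma> n \<longleftrightarrow>
     continuous_on ({0<..} \<times> UNIV) (\<lambda>(t, x). n t x) \<and>
     smooth_on {(t, x). 0 < t \<and> 0 < n t x} (\<lambda>(t, x). n t x) \<and>
     (\<gamma> < 0 \<longrightarrow> (\<forall>t>0. \<forall>x. 0 < n t x))"

text \<open>Admissible data: \<open>n0 \<in> L\<^sup>1\<close>, \<open>n0 \<ge> 0\<close>, and \<open>n0\<close> not identically zero if \<open>\<gamma> < 0\<close>
  (as elements of \<open>L\<^sup>1\<close>, hence up to null sets).\<close>
definition admissible_datum :: "real \<Rightarrow> (real^'d \<Rightarrow> real) \<Rightarrow> bool" where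
  "admissible_datum \<gamma> n0 \<longleftrightarrow> integrable lebesgue n0 \<and> (AE x in lebesgue. 0 \<le> n0 x) \<and>
     (\<gamma> < 0 \<longrightarrow> \<not> (AE x in lebesgue. n0 x = 0))"

definition ess_bounded :: "(real^'d \<Rightarrow> real) \<Rightarrow> bool" where
  "ess_bounded f \<longleftrightarrow> (\<exists>M. AE x in lebesgue. \<bar>f x\<bar> \<le> M)"

definition similarity_exponent :: "nat \<Rightarrow> real \<Rightarrow> real" where
  "similarity_exponent d \<gamma> = 1 / (real d * \<gamma> + 2)"

definition barenblatt_profile :: "real \<Rightarrow> real \<Rightarrow> real^'d \<Rightarrow> real" where
  "barenblatt_profile \<gamma> K \<xi> = (let \<alpha> = similarity_exponent CARD('d) \<gamma> in
     if \<gamma> > 0 then max 0 (K - \<alpha> * (norm \<xi>)\<^sup>2 / 2) powr (1 / \<gamma>)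
     else (K + \<alpha> * (norm \<xi>)\<^sup>2 / 2) powr (1 / \<gamma>))"

definition barenblatt :: "real \<Rightarrow> real \<Rightarrow> real \<Rightarrow> real^'d \<Rightarrow> real" where
  "barenblatt \<gamma> K t x = (let \<alpha> = similarity_exponent CARD('d) \<gamma> in
     t powr (- \<alpha> * real CARD('d)) * barenblatt_profile \<gamma> K (t powr (- \<alpha>) *\<^sub>R x))"

text \<open>\<open>max\<^sub>x |p|\<^sup>b |\<nabla>p|\<^sup>2\<close> at time \<open>t\<close>, as a supremum in \<open>[0,\<infinity>]\<close>; for \<open>\<gamma> > 0\<close> it runs over the
  positivity set of the density.\<close>
definition max_pressure_gradient ::
    "real \<Rightarrow> real \<Rightarrow> (real \<Rightarrow> real^'d \<Rightarrow> real) \<Rightarrow> real \<Rightarrow> ennreal" where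
  "max_pressure_gradient \<gamma> b n t = (SUP x\<in>{x. \<gamma> > 0 \<longrightarrow> n t x > 0}.
     ennreal (\<bar>pressure \<gamma> n t x\<bar> powr b * (norm (grad (pressure \<gamma> n t) x))\<^sup>2))"

end

theory Submission
  imports Defs
begin

text \<open>For \<open>W = sgn \<gamma> * n powr \<theta>\<close> with a suitable \<open>\<theta>\<close>, the sup-convolution
 \<open>\<lambda>x. SUP z. W t (x + sqrt (t - t0) z) - \<kappa> |z|\<close>, rewritten as a density \<open>w \<ge> n\<close>, is a subsolution: difference
 quotients at the two points are compared by coupling steps of different lengths, and the admissible range of
 \<open>\<gamma> b\<close> is what makes the coupling work. The mass of \<open>w\<close> does not increase and that of \<open>n\<close> is conserved, so
 \<open>w = n\<close>, which says that \<open>W\<close> is Lipschitz with constant \<open>\<kappa> / sqrt (t - t0)\<close>. This bounds the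
 gradient of the pressure in terms of the supremum of \<open>n\<close>, which is at most a multiple of \<open>t powr (- \<alpha> d)\<close>:
 for \<open>\<gamma> < 0\<close> by the Lipschitz bound and the conservation of mass, for \<open>\<gamma> > 0\<close> by the inequality
 \<open>\<partial>\<^sub>t n \<ge> - n / (\<gamma> t)\<close> of Benilan and Crandall and a mean value inequality.\<close>

text \<open>A maximum principle for the gradient is hard to set up: for \<gamma> > 0 there is a free
  boundary, and decay at infinity is not known. Comparing masses only takes one-sided difference
  quotients on the positivity set and some control of the diffusion far out.

  If \<open>W_t = f(W) Delta W + h(W) |grad W|^2\<close>, comparing two points with values p < q
  after coupling leads to the condition \<open>(h q - h p) (q - p) + (d - 1) (sqrt (f q) - sqrt (f
  p))^2 \<le> - c0 (q - p)^2\<close>, whose right side pays for the decrease of the slope in time.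

  For \<gamma> > 0 the choice \<open>\<theta> = \<gamma> + \<gamma> b / 2\<close> makes
  \<open>|p|^b |grad p|^2\<close> a constant multiple of \<open>|grad W|^2\<close>, and by
  Cauchy-Schwarz the condition follows from
  \<open>(\<gamma> b - 1)^2 < 1 - (d - 1) \<gamma>^2\<close>. For \<gamma> < 0 the choice
  \<open>\<theta> = \<gamma> / 2\<close> turns it into an equality with
  \<open>c0 = 2 + d \<gamma>\<close>; the left-over factor \<open>n powr (\<gamma> (b + 1))\<close>
  has a positive exponent because \<open>b < -1\<close>.\<close>

abbreviation (input) diff2 :: "('a::real_normed_vector => real) => 'a => 'a => real" where
 "diff2 f x v \<equiv> f (x + v) + f (x - v) - 2 * f x"

abbreviation (input) diff2_comp :: "(real => real) => ('a::real_normed_vector => real) => 'a => 'a => real" where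
 "diff2_comp F f x v \<equiv> F (f (x + v)) + F (f (x - v)) - 2 * F (f x)"

text \<open>One-sided bounds, uniform in \<open>x\<close> on a ball: they supply the dominating
  function when pointwise inequalities between difference quotients are integrated. The constants
  may depend on \<open>t\<close>.\<close>

abbreviation (input) difference_bounds ::
  "(real => real) => (real => 'a::euclidean_space => real) => real => real => real => bool" where
 "difference_bounds F w R \<kappa> t \<equiv> \<exists>C \<sigma>. C \<ge> 0 \<and> \<sigma> > 0 \<and> (\<forall>x. norm x \<le> R \<longrightarrow> w t x > \<kappa> \<longrightarrow>
   (\<forall>h. 0 < h \<longrightarrow> h < \<sigma> \<longrightarrow> w t x - w (t - h) x \<le> C * h) \<and>
   (\<forall>i\<in>Basis. \<forall>s. 0 < s \<longrightarrow> s < \<sigma> \<longrightarrow> - (C * s^2) \<le> diff2_comp F (w t) x (s *\<^sub>R i)))"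

text \<open>A pointwise form of \<open>w\<^sub>t \<le> \<Delta> F(w)\<close>, by difference quotients, up to an error \<open>2 e\<close>.\<close>
abbreviation (input) infinitesimal_le ::
  "(real => real) => (real => 'a::euclidean_space => real) => real => real => 'a => bool" where
 "infinitesimal_le F w e t x \<equiv> \<exists>l. (\<forall>\<^sub>F h in at_right 0. w t x - w (t - h) x \<le> h * (l + e)) \<and>
   (\<forall>\<^sub>F s in at_right 0. s^2 * (l - e) \<le> (\<Sum>i\<in>Basis. diff2_comp F (w t) x (s *\<^sub>R i)))"

section \<open>Difference quotients of functions that are \<open>C12\<close> on an open set\<close>

lemma second_difference_tendsto:
 fixes g :: "real => real"
 assumes e: "e > 0" and g: "\<And>s. \<bar>s\<bar> < e ==> DERIV g s :> g' s"
  and g': "DERIV g' 0 :> D"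
 shows "((\<lambda>s. (g s + g (- s) - 2 * g 0) / s^2) \<longlongrightarrow> D) (at_right 0)"
\<comment> \<open>L'Hopital is used only once: \<open>g'\<close> is known to be differentiable at
  the single point 0, so the remaining limit is read off from the difference quotients of
  \<open>g'\<close> at \<open>s\<close> and \<open>- s\<close>.\<close>
proof (rule lhopital_right_0[where f' = "\<lambda>s. g' s - g' (- s)" and g' = "\<lambda>s. 2 * s"])
 have cont: "isCont g 0" using g[of 0] e by (auto intro: DERIV_isCont)
 have c2: "isCont (\<lambda>s. g s + g (- s) - 2 * g 0) 0"
  by (intro continuous_intros isCont_o2[where g = g and f = uminus]) (use cont in auto)
 show "((\<lambda>s. g s + g (- s) - 2 * g 0) \<longlongrightarrow> 0) (at_right 0)"
  using c2 unfolding isCont_def by (auto intro: tendsto_within_subset)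
 show "((\<lambda>s::real. s^2) \<longlongrightarrow> 0) (at_right 0)" by (auto intro!: tendsto_eq_intros)
 show "\<forall>\<^sub>F x::real in at_right 0. x^2 \<noteq> 0" by (auto simp: eventually_at_right_less eventually_at_filter)
 show "\<forall>\<^sub>F x::real in at_right 0. 2 * x \<noteq> 0" by (auto simp: eventually_at_filter)
 show "\<forall>\<^sub>F x in at_right 0. DERIV (\<lambda>s. g s + g (- s) - 2 * g 0) x :> g' x - g' (- x)"
  unfolding eventually_at_right_field
 proof (intro exI[of _ e] conjI allI impI e)
  fix y assume y: "0 < y" "y < e"
  show "DERIV (\<lambda>s. g s + g (- s) - 2 * g 0) y :> g' y - g' (- y)"
   using y by (auto intro!: derivative_eq_intros g DERIV_mirror[THEN iffD1])
 qed
 show "\<forall>\<^sub>F x in at_right 0. DERIV (\<lambda>s. s^2) x :> 2 * x"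
  by (auto intro!: derivative_eq_intros always_eventually)
 have 1: "((\<lambda>s. (g' s - g' 0) / s) \<longlongrightarrow> D) (at_right 0)"
  using g' by (auto simp: has_field_derivative_iff intro: tendsto_within_subset)
 have "DERIV (\<lambda>s. g' (- s)) 0 :> - D"
  by (rule DERIV_cong, rule DERIV_chain2[where f = g' and g = uminus]) (use g' in \<open>auto intro!: derivative_eq_intros\<close>)
 then have 2: "((\<lambda>s. (g' (- s) - g' 0) / s) \<longlongrightarrow> - D) (at_right 0)"
  by (auto simp: has_field_derivative_iff intro: tendsto_within_subset)
 have "((\<lambda>s. ((g' s - g' 0) / s - (g' (- s) - g' 0) / s) / 2) \<longlongrightarrow> D) (at_right 0)"
  using tendsto_divide[OF tendsto_diff[OF 1 2] tendsto_const[of 2]] by simp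
 then show "((\<lambda>s. (g' s - g' (- s)) / (2 * s)) \<longlongrightarrow> D) (at_right 0)"
  by (rule Lim_transform_eventually) (auto simp: eventually_at_filter field_simps)
qed

lemma first_difference_bound:
 fixes g :: "real => real"
 assumes "\<And>r. \<bar>r\<bar> \<le> \<bar>s\<bar> ==> DERIV g r :> g' r" "\<And>r. \<bar>r\<bar> \<le> \<bar>s\<bar> ==> \<bar>g' r\<bar> \<le> C"
 shows "\<bar>g s - g 0\<bar> \<le> C * \<bar>s\<bar>"
proof -
 have "norm (g s - g 0) \<le> C * norm (s - 0)"
  by (rule field_differentiable_bound[where S = "{- \<bar>s\<bar>..\<bar>s\<bar>}" and f' = g'])
    (use assms in \<open>auto intro: has_field_derivative_at_within\<close>)
 then show ?thesis by simp
qed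

lemma second_difference_bound:
 fixes g :: "real => real"
 assumes g: "\<And>r. \<bar>r\<bar> \<le> \<bar>s\<bar> ==> DERIV g r :> g' r"
  and g': "\<And>r. \<bar>r\<bar> \<le> \<bar>s\<bar> ==> DERIV g' r :> g'' r"
  and C: "\<And>r. \<bar>r\<bar> \<le> \<bar>s\<bar> ==> \<bar>g'' r\<bar> \<le> C"
 shows "\<bar>g s + g (- s) - 2 * g 0\<bar> \<le> 2 * C * s^2"
proof -
 have C0: "C \<ge> 0" using C[of 0] by simp
 have *: "\<bar>g' r - g' (- r)\<bar> \<le> 2 * C * \<bar>s\<bar>" if r: "\<bar>r\<bar> \<le> \<bar>s\<bar>" for r
 proof -
  have "norm (g' r - g' (- r)) \<le> C * norm (r - (- r))"
   by (rule field_differentiable_bound[where S = "{- \<bar>s\<bar>..\<bar>s\<bar>}" and f' = g''])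
     (use g' C r in \<open>auto intro: has_field_derivative_at_within\<close>)
  also have "\<dots> \<le> C * (2 * \<bar>s\<bar>)" using r C0 by (intro mult_left_mono) auto
  finally show ?thesis by simp
 qed
 have "\<bar>(\<lambda>r. g r + g (- r)) s - (\<lambda>r. g r + g (- r)) 0\<bar> \<le> (2 * C * \<bar>s\<bar>) * \<bar>s\<bar>"
  by (rule first_difference_bound[where g' = "\<lambda>r. g' r - g' (- r)"])
    (auto intro!: derivative_eq_intros DERIV_mirror[THEN iffD1] g *)
 then show ?thesis by (simp add: power2_eq_square abs_mult_self)
qed

text \<open>Membership in \<open>C\<^sup>1\<close> in time and \<open>C\<^sup>2\<close> in space, with the derivatives
 \<open>gt = \<partial>\<^sub>t g\<close>, \<open>g1 i = \<partial>\<^sub>i g\<close>, \<open>g2 i = \<partial>\<^sub>i\<partial>\<^sub>i g\<close>.\<close>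
definition C12 :: "(real \<times> 'a::euclidean_space) set => (real => 'a => real) => (real => 'a => real) =>
  ('a => real => 'a => real) => ('a => real => 'a => real) => bool" where
 "C12 P g gt g1 g2 \<longleftrightarrow> open P \<and>
   (\<forall>t x. (t, x) \<in> P \<longrightarrow> DERIV (\<lambda>s. g s x) t :> gt t x \<and>
    (\<forall>i\<in>Basis. DERIV (\<lambda>s. g t (x + s *\<^sub>R i)) 0 :> g1 i t x \<and>
          DERIV (\<lambda>s. g1 i t (x + s *\<^sub>R i)) 0 :> g2 i t x)) \<and>
   continuous_on P (\<lambda>(t, x). gt t x) \<and>
   (\<forall>i\<in>Basis. continuous_on P (\<lambda>(t, x). g1 i t x) \<and> continuous_on P (\<lambda>(t, x). g2 i t x))"

lemma line_derivative_shift: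
 fixes g :: "'a::real_normed_vector => real"
 assumes "DERIV (\<lambda>s. g ((x + r *\<^sub>R i) + s *\<^sub>R i)) 0 :> D"
 shows "DERIV (\<lambda>s. g (x + s *\<^sub>R i)) r :> D"
proof -
 have "DERIV (\<lambda>s. g (x + (r + s) *\<^sub>R i)) 0 :> D"
  using assms by (simp add: algebra_simps)
 then show ?thesis
  using DERIV_shift[of "\<lambda>s. g (x + s *\<^sub>R i)" D 0 r] by (simp add: add.commute)
qed

lemma C12_line:
 assumes "C12 P g gt g1 g2" "(t, x + r *\<^sub>R i) \<in> P" "i \<in> Basis"
 shows "DERIV (\<lambda>s. g t (x + s *\<^sub>R i)) r :> g1 i t (x + r *\<^sub>R i)"
  and "DERIV (\<lambda>s. g1 i t (x + s *\<^sub>R i)) r :> g2 i t (x + r *\<^sub>R i)"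
proof -
 have "DERIV (\<lambda>s. g t ((x + r *\<^sub>R i) + s *\<^sub>R i)) 0 :> g1 i t (x + r *\<^sub>R i)"
  "DERIV (\<lambda>s. g1 i t ((x + r *\<^sub>R i) + s *\<^sub>R i)) 0 :> g2 i t (x + r *\<^sub>R i)"
  using assms unfolding C12_def by blast+
 then show "DERIV (\<lambda>s. g t (x + s *\<^sub>R i)) r :> g1 i t (x + r *\<^sub>R i)"
  and "DERIV (\<lambda>s. g1 i t (x + s *\<^sub>R i)) r :> g2 i t (x + r *\<^sub>R i)"
  by - (rule line_derivative_shift, assumption)+
qed

lemma C12_compact_bounds:
 fixes g :: "real => 'a::euclidean_space => real"
 assumes g: "C12 P g gt g1 g2" and K: "compact K" "K \<subseteq> P"
 obtains C \<sigma> where "C > 0" "\<sigma> > 0"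
  "\<And>t x h. (t, x) \<in> K ==> \<bar>h\<bar> < \<sigma> ==> (t + h, x) \<in> P \<and> \<bar>g (t + h) x - g t x\<bar> \<le> C * \<bar>h\<bar>"
  "\<And>t x i s. (t, x) \<in> K ==> i \<in> Basis ==> \<bar>s\<bar> < \<sigma> ==> (t, x + s *\<^sub>R i) \<in> P \<and>
    \<bar>g t (x + s *\<^sub>R i) - g t x\<bar> \<le> C * \<bar>s\<bar> \<and>
    \<bar>diff2 (g t) x (s *\<^sub>R i)\<bar> \<le> C * s^2"
proof -
 have "open P" using g by (simp add: C12_def)
 obtain e where e: "e > 0" "(\<Union>z\<in>K. cball z e) \<subseteq> P"
  using compact_subset_open_imp_cball_epsilon_subset[OF K(1) \<open>open P\<close> K(2)] by blast
 \<comment> \<open>The closed \<open>e\<close>-neighbourhood of \<open>K\<close> contains every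
   short segment that starts in \<open>K\<close>, in time or in space, and is still a compact subset
   of \<open>P\<close>. Bounds of the derivatives on it feed the mean value theorem.\<close>
 define K' where "K' = {z + w |z w. z \<in> K \<and> w \<in> cball 0 e}"
 have K': "compact K'" unfolding K'_def by (intro compact_sums K compact_cball)
 have K'I: "z + w \<in> K'" if "z \<in> K" "norm w \<le> e" for z w
  using that unfolding K'_def mem_cball_0 by blast
 have K'P: "K' \<subseteq> P"
 proof
  fix p assume "p \<in> K'"
  then obtain z w where "p = z + w" "z \<in> K" "norm w \<le> e" by (auto simp: K'_def)
  then have "p \<in> cball z e" by (simp add: dist_norm)
  with e(2) \<open>z \<in> K\<close> show "p \<in> P" by blast
 qed
 have bnd: "\<exists>C. \<forall>z\<in>K'. \<bar>f z\<bar> \<le> C" if "continuous_on P f" for f :: "real \<times> 'a => real"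
  using compact_imp_bounded[OF compact_continuous_image[OF continuous_on_subset[OF that K'P] K']]
  by (auto simp: bounded_iff)
 obtain C0 where C0: "\<And>z. z \<in> K' ==> \<bar>(\<lambda>(t, x). gt t x) z\<bar> \<le> C0"
  using bnd[of "\<lambda>(t, x). gt t x"] g unfolding C12_def by blast
 have "\<forall>i\<in>Basis. \<exists>C. \<forall>z\<in>K'. \<bar>(\<lambda>(t, x). g1 i t x) z\<bar> \<le> C"
  using bnd g unfolding C12_def by blast
 then obtain C1 where C1: "\<And>i z. i \<in> Basis ==> z \<in> K' ==> \<bar>(\<lambda>(t, x). g1 i t x) z\<bar> \<le> C1 i" by metis
 have "\<forall>i\<in>Basis. \<exists>C. \<forall>z\<in>K'. \<bar>(\<lambda>(t, x). g2 i t x) z\<bar> \<le> C"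
  using bnd g unfolding C12_def by blast
 then obtain C2 where C2: "\<And>i z. i \<in> Basis ==> z \<in> K' ==> \<bar>(\<lambda>(t, x). g2 i t x) z\<bar> \<le> C2 i" by metis
 define C where "C = 1 + \<bar>C0\<bar> + (\<Sum>i\<in>Basis. \<bar>C1 i\<bar>) + 2 * (\<Sum>i\<in>Basis. \<bar>C2 i\<bar>)"
 have s1: "\<bar>C1 i\<bar> \<le> (\<Sum>i\<in>Basis. \<bar>C1 i\<bar>)" and s2: "\<bar>C2 i\<bar> \<le> (\<Sum>i\<in>Basis. \<bar>C2 i\<bar>)" if "i \<in> Basis" for i
  using that by (auto intro!: member_le_sum)
 have p1: "0 \<le> (\<Sum>i\<in>Basis. \<bar>C1 i\<bar>)" and p2: "0 \<le> (\<Sum>i\<in>Basis. \<bar>C2 i\<bar>)" by (auto intro: sum_nonneg)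
 have le: "0 < C" "C0 \<le> C" "\<And>i. i \<in> Basis ==> C1 i \<le> C" "\<And>i. i \<in> Basis ==> 2 * C2 i \<le> C"
  using p1 p2 s1 s2 abs_ge_self[of C0] abs_ge_zero[of C0] abs_ge_self[of "C1 _"] abs_ge_self[of "C2 _"]
  unfolding C_def by (smt (verit))+
 show thesis
 proof (rule that[of C e])
  show "C > 0" by (rule le)
  show "e > 0" by fact
  fix t x h assume tx: "(t, x) \<in> K" and h: "\<bar>h\<bar> < e"
  have in': "(t + r, x) \<in> K'" if "\<bar>r\<bar> \<le> \<bar>h\<bar>" for r
   using K'I[OF tx, of "(r, 0)"] that h by (simp add: norm_Pair)
  have "\<bar>g (t + h) x - g (t + 0) x\<bar> \<le> C0 * \<bar>h\<bar>"
  proof (rule first_difference_bound[where g = "\<lambda>r. g (t + r) x" and g' = "\<lambda>r. gt (t + r) x"])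
   fix r assume r: "\<bar>r\<bar> \<le> \<bar>h\<bar>"
   show "\<bar>gt (t + r) x\<bar> \<le> C0" using C0[OF in'[OF r]] by simp
   have "(t + r, x) \<in> P" using in'[OF r] K'P by blast
   then have "DERIV (\<lambda>s. g s x) (t + r) :> gt (t + r) x"
    using g unfolding C12_def by blast
   then show "DERIV (\<lambda>r. g (t + r) x) r :> gt (t + r) x"
    using DERIV_shift[of "\<lambda>s. g s x" _ r t] by (simp add: add.commute)
  qed
  also have "\<dots> \<le> C * \<bar>h\<bar>" by (intro mult_right_mono le) auto
  finally show "(t + h, x) \<in> P \<and> \<bar>g (t + h) x - g t x\<bar> \<le> C * \<bar>h\<bar>"
   using in'[of h] K'P by auto
 next
  fix t s :: real and x i :: 'a assume tx: "(t, x) \<in> K" and i: "i \<in> Basis" and s: "\<bar>s\<bar> < e"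
  have in': "(t, x + r *\<^sub>R i) \<in> K'" if "\<bar>r\<bar> \<le> \<bar>s\<bar>" for r
   using K'I[OF tx, of "(0, r *\<^sub>R i)"] that s i by (simp add: norm_Pair)
  have inP: "(t, x + r *\<^sub>R i) \<in> P" if "\<bar>r\<bar> \<le> \<bar>s\<bar>" for r
   using in'[OF that] K'P by blast
  have "\<bar>g t (x + s *\<^sub>R i) - g t (x + 0 *\<^sub>R i)\<bar> \<le> C1 i * \<bar>s\<bar>"
   by (rule first_difference_bound[where g = "\<lambda>r. g t (x + r *\<^sub>R i)" and g' = "\<lambda>r. g1 i t (x + r *\<^sub>R i)"])
     (use C12_line[OF g inP i] C1[OF i in'] in auto)
  also have "\<dots> \<le> C * \<bar>s\<bar>" by (intro mult_right_mono le i) auto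
  finally have 1: "\<bar>g t (x + s *\<^sub>R i) - g t x\<bar> \<le> C * \<bar>s\<bar>" by simp
  have "\<bar>g t (x + s *\<^sub>R i) + g t (x + (- s) *\<^sub>R i) - 2 * g t (x + 0 *\<^sub>R i)\<bar> \<le> 2 * C2 i * s^2"
   by (rule second_difference_bound[where g = "\<lambda>r. g t (x + r *\<^sub>R i)" and g' = "\<lambda>r. g1 i t (x + r *\<^sub>R i)"
      and g'' = "\<lambda>r. g2 i t (x + r *\<^sub>R i)"])
     (use C12_line[OF g inP i] C2[OF i in'] in auto)
  also have "\<dots> \<le> C * s^2" by (intro mult_right_mono le i) auto
  finally have 2: "\<bar>diff2 (g t) x (s *\<^sub>R i)\<bar> \<le> C * s^2" by simp
  show "(t, x + s *\<^sub>R i) \<in> P \<and> \<bar>g t (x + s *\<^sub>R i) - g t x\<bar> \<le> C * \<bar>s\<bar> \<and>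
    \<bar>diff2 (g t) x (s *\<^sub>R i)\<bar> \<le> C * s^2"
   using 1 2 inP[of s] by simp
 qed
qed

lemma C12_compose:
 assumes g: "C12 P g gt g1 g2" and cont: "continuous_on P (\<lambda>(t, x). g t x)"
  and I: "\<And>t x. (t, x) \<in> P ==> g t x \<in> I"
  and F: "\<And>y. y \<in> I ==> DERIV F y :> F1 y"
  and F1: "\<And>y. y \<in> I ==> DERIV F1 y :> F2 y"
  and F2: "continuous_on I F2"
 shows "C12 P (\<lambda>t x. F (g t x)) (\<lambda>t x. F1 (g t x) * gt t x) (\<lambda>i t x. F1 (g t x) * g1 i t x)
  (\<lambda>i t x. F1 (g t x) * g2 i t x + F2 (g t x) * (g1 i t x)^2)"
proof -
 have cF1: "continuous_on I F1" by (rule DERIV_continuous_on[where D = F2]) (rule has_field_derivative_at_within, rule F1)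
 have im: "(\<lambda>(t, x). g t x) ` P \<subseteq> I" using I by auto
 have c1: "continuous_on P (\<lambda>(t, x). F1 (g t x))"
  using continuous_on_compose2[OF cF1 cont im] by (simp add: case_prod_unfold)
 have c2: "continuous_on P (\<lambda>(t, x). F2 (g t x))"
  using continuous_on_compose2[OF F2 cont im] by (simp add: case_prod_unfold)
 show ?thesis
  unfolding C12_def
 proof (intro conjI allI impI ballI)
  show "open P" using g by (simp add: C12_def)
  fix t x assume tx: "(t, x) \<in> P"
  show "DERIV (\<lambda>s. F (g s x)) t :> F1 (g t x) * gt t x"
   by (rule DERIV_chain2[where f = F and g = "\<lambda>s. g s x"]) (use g tx F[OF I[OF tx]] in \<open>auto simp: C12_def\<close>)
  fix i :: 'a assume i: "i \<in> Basis"
  have d1: "DERIV (\<lambda>s. g t (x + s *\<^sub>R i)) 0 :> g1 i t x"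
   and d2: "DERIV (\<lambda>s. g1 i t (x + s *\<^sub>R i)) 0 :> g2 i t x"
   using C12_line[OF g, of t x 0 i] tx i by auto
  show "DERIV (\<lambda>s. F (g t (x + s *\<^sub>R i))) 0 :> F1 (g t x) * g1 i t x"
   by (rule DERIV_chain2[where f = F and g = "\<lambda>s. g t (x + s *\<^sub>R i)"]) (use d1 F[OF I[OF tx]] in auto)
  have d3: "DERIV (\<lambda>s. F1 (g t (x + s *\<^sub>R i))) 0 :> F2 (g t x) * g1 i t x"
   by (rule DERIV_chain2[where f = F1 and g = "\<lambda>s. g t (x + s *\<^sub>R i)"]) (use d1 F1[OF I[OF tx]] in auto)
  show "((\<lambda>s. F1 (g t (x + s *\<^sub>R i)) * g1 i t (x + s *\<^sub>R i)) has_real_derivative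
     F1 (g t x) * g2 i t x + F2 (g t x) * (g1 i t x)^2) (at 0)"
   by (rule DERIV_cong[OF DERIV_mult[OF d3 d2]]) (simp add: power2_eq_square)
 next
  show "continuous_on P (\<lambda>(t, x). F1 (g t x) * gt t x)"
   using continuous_on_mult[OF c1, of "\<lambda>(t, x). gt t x"] g unfolding C12_def case_prod_unfold by blast
  fix i :: 'a assume i: "i \<in> Basis"
  show "continuous_on P (\<lambda>(t, x). F1 (g t x) * g1 i t x)"
   using continuous_on_mult[OF c1, of "\<lambda>(t, x). g1 i t x"] g i unfolding C12_def case_prod_unfold by blast
  have "continuous_on P (\<lambda>z. (case z of (t, x) => F1 (g t x)) * (case z of (t, x) => g2 i t x) +
    (case z of (t, x) => F2 (g t x)) * (case z of (t, x) => g1 i t x)^2)"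
   by (intro continuous_on_add continuous_on_mult continuous_on_power c1 c2) (use g i in \<open>unfold C12_def, blast+\<close>)
  then show "continuous_on P (\<lambda>(t, x). F1 (g t x) * g2 i t x + F2 (g t x) * (g1 i t x)^2)"
   by (simp add: case_prod_unfold)
 qed
qed

section \<open>Integration by parts for compactly supported continuous functions\<close>

lemma integrable_bounded_support:
 fixes f :: "'a::euclidean_space => real"
 assumes [measurable]: "f \<in> borel_measurable borel" and C: "\<And>x. \<bar>f x\<bar> \<le> C"
  and R: "\<And>x. norm x > R ==> f x = 0"
 shows "integrable lborel f"
proof (rule Bochner_Integration.integrable_bound)
 show "integrable lborel (\<lambda>x::'a. C * indicat_real (cball 0 R) x)"
  by (intro integrable_mult_right integrable_real_indicator) (simp_all add: emeasure_lborel_cball_finite[unfolded infinity_ennreal_def])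
 have "C \<ge> 0" using C[of 0] by simp
 then show "AE x in lborel. norm (f x) \<le> norm (C * indicat_real (cball 0 R) x)"
  using C R by (auto simp: indicator_def abs_mult not_le[symmetric] simp del: not_le)
qed simp

lemma integrable_continuous_support:
 fixes f :: "'a::euclidean_space => real"
 assumes f: "continuous_on UNIV f" and R: "\<And>x. norm x > R ==> f x = 0"
 shows "integrable lborel f"
proof -
 have "bounded (f ` cball 0 R)"
  by (intro compact_imp_bounded compact_continuous_image continuous_on_subset[OF f]) auto
 then obtain C where C: "\<And>x. norm x \<le> R ==> \<bar>f x\<bar> \<le> C" unfolding bounded_iff by (metis image_eqI mem_cball_0 real_norm_def)
 show ?thesis
 proof (rule integrable_bounded_support)
  show "f \<in> borel_measurable borel" by (rule borel_measurable_continuous_onI[OF f])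
  show "\<bar>f x\<bar> \<le> \<bar>C\<bar>" for x using C[of x] R[of x] by (cases "norm x \<le> R") auto
 qed (rule R)
qed

lemma lborel_integral_translate:
 fixes f :: "'a::euclidean_space => real"
 assumes "f \<in> borel_measurable borel"
 shows "(LINT x|lborel. f (x + a)) = (LINT x|lborel. f x)"
proof -
 have "(LINT x|lborel. f x) = (LINT x|distr lborel borel ((+) a). f x)" by (simp add: lborel_distr_plus)
 also have "\<dots> = (LINT x|lborel. f (a + x))" using assms by (intro integral_distr) auto
 finally show ?thesis by (simp add: add.commute)
qed

text \<open>Discrete integration by parts: translation invariance of Lebesgue measure moves the
  shifts onto \<open>g\<close>, so that continuity of \<open>f\<close> is enough.\<close>

lemma integral_second_difference:
 fixes f g :: "'a::euclidean_space => real"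
 assumes f: "continuous_on UNIV f" and g: "continuous_on UNIV g" and R: "\<And>x. norm x \<ge> R ==> g x = 0"
 shows "(LINT x|lborel. (f (x + a) + f (x - a) - 2 * f x) * g x) = (LINT x|lborel. f x * (g (x + a) + g (x - a) - 2 * g x))"
proof -
 have cont: "continuous_on UNIV (\<lambda>x. h (x + b))" if "continuous_on UNIV h" for h :: "'a => real" and b
  by (rule continuous_on_compose2[OF that]) (auto intro!: continuous_intros)
 have int: "integrable lborel (\<lambda>x. h (x + b) * g (x + c))" if "continuous_on UNIV h" for h :: "'a => real" and b c
 proof (rule integrable_continuous_support[where R = "R + norm c"])
  show "continuous_on UNIV (\<lambda>x. h (x + b) * g (x + c))" by (intro continuous_intros cont that g)
  show "h (x + b) * g (x + c) = 0" if "norm x > R + norm c" for x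
  proof -
   have "norm x \<le> norm (x + c) + norm c" using norm_triangle_ineq4[of "x + c" c] by simp
   with that show ?thesis using R[of "x + c"] by simp
  qed
 qed
 have shift: "(LINT x|lborel. f (x + b) * g x) = (LINT x|lborel. f x * g (x - b))" for b
 proof -
  have "(LINT x|lborel. (\<lambda>x. f x * g (x - b)) (x + b)) = (LINT x|lborel. f x * g (x - b))"
   by (rule lborel_integral_translate) (intro borel_measurable_continuous_onI continuous_intros f
    cont[OF g, of "- b", simplified])
  then show ?thesis by simp
 qed
 have "(LINT x|lborel. (f (x + a) + f (x - a) - 2 * f x) * g x)
   = (LINT x|lborel. f (x + a) * g x + f (x - a) * g x - 2 * (f x * g x))"
  by (simp add: algebra_simps)
 also have "\<dots> = (LINT x|lborel. f x * g (x - a)) + (LINT x|lborel. f x * g (x + a)) - 2 * (LINT x|lborel. f x * g x)"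
  using int[OF f, of a 0] int[OF f, of "- a" 0] int[OF f, of 0 0] shift[of a] shift[of "- a"] by simp
 also have "\<dots> = (LINT x|lborel. f x * g (x - a) + f x * g (x + a) - 2 * (f x * g x))"
  using int[OF f, of 0 a] int[OF f, of 0 "- a"] int[OF f, of 0 0] by simp
 finally show ?thesis by (simp add: algebra_simps)
qed

text \<open>The difference quotients of \<open>F\<close> in direction \<open>v\<close> have integral
  zero by translation invariance, and they converge to \<open>F'\<close> with a common bound on a
  common ball. This is how every later integration by parts is done, in space and in
  space-time.\<close>

lemma integral_line_derivative_eq_0:
 fixes F :: "'a::euclidean_space => real"
 assumes F: "continuous_on UNIV F" and F': "continuous_on UNIV F'"
  and d: "\<And>z. DERIV (\<lambda>s. F (z + s *\<^sub>R v)) 0 :> F' z"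
  and R: "\<And>z. norm z > R ==> F z = 0"
 shows "(LINT z|lborel. F' z) = 0"
proof -
 have F'0: "F' z = 0" if z: "norm z > R" for z
 proof (rule DERIV_unique[OF d])
  have "continuous (at 0) (\<lambda>s. norm (z + s *\<^sub>R v))" by (intro continuous_intros)
  then have "((\<lambda>s. norm (z + s *\<^sub>R v)) \<longlongrightarrow> norm z) (at 0)" by (simp add: continuous_within)
  then have "\<forall>\<^sub>F s in at 0. norm (z + s *\<^sub>R v) > R" using z by (rule order_tendstoD)
  then have ev: "\<forall>\<^sub>F s in nhds 0. F (z + s *\<^sub>R v) = 0"
   unfolding eventually_at_filter using R z by (auto elim!: eventually_mono)
  show "DERIV (\<lambda>s. F (z + s *\<^sub>R v)) 0 :> 0"
   using DERIV_cong_ev[THEN iffD2, OF refl ev refl] by simp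
 qed
 have "bounded (F' ` cball 0 R)"
  by (intro compact_imp_bounded compact_continuous_image continuous_on_subset[OF F']) auto
 then obtain C0 where "\<And>x. norm x \<le> R ==> \<bar>F' x\<bar> \<le> C0" unfolding bounded_iff by (metis image_eqI mem_cball_0 real_norm_def)
 then have C: "\<bar>F' x\<bar> \<le> \<bar>C0\<bar>" for x using F'0[of x] by (cases "norm x \<le> R") force+
 define h where "h j = 1 / real (Suc j)" for j
 have h: "h j > 0" "h j \<le> 1" for j by (auto simp: h_def)
 have h0: "h \<longlonglongrightarrow> 0" unfolding h_def by (rule LIMSEQ_Suc[OF lim_1_over_n])
 have lim: "(\<lambda>j. LINT z|lborel. (F (z + h j *\<^sub>R v) - F z) / h j) \<longlonglongrightarrow> (LINT z|lborel. F' z)"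
 proof (rule integral_dominated_convergence[where w = "\<lambda>z. \<bar>C0\<bar> * indicat_real (cball 0 (R + norm v)) z"])
  show "F' \<in> borel_measurable lborel" using borel_measurable_continuous_onI[OF F'] by simp
  show "(\<lambda>z. (F (z + h j *\<^sub>R v) - F z) / h j) \<in> borel_measurable lborel" for j
  proof -
   have "continuous_on UNIV (\<lambda>z. (F (z + h j *\<^sub>R v) - F z) / h j)"
    by (intro continuous_intros continuous_on_compose2[OF F]) (use h(1)[of j] F in auto)
   then show ?thesis using borel_measurable_continuous_onI by simp
  qed
  show "integrable lborel (\<lambda>z::'a. \<bar>C0\<bar> * indicat_real (cball 0 (R + norm v)) z)"
   by (intro integrable_mult_right integrable_real_indicator) (simp_all add: emeasure_lborel_cball_finite[unfolded infinity_ennreal_def])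
  show "AE z in lborel. (\<lambda>j. (F (z + h j *\<^sub>R v) - F z) / h j) \<longlonglongrightarrow> F' z"
  proof (rule AE_I2)
   fix z
   have "((\<lambda>s. (F (z + s *\<^sub>R v) - F z) / s) \<longlongrightarrow> F' z) (at 0)"
    using d[of z] by (simp add: has_field_derivative_iff)
   moreover have "filterlim h (at 0) sequentially"
    using h0 h(1) by (auto simp: filterlim_at less_imp_neq[THEN not_sym] intro!: always_eventually)
   ultimately show "(\<lambda>j. (F (z + h j *\<^sub>R v) - F z) / h j) \<longlonglongrightarrow> F' z"
    by (rule filterlim_compose)
  qed
  show "AE z in lborel. norm ((F (z + h j *\<^sub>R v) - F z) / h j) \<le> \<bar>C0\<bar> * indicat_real (cball 0 (R + norm v)) z" for j
  proof (rule AE_I2)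
   fix z
   show "norm ((F (z + h j *\<^sub>R v) - F z) / h j) \<le> \<bar>C0\<bar> * indicat_real (cball 0 (R + norm v)) z"
   proof (cases "norm z \<le> R + norm v")
    case True
    have "\<bar>F (z + h j *\<^sub>R v) - F (z + 0 *\<^sub>R v)\<bar> \<le> \<bar>C0\<bar> * \<bar>h j\<bar>"
     by (rule first_difference_bound[where g' = "\<lambda>r. F' (z + r *\<^sub>R v)"])
       (auto intro: line_derivative_shift d C)
    then show ?thesis using True h(1)[of j] by (simp add: divide_simps)
   next
    case False
    have "norm (h j *\<^sub>R v) \<le> norm v" using h[of j] by (simp add: mult_left_le_one_le)
    moreover have "norm z \<le> norm (z + h j *\<^sub>R v) + norm (h j *\<^sub>R v)"
     using norm_triangle_ineq4[of "z + h j *\<^sub>R v" "h j *\<^sub>R v"] by simp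
    ultimately have "norm (z + h j *\<^sub>R v) > R" using False by linarith
    moreover have "norm z > R" using False norm_ge_zero[of v] by linarith
    ultimately show ?thesis using R False by simp
   qed
  qed
 qed
 have "(\<lambda>j. LINT z|lborel. (F (z + h j *\<^sub>R v) - F z) / h j) = (\<lambda>j. 0)"
 proof
  fix j
  have b: "F \<in> borel_measurable borel" by (rule borel_measurable_continuous_onI[OF F])
  have i1: "integrable lborel F" by (rule integrable_continuous_support[OF F R])
  have i2: "integrable lborel (\<lambda>z. F (z + h j *\<^sub>R v))"
  proof (rule integrable_continuous_support[where R = "R + norm (h j *\<^sub>R v)"])
   show "continuous_on UNIV (\<lambda>z. F (z + h j *\<^sub>R v))"
    by (intro continuous_intros continuous_on_compose2[OF F]) auto
   show "F (z + h j *\<^sub>R v) = 0" if "norm z > R + norm (h j *\<^sub>R v)" for z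
   proof (rule R)
    have "norm z \<le> norm (z + h j *\<^sub>R v) + norm (h j *\<^sub>R v)"
     using norm_triangle_ineq4[of "z + h j *\<^sub>R v" "h j *\<^sub>R v"] by simp
    then show "norm (z + h j *\<^sub>R v) > R" using that by linarith
   qed
  qed
  show "(LINT z|lborel. (F (z + h j *\<^sub>R v) - F z) / h j) = 0"
   using i1 i2 lborel_integral_translate[OF b, of "h j *\<^sub>R v"] by simp
 qed
 with lim show ?thesis by (simp only: LIMSEQ_const_iff)
qed

section \<open>Growth of truncated masses\<close>

text \<open>The Laplacian is read as a limit of second difference quotients: on \<open>{w > \<kappa>}\<close> they dominate the
 time difference quotients of \<open>w\<close>, and summing them by parts puts them on the weight \<open>\<zeta>\<close>.\<close>
lemma truncated_mass_difference:
 fixes w :: "real => 'a::euclidean_space => real"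
 assumes at: "a < t"
  and wc: "\<And>s. s \<in> {a..t} ==> continuous_on UNIV (w s)"
  and w0: "\<And>s x. s \<in> {a..t} ==> 0 \<le> w s x"
  and Phi: "continuous_on {0..} \<Phi>" "\<And>x y. 0 \<le> x ==> x < y ==> \<Phi> x < \<Phi> y"
  and k: "\<kappa> \<ge> 0"
  and z: "C12 UNIV (\<lambda>t. \<zeta>) (\<lambda>t x. 0) (\<lambda>i t. z1 i) (\<lambda>i t. z2 i)"
  and zc: "continuous_on UNIV \<zeta>" and z0: "\<And>x. 0 \<le> \<zeta> x" and zR: "\<And>x. norm x \<ge> R ==> \<zeta> x = 0"
  and C: "C \<ge> 0" and sig: "\<sigma> > 0"
  and dt: "\<And>x h. norm x \<le> R ==> w t x > \<kappa> ==> 0 < h ==> h < \<sigma> ==> w t x - w (t - h) x \<le> C * h"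
  and dx: "\<And>x i s. norm x \<le> R ==> w t x > \<kappa> ==> i \<in> Basis ==> 0 < s ==> s < \<sigma> ==>
    - (C * s^2) \<le> diff2_comp \<Phi> (w t) x (s *\<^sub>R i)"
  and pt: "\<And>x e. norm x \<le> R ==> w t x > \<kappa> ==> e > 0 ==> infinitesimal_le \<Phi> w e t x"
  and e: "e > 0"
 shows "\<forall>\<^sub>F h in at_right 0.
  (LINT x|lborel. max 0 (w t x - \<kappa>) * \<zeta> x) - (LINT x|lborel. max 0 (w (t - h) x - \<kappa>) * \<zeta> x)
   \<le> h * ((LINT x|lborel. max 0 (\<Phi> (w t x) - \<Phi> \<kappa>) * (\<Sum>i\<in>Basis. z2 i x)) + e)"
proof -
 have "compact ({0::real} \<times> cball (0::'a) (R + 1))" by (intro compact_Times) auto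
 from C12_compact_bounds[OF z this]
 obtain Cz \<sigma>z where Cz: "Cz > 0" "\<sigma>z > 0"
  and zb: "\<And>x i s. norm x \<le> R + 1 ==> i \<in> Basis ==> \<bar>s\<bar> < \<sigma>z ==>
   \<bar>diff2 \<zeta> x (s *\<^sub>R i)\<bar> \<le> Cz * s^2"
  by (metis UNIV_I mem_Sigma_iff mem_cball_0 singletonI subset_UNIV)
 have z2c: "continuous_on UNIV (z2 i)" if "i \<in> Basis" for i
 proof -
  have "continuous_on UNIV (\<lambda>(t::real, x). z2 i x)" using z that unfolding C12_def by blast
  from continuous_on_compose2[OF this, of UNIV "\<lambda>x. (0, x)"] show ?thesis
   by (simp add: continuous_on_Pair continuous_on_const continuous_on_id)
 qed
 show ?thesis
\<comment> \<open>The limit from the right is tested along sequences so that dominated convergence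
  applies. The same \<open>h n\<close> is both the time step and the space step; no parabolic
  relation between them is required, since the two quotients are compared with the same number
  \<open>l\<close> separately.\<close>
proof (rule sequentially_imp_eventually_at_right[where b = "min (min \<sigma> (t - a)) (min \<sigma>z 1)"])
 show "0 < min (min \<sigma> (t - a)) (min \<sigma>z 1)" using at sig Cz by simp
 fix h :: "nat => real" assume h0: "\<And>n. 0 < h n" and hb: "\<And>n. h n < min (min \<sigma> (t - a)) (min \<sigma>z 1)"
  and hl: "h \<longlonglongrightarrow> 0"
 have tin: "t \<in> {a..t}" using at by simp
 have thin: "t - h n \<in> {a..t}" for n using h0[of n] hb[of n] by auto
 have hs: "h n < \<sigma>" "h n < \<sigma>z" "h n < 1" for n using hb[of n] by auto
 have hat: "filterlim h (at_right 0) sequentially"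
  using hl h0 less_imp_neq[OF h0] by (auto simp: filterlim_at intro!: always_eventually)
 define W where "W x = \<Phi> (w t x)" for x
 define G where "G x = max 0 (W x - \<Phi> \<kappa>)" for x
 define D where "D n x = (\<Sum>i\<in>Basis. diff2 W x (h n *\<^sub>R i)) / (h n)^2" for n x
 define DG where "DG n x = (\<Sum>i\<in>Basis. diff2 G x (h n *\<^sub>R i)) / (h n)^2" for n x
 define S where "S n x = (\<Sum>i\<in>Basis. diff2 \<zeta> x (h n *\<^sub>R i)) / (h n)^2" for n x
 define A where "A = {x. w t x > \<kappa> \<and> norm x \<le> R}"
 define q where "q n x = (w t x - w (t - h n) x) / h n" for n x
 \<comment> \<open>The amount by which the time quotient exceeds the space quotient on
   \<open>A\<close>. By \<open>pt\<close> it tends to 0 pointwise, by \<open>dt\<close> and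
   \<open>dx\<close> it is dominated, so its integral tends to 0.\<close>
 define X where "X n x = (if x \<in> A then max 0 (q n x - D n x) * \<zeta> x else 0)" for n x
 have mono: "x \<le> y ==> \<Phi> x \<le> \<Phi> y" if "0 \<le> x" for x y using Phi(2)[OF that, of y] by (cases "x = y") auto
 have shc: "continuous_on UNIV (\<lambda>x. f (x + b))" "continuous_on UNIV (\<lambda>x. f (x - b))"
  if "continuous_on UNIV f" for f :: "'a => real" and b
  by (rule continuous_on_compose2[OF that]; auto intro!: continuous_intros)+
 have Wc: "continuous_on UNIV W"
  unfolding W_def by (rule continuous_on_compose2[OF Phi(1) wc[OF tin]]) (use w0[OF tin] in auto)
 have Gc: "continuous_on UNIV G" unfolding G_def by (intro continuous_intros Wc)
 have Dc: "continuous_on UNIV (D n)" for n unfolding D_def by (intro continuous_intros Wc shc) (use h0[of n] in auto)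
 have DGc: "continuous_on UNIV (DG n)" for n unfolding DG_def by (intro continuous_intros Gc shc) (use h0[of n] in auto)
 have Sc: "continuous_on UNIV (S n)" for n unfolding S_def by (intro continuous_intros zc shc) (use h0[of n] in auto)
 have qc: "continuous_on UNIV (q n)" for n
  unfolding q_def by (intro continuous_intros wc tin thin) (use h0[of n] in auto)
 have [measurable]: "w t \<in> borel_measurable borel" "\<zeta> \<in> borel_measurable borel"
  "q n \<in> borel_measurable borel" "D n \<in> borel_measurable borel" for n
  by (intro borel_measurable_continuous_onI wc tin zc qc Dc)+
 have [measurable]: "Measurable.pred borel (\<lambda>x. x \<in> A)" unfolding A_def by measurable
 have intz: "integrable lborel (\<lambda>x. f x * \<zeta> x)" if "continuous_on UNIV f" for f
  by (rule integrable_continuous_support[where R = R]) (auto intro!: continuous_intros that zc simp: zR)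
 have GS: "(LINT x|lborel. DG n x * \<zeta> x) = (LINT x|lborel. G x * S n x)" for n
 proof -
  have i1: "integrable lborel (\<lambda>x. (diff2 G x (h n *\<^sub>R i)) * \<zeta> x)" for i
   by (rule intz) (intro continuous_intros Gc shc)
  have i2: "integrable lborel (\<lambda>x. G x * (diff2 \<zeta> x (h n *\<^sub>R i)))" if "i \<in> Basis" for i
  proof (rule integrable_continuous_support[where R = "R + 1"])
   show "continuous_on UNIV (\<lambda>x. G x * (diff2 \<zeta> x (h n *\<^sub>R i)))"
    by (intro continuous_intros Gc shc zc)
   fix x :: 'a assume x: "norm x > R + 1"
   have "norm (h n *\<^sub>R i) \<le> 1" using that h0[of n] hs[of n] by simp
   then have "norm (x + h n *\<^sub>R i) \<ge> R" "norm (x - h n *\<^sub>R i) \<ge> R"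
    using x norm_diff_ineq[of x "h n *\<^sub>R i"] norm_triangle_ineq2[of x "h n *\<^sub>R i"] by linarith+
   then show "G x * (diff2 \<zeta> x (h n *\<^sub>R i)) = 0" using x by (simp add: zR)
  qed
  have "(LINT x|lborel. DG n x * \<zeta> x)
    = (LINT x|lborel. (\<Sum>i\<in>Basis. (diff2 G x (h n *\<^sub>R i)) * \<zeta> x) / (h n)^2)"
   by (simp add: DG_def sum_distrib_right)
  also have "\<dots> = (\<Sum>i\<in>Basis. LINT x|lborel. (diff2 G x (h n *\<^sub>R i)) * \<zeta> x) / (h n)^2"
   by (simp add: Bochner_Integration.integral_sum i1)
  also have "\<dots> = (\<Sum>i\<in>Basis. LINT x|lborel. G x * (diff2 \<zeta> x (h n *\<^sub>R i))) / (h n)^2"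
   by (simp add: integral_second_difference[OF Gc zc zR])
  also have "\<dots> = (LINT x|lborel. (\<Sum>i\<in>Basis. G x * (diff2 \<zeta> x (h n *\<^sub>R i))) / (h n)^2)"
   by (simp add: Bochner_Integration.integral_sum i2)
  also have "\<dots> = (LINT x|lborel. G x * S n x)" by (simp add: S_def sum_distrib_left)
  finally show ?thesis .
 qed
 have lim1: "(\<lambda>n. LINT x|lborel. G x * S n x) \<longlonglongrightarrow> (LINT x|lborel. G x * (\<Sum>i\<in>Basis. z2 i x))"
 proof (rule integral_dominated_convergence[where w = "\<lambda>x. G x * (real DIM('a) * Cz) * indicat_real (cball 0 (R + 1)) x"])
  show "(\<lambda>x. G x * (\<Sum>i\<in>Basis. z2 i x)) \<in> borel_measurable lborel"
   using borel_measurable_continuous_onI[of "\<lambda>x. G x * (\<Sum>i\<in>Basis. z2 i x)"] by (simp add: continuous_intros Gc z2c)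
  show "(\<lambda>x. G x * S n x) \<in> borel_measurable lborel" for n
   using borel_measurable_continuous_onI[of "\<lambda>x. G x * S n x"] by (simp add: continuous_intros Gc Sc)
  have "integrable lborel (\<lambda>x. indicator (cball 0 (R + 1)) x *\<^sub>R (G x * (real DIM('a) * Cz)))"
   by (rule borel_integrable_compact) (auto intro!: continuous_intros continuous_on_subset[OF Gc])
  then show "integrable lborel (\<lambda>x. G x * (real DIM('a) * Cz) * indicat_real (cball 0 (R + 1)) x)"
   by (simp add: mult.commute)
  show "AE x in lborel. (\<lambda>n. G x * S n x) \<longlonglongrightarrow> G x * (\<Sum>i\<in>Basis. z2 i x)"
  proof (intro AE_I2 tendsto_mult tendsto_const)
   fix x
   have "((\<lambda>s. (\<Sum>i\<in>Basis. (\<zeta> (x + s *\<^sub>R i) + \<zeta> (x + (- s) *\<^sub>R i) - 2 * \<zeta> (x + 0 *\<^sub>R i)) / s^2)) \<longlongrightarrow> (\<Sum>i\<in>Basis. z2 i x)) (at_right 0)"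
   proof (intro tendsto_sum second_difference_tendsto[where e = 1])
    fix i :: 'a and s :: real assume i: "i \<in> Basis"
    show "DERIV (\<lambda>s. \<zeta> (x + s *\<^sub>R i)) s :> z1 i (x + s *\<^sub>R i)"
     using C12_line(1)[OF z, of 0 x s i] i by simp
    show "DERIV (\<lambda>s. z1 i (x + s *\<^sub>R i)) 0 :> z2 i x"
     using C12_line(2)[OF z, of 0 x 0 i] i by simp
   qed auto
   from filterlim_compose[OF this hat] show "(\<lambda>n. S n x) \<longlonglongrightarrow> (\<Sum>i\<in>Basis. z2 i x)"
    by (simp add: S_def sum_divide_distrib)
  qed
  show "AE x in lborel. norm (G x * S n x) \<le> G x * (real DIM('a) * Cz) * indicat_real (cball 0 (R + 1)) x" for n
  proof (rule AE_I2)
   fix x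
   have G0: "G x \<ge> 0" by (simp add: G_def)
   show "norm (G x * S n x) \<le> G x * (real DIM('a) * Cz) * indicat_real (cball 0 (R + 1)) x"
   proof (cases "norm x \<le> R + 1")
    case True
    have "\<bar>\<Sum>i\<in>Basis. diff2 \<zeta> x (h n *\<^sub>R i)\<bar>
      \<le> (\<Sum>i\<in>(Basis::'a set). Cz * (h n)^2)"
     by (rule order_trans[OF sum_abs sum_mono]) (use zb[OF True] hs h0[of n] in auto)
    then have "\<bar>S n x\<bar> \<le> real DIM('a) * Cz"
     using h0[of n] by (simp add: S_def divide_simps mult.assoc)
    then show ?thesis using True G0 by (simp add: abs_mult mult_left_mono)
   next
    case False
    have "\<zeta> (x + h n *\<^sub>R i) = 0 \<and> \<zeta> (x - h n *\<^sub>R i) = 0 \<and> \<zeta> x = 0" if "i \<in> Basis" for i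
    proof -
     have "norm (h n *\<^sub>R i) \<le> 1" using that h0[of n] hs[of n] by simp
     then have "norm (x + h n *\<^sub>R i) \<ge> R" "norm (x - h n *\<^sub>R i) \<ge> R"
      using False norm_diff_ineq[of x "h n *\<^sub>R i"] norm_triangle_ineq2[of x "h n *\<^sub>R i"] by linarith+
     then show ?thesis using False by (simp add: zR)
    qed
    then show ?thesis using False by (simp add: S_def)
   qed
  qed
 qed
 have bX: "\<bar>X n x\<bar> \<le> (C + real DIM('a) * C) * \<zeta> x" for n x
 proof (cases "x \<in> A")
  case True
  then have x: "norm x \<le> R" "w t x > \<kappa>" by (auto simp: A_def)
  have "q n x \<le> C" using dt[OF x h0 hs(1)] h0[of n] by (simp add: q_def divide_simps)
  moreover have "- (real DIM('a) * C) \<le> D n x"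
  proof -
   have "(\<Sum>i\<in>(Basis::'a set). - (C * (h n)^2)) \<le> (\<Sum>i\<in>Basis. diff2 W x (h n *\<^sub>R i))"
    unfolding W_def by (intro sum_mono dx x h0 hs)
   then show ?thesis using h0[of n] by (simp add: D_def divide_simps mult.assoc)
  qed
  moreover have "0 \<le> real DIM('a) * C" using C by simp
  ultimately have "max 0 (q n x - D n x) \<le> C + real DIM('a) * C" using C by linarith
  then show ?thesis using True z0[of x] by (simp add: X_def mult_right_mono abs_mult)
 next
  case False
  then show ?thesis using C z0[of x] by (simp add: X_def)
 qed
 have lim2: "(\<lambda>n. LINT x|lborel. X n x) \<longlonglongrightarrow> (LINT x|(lborel :: 'a measure). (0::real))"
 proof (rule integral_dominated_convergence[where w = "\<lambda>x. (C + real DIM('a) * C) * \<zeta> x"])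
  show "X n \<in> borel_measurable lborel" for n
   unfolding X_def by measurable
  show "integrable lborel (\<lambda>x. (C + real DIM('a) * C) * \<zeta> x)" by (rule intz) (rule continuous_on_const)
  show "AE x in lborel. norm (X n x) \<le> (C + real DIM('a) * C) * \<zeta> x" for n using bX by simp
  show "AE x in lborel. (\<lambda>n. X n x) \<longlonglongrightarrow> 0"
  proof (rule AE_I2)
   fix x
   show "(\<lambda>n. X n x) \<longlonglongrightarrow> 0"
   proof (cases "x \<in> A")
    case True
    then have x: "norm x \<le> R" "w t x > \<kappa>" by (auto simp: A_def)
    have "(\<lambda>n. max 0 (q n x - D n x)) \<longlonglongrightarrow> 0"
    proof (rule tendstoI)
     fix r :: real assume r: "r > 0"
     obtain l where l1: "\<forall>\<^sub>F h in at_right 0. w t x - w (t - h) x \<le> h * (l + r / 4)"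
      and l2: "\<forall>\<^sub>F s in at_right 0. s^2 * (l - r / 4) \<le>
       (\<Sum>i\<in>Basis. diff2_comp \<Phi> (w t) x (s *\<^sub>R i))"
      using pt[OF x, of "r / 4"] r by auto
     have "\<forall>\<^sub>F n in sequentially. w t x - w (t - h n) x \<le> h n * (l + r / 4) \<and>
       (h n)^2 * (l - r / 4) \<le> (\<Sum>i\<in>Basis. diff2_comp \<Phi> (w t) x (h n *\<^sub>R i))"
      by (rule eventually_conj[OF eventually_compose_filterlim[OF l1 hat] eventually_compose_filterlim[OF l2 hat]])
     then show "\<forall>\<^sub>F n in sequentially. dist (max 0 (q n x - D n x)) 0 < r"
     proof eventually_elim
      case (elim n)
      have "q n x \<le> l + r / 4" using elim h0[of n] by (simp add: q_def divide_simps mult.commute)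
      moreover have "l - r / 4 \<le> D n x" using elim h0[of n] by (simp add: D_def W_def divide_simps mult.commute)
      ultimately show ?case using r by (simp add: dist_real_def)
     qed
    qed
    from tendsto_mult[OF this tendsto_const[of "\<zeta> x"]] show ?thesis using True by (simp add: X_def)
   qed (simp add: X_def)
  qed
 qed simp
 have "(\<lambda>n. (LINT x|lborel. G x * S n x) + (LINT x|lborel. X n x)) \<longlonglongrightarrow> (LINT x|lborel. G x * (\<Sum>i\<in>Basis. z2 i x)) + 0"
  using tendsto_add[OF lim1 lim2] by simp
 then have "\<forall>\<^sub>F n in sequentially. (LINT x|lborel. G x * S n x) + (LINT x|lborel. X n x) < (LINT x|lborel. G x * (\<Sum>i\<in>Basis. z2 i x)) + e"
  by (rule order_tendstoD) (use e in simp)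
 then show "\<forall>\<^sub>F n in sequentially.
  (LINT x|lborel. max 0 (w t x - \<kappa>) * \<zeta> x) - (LINT x|lborel. max 0 (w (t - h n) x - \<kappa>) * \<zeta> x)
   \<le> h n * ((LINT x|lborel. max 0 (\<Phi> (w t x) - \<Phi> \<kappa>) * (\<Sum>i\<in>Basis. z2 i x)) + e)"
 proof eventually_elim
  case (elim n)
  have iX: "integrable lborel (X n)"
  proof (rule Bochner_Integration.integrable_bound)
   show "integrable lborel (\<lambda>x. (C + real DIM('a) * C) * \<zeta> x)" by (rule intz) (rule continuous_on_const)
   show "X n \<in> borel_measurable lborel" unfolding X_def by measurable
   show "AE x in lborel. norm (X n x) \<le> norm ((C + real DIM('a) * C) * \<zeta> x)"
    using bX[of n] by (auto intro!: AE_I2 order_trans[OF bX abs_ge_self])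
  qed
  have iI: "integrable lborel (\<lambda>x. max 0 (w s x - \<kappa>) * \<zeta> x)" if "s \<in> {a..t}" for s
   by (rule intz) (intro continuous_intros wc that)
  have iDG: "integrable lborel (\<lambda>x. DG n x * \<zeta> x)" by (rule intz[OF DGc])
  \<comment> \<open>A discrete Kato inequality. On \<open>A\<close> the truncation \<open>G\<close>
    agrees with \<open>W - \<Phi> \<kappa>\<close> at the centre and lies above it at the
    neighbours, which only increases the second difference. Where
    \<open>w t x \<le> \<kappa>\<close>, \<open>G\<close> attains its minimum 0, so its second
    difference is nonnegative, while the time difference on the left is at most 0.\<close>
  have pw: "max 0 (w t x - \<kappa>) * \<zeta> x - max 0 (w (t - h n) x - \<kappa>) * \<zeta> x \<le> h n * (DG n x * \<zeta> x + X n x)" for x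
  proof (cases "x \<in> A")
   case True
   then have x: "norm x \<le> R" "w t x > \<kappa>" by (auto simp: A_def)
   have "max 0 (w t x - \<kappa>) - max 0 (w (t - h n) x - \<kappa>) \<le> h n * q n x"
    using x(2) h0[of n] by (simp add: q_def)
   also have "\<dots> \<le> h n * (D n x + max 0 (q n x - D n x))"
    using h0[of n] by (intro mult_left_mono) auto
   also have "\<dots> \<le> h n * (DG n x + max 0 (q n x - D n x))"
   proof -
    have "G x = W x - \<Phi> \<kappa>" using mono[OF k, of "w t x"] x by (simp add: G_def W_def)
    moreover have "G y \<ge> W y - \<Phi> \<kappa>" for y by (simp add: G_def)
    ultimately have "diff2 W x (h n *\<^sub>R i)
     \<le> diff2 G x (h n *\<^sub>R i)" for i
     by (smt (verit))
    then have "D n x \<le> DG n x"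
     unfolding D_def DG_def by (intro divide_right_mono sum_mono) auto
    then show ?thesis using h0[of n] by (intro mult_left_mono) auto
   qed
   finally have "(max 0 (w t x - \<kappa>) - max 0 (w (t - h n) x - \<kappa>)) * \<zeta> x
     \<le> h n * (DG n x + max 0 (q n x - D n x)) * \<zeta> x"
    by (rule mult_right_mono) (rule z0)
   then show ?thesis using True by (simp add: X_def algebra_simps)
  next
   case False
   show ?thesis
   proof (cases "norm x \<ge> R")
    case True
    then show ?thesis using False by (simp add: X_def zR)
   next
    case False
    then have wk: "w t x \<le> \<kappa>" using \<open>x \<notin> A\<close> by (auto simp: A_def)
    then have "G x = 0" using mono[OF w0[OF tin], of x \<kappa>] by (simp add: G_def W_def)
    moreover have "G y \<ge> 0" for y by (simp add: G_def)
    ultimately have "DG n x \<ge> 0" unfolding DG_def by (auto intro!: divide_nonneg_nonneg sum_nonneg)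
    then have "0 \<le> h n * (DG n x * \<zeta> x)" using h0[of n] z0[of x] by simp
    moreover have "max 0 (w t x - \<kappa>) * \<zeta> x - max 0 (w (t - h n) x - \<kappa>) * \<zeta> x \<le> 0"
     using wk z0[of x] by simp
    ultimately show ?thesis using \<open>x \<notin> A\<close> by (simp add: X_def)
   qed
  qed
  have "(LINT x|lborel. max 0 (w t x - \<kappa>) * \<zeta> x) - (LINT x|lborel. max 0 (w (t - h n) x - \<kappa>) * \<zeta> x)
   = (LINT x|lborel. max 0 (w t x - \<kappa>) * \<zeta> x - max 0 (w (t - h n) x - \<kappa>) * \<zeta> x)"
   using iI[OF tin] iI[OF thin] by simp
  also have "\<dots> \<le> (LINT x|lborel. h n * (DG n x * \<zeta> x + X n x))"
   by (rule integral_mono) (use iI[OF tin] iI[OF thin] iDG iX pw in auto)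
  also have "\<dots> = h n * ((LINT x|lborel. G x * S n x) + (LINT x|lborel. X n x))"
   using iDG iX by (simp add: GS)
  also have "\<dots> \<le> h n * ((LINT x|lborel. G x * (\<Sum>i\<in>Basis. z2 i x)) + e)"
   using elim h0[of n] by (intro mult_left_mono) auto
  finally show ?case by (simp add: G_def W_def)
 qed
qed
qed

text \<open>Continuous induction downwards from \<open>b\<close>: by continuity the infimum
  \<open>T\<close> of the points from which \<open>f\<close> stays above \<open>f b\<close> is such
  a point itself, and the hypothesis at \<open>T\<close> would extend the range to the left unless
  \<open>T = a\<close>.\<close>

lemma le_of_eventually_le_left:
 fixes f :: "real => real"
 assumes ab: "a \<le> b" and f: "continuous_on {a..b} f"
  and ev: "\<And>t. a < t ==> t \<le> b ==> \<forall>\<^sub>F h in at_right 0. f t \<le> f (t - h)"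
 shows "f b \<le> f a"
proof -
 define S where "S = {s\<in>{a..b}. \<forall>r\<in>{s..b}. f b \<le> f r}"
 define T where "T = Inf S"
 have bS: "b \<in> S" using ab by (auto simp: S_def)
 have bdd: "bdd_below S" by (auto simp: S_def intro!: bdd_belowI[of _ a])
 have T: "a \<le> T" "T \<le> b"
  unfolding T_def using bS bdd by (auto intro!: cInf_greatest cInf_lower simp: S_def)
 have gt: "f b \<le> f r" if r: "T < r" "r \<le> b" for r
 proof -
  obtain s where "s \<in> S" "s < r" using cInf_lessD[of S r] r bS unfolding T_def by auto
  then show ?thesis using r by (auto simp: S_def)
 qed
 have fT: "f b \<le> f T"
 proof (cases "T = b")
  case False
  then have Tb: "T < b" using T by simp
  have "continuous_on {T..b} f" using T by (intro continuous_on_subset[OF f]) auto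
  then have lim: "(f \<longlongrightarrow> f T) (at_right T)" using Tb by (rule continuous_on_Icc_at_rightD)
  show ?thesis
  proof (rule tendsto_lowerbound[OF lim])
   show "\<forall>\<^sub>F x in at_right T. f b \<le> f x"
    using Tb gt unfolding eventually_at_right_field by (metis less_le)
  qed simp
 qed simp
 have "T = a"
 proof (rule ccontr)
  assume "T \<noteq> a"
  then have aT: "a < T" using T by simp
  obtain d where d: "d > 0" "\<And>h. 0 < h ==> h < d ==> f T \<le> f (T - h)"
   using ev[OF aT T(2)] unfolding eventually_at_right_field by auto
  define s where "s = max a (T - d / 2)"
  have s: "a \<le> s" "s < T" using aT d by (auto simp: s_def)
  have "f b \<le> f r" if "r \<in> {s..b}" for r
  proof (cases "r < T")
   case True
   then have "f T \<le> f (T - (T - r))" using that d(1) by (intro d(2)) (auto simp: s_def)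
   then show ?thesis using fT by simp
  next
   case False
   then show ?thesis using gt[of r] fT that by (cases "r = T") auto
  qed
  then have "s \<in> S" using s T by (auto simp: S_def)
  then show False using cInf_lower[OF _ bdd, of s] s by (simp add: T_def)
 qed
 then show ?thesis using fT by simp
qed

text \<open>A mean value inequality for a function that is only known to have controlled left Dini
  derivatives: after subtracting \<open>K\<close> and a small linear term, it satisfies the local
  monotonicity of the preceding lemma.\<close>

lemma le_of_left_dini:
 fixes f K :: "real => real"
 assumes ab: "a \<le> b" and f: "continuous_on {a..b} f"
  and K: "\<And>t. t \<in> {a..b} ==> (K has_real_derivative K' t) (at t within {a..b})"
  and ev: "\<And>t e. a < t ==> t \<le> b ==> e > 0 ==> \<forall>\<^sub>F h in at_right 0. f t - f (t - h) \<le> h * (K' t + e)"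
 shows "f b - f a \<le> K b - K a"
proof (rule field_le_epsilon)
 fix e :: real assume e: "e > 0"
 define r where "r = e / (2 * (b - a + 1))"
 have r: "r > 0" using e ab by (simp add: r_def)
 \<comment> \<open>One \<open>r\<close> absorbs the error allowed in \<open>ev\<close>, the other
   the error of the left difference quotient of \<open>K\<close>. Over the whole interval this costs
   \<open>2 * r * (b - a)\<close>, which is at most \<open>e\<close>.\<close>
 define g where "g t = f t - K t - 2 * r * t" for t
 have Kc: "continuous_on {a..b} K" by (rule DERIV_continuous_on[OF K])
 have "g b \<le> g a"
 proof (rule le_of_eventually_le_left[OF ab])
  show "continuous_on {a..b} g" unfolding g_def by (intro continuous_intros f Kc)
  fix t assume t: "a < t" "t \<le> b"
  have "((\<lambda>y. (K y - K t) / (y - t)) \<longlongrightarrow> K' t) (at t within {a..b})"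
   using K[of t] t by (simp add: has_field_derivative_iff)
  moreover have "filterlim (\<lambda>h. t - h) (at t within {a..b}) (at_right 0)"
  proof -
   have "((\<lambda>h. t - h) \<longlongrightarrow> t) (at_right 0)" by (auto intro!: tendsto_eq_intros)
   moreover have "\<forall>\<^sub>F h in at_right 0. t - h \<in> {a..b} \<and> t - h \<noteq> t"
    unfolding eventually_at_right_field using t by (intro exI[of _ "t - a"]) auto
   ultimately show ?thesis by (simp add: filterlim_at)
  qed
  ultimately have "((\<lambda>h. (K (t - h) - K t) / (t - h - t)) \<longlongrightarrow> K' t) (at_right 0)"
   by (rule filterlim_compose)
  then have "\<forall>\<^sub>F h in at_right 0. K' t - r < (K (t - h) - K t) / (t - h - t)"
   by (rule order_tendstoD) (use r in simp)
  moreover have "\<forall>\<^sub>F h in at_right 0. (h::real) > 0" by (simp add: eventually_at_right_less)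
  ultimately show "\<forall>\<^sub>F h in at_right 0. g t \<le> g (t - h)"
   using ev[OF t r]
  proof eventually_elim
   case (elim h)
   have "h * (K' t - r) \<le> K t - K (t - h)"
    using elim(1,2) by (simp add: field_simps)
   then show ?case using elim(3) by (simp add: g_def algebra_simps)
  qed
 qed
 then have "f b - f a \<le> K b - K a + 2 * r * (b - a)" by (simp add: g_def algebra_simps)
 also have "2 * r * (b - a) \<le> e" using e ab by (simp add: r_def divide_simps)
 finally show "f b - f a \<le> K b - K a + e" by simp
qed

lemma continuous_on_integral_support:
 fixes f :: "real => 'a::euclidean_space => real"
 assumes f: "continuous_on ({a..b} \<times> UNIV) (\<lambda>(s, x). f s x)" and R: "\<And>s x. norm x > R ==> f s x = 0"
 shows "continuous_on {a..b} (\<lambda>s. LINT x|lborel. f s x)"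
 unfolding continuous_on_sequentially
proof (intro allI ballI impI, elim conjE)
 fix X s assume s: "s \<in> {a..b}" and X: "\<forall>n. X n \<in> {a..b}" and lim: "X \<longlonglongrightarrow> s"
 have fs: "continuous_on UNIV (f r)" if "r \<in> {a..b}" for r
 proof -
  have "continuous_on UNIV (\<lambda>x::'a. (r, x))" by (intro continuous_intros)
  moreover have "range (\<lambda>x::'a. (r, x)) \<subseteq> {a..b} \<times> UNIV" using that by auto
  ultimately show ?thesis using continuous_on_compose2[OF f] by fastforce
 qed
 have "bounded ((\<lambda>(s, x). f s x) ` ({a..b} \<times> cball 0 R))"
  by (intro compact_imp_bounded compact_continuous_image continuous_on_subset[OF f] compact_Times) auto
 then obtain B where B: "\<And>r x. r \<in> {a..b} ==> norm x \<le> R ==> \<bar>f r x\<bar> \<le> B"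
  unfolding bounded_iff by force
 have "(\<lambda>n. LINT x|lborel. f (X n) x) \<longlonglongrightarrow> (LINT x|lborel. f s x)"
 proof (rule integral_dominated_convergence[where w = "\<lambda>x. B * indicat_real (cball 0 R) x"])
  show "f s \<in> borel_measurable lborel" "f (X n) \<in> borel_measurable lborel" for n
   using borel_measurable_continuous_onI[OF fs] s X by auto
  show "integrable lborel (\<lambda>x::'a. B * indicat_real (cball 0 R) x)"
   by (intro integrable_mult_right integrable_real_indicator) (simp_all add: emeasure_lborel_cball_finite[unfolded infinity_ennreal_def])
  show "AE x in lborel. norm (f (X n) x) \<le> B * indicat_real (cball 0 R) x" for n
   using B X R by (intro AE_I2) (auto simp: indicator_def not_le[symmetric] simp del: not_le)
  show "AE x in lborel. (\<lambda>n. f (X n) x) \<longlonglongrightarrow> f s x"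
  proof (rule AE_I2)
   fix x :: 'a
   have "continuous_on {a..b} (\<lambda>r. (r, x))" by (intro continuous_intros)
   from continuous_on_compose2[OF f this] have "continuous_on {a..b} (\<lambda>r. f r x)" by auto
   then show "(\<lambda>n. f (X n) x) \<longlonglongrightarrow> f s x"
    using s X lim unfolding continuous_on_sequentially by (auto simp: o_def)
  qed
 qed
 then show "((\<lambda>s. LINT x|lborel. f s x) \<circ> X) \<longlonglongrightarrow> (LINT x|lborel. f s x)" by (simp add: o_def)
qed


text \<open>The infinitesimal estimate integrated in time. The bound enters through an
  antiderivative \<open>K\<close> because later \<open>K'\<close> is sometimes constant and
  sometimes a merely continuous function of time.\<close>

lemma truncated_mass_growth:
 fixes w :: "real => 'a::euclidean_space => real"
 assumes ab: "a \<le> b"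
  and wc: "continuous_on ({a..b} \<times> UNIV) (\<lambda>(s, x). w s x)"
  and w0: "\<And>s x. s \<in> {a..b} ==> 0 \<le> w s x"
  and Phi: "continuous_on {0..} \<Phi>" "\<And>x y. 0 \<le> x ==> x < y ==> \<Phi> x < \<Phi> y"
  and k: "\<kappa> \<ge> 0"
  and z: "C12 UNIV (\<lambda>t. \<zeta>) (\<lambda>t x. 0) (\<lambda>i t. z1 i) (\<lambda>i t. z2 i)"
  and zc: "continuous_on UNIV \<zeta>" and z0: "\<And>x. 0 \<le> \<zeta> x" and zR: "\<And>x. norm x \<ge> R ==> \<zeta> x = 0"
  and dom: "\<And>t. a < t ==> t \<le> b ==> difference_bounds \<Phi> w R \<kappa> t"
  and pt: "\<And>t x e. a < t ==> t \<le> b ==> norm x \<le> R ==> w t x > \<kappa> ==> e > 0 ==> infinitesimal_le \<Phi> w e t x"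
  and K: "\<And>t. t \<in> {a..b} ==> (K has_real_derivative K' t) (at t within {a..b})"
  and K': "\<And>t. t \<in> {a..b} ==>
    (LINT x|lborel. max 0 (\<Phi> (w t x) - \<Phi> \<kappa>) * (\<Sum>i\<in>Basis. z2 i x)) \<le> K' t"
 shows "(LINT x|lborel. max 0 (w b x - \<kappa>) * \<zeta> x) - (LINT x|lborel. max 0 (w a x - \<kappa>) * \<zeta> x) \<le> K b - K a"
proof (rule le_of_left_dini[where f = "\<lambda>t. LINT x|lborel. max 0 (w t x - \<kappa>) * \<zeta> x" and K' = K'])
 have ws: "continuous_on UNIV (w r)" if "r \<in> {a..b}" for r
 proof -
  have "continuous_on UNIV (\<lambda>x::'a. (r, x))" by (intro continuous_intros)
  moreover have "range (\<lambda>x::'a. (r, x)) \<subseteq> {a..b} \<times> UNIV" using that by auto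
  ultimately show ?thesis using continuous_on_compose2[OF wc] by fastforce
 qed
 show "continuous_on {a..b} (\<lambda>t. LINT x|lborel. max 0 (w t x - \<kappa>) * \<zeta> x)"
 proof (rule continuous_on_integral_support[where R = R])
  have "continuous_on ({a..b} \<times> UNIV) (\<lambda>z. max 0 ((\<lambda>(s, x). w s x) z - \<kappa>) * \<zeta> (snd z))"
   by (intro continuous_intros wc continuous_on_compose2[OF zc]) auto
  then show "continuous_on ({a..b} \<times> UNIV) (\<lambda>(s, x). max 0 (w s x - \<kappa>) * \<zeta> x)"
   by (simp add: case_prod_unfold)
 qed (simp add: zR)
 fix t e :: real assume t: "a < t" "t \<le> b" and e: "e > 0"
 obtain C \<sigma> where C: "C \<ge> 0" "\<sigma> > 0" and d1: "\<And>x h. norm x \<le> R ==> w t x > \<kappa> ==> 0 < h ==> h < \<sigma> ==> w t x - w (t - h) x \<le> C * h"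
  and d2: "\<And>x i s. norm x \<le> R ==> w t x > \<kappa> ==> i \<in> Basis ==> 0 < s ==> s < \<sigma> ==>
      - (C * s^2) \<le> diff2_comp \<Phi> (w t) x (s *\<^sub>R i)"
  using dom[OF t] by blast
 have sub: "s \<in> {a..b}" if "s \<in> {a..t}" for s using that t by auto
 have "\<forall>\<^sub>F h in at_right 0.
  (LINT x|lborel. max 0 (w t x - \<kappa>) * \<zeta> x) - (LINT x|lborel. max 0 (w (t - h) x - \<kappa>) * \<zeta> x)
   \<le> h * ((LINT x|lborel. max 0 (\<Phi> (w t x) - \<Phi> \<kappa>) * (\<Sum>i\<in>Basis. z2 i x)) + e)"
  by (rule truncated_mass_difference[OF t(1) ws[OF sub] w0[OF sub] Phi k z zc z0 zR C d1 d2 pt[OF t] e])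
 moreover have "\<forall>\<^sub>F h in at_right 0. (h::real) > 0" by (simp add: eventually_at_right_less)
 ultimately show "\<forall>\<^sub>F h in at_right 0. (LINT x|lborel. max 0 (w t x - \<kappa>) * \<zeta> x)
   - (LINT x|lborel. max 0 (w (t - h) x - \<kappa>) * \<zeta> x) \<le> h * (K' t + e)"
 proof eventually_elim
  case (elim h)
  have "h * ((LINT x|lborel. max 0 (\<Phi> (w t x) - \<Phi> \<kappa>) * (\<Sum>i\<in>Basis. z2 i x)) + e) \<le> h * (K' t + e)"
   using K'[of t] t elim(2) by (intro mult_left_mono add_right_mono) auto
  with elim(1) show ?case by linarith
 qed
qed (use ab K in auto)

section \<open>A compactly supported weight and its Laplacian\<close>

lemma has_real_derivative_max_power:
 assumes p: "2 \<le> p"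
 shows "DERIV (\<lambda>s::real. max 0 s ^ p) s :> real p * max 0 s ^ (p - 1)"
proof (cases s "0::real" rule: linorder_cases)
 case less
 then have "\<forall>\<^sub>F y in nhds s. max 0 y ^ p = (0::real)"
  using p by (auto intro!: eventually_mono[OF eventually_nhds_in_open[of "{..<0}"]])
 from DERIV_cong_ev[OF refl this refl, of 0] have "DERIV (\<lambda>s::real. max 0 s ^ p) s :> 0"
  by simp
 then show ?thesis using less p by (simp add: power_0_left)
next
 case greater
 then have ev: "\<forall>\<^sub>F y in nhds s. max 0 y ^ p = y ^ p"
  by (auto intro!: eventually_mono[OF eventually_nhds_in_open[of "{0<..}"]])
 have "DERIV (\<lambda>s::real. s ^ p) s :> real p * s ^ (p - 1)"
  by (auto intro!: derivative_eq_intros)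
 then have "DERIV (\<lambda>s::real. max 0 s ^ p) s :> real p * s ^ (p - 1)"
  using DERIV_cong_ev[OF refl ev refl] by blast
 then show ?thesis using greater by simp
next
 case equal
 have "((\<lambda>y::real. (max 0 y ^ p - max 0 0 ^ p) / (y - 0)) \<longlongrightarrow> 0) (at 0)"
 proof (rule Lim_null_comparison)
  show "\<forall>\<^sub>F y in at 0. norm ((max 0 y ^ p - max 0 0 ^ p) / (y - 0)) \<le> \<bar>y\<bar> ^ (p - 1)"
  proof (rule always_eventually, rule allI)
   fix y :: real
   obtain q where q: "p = Suc q" using p by (cases p) auto
   show "norm ((max 0 y ^ p - max 0 0 ^ p) / (y - 0)) \<le> \<bar>y\<bar> ^ (p - 1)"
    using p unfolding q by (auto simp: max_def power_0_left)
  qed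
  have "((\<lambda>y::real. \<bar>y\<bar> ^ (p - 1)) \<longlongrightarrow> \<bar>0\<bar> ^ (p - 1)) (at 0)" by (intro tendsto_intros)
  moreover have "\<bar>0::real\<bar> ^ (p - 1) = 0" using p by (simp add: power_0_left)
  ultimately show "((\<lambda>y::real. \<bar>y\<bar> ^ (p - 1)) \<longlongrightarrow> 0) (at 0)" by (simp only:)
 qed
 then show ?thesis using equal p by (simp add: has_field_derivative_iff power_0_left)
qed

text \<open>The exponent \<open>p\<close> is left free: the Laplacian of the weight is controlled by
  the power \<open>p - 2\<close> of the base, that is, by the power \<open>(p - 2) / p\<close> of
  the weight, and a large \<open>p\<close> brings this exponent as close to 1 as an estimate
  demands.\<close>

definition bump :: "nat => real => 'a::euclidean_space => real" where
 "bump p R x = max 0 (1 - (norm x)^2 / R^2) ^ p"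

definition bump1 :: "nat => real => 'a::euclidean_space => 'a => real" where
 "bump1 p R i x = real p * max 0 (1 - (norm x)^2 / R^2) ^ (p - 1) * (- 2 * (x \<bullet> i) / R^2)"

definition bump2 :: "nat => real => 'a::euclidean_space => 'a => real" where
 "bump2 p R i x = real p * real (p - 1) * max 0 (1 - (norm x)^2 / R^2) ^ (p - 2) * (4 * (x \<bullet> i)^2 / R ^ 4)
   - 2 * real p * max 0 (1 - (norm x)^2 / R^2) ^ (p - 1) / R^2"

lemma bump_line:
 fixes x i :: "'a::euclidean_space"
 assumes R: "R > 0" and p: "3 \<le> p" and i: "i \<in> Basis"
 shows "DERIV (\<lambda>s. bump p R (x + s *\<^sub>R i)) 0 :> bump1 p R i x"
  and "DERIV (\<lambda>s. bump1 p R i (x + s *\<^sub>R i)) 0 :> bump2 p R i x"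
proof -
 define y where "y s = 1 - (norm (x + s *\<^sub>R i))^2 / R^2" for s
 have "(norm (x + s *\<^sub>R i))^2 = (norm x)^2 + 2 * s * (x \<bullet> i) + s^2" for s
  unfolding power2_norm_eq_inner using i by (simp add: inner_add_left inner_add_right inner_commute power2_eq_square)
 then have y: "y s = 1 - ((norm x)^2 + 2 * s * (x \<bullet> i) + s^2) / R^2" for s
  by (simp add: y_def)
 have dy: "DERIV y 0 :> - 2 * (x \<bullet> i) / R^2"
  unfolding y using R by (auto intro!: derivative_eq_intros simp: field_simps)
 have y0: "y 0 = 1 - (norm x)^2 / R^2" by (simp add: y_def)
 have d: "DERIV (\<lambda>s. max 0 (y s) ^ q) 0 :> real q * max 0 (y 0) ^ (q - 1) * (- 2 * (x \<bullet> i) / R^2)"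
  if "2 \<le> q" for q
  by (rule DERIV_chain2[where f = "\<lambda>s. max 0 s ^ q" and g = y]) (use has_real_derivative_max_power[OF that] dy in auto)
 show "DERIV (\<lambda>s. bump p R (x + s *\<^sub>R i)) 0 :> bump1 p R i x"
  using d[of p] p by (simp add: bump_def bump1_def y_def)
 have di: "DERIV (\<lambda>s. - 2 * ((x + s *\<^sub>R i) \<bullet> i) / R^2) 0 :> - 2 / R^2"
  using i R by (auto intro!: derivative_eq_intros simp: inner_add_left field_simps)
 have "((\<lambda>s. real p * (max 0 (y s) ^ (p - 1) * (- 2 * ((x + s *\<^sub>R i) \<bullet> i) / R^2))) has_real_derivative
   real p * (real (p - 1) * max 0 (y 0) ^ (p - 1 - 1) * (- 2 * (x \<bullet> i) / R^2) * (- 2 * (x \<bullet> i) / R^2) + (- 2 / R^2) * max 0 (y 0) ^ (p - 1))) (at 0)"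
  by (intro DERIV_cmult) (rule DERIV_cong[OF DERIV_mult[OF d[of "p - 1"] di]], use p in auto)
 moreover have "p - 1 - 1 = p - 2" by simp
 ultimately show "DERIV (\<lambda>s. bump1 p R i (x + s *\<^sub>R i)) 0 :> bump2 p R i x"
  unfolding bump1_def bump2_def y0[symmetric] y_def[symmetric]
  by (rule_tac DERIV_cong[where X = "real p * (real (p - 1) * max 0 (y 0) ^ (p - 1 - 1) * (- 2 * (x \<bullet> i) / R^2) * (- 2 * (x \<bullet> i) / R^2) + (- 2 / R^2) * max 0 (y 0) ^ (p - 1))"])
    (simp_all add: mult.assoc field_simps power2_eq_square power4_eq_xxxx)
qed

lemma continuous_on_bump: "continuous_on A (bump p R)" "continuous_on A (bump1 p R i)" "continuous_on A (bump2 p R i)" if "R > 0"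
 using that unfolding bump_def bump1_def bump2_def by (auto intro!: continuous_intros)

lemma C12_bump:
 assumes "R > 0" "3 \<le> p"
 shows "C12 UNIV (\<lambda>t. bump p R :: 'a::euclidean_space => real) (\<lambda>t x. 0) (\<lambda>i t. bump1 p R i) (\<lambda>i t. bump2 p R i)"
proof -
 have "continuous_on UNIV (\<lambda>(t::real, x). f x)" if "continuous_on UNIV f" for f :: "'a => real"
  using continuous_on_compose2[OF that, of UNIV snd] by (simp add: case_prod_unfold continuous_on_snd)
 note c = this[OF continuous_on_bump(2)[OF assms(1)]] this[OF continuous_on_bump(3)[OF assms(1)]]
 show ?thesis
  unfolding C12_def using c by (auto simp: case_prod_unfold intro: bump_line[OF assms])
qed

lemma bump_nonneg: "0 \<le> bump p R x" by (simp add: bump_def)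

lemma bump_le_1: "bump p R x \<le> 1" if "R > 0" using that by (auto simp: bump_def intro!: power_le_one)

lemma bump_eq_0: "bump p R x = 0" if "R > 0" "0 < p" "norm x \<ge> R"
proof -
 have "(norm x)^2 / R^2 \<ge> 1" using that by (simp add: power_mono)
 then show ?thesis using that(2) by (simp add: bump_def)
qed

text \<open>An upper bound is what the mass estimates use, since the Laplacian of the weight is
  multiplied there by a nonnegative truncated diffusion. The second summand of \<open>bump2\<close>
  is then of good sign and is dropped.\<close>

lemma sum_bump2_le:
 fixes x :: "'a::euclidean_space"
 assumes R: "R > 0" and p: "3 \<le> p"
 shows "(\<Sum>i\<in>Basis. bump2 p R i x) \<le> 4 * (real p)^2 / R^2 * max 0 (1 - (norm x)^2 / R^2) ^ (p - 2)"
proof (cases "norm x < R")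
 case True
 define m where "m = max 0 (1 - (norm x)^2 / R^2)"
 have m0: "0 \<le> m" by (simp add: m_def)
 have "(\<Sum>i\<in>Basis. bump2 p R i x) \<le> (\<Sum>i\<in>Basis. real p * real (p - 1) * m ^ (p - 2) * (4 * (x \<bullet> i)^2 / R ^ 4))"
  by (intro sum_mono) (simp add: bump2_def m_def[symmetric] m0)
 also have "\<dots> = real p * real (p - 1) * m ^ (p - 2) * (4 * (norm x)^2 / R ^ 4)"
  unfolding power2_norm_eq_inner
  by (subst euclidean_inner[of x x]) (simp add: sum_distrib_left sum_divide_distrib power2_eq_square)
 also have "\<dots> \<le> real p * real p * m ^ (p - 2) * (4 * R^2 / R ^ 4)"
  using True R m0 by (intro mult_mono divide_right_mono mult_left_mono power_mono) auto
 also have "\<dots> = 4 * (real p)^2 / R^2 * m ^ (p - 2)"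
  using R by (simp add: field_simps power2_eq_square power4_eq_xxxx)
 finally show ?thesis by (simp add: m_def)
next
 case False
 then have "(norm x)^2 / R^2 \<ge> 1" using R by (simp add: power_mono)
 then have "max 0 (1 - (norm x)^2 / R^2) = 0" by simp
 then show ?thesis using p by (simp add: bump2_def power_0_left)
qed

section \<open>Classical solutions\<close>

text \<open>The equation in the form \<open>\<partial>\<^sub>t n = \<Delta> \<Phi>(n)\<close>: \<open>\<Phi> = diffusion \<gamma>\<close> has derivative \<open>\<Phi>' = \<bar>\<gamma>\<bar> n\<^sup>\<gamma>\<close>.\<close>
definition diffusion :: "real => real => real" where
 "diffusion \<gamma> v = \<bar>\<gamma>\<bar> / (\<gamma> + 1) * v powr (\<gamma> + 1)"

abbreviation (input) diffusion2 :: "real => real => real => real => real" where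
 "diffusion2 \<gamma> v v1 v2 \<equiv> \<bar>\<gamma>\<bar> * v powr \<gamma> * v2 + \<bar>\<gamma>\<bar> * \<gamma> * v powr (\<gamma> - 1) * v1^2"

text \<open>The derivatives and the equation are confined to the positivity set; across the free
  boundary only continuity of \<open>n\<close> is demanded. The right side of the equation is the
  Laplacian of \<open>diffusion \<gamma> (n t x)\<close> written out.\<close>

definition pme_solution where
 "pme_solution \<gamma> n nt n1 n2 \<longleftrightarrow>
   continuous_on ({0<..} \<times> UNIV) (\<lambda>(t, x). n t x) \<and> (\<forall>t>0. \<forall>x. 0 \<le> n t x) \<and>
   C12 {(t, x). 0 < t \<and> 0 < n t x} n nt n1 n2 \<and>
   (\<forall>t>0. \<forall>x. 0 < n t x \<longrightarrow> nt t x =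
    (\<Sum>i\<in>Basis. diffusion2 \<gamma> (n t x) (n1 i t x) (n2 i t x)))"

lemma continuous_on_diffusion: "continuous_on {0..} (diffusion \<gamma>)" if "-1 < \<gamma>"
 unfolding diffusion_def using that by (auto intro!: continuous_intros continuous_on_powr')

lemma diffusion_strict_mono: "diffusion \<gamma> x < diffusion \<gamma> y" if "-1 < \<gamma>" "\<gamma> \<noteq> 0" "0 \<le> x" "x < y"
 unfolding diffusion_def using that by (intro mult_strict_left_mono powr_less_mono2) auto

lemma diffusion_nonneg: "0 \<le> diffusion \<gamma> v" if "-1 < \<gamma>"
 using that by (simp add: diffusion_def)

lemma diffusion_derivative:
 assumes "-1 < \<gamma>" "0 < v"
 shows "(diffusion \<gamma> has_real_derivative \<bar>\<gamma>\<bar> * v powr \<gamma>) (at v)"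
 unfolding diffusion_def using assms by (auto intro!: derivative_eq_intros)

lemma diffusion_derivative2:
 assumes "0 < (v::real)"
 shows "DERIV (\<lambda>v. \<bar>\<gamma>\<bar> * v powr \<gamma>) v :> \<bar>\<gamma>\<bar> * \<gamma> * v powr (\<gamma> - 1)"
 using assms by (auto intro!: derivative_eq_intros)

lemma C12_continuous:
 fixes n :: "real => 'a::euclidean_space => real"
 assumes "pme_solution \<gamma> n nt n1 n2"
 shows "continuous_on {(t, x). 0 < t \<and> 0 < n t x} (\<lambda>(t, x). n t x)"
 by (rule continuous_on_subset[of "{0<..} \<times> UNIV"]) (use assms in \<open>auto simp: pme_solution_def\<close>)

lemma C12_diffusion:
 fixes n :: "real => 'a::euclidean_space => real"
 assumes n: "pme_solution \<gamma> n nt n1 n2" and g: "-1 < \<gamma>"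
 shows "C12 {(t, x). 0 < t \<and> 0 < n t x} (\<lambda>t x. diffusion \<gamma> (n t x))
  (\<lambda>t x. \<bar>\<gamma>\<bar> * n t x powr \<gamma> * nt t x) (\<lambda>i t x. \<bar>\<gamma>\<bar> * n t x powr \<gamma> * n1 i t x)
  (\<lambda>i t x. diffusion2 \<gamma> (n t x) (n1 i t x) (n2 i t x))"
 by (rule C12_compose[OF _ C12_continuous[OF n], where I = "{0<..}"])
   (use n g in \<open>auto simp: pme_solution_def intro!: diffusion_derivative diffusion_derivative2 continuous_intros\<close>)

lemma pme_compact_superlevel:
 fixes n :: "real => 'a::euclidean_space => real"
 assumes n: "pme_solution \<gamma> n nt n1 n2" and a: "0 < a"
 shows "compact {(t, x). t \<in> {a..b} \<and> norm x \<le> R \<and> \<kappa> \<le> n t x}"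
proof -
 have "continuous_on ({a..b} \<times> cball 0 R) (\<lambda>(t, x). n t x)"
  by (rule continuous_on_subset[of "{0<..} \<times> UNIV"]) (use n a in \<open>auto simp: pme_solution_def\<close>)
 from continuous_closed_preimage[OF this _ closed_atLeast[of \<kappa>]]
 have "closed (({a..b} \<times> cball 0 R) \<inter> (\<lambda>(t, x). n t x) -` {\<kappa>..})"
  by (simp add: closed_Times)
 moreover have "bounded (({a..b} \<times> cball (0::'a) R) \<inter> (\<lambda>(t, x). n t x) -` {\<kappa>..})"
  by (rule bounded_subset[of "{a..b} \<times> cball 0 R"]) (auto intro: bounded_Times)
 moreover have "{(t, x). t \<in> {a..b} \<and> norm x \<le> R \<and> \<kappa> \<le> n t x} = ({a..b} \<times> cball 0 R) \<inter> (\<lambda>(t, x). n t x) -` {\<kappa>..}"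
  by auto
 ultimately show ?thesis by (simp add: compact_eq_bounded_closed)
qed

lemma pme_difference_bounds:
 fixes n :: "real => 'a::euclidean_space => real"
 assumes n: "pme_solution \<gamma> n nt n1 n2" and g: "-1 < \<gamma>" and t: "0 < t" and k: "0 < \<kappa>"
 obtains C \<sigma> where "C > 0" "\<sigma> > 0"
  "\<And>x h. norm x \<le> R ==> \<kappa> \<le> n t x ==> 0 < h ==> h < \<sigma> ==> n t x - n (t - h) x \<le> C * h"
  "\<And>x i s. norm x \<le> R ==> \<kappa> \<le> n t x ==> i \<in> Basis ==> 0 < s ==> s < \<sigma> ==>
    - (C * s^2) \<le> diff2_comp (diffusion \<gamma>) (n t) x (s *\<^sub>R i)"
proof -
 let ?K = "{(s, x). s \<in> {t..t} \<and> norm x \<le> R \<and> \<kappa> \<le> n s x}"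
 let ?P = "{(t, x). 0 < t \<and> 0 < n t x}"
 have K: "compact ?K" by (rule pme_compact_superlevel[OF n t])
 have KP: "?K \<subseteq> ?P" using t k by auto
 have Cn: "C12 ?P n nt n1 n2" using n by (simp add: pme_solution_def)
 obtain C1 s1 where 1: "C1 > 0" "s1 > 0"
  "\<And>t x h. (t, x) \<in> ?K ==> \<bar>h\<bar> < s1 ==> (t + h, x) \<in> ?P \<and> \<bar>n (t + h) x - n t x\<bar> \<le> C1 * \<bar>h\<bar>"
  by (rule C12_compact_bounds[OF Cn K KP]) blast
 obtain C2 s2 where 2: "C2 > 0" "s2 > 0"
  "\<And>t x i s. (t, x) \<in> ?K ==> i \<in> Basis ==> \<bar>s\<bar> < s2 ==> (t, x + s *\<^sub>R i) \<in> ?P \<and>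
    \<bar>diffusion \<gamma> (n t (x + s *\<^sub>R i)) - diffusion \<gamma> (n t x)\<bar> \<le> C2 * \<bar>s\<bar> \<and>
    \<bar>diff2_comp (diffusion \<gamma>) (n t) x (s *\<^sub>R i)\<bar> \<le> C2 * s^2"
  by (rule C12_compact_bounds[OF C12_diffusion[OF n g] K KP]) blast
 show thesis
 proof (rule that[of "max C1 C2" "min s1 s2"])
  fix x h assume x: "norm x \<le> R" "\<kappa> \<le> n t x" and h: "0 < h" "h < min s1 s2"
  have 3: "\<bar>n (t - h) x - n t x\<bar> \<le> C1 * h" using 1(3)[of t x "- h"] x h by simp
  have 4: "C1 * h \<le> max C1 C2 * h" using h by (intro mult_right_mono) auto
  show "n t x - n (t - h) x \<le> max C1 C2 * h" using 3 4 by linarith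
 next
  fix x i :: 'a and s :: real assume x: "norm x \<le> R" "\<kappa> \<le> n t x" and i: "i \<in> Basis" and s: "0 < s" "s < min s1 s2"
  have "\<bar>diff2_comp (diffusion \<gamma>) (n t) x (s *\<^sub>R i)\<bar> \<le> C2 * s^2"
   using 2(3)[of t x i s] x i s by simp
  moreover have "C2 * s^2 \<le> max C1 C2 * s^2" by (intro mult_right_mono) auto
  ultimately show "- (max C1 C2 * s^2) \<le> diff2_comp (diffusion \<gamma>) (n t) x (s *\<^sub>R i)"
   by linarith
 qed (use 1 2 in auto)
qed

lemma C12_second_difference_tendsto:
 fixes g :: "real => 'a::euclidean_space => real"
 assumes g: "C12 P g gt g1 g2" and tx: "(t, x) \<in> P"
 shows "((\<lambda>s. (\<Sum>i\<in>Basis. diff2 (g t) x (s *\<^sub>R i)) / s^2) \<longlongrightarrow> (\<Sum>i\<in>Basis. g2 i t x)) (at_right 0)"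
proof -
 have "open P" using g by (simp add: C12_def)
 then obtain e where e: "e > 0" "cball (t, x) e \<subseteq> P" using tx open_contains_cball by blast
 have inP: "(t, x + s *\<^sub>R i) \<in> P" if "\<bar>s\<bar> < e" "i \<in> Basis" for s i
  using e that by (intro subsetD[OF e(2)]) (simp add: dist_Pair_Pair dist_norm)
 have "((\<lambda>s. (\<Sum>i\<in>Basis. (g t (x + s *\<^sub>R i) + g t (x + (- s) *\<^sub>R i) - 2 * g t (x + 0 *\<^sub>R i)) / s^2)) \<longlongrightarrow> (\<Sum>i\<in>Basis. g2 i t x)) (at_right 0)"
 proof (intro tendsto_sum second_difference_tendsto[where e = e])
  fix i :: 'a and s :: real assume i: "i \<in> Basis"
  show "DERIV (\<lambda>s. g1 i t (x + s *\<^sub>R i)) 0 :> g2 i t x"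
   using C12_line(2)[OF g, of t x 0 i] tx i by simp
  show "DERIV (\<lambda>s. g t (x + s *\<^sub>R i)) s :> g1 i t (x + s *\<^sub>R i)" if "\<bar>s\<bar> < e"
   using C12_line(1)[OF g, of t x s i] inP[OF that i] i by simp
 qed (use e in auto)
 then show ?thesis by (simp add: sum_divide_distrib)
qed

lemma eventually_difference_le:
 fixes f :: "real => real"
 assumes f: "DERIV f t :> D" and e: "e > 0"
 shows "\<forall>\<^sub>F h in at_right 0. f t - f (t - h) \<le> h * (D + e)"
proof -
 have "((\<lambda>h. (f (t + h) - f t) / h) \<longlongrightarrow> D) (at 0)" using f by (simp add: DERIV_def)
 moreover have "filterlim uminus (at (0::real)) (at_right 0)"
  by (auto simp: filterlim_at eventually_at_filter intro!: tendsto_eq_intros)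
 ultimately have "((\<lambda>h. (f (t + - h) - f t) / - h) \<longlongrightarrow> D) (at_right 0)" by (rule filterlim_compose)
 then have "\<forall>\<^sub>F h in at_right 0. (f (t + - h) - f t) / - h < D + e" by (rule order_tendstoD) (use e in simp)
 moreover have "\<forall>\<^sub>F h in at_right 0. (h::real) > 0" by (simp add: eventually_at_right_less)
 ultimately show ?thesis by eventually_elim (simp add: field_simps)
qed

lemma eventually_second_difference_ge:
 fixes S :: "real => real"
 assumes "((\<lambda>s. S s / s^2) \<longlongrightarrow> l) (at_right 0)" and e: "e > 0"
 shows "\<forall>\<^sub>F s in at_right 0. s^2 * (l - e) \<le> S s"
proof -
 have "\<forall>\<^sub>F s in at_right 0. l - e < S s / s^2" using assms by (intro order_tendstoD(1)) auto
 moreover have "\<forall>\<^sub>F h in at_right 0. (h::real) > 0" by (simp add: eventually_at_right_less)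
 ultimately show ?thesis by eventually_elim (simp add: field_simps)
qed

lemma pme_infinitesimal:
 fixes n :: "real => 'a::euclidean_space => real"
 assumes n: "pme_solution \<gamma> n nt n1 n2" and g: "-1 < \<gamma>" and t: "0 < t" "0 < n t x" and e: "e > 0"
 shows "\<forall>\<^sub>F h in at_right 0. n t x - n (t - h) x \<le> h * (nt t x + e)"
  "\<forall>\<^sub>F s in at_right 0. s^2 * (nt t x - e) \<le> (\<Sum>i\<in>Basis. diff2_comp (diffusion \<gamma>) (n t) x (s *\<^sub>R i))"
proof -
 have "DERIV (\<lambda>s. n s x) t :> nt t x"
  using n t by (auto simp: pme_solution_def C12_def)
 from eventually_difference_le[OF this e]
 show "\<forall>\<^sub>F h in at_right 0. n t x - n (t - h) x \<le> h * (nt t x + e)" .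
 have "nt t x = (\<Sum>i\<in>Basis. diffusion2 \<gamma> (n t x) (n1 i t x) (n2 i t x))"
  using n t by (simp add: pme_solution_def)
 with C12_second_difference_tendsto[OF C12_diffusion[OF n g], of t x] t
 have "((\<lambda>s. (\<Sum>i\<in>Basis. diff2_comp (diffusion \<gamma>) (n t) x (s *\<^sub>R i)) / s^2)
   \<longlongrightarrow> nt t x) (at_right 0)" by simp
 from eventually_second_difference_ge[OF this e]
 show "\<forall>\<^sub>F s in at_right 0. s^2 * (nt t x - e) \<le> (\<Sum>i\<in>Basis. diff2_comp (diffusion \<gamma>) (n t) x (s *\<^sub>R i))" .
qed

text \<open>The maximum of two solutions is a subsolution.\<close>
lemma pme_max_mass_growth:
 fixes n m :: "real => 'a::euclidean_space => real"
 assumes n: "pme_solution \<gamma> n nt n1 n2" and m: "pme_solution \<gamma> m mt m1 m2"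
  and g: "-1 < \<gamma>" "\<gamma> \<noteq> 0" and ab: "0 < a" "a \<le> b" and k: "0 < \<kappa>" and R: "0 < R" and p: "3 \<le> p"
  and w: "w = (\<lambda>t x. max (n t x) (m t x))"
  and K: "\<And>t. t \<in> {a..b} ==> (K has_real_derivative K' t) (at t within {a..b})"
  and K': "\<And>t. t \<in> {a..b} ==> (LINT x|lborel. max 0 (diffusion \<gamma> (w t x) - diffusion \<gamma> \<kappa>)
    * (\<Sum>i\<in>Basis. bump2 p R i x)) \<le> K' t"
 shows "(LINT x|lborel. max 0 (w b x - \<kappa>) * bump p R x) - (LINT x|lborel. max 0 (w a x - \<kappa>) * bump p R x) \<le> K b - K a"
proof (rule truncated_mass_growth[where \<Phi> = "diffusion \<gamma>" and R = R])
 have cn: "continuous_on ({a..b} \<times> UNIV) (\<lambda>(s, x). f s x)" if "continuous_on ({0<..} \<times> UNIV) (\<lambda>(s, x). f s x)"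
  for f :: "real => 'a => real"
  by (rule continuous_on_subset[OF that]) (use ab in auto)
 have "continuous_on ({a..b} \<times> UNIV) (\<lambda>z. max ((\<lambda>(s, x). n s x) z) ((\<lambda>(s, x). m s x) z))"
  using n m by (intro continuous_intros cn) (auto simp: pme_solution_def)
 then show "continuous_on ({a..b} \<times> UNIV) (\<lambda>(s, x). w s x)" by (simp add: w case_prod_unfold)
 show "0 \<le> w s x" if "s \<in> {a..b}" for s x using that ab n by (auto simp: w pme_solution_def le_max_iff_disj)
 have mono: "diffusion \<gamma> x \<le> diffusion \<gamma> y" if "0 \<le> x" "x \<le> y" for x y
  using diffusion_strict_mono[OF g that(1), of y] that by (cases "x = y") auto
 have Dn: "diffusion \<gamma> (n t x) \<le> diffusion \<gamma> (w t x)" and Dm: "diffusion \<gamma> (m t x) \<le> diffusion \<gamma> (w t x)" if "0 < t" for t x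
  using n m that by (auto simp: w pme_solution_def intro!: mono)
 fix t assume t: "a < t" "t \<le> b"
 then have t0: "0 < t" using ab by simp
 obtain C \<sigma> where 1: "C > 0" "\<sigma> > 0"
  "\<And>x h. norm x \<le> R ==> \<kappa> \<le> n t x ==> 0 < h ==> h < \<sigma> ==> n t x - n (t - h) x \<le> C * h"
  "\<And>x i s. norm x \<le> R ==> \<kappa> \<le> n t x ==> i \<in> Basis ==> 0 < s ==> s < \<sigma> ==>
    - (C * s^2) \<le> diff2_comp (diffusion \<gamma>) (n t) x (s *\<^sub>R i)"
  by (rule pme_difference_bounds[OF n g(1) t0 k, where R = R]) blast
 obtain C' \<sigma>' where 2: "C' > 0" "\<sigma>' > 0"
  "\<And>x h. norm x \<le> R ==> \<kappa> \<le> m t x ==> 0 < h ==> h < \<sigma>' ==> m t x - m (t - h) x \<le> C' * h"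
  "\<And>x i s. norm x \<le> R ==> \<kappa> \<le> m t x ==> i \<in> Basis ==> 0 < s ==> s < \<sigma>' ==>
    - (C' * s^2) \<le> diff2_comp (diffusion \<gamma>) (m t) x (s *\<^sub>R i)"
  by (rule pme_difference_bounds[OF m g(1) t0 k, where R = R]) blast
 show "difference_bounds (diffusion \<gamma>) w R \<kappa> t"
 proof (rule exI[of _ "C + C'"], rule exI[of _ "min \<sigma> \<sigma>'"], intro conjI allI impI ballI)
  fix x h assume x: "norm x \<le> R" "w t x > \<kappa>" and h: "0 < h" "h < min \<sigma> \<sigma>'"
  have Ch: "C * h \<le> (C + C') * h" "C' * h \<le> (C + C') * h" using h 1 2 by (auto simp: algebra_simps)
  show "w t x - w (t - h) x \<le> (C + C') * h"
  \<comment> \<open>The solution that realises the maximum touches \<open>w\<close> from below.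
    Replacing \<open>w\<close> by it increases the backward time difference and decreases the second
    differences, so its one-sided bounds carry over to \<open>w\<close>.\<close>
  proof (cases "n t x \<ge> m t x")
   case True
   then have "w t x - w (t - h) x \<le> n t x - n (t - h) x" by (simp add: w)
   also have "\<dots> \<le> C * h" using x h True by (intro 1) (auto simp: w)
   finally show ?thesis using Ch by linarith
  next
   case False
   then have "w t x - w (t - h) x \<le> m t x - m (t - h) x" by (simp add: w)
   also have "\<dots> \<le> C' * h" using x h False by (intro 2) (auto simp: w)
   finally show ?thesis using Ch by linarith
  qed
 next
  fix x i s assume x: "norm x \<le> R" "w t x > \<kappa>" and i: "i \<in> (Basis::'a set)" and s: "0 < s" "s < min \<sigma> \<sigma>'"
  have Cs: "C * s^2 \<le> (C + C') * s^2" "C' * s^2 \<le> (C + C') * s^2" using 1 2 by (auto simp: algebra_simps)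
  note D = Dn[OF t0, of "x + s *\<^sub>R i"] Dn[OF t0, of "x - s *\<^sub>R i"] Dm[OF t0, of "x + s *\<^sub>R i"] Dm[OF t0, of "x - s *\<^sub>R i"]
  show "- ((C + C') * s^2) \<le> diff2_comp (diffusion \<gamma>) (w t) x (s *\<^sub>R i)"
  proof (cases "n t x \<ge> m t x")
   case True
   then have "w t x = n t x" by (simp add: w)
   with x have "\<kappa> \<le> n t x" "norm x \<le> R" by auto
   from 1(4)[OF this(2,1) i s(1)] s(2) show ?thesis unfolding \<open>w t x = n t x\<close> using D Cs by linarith
  next
   case False
   then have "w t x = m t x" by (simp add: w)
   with x have "\<kappa> \<le> m t x" "norm x \<le> R" by auto
   from 2(4)[OF this(2,1) i s(1)] s(2) show ?thesis unfolding \<open>w t x = m t x\<close> using D Cs by linarith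
  qed
 qed (use 1 2 in auto)
 fix x e assume x: "norm x \<le> R" "w t x > \<kappa>" and e: "(e::real) > 0"
 show "infinitesimal_le (diffusion \<gamma>) w e t x"
 proof (cases "n t x \<ge> m t x")
  case True
  then have wn: "w t x = n t x" by (simp add: w)
  with x k have pos: "0 < n t x" by simp
  show ?thesis
  proof (intro exI[of _ "nt t x"] conjI)
   show "\<forall>\<^sub>F h in at_right 0. w t x - w (t - h) x \<le> h * (nt t x + e)"
    using pme_infinitesimal(1)[OF n g(1) t0 pos e] by eventually_elim (auto simp: w True)
   show "\<forall>\<^sub>F s in at_right 0. s^2 * (nt t x - e) \<le>
      (\<Sum>i\<in>Basis. diff2_comp (diffusion \<gamma>) (w t) x (s *\<^sub>R i))"
    using pme_infinitesimal(2)[OF n g(1) t0 pos e]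
    by eventually_elim (erule order_trans, auto simp: wn intro!: sum_mono add_mono Dn t0)
  qed
 next
  case False
  then have wn: "w t x = m t x" by (simp add: w)
  with x k have pos: "0 < m t x" by simp
  show ?thesis
  proof (intro exI[of _ "mt t x"] conjI)
   show "\<forall>\<^sub>F h in at_right 0. w t x - w (t - h) x \<le> h * (mt t x + e)"
    using pme_infinitesimal(1)[OF m g(1) t0 pos e] by eventually_elim (use False in \<open>auto simp: w\<close>)
   show "\<forall>\<^sub>F s in at_right 0. s^2 * (mt t x - e) \<le>
      (\<Sum>i\<in>Basis. diff2_comp (diffusion \<gamma>) (w t) x (s *\<^sub>R i))"
    using pme_infinitesimal(2)[OF m g(1) t0 pos e]
    by eventually_elim (erule order_trans, auto simp: wn intro!: sum_mono add_mono Dm t0)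
  qed
 qed
qed (use ab k g K K' p R in \<open>auto intro: continuous_on_diffusion diffusion_strict_mono C12_bump continuous_on_bump bump_nonneg bump_eq_0\<close>)

section \<open>Calculus for the change of variables and for the cone penalty\<close>

lemma mono_of_pos_derivative:
 fixes F :: "real => real"
 assumes I: "is_interval I" and F: "\<And>q. q \<in> I ==> DERIV F q :> F1 q" and "\<And>q. q \<in> I ==> 0 < F1 q"
  and q: "q \<in> I" "q' \<in> I" "q \<le> q'"
 shows "F q \<le> F q'"
proof (cases "q = q'")
 case False
 have in': "x \<in> I" if "q \<le> x" "x \<le> q'" for x
  using I q that unfolding is_interval_1 by blast
 show ?thesis
  by (rule less_imp_le, rule DERIV_pos_imp_increasing) (use False q F assms(3) in' in auto)
qed simp

lemma taylor_lower_bound: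
 fixes F :: "real => real"
 assumes F: "\<And>q. q \<in> {A..B} ==> DERIV F q :> F1 q"
  and F1: "\<And>q. q \<in> {A..B} ==> DERIV F1 q :> F2 q"
  and C: "\<And>q. q \<in> {A..B} ==> \<bar>F2 q\<bar> \<le> C" and q: "q0 \<in> {A..B}" "q \<in> {A..B}"
 shows "F q0 + F1 q0 * (q - q0) - C * (q - q0)^2 \<le> F q"
proof -
 have 1: "\<bar>F1 x - F1 q0\<bar> \<le> C * \<bar>q - q0\<bar>" if x: "x \<in> closed_segment q0 q" for x
 proof -
  have xi: "x \<in> {A..B}" and xq: "\<bar>x - q0\<bar> \<le> \<bar>q - q0\<bar>"
   using x q by (auto simp: closed_segment_eq_real_ivl split: if_splits)
  have "norm (F1 x - F1 q0) \<le> C * norm (x - q0)"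
   by (rule field_differentiable_bound[where S = "{A..B}" and f' = F2])
     (use F1 C q xi in \<open>auto intro: has_field_derivative_at_within\<close>)
  also have "\<dots> \<le> C * \<bar>q - q0\<bar>" using xq C[OF q(1)] by (intro mult_left_mono) auto
  finally show ?thesis by simp
 qed
 define G where "G x = F x - F1 q0 * x" for x
 have "norm (G q - G q0) \<le> (C * \<bar>q - q0\<bar>) * norm (q - q0)"
 proof (rule field_differentiable_bound[where S = "closed_segment q0 q" and f' = "\<lambda>x. F1 x - F1 q0"])
  fix x assume x: "x \<in> closed_segment q0 q"
  then have "x \<in> {A..B}" using q by (auto simp: closed_segment_eq_real_ivl split: if_splits)
  then have "(F has_real_derivative F1 x) (at x within closed_segment q0 q)"
   by (rule has_field_derivative_at_within[OF F])
  then show "(G has_field_derivative F1 x - F1 q0) (at x within closed_segment q0 q)"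
   unfolding G_def by (rule DERIV_diff) (rule DERIV_cmult_Id)
  show "norm (F1 x - F1 q0) \<le> C * \<bar>q - q0\<bar>" using 1[OF x] by simp
 qed auto
 moreover have "(C * \<bar>q - q0\<bar>) * norm (q - q0) = C * (q - q0)^2"
  by (simp add: power2_eq_square mult.assoc)
 ultimately have "\<bar>G q - G q0\<bar> \<le> C * (q - q0)^2" by (simp only: real_norm_def)
 moreover have "G q - G q0 = F q - F q0 - F1 q0 * (q - q0)"
  unfolding G_def right_diff_distrib by linarith
 ultimately show ?thesis by linarith
qed

lemma norm_line_derivative:
 fixes z i :: "'a::euclidean_space"
 assumes z: "z + s *\<^sub>R (a *\<^sub>R i) \<noteq> 0" and i: "i \<in> Basis"
 shows "DERIV (\<lambda>s. norm (z + s *\<^sub>R (a *\<^sub>R i))) s :> a * ((z + s *\<^sub>R (a *\<^sub>R i)) \<bullet> i) / norm (z + s *\<^sub>R (a *\<^sub>R i))"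
proof -
 define g where "g s = z \<bullet> z + 2 * (s * a) * (z \<bullet> i) + (s * a)^2" for s
 have ii: "i \<bullet> i = 1" using i by (simp add: inner_Basis)
 have vg: "(z + s *\<^sub>R (a *\<^sub>R i)) \<bullet> (z + s *\<^sub>R (a *\<^sub>R i)) = g s" for s
  using ii by (simp add: g_def inner_add_left inner_add_right inner_commute power2_eq_square)
 then have ng: "norm (z + s *\<^sub>R (a *\<^sub>R i)) = sqrt (g s)" for s by (simp add: norm_eq_sqrt_inner)
 have gpos: "0 < g s" using z vg[of s] by (metis inner_gt_zero_iff)
 have dg: "DERIV g s :> 2 * a * (z \<bullet> i) + 2 * s * a^2"
  unfolding g_def by (auto intro!: derivative_eq_intros simp: power2_eq_square)
 have "DERIV (\<lambda>s. sqrt (g s)) s :> inverse (sqrt (g s)) / 2 * (2 * a * (z \<bullet> i) + 2 * s * a^2)"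
  by (rule DERIV_chain2[OF DERIV_real_sqrt[OF gpos] dg])
 moreover have "inverse (sqrt (g s)) / 2 * (2 * a * (z \<bullet> i) + 2 * s * a^2) = a * ((z + s *\<^sub>R (a *\<^sub>R i)) \<bullet> i) / sqrt (g s)"
  using ii gpos by (simp add: inner_add_left divide_simps power2_eq_square) (simp add: algebra_simps)
 ultimately show ?thesis unfolding ng by (simp only:)
qed

section \<open>Sup-convolution\<close>

text \<open>\<open>M\<close> is the transformed density, with
  \<open>M_t = f(M) Delta M + h(M) |grad M|^2\<close> where its values lie in \<open>I\<close>.
  \<open>N\<close> maps back to the density and \<open>H\<close> plays the role of the diffusion
  function composed with \<open>N\<close>; the relations \<open>H1 = f * N1\<close> and
  \<open>H2 = h * N1\<close> say that \<open>N(M)\<close> satisfies an equation whose right side is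
  the Laplacian of \<open>H(M)\<close>. \<open>upI\<close> excludes only low values, such as those
  of the vacuum for \<gamma> > 0. \<open>key\<close> is the coupling condition, with
  \<open>c0\<close> as the gain that pays for the changing slope.\<close>

locale supconv =
 fixes M Mt :: "real => 'a::euclidean_space => real" and M1 M2 :: "'a => real => 'a => real"
  and P :: "(real \<times> 'a) set" and t0 t1 Wmax kap c0 :: real and I :: "real set"
  and N N1 H H1 H2 f h :: "real => real"
 assumes t01: "t0 < t1" and kap: "0 < kap" "1 \<le> 2 * c0 * kap^2"
  and Mcont: "continuous_on ({t0..t1} \<times> UNIV) (\<lambda>(t, x). M t x)"
  and Mmax: "\<And>t x. t \<in> {t0..t1} ==> M t x \<le> Wmax"
  and MP: "C12 P M Mt M1 M2"
  and PinI: "\<And>t x. (t, x) \<in> P ==> M t x \<in> I" and MPc: "continuous_on P (\<lambda>(t, x). M t x)"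
  and PI: "\<And>t x. t \<in> {t0..t1} ==> M t x \<in> I ==> (t, x) \<in> P"
  and I: "is_interval I" "open I"
  and upI: "\<And>t x q. t \<in> {t0..t1} ==> q \<in> I ==> q \<le> M t x ==> M t x \<in> I"
  and N: "\<And>q. q \<in> I ==> DERIV N q :> N1 q" "continuous_on I N1" "\<And>q. q \<in> I ==> 0 < N1 q"
  and H: "\<And>q. q \<in> I ==> DERIV H q :> H1 q" "\<And>q. q \<in> I ==> DERIV H1 q :> H2 q"
   "continuous_on I H2"
  and f: "\<And>q. q \<in> I ==> 0 < f q" "\<And>q. q \<in> I ==> H1 q = f q * N1 q" "\<And>q. q \<in> I ==> H2 q = h q * N1 q"
  and pde: "\<And>t x. t \<in> {t0..t1} ==> M t x \<in> I ==>
    Mt t x = f (M t x) * (\<Sum>i\<in>Basis. M2 i t x) + h (M t x) * (\<Sum>i\<in>Basis. (M1 i t x)^2)"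
  and key: "\<And>p q. p \<in> I ==> q \<in> I ==> p < q ==> q \<le> Wmax ==>
    (h q - h p) * (q - p) + (real DIM('a) - 1) * (sqrt (f q) - sqrt (f p))^2 \<le> - c0 * (q - p)^2"
begin

text \<open>Parametrised by \<open>z\<close> rather than by the end point, so that the formula stays
  meaningful and continuous at \<open>t = t0\<close>, where the slope of the penalty blows up and
  \<open>S\<close> reduces to \<open>M\<close>. The square root is the parabolic scaling of
  distances.\<close>

definition S :: "real => 'a => real" where
 "S t x = (SUP z. M t (x + sqrt (t - t0) *\<^sub>R z) - kap * norm z)"

lemma
 assumes t: "t \<in> {t0..t1}"
 shows S_attained: "\<exists>z. S t x = M t (x + sqrt (t - t0) *\<^sub>R z) - kap * norm z"
  and S_upper: "M t (x + sqrt (t - t0) *\<^sub>R z) - kap * norm z \<le> S t x"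
proof -
 let ?F = "\<lambda>z. M t (x + sqrt (t - t0) *\<^sub>R z) - kap * norm z"
 \<comment> \<open>Outside this radius the penalty exceeds the largest possible gain
   \<open>Wmax - M t x\<close>, so the supremum is a maximum over a ball.\<close>
 define Z where "Z = (Wmax - M t x) / kap"
 have Z: "0 \<le> Z" using Mmax[OF t, of x] kap by (simp add: Z_def)
 have "continuous_on (cball 0 Z) (\<lambda>z. (t, x + sqrt (t - t0) *\<^sub>R z))" by (intro continuous_intros)
 moreover have "(\<lambda>z. (t, x + sqrt (t - t0) *\<^sub>R z)) ` cball 0 Z \<subseteq> {t0..t1} \<times> UNIV" using t by auto
 ultimately have "continuous_on (cball 0 Z) (\<lambda>z. M t (x + sqrt (t - t0) *\<^sub>R z))"
  using continuous_on_compose2[OF Mcont] by fastforce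
 then have "continuous_on (cball 0 Z) ?F" by (intro continuous_intros)
 then obtain z0 where z0: "z0 \<in> cball 0 Z" "\<And>z. z \<in> cball 0 Z ==> ?F z \<le> ?F z0"
  using continuous_attains_sup[of "cball 0 Z" ?F] Z by auto
 have le: "?F z \<le> ?F z0" for z
 proof (cases "z \<in> cball 0 Z")
  case False
  then have "kap * norm z > Wmax - M t x" using kap by (simp add: Z_def field_simps)
  then have "?F z \<le> M t x" using Mmax[OF t, of "x + sqrt (t - t0) *\<^sub>R z"] by linarith
  also have "\<dots> \<le> ?F z0" using z0(2)[of 0] Z by simp
  finally show ?thesis .
 qed (rule z0)
 have "S t x = ?F z0" unfolding S_def by (rule cSup_eq_maximum) (use le in auto)
 then show "\<exists>z. S t x = ?F z" "?F z \<le> S t x" using le by auto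
qed

lemma M_le_S: "M t x \<le> S t x" if "t \<in> {t0..t1}"
 using S_upper[OF that, of x 0] by simp

lemma continuous_on_S: "continuous_on ({t0..t1} \<times> UNIV) (\<lambda>(t, x). S t x)"
 unfolding continuous_on_iff
proof (intro ballI allI impI)
 fix p :: "real \<times> 'a" and e :: real assume p: "p \<in> {t0..t1} \<times> UNIV" and e: "0 < e"
 define R where "R = norm (snd p) + 1"
 have "compact ((\<lambda>(t, x). M t x) ` ({t0..t1} \<times> cball 0 R))"
  by (intro compact_continuous_image continuous_on_subset[OF Mcont] compact_Times) auto
 then have "bounded ((\<lambda>(t, x). M t x) ` ({t0..t1} \<times> cball 0 R))" by (rule compact_imp_bounded)
 then obtain B where "\<forall>v\<in>(\<lambda>(t, x). M t x) ` ({t0..t1} \<times> cball 0 R). norm v \<le> B" unfolding bounded_iff by blast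
 then have B: "\<And>t x. t \<in> {t0..t1} ==> norm x \<le> R ==> \<bar>M t x\<bar> \<le> B" by force
 \<comment> \<open>A radius valid for all points near \<open>p\<close>: their maximisers lie in one
   ball, and uniform continuity of the penalised function on a compact set finishes the
   argument.\<close>
 define Z where "Z = (Wmax + B) / kap"
 let ?K = "({t0..t1} \<times> cball (0::'a) R) \<times> cball (0::'a) Z"
 let ?F = "\<lambda>((t, x), z). M t (x + sqrt (t - t0) *\<^sub>R z) - kap * norm z"
 have "continuous_on ?K (\<lambda>u. (\<lambda>(t, x). M t x) (fst (fst u), snd (fst u) + sqrt (fst (fst u) - t0) *\<^sub>R snd u) - kap * norm (snd u))"
  by (intro continuous_intros continuous_on_compose2[OF Mcont]) auto
 then have "continuous_on ?K ?F" by (simp add: case_prod_unfold)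
 then have "uniformly_continuous_on ?K ?F"
  by (rule compact_uniformly_continuous) (intro compact_Times compact_Icc compact_cball)
 then obtain d where d: "d > 0" "\<And>u v. u \<in> ?K ==> v \<in> ?K ==> dist v u < d ==> dist (?F v) (?F u) < e / 2"
  using half_gt_zero[OF e] unfolding uniformly_continuous_on_def by meson
 have le: "S t x \<le> S t' x' + e / 2"
  if as: "t \<in> {t0..t1}" "t' \<in> {t0..t1}" "norm x \<le> R" "norm x' \<le> R" "dist (t, x) (t', x') < d" for t t' x x'
 proof -
  obtain z where z: "S t x = M t (x + sqrt (t - t0) *\<^sub>R z) - kap * norm z" using S_attained[OF as(1)] by blast
  have "kap * norm z \<le> Wmax + B"
   using z M_le_S[OF as(1), of x] Mmax[OF as(1), of "x + sqrt (t - t0) *\<^sub>R z"] B[OF as(1,3)] by linarith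
  then have "norm z \<le> Z" using kap by (simp add: Z_def field_simps)
  then have "dist (?F ((t, x), z)) (?F ((t', x'), z)) < e / 2"
   using as by (intro d(2)) (auto simp: dist_Pair_Pair dist_commute)
  then have "\<bar>(M t (x + sqrt (t - t0) *\<^sub>R z) - kap * norm z) - (M t' (x' + sqrt (t' - t0) *\<^sub>R z) - kap * norm z)\<bar> < e / 2"
   by (simp add: dist_real_def abs_minus_commute)
  then show ?thesis using z S_upper[OF as(2), of x' z] by linarith
 qed
 show "\<exists>d>0. \<forall>p'\<in>{t0..t1} \<times> UNIV. dist p' p < d \<longrightarrow> dist ((\<lambda>(t, x). S t x) p') ((\<lambda>(t, x). S t x) p) < e"
 proof (intro exI[of _ "min d 1"] conjI ballI impI)
  show "0 < min d 1" using d by simp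
  fix p' :: "real \<times> 'a" assume p': "p' \<in> {t0..t1} \<times> UNIV" "dist p' p < min d 1"
  obtain t x t' x' where [simp]: "p = (t, x)" "p' = (t', x')" by (metis surj_pair)
  have "dist x' x \<le> dist p' p" using dist_snd_le[of p' p] by simp
  then have "dist x' x < 1" using p'(2) by linarith
  then have "norm x' \<le> R" using norm_triangle_ineq2[of x' x] by (simp add: R_def dist_norm)
  moreover have "norm x \<le> R" by (simp add: R_def)
  ultimately have "S t x \<le> S t' x' + e / 2" "S t' x' \<le> S t x + e / 2"
   using p p' by (auto intro!: le simp: dist_commute)
  then show "dist ((\<lambda>(t, x). S t x) p') ((\<lambda>(t, x). S t x) p) < e" using e by (simp add: dist_real_def)
 qed
qed

text \<open>The slope of the penalty in terms of the end point. It solves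
  \<open>L' = - L^3 / (2 * kap^2)\<close>, and \<open>1 \<le> 2 * c0 * kap^2\<close> says exactly
  that \<open>- L'\<close> is at most \<open>c0 * L^3\<close>, the gain that \<open>key\<close>
  yields.\<close>

definition L :: "real => real" where
 "L t = kap * (t - t0) powr (- (1 / 2))"

lemma L_pos: "0 < L t" if "t0 < t"
 using that kap by (simp add: L_def)

lemma L_derivative: "DERIV L t :> - (kap / 2) * (t - t0) powr (- (3 / 2))" if "t0 < t"
proof -
 have "DERIV L t :> kap * (- (1 / 2) * (t - t0) powr (- (1 / 2) - 1) * 1)"
  unfolding L_def using that by (auto intro!: derivative_eq_intros)
 moreover have "- (1 / 2) - 1 = - (3 / 2 :: real)" by simp
 ultimately show ?thesis by simp
qed

lemma L_scale: "L t * norm (sqrt (t - t0) *\<^sub>R z) = kap * norm z" if "t0 < t" for z :: 'a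
proof -
 have "(t - t0) powr (- (1 / 2)) * sqrt (t - t0) = 1"
  using that by (simp add: powr_half_sqrt[symmetric] powr_add[symmetric])
 then show ?thesis using that by (simp add: L_def)
qed

lemma S_ge: "M t y - L t * norm (x - y) \<le> S t x" if t: "t0 < t" "t \<le> t1"
proof -
 define z where "z = inverse (sqrt (t - t0)) *\<^sub>R (y - x)"
 have z: "sqrt (t - t0) *\<^sub>R z = y - x" using t by (simp add: z_def)
 then show ?thesis
  using S_upper[of t x z] t L_scale[OF t(1), of z] by (simp add: norm_minus_commute)
qed

lemma S_eq: "\<exists>y. S t x = M t y - L t * norm (x - y)" if t: "t0 < t" "t \<le> t1"
proof -
 obtain z where z: "S t x = M t (x + sqrt (t - t0) *\<^sub>R z) - kap * norm z" using S_attained[of t x] t by auto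
 moreover have "norm (x - (x + sqrt (t - t0) *\<^sub>R z)) = norm (sqrt (t - t0) *\<^sub>R z)" by simp
 ultimately have "S t x = M t (x + sqrt (t - t0) *\<^sub>R z) - L t * norm (x - (x + sqrt (t - t0) *\<^sub>R z))"
  using L_scale[OF t(1), of z] by (simp only:)
 then show ?thesis by blast
qed

lemma S_in_I: "S t x \<in> I" if t: "t \<in> {t0..t1}" and q: "q \<in> I" "q \<le> S t x"
proof -
 obtain z where z: "S t x = M t (x + sqrt (t - t0) *\<^sub>R z) - kap * norm z" using S_attained[OF t] by blast
 then have le: "S t x \<le> M t (x + sqrt (t - t0) *\<^sub>R z)" using kap by simp
 have "M t (x + sqrt (t - t0) *\<^sub>R z) \<in> I" using upI[OF t q(1)] q(2) le by simp
 then show ?thesis using I(1) q le unfolding is_interval_1 by blast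
qed

lemma N_mono: "q \<in> I ==> q' \<in> I ==> q \<le> q' ==> N q \<le> N q'"
 by (rule mono_of_pos_derivative[OF I(1) N(1) N(3)])

lemma H1_pos: "q \<in> I ==> 0 < H1 q"
 using f N by simp

lemma H_mono: "q \<in> I ==> q' \<in> I ==> q \<le> q' ==> H q \<le> H q'"
 by (rule mono_of_pos_derivative[OF I(1) H(1) H1_pos])

text \<open>At a maximiser \<open>y\<close> for \<open>x\<close>, moving \<open>x\<close> and
  \<open>y\<close> together leaves the penalty unchanged, so second differences of \<open>S\<close>
  at \<open>x\<close> are bounded below through those of \<open>M\<close> at \<open>y\<close>. Going
  back in time with \<open>y\<close> fixed changes only \<open>M\<close> and the slope. All
  maximisers in question lie in the compact set \<open>K\<close>, so the constants are
  uniform.\<close>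

lemma S_difference_bounds:
 assumes t: "t0 < t" "t \<le> t1" and qk: "qk \<in> I"
 shows "\<exists>C \<sigma>. C \<ge> 0 \<and> \<sigma> > 0 \<and> (\<forall>x. norm x \<le> R \<longrightarrow> S t x > qk \<longrightarrow>
    (\<forall>h. 0 < h \<longrightarrow> h < \<sigma> \<longrightarrow> S (t - h) x \<in> I \<and> N (S t x) - N (S (t - h) x) \<le> C * h) \<and>
    (\<forall>i\<in>Basis. \<forall>s. 0 < s \<longrightarrow> s < \<sigma> \<longrightarrow> S t (x + s *\<^sub>R i) \<in> I \<and> S t (x - s *\<^sub>R i) \<in> I \<and>
      - (C * s^2) \<le> diff2_comp H (S t) x (s *\<^sub>R i)))"
proof -
 have tin: "t \<in> {t0..t1}" using t by simp
 define R' where "R' = R + (Wmax - qk) / L t"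
 define K where "K = {t} \<times> {y. norm y \<le> R' \<and> qk \<le> M t y}"
 have Mt: "continuous_on UNIV (M t)"
 proof -
  have "continuous_on UNIV (\<lambda>x::'a. (t, x))" by (intro continuous_intros)
  moreover have "range (\<lambda>x::'a. (t, x)) \<subseteq> {t0..t1} \<times> UNIV" using tin by auto
  ultimately show ?thesis using continuous_on_compose2[OF Mcont] by fastforce
 qed
 have "closed {y. qk \<le> M t y}" by (intro closed_Collect_le continuous_on_const Mt)
 then have "compact ({y. qk \<le> M t y} \<inter> cball 0 R')" by (intro closed_Int_compact compact_cball)
 moreover have "{y. qk \<le> M t y} \<inter> cball 0 R' = {y. norm y \<le> R' \<and> qk \<le> M t y}" by auto
 ultimately have K: "compact K" unfolding K_def by (intro compact_Times) auto
 have KP: "K \<subseteq> P" using PI[OF tin] upI[OF tin qk] by (auto simp: K_def)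
 obtain C1 s1 where C1: "C1 > 0" "s1 > 0"
  and C1t: "\<And>t x h. (t, x) \<in> K ==> \<bar>h\<bar> < s1 ==> (t + h, x) \<in> P \<and> \<bar>M (t + h) x - M t x\<bar> \<le> C1 * \<bar>h\<bar>"
  and C1x: "\<And>t x i s. (t, x) \<in> K ==> i \<in> Basis ==> \<bar>s\<bar> < s1 ==> (t, x + s *\<^sub>R i) \<in> P \<and>
    \<bar>M t (x + s *\<^sub>R i) - M t x\<bar> \<le> C1 * \<bar>s\<bar> \<and>
    \<bar>diff2 (M t) x (s *\<^sub>R i)\<bar> \<le> C1 * s^2"
  by (rule C12_compact_bounds[OF MP K KP]) blast
 have opt: "\<exists>y. S t x = M t y - L t * norm (x - y) \<and> (t, y) \<in> K \<and> norm (x - y) \<le> (Wmax - qk) / L t"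
  if x: "norm x \<le> R" "S t x > qk" for x
 proof -
  obtain y where y: "S t x = M t y - L t * norm (x - y)" using S_eq[OF t] by blast
  then have "L t * norm (x - y) \<le> Wmax - qk" using x(2) Mmax[OF tin, of y] by linarith
  then have r: "norm (x - y) \<le> (Wmax - qk) / L t" using L_pos[OF t(1)] by (simp add: field_simps)
  have "norm y \<le> R'" using norm_triangle_ineq2[of y x] x(1) r by (simp add: R'_def norm_minus_commute)
  moreover have "qk \<le> M t y" using y x(2) mult_nonneg_nonneg[OF less_imp_le[OF L_pos[OF t(1)]] norm_ge_zero[of "x - y"]] by linarith
  ultimately show ?thesis using y r by (auto simp: K_def)
 qed
 \<comment> \<open>An upper bound inside \<open>I\<close> for \<open>M\<close> at the maximisers.
   Together with \<open>qk\<close> it confines all relevant values to a compact interval, on which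
   \<open>N1\<close>, \<open>H1\<close> and \<open>H2\<close> are bounded.\<close>
 obtain B where B: "B \<in> I" "qk \<le> B" "\<And>y. (t, y) \<in> K ==> M t y \<le> B"
 proof (cases "K = {}")
  case False
  have "continuous_on K (\<lambda>(t, x). M t x)"
   by (rule continuous_on_subset[OF Mcont]) (use tin in \<open>auto simp: K_def\<close>)
  then obtain u where u: "u \<in> K" "\<And>v. v \<in> K ==> (\<lambda>(t, x). M t x) v \<le> (\<lambda>(t, x). M t x) u"
   using continuous_attains_sup[OF K False] by blast
  then obtain y where y: "u = (t, y)" "qk \<le> M t y" by (auto simp: K_def)
  show thesis
  proof (rule that[of "M t y"])
   show "M t y \<in> I" using upI[OF tin qk y(2)] .
   show "M t y' \<le> M t y" if "(t, y') \<in> K" for y' using u(2)[OF that] y by simp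
  qed (use y in auto)
 qed (use qk in auto)
 obtain e where e: "e > 0" "{qk - e..B + e} \<subseteq> I"
 proof -
  obtain e1 where e1: "e1 > 0" "cball qk e1 \<subseteq> I" using I(2) qk open_contains_cball by blast
  obtain e2 where e2: "e2 > 0" "cball B e2 \<subseteq> I" using I(2) B(1) open_contains_cball by blast
  define e where "e = min e1 e2"
  have "qk - e \<in> cball qk e1" "B + e \<in> cball B e2" using e1 e2 by (auto simp: e_def dist_real_def)
  then have "qk - e \<in> I" "B + e \<in> I" using e1 e2 by auto
  then have "{qk - e..B + e} \<subseteq> I" using I(1) unfolding is_interval_1 by (meson atLeastAtMost_iff subsetI)
  then show thesis using that[of e] e1 e2 by (simp add: e_def)
 qed
 define J where "J = {qk - e..B + e}"
 have JI: "q \<in> I" if "q \<in> J" for q using e that by (auto simp: J_def)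
 have bnd: "\<exists>C. \<forall>q\<in>J. \<bar>F q\<bar> \<le> C" if "continuous_on I F" for F :: "real => real"
 proof -
  have "compact (F ` J)" unfolding J_def
   by (rule compact_continuous_image[OF continuous_on_subset[OF that e(2)] compact_Icc])
  then have "bounded (F ` J)" by (rule compact_imp_bounded)
  then obtain C where "\<forall>x\<in>F ` J. norm x \<le> C" unfolding bounded_iff by blast
  then show ?thesis by (intro exI[of _ C]) auto
 qed
 obtain CN where CN: "\<And>q. q \<in> J ==> \<bar>N1 q\<bar> \<le> CN" using bnd[OF N(2)] by blast
 have H1c: "continuous_on I H1"
  by (rule DERIV_continuous_on[where D = H2]) (rule has_field_derivative_at_within, rule H(2))
 obtain CH1 where CH1: "\<And>q. q \<in> J ==> \<bar>H1 q\<bar> \<le> CH1" using bnd[OF H1c] by blast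
 obtain CH2 where CH2: "\<And>q. q \<in> J ==> \<bar>H2 q\<bar> \<le> CH2" using bnd[OF H(3)] by blast
 have "qk \<in> J" using e B by (auto simp: J_def)
 then have C0: "CN \<ge> 0" "CH1 \<ge> 0" "CH2 \<ge> 0" using CN[of qk] CH1[of qk] CH2[of qk] by auto
 \<comment> \<open>Time steps shorter than half of the elapsed time stay away from the singularity
   of \<open>L\<close> at \<open>t0\<close>.\<close>
 define \<tau> where "\<tau> = (t - t0) / 2"
 have tau: "\<tau> > 0" using t by (simp add: \<tau>_def)
 define CL where "CL = kap / 2 * \<tau> powr (- (3 / 2))"
 have CL: "CL \<ge> 0" using kap by (simp add: CL_def)
 have Ldiff: "\<bar>L (t - h) - L t\<bar> \<le> CL * h" if h: "0 < h" "h < \<tau>" for h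
 proof -
  have "\<bar>L (t + (- h)) - L (t + 0)\<bar> \<le> CL * \<bar>- h\<bar>"
  proof (rule first_difference_bound[where g = "\<lambda>r. L (t + r)"])
   fix r assume "\<bar>r\<bar> \<le> \<bar>- h\<bar>"
   then have r: "t + r - t0 \<ge> \<tau>" using h by (simp add: \<tau>_def)
   then have "DERIV L (t + r) :> - (kap / 2) * (t + r - t0) powr (- (3 / 2))"
    using tau by (intro L_derivative) linarith
   then show "DERIV (\<lambda>r. L (t + r)) r :> - (kap / 2) * (t + r - t0) powr (- (3 / 2))"
    using DERIV_shift[of L _ r t] by (simp add: add.commute)
   have "(t + r - t0) powr (- (3 / 2)) \<le> \<tau> powr (- (3 / 2))" using r tau by (intro powr_mono2') auto
   then show "\<bar>- (kap / 2) * (t + r - t0) powr (- (3 / 2))\<bar> \<le> CL" using kap by (simp add: CL_def abs_mult)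
  qed
  then show ?thesis using h by simp
 qed
 define rm where "rm = \<bar>(Wmax - qk) / L t\<bar>"
 define C' where "C' = C1 + CL * rm"
 have C': "C' > 0" using C1 CL by (simp add: C'_def rm_def add_pos_nonneg)
 define C where "C = CN * C' + (CH1 * C1 + 2 * CH2 * C1^2)"
 have Cge: "CN * C' \<le> C" "CH1 * C1 + 2 * CH2 * C1^2 \<le> C" "0 \<le> C"
  using C0 C' C1 by (auto simp: C_def)
 define \<sigma> where "\<sigma> = min (min s1 \<tau>) (min (e / C') (e / C1))"
 have sig: "\<sigma> > 0" using C1 tau e C' by (simp add: \<sigma>_def)
 show ?thesis
 proof (rule exI[of _ C], rule exI[of _ \<sigma>], intro conjI allI impI ballI sig Cge(3))
  fix x h assume x: "norm x \<le> R" "S t x > qk" and h: "0 < h" "h < \<sigma>"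
  obtain y where y: "S t x = M t y - L t * norm (x - y)" "(t, y) \<in> K" "norm (x - y) \<le> (Wmax - qk) / L t"
   using opt[OF x] by blast
  have h': "h < s1" "h < \<tau>" "C' * h < e" using h C' by (auto simp: \<sigma>_def field_simps)
  have th: "t0 < t - h" "t - h \<le> t1" using h h' t by (auto simp: \<tau>_def)
  have "\<bar>M (t + - h) y - M t y\<bar> \<le> C1 * \<bar>- h\<bar>" using C1t[OF y(2), of "- h"] h h' by simp
  moreover have "(L (t - h) - L t) * norm (x - y) \<le> (CL * h) * rm"
   using Ldiff[OF h(1) h'(2)] y(3) CL h abs_ge_self[of "(Wmax - qk) / L t"] unfolding rm_def by (intro mult_mono) auto
  moreover have "M (t - h) y - L (t - h) * norm (x - y) \<le> S (t - h) x" by (rule S_ge[OF th])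
  ultimately have Sh: "S t x - C' * h \<le> S (t - h) x"
   using y(1) h by (simp add: C'_def algebra_simps)
  have Jx: "q \<in> J" if "S t x - e \<le> q" "q \<le> S t x" for q
   using that x(2) y(1) B(3)[OF y(2)] e(1) mult_nonneg_nonneg[OF less_imp_le[OF L_pos[OF t(1)]] norm_ge_zero[of "x - y"]]
   by (auto simp: J_def)
  have q1: "S t x - C' * h \<in> J" by (rule Jx) (use h' h C' in auto)
  have thin: "t - h \<in> {t0..t1}" using th by simp
  have SI: "S (t - h) x \<in> I" by (rule S_in_I[OF thin JI[OF q1] Sh])
  have "\<bar>N (S t x) - N (S t x - C' * h)\<bar> \<le> CN * \<bar>S t x - (S t x - C' * h)\<bar>"
   using field_differentiable_bound[of J N N1 CN "S t x" "S t x - C' * h"] CN q1 Jx[of "S t x"] e(1) JI N(1)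
   by (auto simp: J_def intro: has_field_derivative_at_within)
  then have "N (S t x) - N (S t x - C' * h) \<le> CN * C' * h" using C' h by (simp add: mult.assoc)
  moreover have "N (S t x - C' * h) \<le> N (S (t - h) x)" by (rule N_mono[OF JI[OF q1] SI Sh])
  moreover have "CN * C' * h \<le> C * h" using Cge h by (intro mult_right_mono) auto
  ultimately show "N (S t x) - N (S (t - h) x) \<le> C * h" by linarith
  show "S (t - h) x \<in> I" by fact
 next
  fix x i s assume x: "norm x \<le> R" "S t x > qk" and i: "i \<in> (Basis :: 'a set)" and s: "0 < s" "s < \<sigma>"
  obtain y where y: "S t x = M t y - L t * norm (x - y)" "(t, y) \<in> K" "norm (x - y) \<le> (Wmax - qk) / L t"
   using opt[OF x] by blast
  have s': "s < s1" "C1 * s < e" using s C1 by (auto simp: \<sigma>_def field_simps)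
  define q0 qp qm where "q0 = S t x" and "qp = M t (y + s *\<^sub>R i) - L t * norm (x - y)"
   and "qm = M t (y - s *\<^sub>R i) - L t * norm (x - y)"
  have b: "\<bar>qp - q0\<bar> \<le> C1 * s" "\<bar>qm - q0\<bar> \<le> C1 * s" "- (C1 * s^2) \<le> qp + qm - 2 * q0"
   using C1x[OF y(2) i, of s] C1x[OF y(2) i, of "- s"] s s' by (auto simp: q0_def qp_def qm_def y(1))
  have q0B: "qk < q0" "q0 \<le> B"
   using x(2) y(1) B(3)[OF y(2)] mult_nonneg_nonneg[OF less_imp_le[OF L_pos[OF t(1)]] norm_ge_zero[of "x - y"]]
   by (auto simp: q0_def)
  have J: "qp \<in> J" "qm \<in> J" "q0 \<in> J" using b s' q0B e(1) by (auto simp: J_def)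
  have Sp: "qp \<le> S t (x + s *\<^sub>R i)" using S_ge[OF t, of "y + s *\<^sub>R i" "x + s *\<^sub>R i"] by (simp add: qp_def)
  have Sm: "qm \<le> S t (x - s *\<^sub>R i)" using S_ge[OF t, of "y - s *\<^sub>R i" "x - s *\<^sub>R i"] by (simp add: qm_def)
  show SIp: "S t (x + s *\<^sub>R i) \<in> I" by (rule S_in_I[OF tin JI[OF J(1)] Sp])
  show SIm: "S t (x - s *\<^sub>R i) \<in> I" by (rule S_in_I[OF tin JI[OF J(2)] Sm])
  \<comment> \<open>Convexity of \<open>H\<close> is not assumed, so the lower bound for the second
    difference is carried through \<open>H\<close> by a second-order Taylor bound:
    \<open>b(3)\<close> controls the linear part, and the first-order bounds on
    \<open>qp - q0\<close> and \<open>qm - q0\<close> control the quadratic errors.\<close>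
  have T: "H q0 + H1 q0 * (q - q0) - CH2 * (q - q0)^2 \<le> H q" if "q \<in> J" for q
   by (rule taylor_lower_bound[OF H(1)[OF JI] H(2)[OF JI] CH2, unfolded J_def])
     (use J that in \<open>simp_all add: J_def\<close>)
  have sq: "(q - q0)^2 \<le> C1^2 * s^2" if "\<bar>q - q0\<bar> \<le> C1 * s" for q
   using power_mono[OF that, of 2] by (simp add: power_mult_distrib)
  have "- (C * s^2) \<le> - ((CH1 * C1 + 2 * CH2 * C1^2) * s^2)"
   using Cge by (simp add: mult_right_mono)
  also have "\<dots> = - (CH1 * (C1 * s^2)) - CH2 * (C1^2 * s^2) - CH2 * (C1^2 * s^2)" by (simp add: algebra_simps)
  also have "\<dots> \<le> H1 q0 * (qp + qm - 2 * q0) - CH2 * (qp - q0)^2 - CH2 * (qm - q0)^2"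
  proof -
   have H10: "0 < H1 q0" "H1 q0 \<le> CH1" using H1_pos[OF JI[OF J(3)]] CH1[OF J(3)] by auto
   have "- (CH1 * (C1 * s^2)) \<le> - (H1 q0 * (C1 * s^2))" using H10 C1 by (simp add: mult_right_mono)
   also have "\<dots> \<le> H1 q0 * (qp + qm - 2 * q0)"
    using mult_left_mono[OF b(3), of "H1 q0"] H10 by simp
   finally show ?thesis
    using mult_left_mono[OF sq[OF b(1)] C0(3)] mult_left_mono[OF sq[OF b(2)] C0(3)] by linarith
  qed
  also have "\<dots> \<le> H qp + H qm - 2 * H q0"
   using T[OF J(1)] T[OF J(2)] by (simp add: algebra_simps)
  also have "\<dots> \<le> diff2_comp H (S t) x (s *\<^sub>R i)"
   using H_mono[OF JI[OF J(1)] SIp Sp] H_mono[OF JI[OF J(2)] SIm Sm] by (simp add: q0_def)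
  finally show "- (C * s^2) \<le> diff2_comp H (S t) x (s *\<^sub>R i)" .
 qed
qed

end

context supconv
begin

lemma M_line_in_P:
 assumes "(t, y) \<in> P"
 shows "\<exists>e>0. \<forall>s. \<bar>s\<bar> < e \<longrightarrow> (t, y + (s * \<rho>) *\<^sub>R i) \<in> P"
proof -
 have "open P" using MP by (simp add: C12_def)
 then have "open ((\<lambda>s::real. (t, y + (s * \<rho>) *\<^sub>R i)) -` P)"
  by (rule open_vimage) (intro continuous_intros)
 moreover have "0 \<in> (\<lambda>s::real. (t, y + (s * \<rho>) *\<^sub>R i)) -` P" using assms by simp
 ultimately obtain e where "e > 0" "ball 0 e \<subseteq> (\<lambda>s::real. (t, y + (s * \<rho>) *\<^sub>R i)) -` P"
  using open_contains_ball by blast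
 then show ?thesis by (intro exI[of _ e]) (auto simp: subset_iff dist_real_def)
qed

text \<open>For a backward difference a lower barrier suffices: with the maximiser \<open>y\<close>
  frozen, \<open>q\<close> lies below \<open>S\<close> and touches it at time \<open>t\<close>. The
  extra term in the bound is \<open>- L' |x - y|\<close>, the price for the decreasing
  slope.\<close>

lemma S_time_infinitesimal:
 assumes t: "t0 < t" "t \<le> t1" and SI: "S t x \<in> I" and e: "e > 0"
  and y: "S t x = M t y - L t * norm (x - y)"
 shows "\<forall>\<^sub>F h in at_right 0. N (S t x) - N (S (t - h) x) \<le>
  h * (N1 (S t x) * (Mt t y + kap / 2 * (t - t0) powr (- (3 / 2)) * norm (x - y)) + e)"
proof -
 have tin: "t \<in> {t0..t1}" using t by simp
 have MI: "M t y \<in> I"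
  by (rule upI[OF tin SI]) (use y mult_nonneg_nonneg[OF less_imp_le[OF L_pos[OF t(1)]] norm_ge_zero[of "x - y"]] in linarith)
 have yP: "(t, y) \<in> P" by (rule PI[OF tin MI])
 define q where "q s = M s y - L s * norm (x - y)" for s
 have dM: "DERIV (\<lambda>s. M s y) t :> Mt t y" using MP yP by (simp add: C12_def)
 have dq: "DERIV q t :> Mt t y + kap / 2 * (t - t0) powr (- (3 / 2)) * norm (x - y)"
  unfolding q_def
  by (rule DERIV_cong[OF DERIV_diff[OF dM DERIV_cmult_right[OF L_derivative[OF t(1)]]]]) simp
 have qt: "q t = S t x" by (simp add: q_def y)
 have "DERIV (\<lambda>s. N (q s)) t :> N1 (S t x) * (Mt t y + kap / 2 * (t - t0) powr (- (3 / 2)) * norm (x - y))"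
  by (rule DERIV_chain2[where f = N and g = q]) (use N(1)[OF SI] dq qt in auto)
 from eventually_difference_le[OF this e]
 have 1: "\<forall>\<^sub>F h in at_right 0. N (q t) - N (q (t - h)) \<le>
  h * (N1 (S t x) * (Mt t y + kap / 2 * (t - t0) powr (- (3 / 2)) * norm (x - y)) + e)" .
 have lim: "((\<lambda>h. t - h) \<longlongrightarrow> t) (at_right 0)" by (auto intro!: tendsto_eq_intros)
 have "isCont q t" using dq by (rule DERIV_isCont)
 from isCont_tendsto_compose[OF this lim] have "((\<lambda>h. q (t - h)) \<longlongrightarrow> S t x) (at_right 0)" by (simp add: qt)
 from topological_tendstoD[OF this I(2) SI] have 2: "\<forall>\<^sub>F h in at_right 0. q (t - h) \<in> I" .
 have 3: "\<forall>\<^sub>F h in at_right 0. t0 < t - h" using order_tendstoD(1)[OF lim t(1)] .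
 have 4: "\<forall>\<^sub>F h in at_right 0. (h::real) > 0" by (simp add: eventually_at_right_less)
 from 1 2 3 4 show ?thesis
 proof eventually_elim
  case (elim h)
  have th: "t - h \<le> t1" using elim t by simp
  have le: "q (t - h) \<le> S (t - h) x" unfolding q_def by (rule S_ge[OF elim(3) th])
  have "N (q (t - h)) \<le> N (S (t - h) x)"
   by (rule N_mono[OF elim(2) _ le]) (rule S_in_I[OF _ elim(2) le], use elim th in auto)
  then show ?case using elim(1) by (simp add: qt)
 qed
qed

text \<open>At \<open>x = y\<close> the norm in the penalty is not differentiable, but there
  \<open>M\<close> itself touches \<open>S\<close> from below, and its equation gives the bound
  directly.\<close>

lemma S_infinitesimal_diagonal:
 assumes t: "t0 < t" "t \<le> t1" and SI: "S t x \<in> I" and e: "e > 0" and x: "S t x = M t x"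
 shows "\<forall>\<^sub>F s in at_right 0. s^2 * (N1 (S t x) * Mt t x - e) \<le>
   (\<Sum>i\<in>Basis. diff2_comp H (S t) x (s *\<^sub>R i))"
proof -
 have tin: "t \<in> {t0..t1}" using t by simp
 have xP: "(t, x) \<in> P" using PI[OF tin] SI x by simp
 have C: "C12 P (\<lambda>t x. H (M t x)) (\<lambda>t x. H1 (M t x) * Mt t x) (\<lambda>i t x. H1 (M t x) * M1 i t x)
  (\<lambda>i t x. H1 (M t x) * M2 i t x + H2 (M t x) * (M1 i t x)^2)"
  by (rule C12_compose[OF MP MPc PinI H])
 have "(\<Sum>i\<in>Basis. H1 (M t x) * M2 i t x + H2 (M t x) * (M1 i t x)^2) = N1 (S t x) * Mt t x"
  using SI x pde[OF tin, of x] f(2,3)[OF SI]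
  by (simp add: sum.distrib sum_distrib_left[symmetric] distrib_left mult.assoc mult.left_commute)
 with C12_second_difference_tendsto[OF C xP]
 have "((\<lambda>s. (\<Sum>i\<in>Basis. diff2_comp H (M t) x (s *\<^sub>R i)) / s^2) \<longlongrightarrow> N1 (S t x) * Mt t x) (at_right 0)"
  by simp
 from eventually_second_difference_ge[OF this e]
 have 1: "\<forall>\<^sub>F s in at_right 0. s^2 * (N1 (S t x) * Mt t x - e) \<le>
   (\<Sum>i\<in>Basis. diff2_comp H (M t) x (s *\<^sub>R i))" .
 have "open P" using MP by (simp add: C12_def)
 then obtain r where r: "r > 0" "ball (t, x) r \<subseteq> P" using xP open_contains_ball by blast
 have inI: "M t (x + s *\<^sub>R i) \<in> I" if "\<bar>s\<bar> < r" "i \<in> Basis" for s i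
  by (rule PinI, rule subsetD[OF r(2)]) (use that in \<open>simp add: dist_Pair_Pair dist_norm\<close>)
 have 2: "\<forall>\<^sub>F s in at_right 0. 0 < s \<and> s < r"
  unfolding eventually_at_right_field using r by blast
 from 1 2 show ?thesis
 proof eventually_elim
  case (elim s)
  have le: "H (M t (x + s' *\<^sub>R i)) \<le> H (S t (x + s' *\<^sub>R i))" if "\<bar>s'\<bar> < r" "i \<in> Basis" for s' i
   by (rule H_mono[OF inI[OF that] _ M_le_S[OF tin]]) (rule S_in_I[OF tin inI[OF that] M_le_S[OF tin]])
  have "(\<Sum>i\<in>Basis. diff2_comp H (M t) x (s *\<^sub>R i))
   \<le> (\<Sum>i\<in>Basis. diff2_comp H (S t) x (s *\<^sub>R i))"
   using le[of s] le[of "- s"] elim by (intro sum_mono) (auto simp: x intro!: add_mono)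
  with elim(1) show ?case by linarith
 qed
qed

text \<open>Coupling: the step \<open>s i\<close> at \<open>x\<close> is matched with the step \<open>s \<rho> i\<close> at \<open>y\<close>, where
 \<open>\<rho> = sqrt (f (M t y) / f (S t x))\<close> compensates the different diffusivities.\<close>
lemma S_infinitesimal_off_diagonal:
 assumes t: "t0 < t" "t \<le> t1" and SI: "S t x \<in> I" and e: "e > 0"
  and y: "S t x = M t y - L t * norm (x - y)" and xy: "x \<noteq> y"
 shows "\<forall>\<^sub>F s in at_right 0. s^2 * (N1 (S t x) * (Mt t y + kap / 2 * (t - t0) powr (- (3 / 2)) * norm (x - y)) - e) \<le>
   (\<Sum>i\<in>Basis. diff2_comp H (S t) x (s *\<^sub>R i))"
proof -
 have tin: "t \<in> {t0..t1}" using t by simp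
 define z r q0 q2 where "z = x - y" and "r = norm z" and "q0 = S t x" and "q2 = M t y"
 define lt where "lt = L t"
 have lt: "lt > 0" using L_pos[OF t(1)] by (simp add: lt_def)
 have r: "r > 0" using xy by (simp add: r_def z_def)
 have q2: "q2 = q0 + lt * r" using y by (simp add: q2_def q0_def lt_def r_def z_def)
 have q0I: "q0 \<in> I" using SI by (simp add: q0_def)
 have q02: "q0 < q2" using q2 lt r by simp
 have q2I: "q2 \<in> I" unfolding q2_def by (rule upI[OF tin q0I]) (use q02 in \<open>simp add: q2_def\<close>)
 have yP: "(t, y) \<in> P" using PI[OF tin] q2I by (simp add: q2_def)
 define \<rho> where "\<rho> = sqrt (f q2 / f q0)"
 have fpos: "0 < f q0" "0 < f q2" using f(1) q0I q2I by auto
 have rho: "f q0 * \<rho>^2 = f q2" "f q0 * (1 - \<rho>)^2 = (sqrt (f q2) - sqrt (f q0))^2"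
 proof -
  show 1: "f q0 * \<rho>^2 = f q2" using fpos by (simp add: \<rho>_def)
  have "\<rho> * sqrt (f q0) = sqrt (f q2)" using fpos by (simp add: \<rho>_def real_sqrt_divide)
  then have "(sqrt (f q2) - sqrt (f q0))^2 = ((\<rho> - 1) * sqrt (f q0))^2" by (simp add: algebra_simps)
  also have "\<dots> = f q0 * (1 - \<rho>)^2" using fpos by (simp add: power_mult_distrib power2_commute)
  finally show "f q0 * (1 - \<rho>)^2 = (sqrt (f q2) - sqrt (f q0))^2" ..
 qed
 \<comment> \<open>Moving the two end points by different amounts changes the connecting vector by
   \<open>(1 - \<rho>) s i\<close>. The second derivative of the norm along this change is the price
   of the coupling.\<close>
 define q where "q i s = M t (y + (s * \<rho>) *\<^sub>R i) - lt * norm (z + s *\<^sub>R ((1 - \<rho>) *\<^sub>R i))" for i s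
 define q' where "q' i s = \<rho> * M1 i t (y + (s * \<rho>) *\<^sub>R i) - lt * ((1 - \<rho>) * ((z + s *\<^sub>R ((1 - \<rho>) *\<^sub>R i)) \<bullet> i)
   / norm (z + s *\<^sub>R ((1 - \<rho>) *\<^sub>R i)))" for i s
 define q'' where "q'' i = \<rho>^2 * M2 i t y - lt * ((1 - \<rho>)^2 * (1 / r - (z \<bullet> i)^2 / r ^ 3))" for i
 have q_0: "q i 0 = q0" for i using q2 by (simp add: q_def q2_def r_def)
 have q_le: "q i s \<le> S t (x + s *\<^sub>R i)" for i s
 proof -
  have "x + s *\<^sub>R i - (y + (s * \<rho>) *\<^sub>R i) = z + s *\<^sub>R ((1 - \<rho>) *\<^sub>R i)"
   by (simp add: z_def algebra_simps)
  then show ?thesis using S_ge[OF t, of "y + (s * \<rho>) *\<^sub>R i" "x + s *\<^sub>R i"] by (simp add: q_def lt_def)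
 qed
 \<comment> \<open>First-order condition for the maximiser, obtained by moving \<open>y\<close>
   alone: the gradient of \<open>M\<close> at \<open>y\<close> has length \<open>lt\<close> and
   points away from \<open>x\<close>. As a consequence the first derivative of \<open>q i\<close> at
   0 does not depend on \<open>\<rho>\<close>.\<close>
 have grad: "M1 i t y = - lt * (z \<bullet> i) / r" if i: "i \<in> Basis" for i
 proof -
  let ?g = "\<lambda>s. M t (y + s *\<^sub>R i) - lt * norm (z + s *\<^sub>R ((- 1) *\<^sub>R i))"
  have d: "(?g has_real_derivative M1 i t (y + 0 *\<^sub>R i) - lt * (- 1 * ((z + 0 *\<^sub>R ((- 1) *\<^sub>R i)) \<bullet> i) / norm (z + 0 *\<^sub>R ((- 1) *\<^sub>R i)))) (at 0)"
   by (intro DERIV_diff DERIV_cmult C12_line(1)[OF MP] norm_line_derivative) (use yP i r in \<open>auto simp: r_def\<close>)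
  have "M1 i t (y + 0 *\<^sub>R i) - lt * (- 1 * ((z + 0 *\<^sub>R ((- 1) *\<^sub>R i)) \<bullet> i) / norm (z + 0 *\<^sub>R ((- 1) *\<^sub>R i))) = 0"
  proof (rule DERIV_local_max[OF d, of 1])
   show "\<forall>s. \<bar>0 - s\<bar> < 1 \<longrightarrow> ?g s \<le> ?g 0"
   proof (intro allI impI)
    fix s
    have "M t (y + s *\<^sub>R i) - L t * norm (x - (y + s *\<^sub>R i)) \<le> S t x" by (rule S_ge[OF t])
    moreover have "x - (y + s *\<^sub>R i) = z + s *\<^sub>R ((- 1) *\<^sub>R i)" by (simp add: z_def)
    moreover have "?g 0 = S t x" using y by (simp add: lt_def z_def)
    ultimately show "?g s \<le> ?g 0" by (simp add: lt_def)
   qed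
  qed simp
  then show ?thesis by (simp add: r_def)
 qed
 have nz: "\<exists>e>0. \<forall>s. \<bar>s\<bar> < e \<longrightarrow> (t, y + (s * \<rho>) *\<^sub>R i) \<in> P \<and> z + s *\<^sub>R ((1 - \<rho>) *\<^sub>R i) \<noteq> 0 \<and> q i s \<in> I"
  if i: "i \<in> Basis" for i
 proof -
  obtain e1 where e1: "e1 > 0" "\<And>s. \<bar>s\<bar> < e1 ==> (t, y + (s * \<rho>) *\<^sub>R i) \<in> P"
   using M_line_in_P[OF yP] by blast
  define e2 where "e2 = r / (\<bar>1 - \<rho>\<bar> + 1)"
  have e2: "e2 > 0" using r by (simp add: e2_def)
  have nz: "z + s *\<^sub>R ((1 - \<rho>) *\<^sub>R i) \<noteq> 0" if "\<bar>s\<bar> < e2" for s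
  proof
   assume "z + s *\<^sub>R ((1 - \<rho>) *\<^sub>R i) = 0"
   then have "z = - (s *\<^sub>R ((1 - \<rho>) *\<^sub>R i))" by (simp add: eq_neg_iff_add_eq_0)
   then have "r = \<bar>s\<bar> * \<bar>1 - \<rho>\<bar>" using i by (simp add: r_def abs_mult)
   also have "\<dots> \<le> \<bar>s\<bar> * (\<bar>1 - \<rho>\<bar> + 1)" by (intro mult_left_mono) auto
   also have "\<dots> < r" using that by (simp add: e2_def field_simps)
   finally show False by simp
  qed
  have "isCont (q i) 0"
  proof -
   have "DERIV (\<lambda>s. M t (y + (s * \<rho>) *\<^sub>R i)) 0 :> M1 i t (y + (0 * \<rho>) *\<^sub>R i) * \<rho>"
    by (rule DERIV_chain2[where g = "\<lambda>s. s * \<rho>" and f = "\<lambda>s. M t (y + s *\<^sub>R i)"], rule C12_line(1)[OF MP])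
     (use yP i in \<open>auto intro!: derivative_eq_intros\<close>)
   then have "isCont (\<lambda>s. M t (y + (s * \<rho>) *\<^sub>R i)) 0" by (rule DERIV_isCont)
   then show ?thesis unfolding q_def by (intro continuous_intros)
  qed
  then have "(q i \<longlongrightarrow> q0) (at 0)" by (simp add: isCont_def q_0)
  from topological_tendstoD[OF this I(2) q0I]
  obtain e3 where e3: "e3 > 0" "\<And>s. s \<noteq> 0 ==> \<bar>s\<bar> < e3 ==> q i s \<in> I"
   unfolding eventually_at by (auto simp: dist_real_def)
  have "q i s \<in> I" if "\<bar>s\<bar> < e3" for s using e3(2)[of s] that q_0[of i] q0I by (cases "s = 0") auto
  then show ?thesis using e1 e2 e3(1) nz by (intro exI[of _ "min e1 (min e2 e3)"]) auto
 qed
 have dq: "(q i has_real_derivative q' i s) (at s)"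
  if i: "i \<in> Basis" and s: "(t, y + (s * \<rho>) *\<^sub>R i) \<in> P" "z + s *\<^sub>R ((1 - \<rho>) *\<^sub>R i) \<noteq> 0" for i s
 proof -
  have "DERIV (\<lambda>s. M t (y + (s * \<rho>) *\<^sub>R i)) s :> M1 i t (y + (s * \<rho>) *\<^sub>R i) * \<rho>"
   by (rule DERIV_chain2[where g = "\<lambda>s. s * \<rho>" and f = "\<lambda>s. M t (y + s *\<^sub>R i)"], rule C12_line(1)[OF MP s(1) i])
    (auto intro!: derivative_eq_intros)
  from DERIV_diff[OF this DERIV_cmult[OF norm_line_derivative[OF s(2) i]]]
  show ?thesis unfolding q_def q'_def by (simp add: mult.commute)
 qed
 have dq': "(q' i has_real_derivative q'' i) (at 0)" if i: "i \<in> Basis" for i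
 proof -
  have 1: "DERIV (\<lambda>s. M1 i t (y + (s * \<rho>) *\<^sub>R i)) 0 :> M2 i t (y + (0 * \<rho>) *\<^sub>R i) * \<rho>"
   by (rule DERIV_chain2[where g = "\<lambda>s. s * \<rho>" and f = "\<lambda>s. M1 i t (y + s *\<^sub>R i)"], rule C12_line(2)[OF MP _ i])
    (use yP in \<open>auto intro!: derivative_eq_intros\<close>)
  have 2: "DERIV (\<lambda>s. (z + s *\<^sub>R ((1 - \<rho>) *\<^sub>R i)) \<bullet> i) 0 :> 1 - \<rho>"
  proof -
   have "(\<lambda>s. (z + s *\<^sub>R ((1 - \<rho>) *\<^sub>R i)) \<bullet> i) = (\<lambda>s. z \<bullet> i + s * (1 - \<rho>))"
    using i by (simp add: inner_add_left)
   then show ?thesis by (auto intro!: derivative_eq_intros)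
  qed
  have 3: "DERIV (\<lambda>s. norm (z + s *\<^sub>R ((1 - \<rho>) *\<^sub>R i))) 0 :> (1 - \<rho>) * (z \<bullet> i) / r"
   using norm_line_derivative[of z 0 "1 - \<rho>" i] r i by (simp add: r_def)
  have 4: "DERIV (\<lambda>s. ((z + s *\<^sub>R ((1 - \<rho>) *\<^sub>R i)) \<bullet> i) / norm (z + s *\<^sub>R ((1 - \<rho>) *\<^sub>R i))) 0 :> (1 - \<rho>) * (1 / r - (z \<bullet> i)^2 / r ^ 3)"
   by (rule DERIV_cong[OF DERIV_divide[OF 2 3]])
     (use r in \<open>auto simp: r_def[symmetric] field_simps power2_eq_square power3_eq_cube\<close>)
  have "((\<lambda>s. \<rho> * M1 i t (y + (s * \<rho>) *\<^sub>R i) - lt * ((1 - \<rho>) * (((z + s *\<^sub>R ((1 - \<rho>) *\<^sub>R i)) \<bullet> i)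
   / norm (z + s *\<^sub>R ((1 - \<rho>) *\<^sub>R i))))) has_real_derivative
   \<rho> * (M2 i t (y + (0 * \<rho>) *\<^sub>R i) * \<rho>) - lt * ((1 - \<rho>) * ((1 - \<rho>) * (1 / r - (z \<bullet> i)^2 / r ^ 3)))) (at 0)"
   by (intro DERIV_diff DERIV_cmult 1 4)
  then show ?thesis unfolding q'_def q''_def by (simp add: power2_eq_square mult.assoc mult.left_commute mult.commute[of "M2 i t y" \<rho>])
 qed
 have lim: "((\<lambda>s. (H (q i s) + H (q i (- s)) - 2 * H (q i 0)) / s^2) \<longlongrightarrow> H2 q0 * (q' i 0)^2 + H1 q0 * q'' i) (at_right 0)"
  if i: "i \<in> Basis" for i
 proof -
  obtain e' where e': "e' > 0" "\<And>s. \<bar>s\<bar> < e' ==> (t, y + (s * \<rho>) *\<^sub>R i) \<in> P \<and> z + s *\<^sub>R ((1 - \<rho>) *\<^sub>R i) \<noteq> 0 \<and> q i s \<in> I"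
   using nz[OF i] by blast
  show ?thesis
  proof (rule second_difference_tendsto[where e = e' and g' = "\<lambda>s. H1 (q i s) * q' i s"])
   fix s assume "\<bar>s\<bar> < e'"
   then show "DERIV (\<lambda>s. H (q i s)) s :> H1 (q i s) * q' i s"
    using e' by (intro DERIV_chain2[where f = H and g = "q i"] H(1) dq i) auto
  next
   have q1: "(q i has_real_derivative q' i 0) (at 0)" using e' by (intro dq i) (use e'(2)[of 0] in auto)
   have "DERIV (\<lambda>s. H1 (q i s)) 0 :> H2 q0 * q' i 0"
    by (rule DERIV_chain2[where f = H1 and g = "q i", OF _ q1]) (use H(2)[OF q0I] q_0 in simp)
   from DERIV_mult[OF this dq'[OF i]]
   show "DERIV (\<lambda>s. H1 (q i s) * q' i s) 0 :> H2 q0 * (q' i 0)^2 + H1 q0 * q'' i"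
    by (simp add: q_0 power2_eq_square algebra_simps)
  qed (rule e')
 qed
 define l2 where "l2 = (\<Sum>i\<in>Basis. H2 q0 * (q' i 0)^2 + H1 q0 * q'' i)"
 have "((\<lambda>s. \<Sum>i\<in>Basis. (H (q i s) + H (q i (- s)) - 2 * H (q i 0)) / s^2) \<longlongrightarrow> l2) (at_right 0)"
  unfolding l2_def by (intro tendsto_sum lim)
 then have "((\<lambda>s. (\<Sum>i\<in>Basis. H (q i s) + H (q i (- s)) - 2 * H (q i 0)) / s^2) \<longlongrightarrow> l2) (at_right 0)"
  by (simp add: sum_divide_distrib)
 from eventually_second_difference_ge[OF this e]
 have ev1: "\<forall>\<^sub>F s in at_right 0. s^2 * (l2 - e) \<le> (\<Sum>i\<in>Basis. H (q i s) + H (q i (- s)) - 2 * H (q i 0))" .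
 have "\<forall>i\<in>Basis. \<forall>\<^sub>F s in at_right 0. q i s \<in> I \<and> q i (- s) \<in> I"
 proof
  fix i :: 'a assume i: "i \<in> Basis"
  obtain e' where e': "e' > 0" "\<And>s. \<bar>s\<bar> < e' ==> q i s \<in> I"
   using nz[OF i] by blast
  show "\<forall>\<^sub>F s in at_right 0. q i s \<in> I \<and> q i (- s) \<in> I"
   unfolding eventually_at_right_field using e' by (intro exI[of _ e']) auto
 qed
 then have ev2: "\<forall>\<^sub>F s in at_right 0. \<forall>i\<in>Basis. q i s \<in> I \<and> q i (- s) \<in> I"
  by (simp add: eventually_ball_finite_distrib)
 have zz: "(\<Sum>i\<in>Basis. (z \<bullet> i)^2) = r^2"
  unfolding r_def power2_norm_eq_inner by (subst euclidean_inner[of z z]) (simp add: power2_eq_square)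
 have q'0: "q' i 0 = - lt * (z \<bullet> i) / r" if "i \<in> Basis" for i
  using grad[OF that] r by (simp add: q'_def r_def[symmetric] field_simps)
 have sum1: "(\<Sum>i\<in>Basis. (q' i 0)^2) = lt^2"
 proof -
  have "(\<Sum>i\<in>Basis. (q' i 0)^2) = (\<Sum>i\<in>Basis. (lt / r)^2 * (z \<bullet> i)^2)"
   by (intro sum.cong refl) (simp add: q'0 power_divide power_mult_distrib)
  also have "\<dots> = (lt / r)^2 * (\<Sum>i\<in>Basis. (z \<bullet> i)^2)" by (simp only: sum_distrib_left)
  also have "\<dots> = lt^2" using r by (simp add: zz power_divide)
  finally show ?thesis .
 qed
 have sumM: "(\<Sum>i\<in>Basis. (M1 i t y)^2) = lt^2"
 proof -
  have "(\<Sum>i\<in>Basis. (M1 i t y)^2) = (\<Sum>i\<in>Basis. (q' i 0)^2)"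
   by (intro sum.cong refl) (simp add: q'0 grad)
  then show ?thesis by (simp add: sum1)
 qed
 define A where "A = (\<Sum>i\<in>Basis. M2 i t y)"
 \<comment> \<open>One less than the dimension: \<open>d / r\<close> is the Laplacian of the norm at
   distance \<open>r\<close>.\<close>
 define d where "d = real DIM('a) - 1"
 have sum2: "(\<Sum>i\<in>Basis. q'' i) = \<rho>^2 * A - lt * (1 - \<rho>)^2 * (d / r)"
 proof -
  have "(\<Sum>i\<in>(Basis::'a set). 1 / r - (z \<bullet> i)^2 / r ^ 3) = real DIM('a) / r - (\<Sum>i\<in>Basis. (z \<bullet> i)^2) / r ^ 3"
   by (simp add: sum_subtractf sum_divide_distrib)
  also have "\<dots> = d / r" using r unfolding zz by (simp add: d_def field_simps power2_eq_square power3_eq_cube)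
  finally have "(\<Sum>i\<in>(Basis::'a set). 1 / r - (z \<bullet> i)^2 / r ^ 3) = d / r" .
  then show ?thesis
   by (simp add: q''_def sum_subtractf sum_distrib_left[symmetric] A_def mult.assoc)
 qed
 define lam where "lam = kap / 2 * (t - t0) powr (- (3 / 2))"
 have l2: "l2 = N1 q0 * (f q2 * A - (sqrt (f q2) - sqrt (f q0))^2 * lt * (d / r) + h q0 * lt^2)"
 proof -
  have "l2 = H2 q0 * lt^2 + H1 q0 * (\<rho>^2 * A - lt * (1 - \<rho>)^2 * (d / r))"
   by (simp add: l2_def sum.distrib sum_distrib_left[symmetric] sum1 sum2)
  also have "\<dots> = N1 q0 * ((f q0 * \<rho>^2) * A - (f q0 * (1 - \<rho>)^2) * lt * (d / r) + h q0 * lt^2)"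
   by (simp add: f(2,3)[OF q0I] algebra_simps)
  finally show ?thesis by (simp only: rho)
 qed
 have Mt: "Mt t y = f q2 * A + h q2 * lt^2"
  using pde[OF tin, of y] q2I by (simp add: q2_def[symmetric] A_def sumM)
 have "lt ^ 3 = kap ^ 3 * (t - t0) powr (- (3 / 2))"
  using t by (simp add: lt_def L_def power_mult_distrib powr_power)
 then have "c0 * lt ^ 3 = (2 * c0 * kap^2) * lam" by (simp add: lam_def power2_eq_square power3_eq_cube)
 moreover have "lam \<ge> 0" using kap by (simp add: lam_def)
 ultimately have lam: "lam \<le> c0 * lt ^ 3"
  using mult_right_mono[OF kap(2), of lam] by (simp only: mult_1)
 \<comment> \<open>\<open>key\<close> is applied to the values at the two end points, whose
   difference is slope times distance. Multiplication by \<open>lt / r\<close> turns it into a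
   statement about the terms of the two equations, with \<open>c0 * lt ^ 3 * r\<close> left to
   absorb the term \<open>lam * r\<close>.\<close>
 have "(h q2 - h q0) * (lt * r) + d * (sqrt (f q2) - sqrt (f q0))^2 \<le> - c0 * (lt * r)^2"
 proof -
  have "q2 \<le> Wmax" using Mmax[OF tin, of y] by (simp add: q2_def)
  moreover have "q2 - q0 = lt * r" using q2 by simp
  ultimately show ?thesis using key[OF q0I q2I q02] by (simp only: d_def)
 qed
 then have "((h q2 - h q0) * (lt * r) + d * (sqrt (f q2) - sqrt (f q0))^2) * (lt / r) \<le> (- c0 * (lt * r)^2) * (lt / r)"
  using lt r by (intro mult_right_mono) auto
 then have "(h q2 - h q0) * lt^2 + (sqrt (f q2) - sqrt (f q0))^2 * lt * (d / r) \<le> - (c0 * lt ^ 3) * r"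
  using r by (simp add: field_simps power2_eq_square power3_eq_cube)
 also have "\<dots> \<le> - lam * r" using lam r by (simp add: mult_right_mono)
 finally have "Mt t y + lam * r \<le> f q2 * A - (sqrt (f q2) - sqrt (f q0))^2 * lt * (d / r) + h q0 * lt^2"
  unfolding Mt by (simp add: algebra_simps)
 then have le: "N1 q0 * (Mt t y + lam * r) \<le> l2"
  unfolding l2 using N(3)[OF q0I] by (intro mult_left_mono) auto
 from ev1 ev2 show ?thesis
 proof eventually_elim
  case (elim s)
  have HH: "H (q i s') \<le> H (S t (x + s' *\<^sub>R i))" if "q i s' \<in> I" for i s'
   by (rule H_mono[OF that S_in_I[OF tin that q_le] q_le])
  have "s^2 * (N1 q0 * (Mt t y + lam * r) - e) \<le> s^2 * (l2 - e)"
   using le by (intro mult_left_mono) auto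
  also have "\<dots> \<le> (\<Sum>i\<in>Basis. H (q i s) + H (q i (- s)) - 2 * H (q i 0))" by (rule elim(1))
  also have "\<dots> \<le> (\<Sum>i\<in>Basis. diff2_comp H (S t) x (s *\<^sub>R i))"
  proof (rule sum_mono)
   fix i :: 'a assume i: "i \<in> Basis"
   show "H (q i s) + H (q i (- s)) - 2 * H (q i 0) \<le> diff2_comp H (S t) x (s *\<^sub>R i)"
    using HH[of i s] HH[of i "- s"] elim(2) i by (simp add: q_0 q0_def)
  qed
  finally show ?case by (simp add: q0_def lam_def r_def z_def)
 qed
qed

lemma S_infinitesimal:
 assumes t: "t0 < t" "t \<le> t1" and SI: "S t x \<in> I" and e: "e > 0"
 shows "\<exists>l. (\<forall>\<^sub>F h in at_right 0. N (S t x) - N (S (t - h) x) \<le> h * (l + e)) \<and>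
  (\<forall>\<^sub>F s in at_right 0. s^2 * (l - e) \<le> (\<Sum>i\<in>Basis. diff2_comp H (S t) x (s *\<^sub>R i)))"
proof -
 obtain y where y: "S t x = M t y - L t * norm (x - y)" using S_eq[OF t] by blast
 show ?thesis
 proof (cases "x = y")
  case True
  then have x: "S t x = M t x" using y by simp
  from S_time_infinitesimal[OF t SI e, of x] S_infinitesimal_diagonal[OF t SI e x] x show ?thesis
   by (intro exI[of _ "N1 (S t x) * Mt t x"]) simp
 next
  case False
  from S_time_infinitesimal[OF t SI e y] S_infinitesimal_off_diagonal[OF t SI e y False] show ?thesis by blast
 qed
qed

end

section \<open>Monotonicity of the mass and the Lipschitz bound\<close>

text \<open>Linearises a sublinear power at the scale \<open>l\<close>. The numerical constant is
  not sharp, but the power of \<open>l\<close> is the right one, and that is what counts when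
  \<open>l\<close> is chosen as a power of the radius.\<close>

lemma powr_le_affine:
 fixes x l :: real
 assumes "0 \<le> x" "0 < l" "0 < \<theta>" "\<theta> < 1"
 shows "x powr \<theta> \<le> l powr (\<theta> - 1) * (x + l)"
proof (cases "x \<le> l")
 case True
 have "x powr \<theta> \<le> l powr \<theta>" using True assms by (intro powr_mono2) auto
 also have "\<dots> = l powr (\<theta> - 1) * l" using assms by (simp add: powr_diff)
 also have "\<dots> \<le> l powr (\<theta> - 1) * (x + l)" using assms by (intro mult_left_mono) auto
 finally show ?thesis .
next
 case False
 then have x: "0 < x" using assms by simp
 have "x powr \<theta> = x powr (\<theta> - 1) * x" using x by (simp add: powr_diff)
 also have "\<dots> \<le> l powr (\<theta> - 1) * x" using False assms x by (intro mult_right_mono powr_mono2') auto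
 also have "\<dots> \<le> l powr (\<theta> - 1) * (x + l)" using assms by (intro mult_left_mono) auto
 finally show ?thesis .
qed

text \<open>The choice of \<open>p\<close> makes \<open>m ^ (p - 2)\<close> at most
  \<open>(m ^ p) powr \<theta>\<close>, so that density and weight combine into the power \<theta>
  of the localised density. This is then linearised, and the estimate closes in terms of the
  localised mass.\<close>

lemma diffusion_times_sum_bump2_le:
 fixes x :: "'a::euclidean_space"
 assumes w: "0 \<le> w" and mono: "\<And>v. 0 \<le> v ==> v \<le> \<kappa> ==> \<Phi> v \<le> \<Phi> \<kappa>" and Phik: "0 \<le> \<Phi> \<kappa>"
  and B: "0 \<le> B" "\<kappa> < w ==> \<Phi> w \<le> B * w powr \<theta>"
  and th: "0 < \<theta>" "\<theta> < 1" and l: "0 < l" and R: "0 < R" and p: "3 \<le> p" "\<theta> * real p \<le> real p - 2"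
 shows "max 0 (\<Phi> w - \<Phi> \<kappa>) * (\<Sum>i\<in>Basis. bump2 p R i x)
  \<le> 4 * (real p)^2 * B * (R powr - 2 * l powr (\<theta> - 1)) * ((if \<kappa> < w then w * bump p R x else 0) + l * indicator (cball 0 R) x)"
  (is "?lhs \<le> ?A * (?w + ?l)")
proof -
 have A: "0 \<le> ?A" using B by simp
 have r0: "0 \<le> ?A * (?w + ?l)" using A w l by (auto simp: bump_nonneg intro!: mult_nonneg_nonneg)
 show ?thesis
 proof (cases "\<kappa> < w")
  case False
  then have "max 0 (\<Phi> w - \<Phi> \<kappa>) = 0" using mono[OF w] by auto
  then show ?thesis using r0 by simp
 next
  case kw: True
  define m where "m = max 0 (1 - (norm x)^2 / R^2)"
  have m: "0 \<le> m" "m \<le> 1" using R by (auto simp: m_def)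
  have R2: "4 * (real p)^2 / R^2 = 4 * (real p)^2 * R powr - 2" using R by (simp add: powr_minus divide_inverse)
  have s: "(\<Sum>i\<in>Basis. bump2 p R i x) \<le> 4 * (real p)^2 * R powr - 2 * m ^ (p - 2)"
   using sum_bump2_le[OF R p(1), of x] unfolding m_def R2 by simp
  show ?thesis
  proof (cases "m = 0")
   case True
   then have "(\<Sum>i\<in>Basis. bump2 p R i x) \<le> 0" using s p by (simp add: power_0_left)
   then have "?lhs \<le> 0" by (intro mult_nonneg_nonpos) auto
   then show ?thesis using r0 by linarith
  next
   case False
   then have mp: "0 < m" using m by simp
   have "norm x < R"
   proof (rule ccontr)
    assume "\<not> norm x < R"
    then have "(norm x)^2 / R^2 \<ge> 1" using R by (simp add: power_mono)
    then show False using mp by (simp add: m_def)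
   qed
   then have ind: "indicator (cball 0 R) x = (1::real)" by simp
   have b: "bump p R x = m ^ p" by (simp add: bump_def m_def)
   have "m ^ (p - 2) = m powr (real p - 2)" using mp p by (simp add: powr_realpow[symmetric] of_nat_diff)
   also have "\<dots> \<le> m powr (\<theta> * real p)" using mp m p by (intro powr_mono') auto
   also have "\<dots> = (m ^ p) powr \<theta>" using mp by (simp add: powr_realpow[symmetric] powr_powr mult.commute)
   finally have mm: "m ^ (p - 2) \<le> (m ^ p) powr \<theta>" .
   have W: "max 0 (\<Phi> w - \<Phi> \<kappa>) \<le> B * w powr \<theta>" using B(2)[OF kw] Phik B(1) by simp
   have "?lhs \<le> max 0 (\<Phi> w - \<Phi> \<kappa>) * (4 * (real p)^2 * R powr - 2 * m ^ (p - 2))"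
    by (intro mult_left_mono s) auto
   also have "\<dots> \<le> (B * w powr \<theta>) * (4 * (real p)^2 * R powr - 2 * (m ^ p) powr \<theta>)"
    using W mm m B by (intro mult_mono mult_left_mono) auto
   also have "\<dots> = 4 * (real p)^2 * B * R powr - 2 * (w * m ^ p) powr \<theta>"
    using w m by (simp add: powr_mult)
   also have "\<dots> \<le> 4 * (real p)^2 * B * R powr - 2 * (l powr (\<theta> - 1) * (w * m ^ p + l))"
    using w m B l th by (intro mult_left_mono powr_le_affine) auto
   also have "\<dots> = ?A * (?w + ?l)" using kw ind b by simp
   finally show ?thesis .
  qed
 qed
qed

lemma integrable_indicator_cball: "integrable lborel (indicat_real (cball (0::'a::euclidean_space) R))"
 by (intro integrable_real_indicator) (simp_all add: emeasure_lborel_cball_finite[unfolded infinity_ennreal_def])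

lemma integral_indicator_cball:
 "0 \<le> R ==> (LINT x|lborel. indicat_real (cball (0::'a::euclidean_space) R) x) = unit_ball_vol (real DIM('a)) * R ^ DIM('a)"
 by (simp add: content_cball)

lemma integral_diffusion_bump2_le:
 fixes w :: "'a::euclidean_space => real"
 assumes wc: "continuous_on UNIV w" and w: "\<And>x. 0 \<le> w x"
  and Phi: "continuous_on {0..} \<Phi>" "\<And>x y. 0 \<le> x ==> x < y ==> \<Phi> x < \<Phi> y" and Phik: "0 \<le> \<Phi> \<kappa>" "0 \<le> \<kappa>"
  and B: "0 \<le> B" "\<And>x. \<kappa> < w x ==> \<Phi> (w x) \<le> B * w x powr \<theta>"
  and th: "0 < \<theta>" "\<theta> < 1" and l: "0 < l" and R: "0 < R" and p: "3 \<le> p" "\<theta> * real p \<le> real p - 2"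
 shows "(LINT x|lborel. max 0 (\<Phi> (w x) - \<Phi> \<kappa>) * (\<Sum>i\<in>Basis. bump2 p R i x))
  \<le> 4 * (real p)^2 * B * (R powr - 2 * l powr (\<theta> - 1)) *
    ((LINT x|lborel. (if \<kappa> < w x then w x * bump p R x else 0)) + l * (unit_ball_vol (real DIM('a)) * R ^ DIM('a)))"
proof -
 have p0: "0 < p" using p by simp
 have b0: "bump p R x = 0" if "norm x > R" for x :: 'a using bump_eq_0[OF R p0, of x] that by simp
 have [measurable]: "w \<in> borel_measurable borel" "(bump p R :: 'a => real) \<in> borel_measurable borel"
  by (intro borel_measurable_continuous_onI wc continuous_on_bump R)+
 have i1: "integrable lborel (\<lambda>x. if \<kappa> < w x then w x * bump p R x else 0)"
 proof (rule Bochner_Integration.integrable_bound)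
  show "integrable lborel (\<lambda>x. w x * bump p R x)"
   by (rule integrable_continuous_support[where R = R]) (auto intro!: continuous_intros wc continuous_on_bump R simp: b0)
 qed (use w bump_nonneg in auto)
 have mono: "\<Phi> v \<le> \<Phi> \<kappa>" if "0 \<le> v" "v \<le> \<kappa>" for v using Phi(2)[OF that(1), of \<kappa>] that by (cases "v = \<kappa>") auto
 have wPhi: "continuous_on UNIV (\<lambda>x. \<Phi> (w x))"
  by (rule continuous_on_compose2[OF Phi(1) wc]) (use w in auto)
 have i0: "integrable lborel (\<lambda>x. max 0 (\<Phi> (w x) - \<Phi> \<kappa>) * (\<Sum>i\<in>Basis. bump2 p R i x))"
 proof (rule integrable_continuous_support[where R = R])
  show "continuous_on UNIV (\<lambda>x. max 0 (\<Phi> (w x) - \<Phi> \<kappa>) * (\<Sum>i\<in>Basis. bump2 p R i x))"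
   by (intro continuous_intros wPhi continuous_on_bump R)
  fix x :: 'a assume "norm x > R"
  then have "(norm x)^2 / R^2 \<ge> 1" using R by (simp add: power_mono)
  then have "max 0 (1 - (norm x)^2 / R^2) = 0" by simp
  then show "max 0 (\<Phi> (w x) - \<Phi> \<kappa>) * (\<Sum>i\<in>Basis. bump2 p R i x) = 0" using p by (simp add: bump2_def power_0_left)
 qed
 have "(LINT x|lborel. max 0 (\<Phi> (w x) - \<Phi> \<kappa>) * (\<Sum>i\<in>Basis. bump2 p R i x))
  \<le> (LINT x|lborel. 4 * (real p)^2 * B * (R powr - 2 * l powr (\<theta> - 1)) * ((if \<kappa> < w x then w x * bump p R x else 0) + l * indicat_real (cball 0 R) x))"
  by (intro integral_mono i0 integrable_mult_right Bochner_Integration.integrable_add i1 integrable_indicator_cball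
    diffusion_times_sum_bump2_le w mono Phik B th l R p)
 also have "\<dots> = 4 * (real p)^2 * B * (R powr - 2 * l powr (\<theta> - 1)) *
    ((LINT x|lborel. (if \<kappa> < w x then w x * bump p R x else 0)) + l * (LINT x|lborel. indicat_real (cball (0::'a) R) x))"
  using Bochner_Integration.integral_add[OF i1 integrable_mult_right[OF integrable_indicator_cball], of l R]
  by (simp only: integral_mult_right_zero)
 also have "\<dots> = 4 * (real p)^2 * B * (R powr - 2 * l powr (\<theta> - 1)) *
    ((LINT x|lborel. (if \<kappa> < w x then w x * bump p R x else 0)) + l * (unit_ball_vol (real DIM('a)) * R ^ DIM('a)))"
  using R by (simp only: integral_indicator_cball[OF less_imp_le])
 finally show ?thesis .
qed

lemma ex_bump_exponent:
 assumes "\<theta> < 1"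
 obtains p :: nat where "3 \<le> p" "\<theta> * real p \<le> real p - 2"
proof -
 obtain n :: nat where n: "2 / (1 - \<theta>) < real n" using reals_Archimedean2 by blast
 show thesis
 proof (rule that[of "n + 3"])
  have "2 < real n * (1 - \<theta>)" using n assms by (simp add: field_simps)
  also have "\<dots> \<le> real (n + 3) * (1 - \<theta>)" using assms by (intro mult_right_mono) auto
  finally show "\<theta> * real (n + 3) \<le> real (n + 3) - 2" by (simp add: algebra_simps)
 qed simp
qed

text \<open>Fatou's lemma along balls of growing radius. The integral is taken in the extended sense
  because integrability of \<open>g\<close> is part of what is to be proved, and the truncation
  level may vary with the radius.\<close>

lemma nn_integral_le_of_bump_integrals:
 fixes g :: "'a::euclidean_space => real" and \<kappa> :: "nat => real"
 assumes g: "continuous_on UNIV g" and g0: "\<And>x. 0 \<le> g x" and p: "3 \<le> p" and k: "\<kappa> \<longlonglongrightarrow> \<kappa>0"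
  and le: "\<And>j. N \<le> j ==> (LINT x|lborel. max 0 (g x - \<kappa> j) * bump p (real (Suc j)) x) \<le> c j" and c: "c \<longlonglongrightarrow> m"
 shows "(\<integral>\<^sup>+x. ennreal (max 0 (g x - \<kappa>0)) \<partial>lborel) \<le> ennreal m"
proof -
 have [measurable]: "g \<in> borel_measurable borel" "(bump p R :: 'a => real) \<in> borel_measurable borel" for R
 proof -
  show "g \<in> borel_measurable borel" by (rule borel_measurable_continuous_onI[OF g])
  show "(bump p R :: 'a => real) \<in> borel_measurable borel" unfolding bump_def[abs_def] by measurable
 qed
 define u where "u j x = ennreal (max 0 (g x - \<kappa> j) * bump p (real (Suc j)) x)" for j x
 have b1: "(\<lambda>j. bump p (real (Suc j)) x) \<longlonglongrightarrow> 1" for x :: 'a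
 proof -
  have "(\<lambda>j. inverse (real (Suc j))) \<longlonglongrightarrow> 0" by (rule LIMSEQ_inverse_real_of_nat)
  then have "(\<lambda>j. max 0 (1 - (norm x)^2 * (inverse (real (Suc j)))^2) ^ p) \<longlonglongrightarrow> max 0 (1 - (norm x)^2 * 0^2) ^ p"
   by (intro tendsto_intros)
  then show ?thesis by (simp add: bump_def power_inverse divide_inverse)
 qed
 have lim: "(\<lambda>j. u j x) \<longlonglongrightarrow> ennreal (max 0 (g x - \<kappa>0))" for x
 proof -
  have "(\<lambda>j. max 0 (g x - \<kappa> j) * bump p (real (Suc j)) x) \<longlonglongrightarrow> max 0 (g x - \<kappa>0) * 1"
   by (intro tendsto_intros k b1)
  then show ?thesis unfolding u_def by (intro tendsto_ennrealI) simp
 qed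
 have int: "integrable lborel (\<lambda>x. max 0 (g x - \<kappa> j) * bump p (real (Suc j)) x)" for j
  by (rule integrable_continuous_support[where R = "real (Suc j)"])
    (use p in \<open>auto intro!: continuous_intros g continuous_on_bump bump_eq_0\<close>)
 have "(\<integral>\<^sup>+x. ennreal (max 0 (g x - \<kappa>0)) \<partial>lborel) = (\<integral>\<^sup>+x. liminf (\<lambda>j. u j x) \<partial>lborel)"
  by (intro nn_integral_cong) (simp add: lim_imp_Liminf[OF _ lim])
 also have "\<dots> \<le> liminf (\<lambda>j. \<integral>\<^sup>+x. u j x \<partial>lborel)"
  by (rule nn_integral_liminf) (simp add: u_def)
 also have "\<dots> \<le> liminf (\<lambda>j. ennreal (c j))"
 proof (rule Liminf_mono, rule eventually_sequentiallyI[of N])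
  fix j assume j: "N \<le> j"
  have "(\<integral>\<^sup>+x. u j x \<partial>lborel) = ennreal (LINT x|lborel. max 0 (g x - \<kappa> j) * bump p (real (Suc j)) x)"
   unfolding u_def by (rule nn_integral_eq_integral[OF int]) (simp add: bump_nonneg)
  also have "\<dots> \<le> ennreal (c j)" using le[OF j] by (rule ennreal_leI)
  finally show "(\<integral>\<^sup>+x. u j x \<partial>lborel) \<le> ennreal (c j)" .
 qed
 also have "\<dots> = ennreal m" by (rule lim_imp_Liminf) (use c in \<open>auto intro: tendsto_ennrealI\<close>)
 finally show ?thesis .
qed

lemma tendsto_Suc_powr_0: "(\<lambda>j. real (Suc j) powr - s) \<longlonglongrightarrow> 0" if "s > 0"
proof (rule tendsto_neg_powr)
 show "LIM j sequentially. real (Suc j) :> at_top"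
  by (rule filterlim_compose[OF filterlim_real_sequentially filterlim_Suc])
qed (use that in simp)

text \<open>Herrero-Pierre type estimate: since \<open>\<Phi>(w) \<le> B w\<^sup>\<theta>\<close> with \<open>d (1 - \<theta>) < 2\<close>, the mass gained inside
 the ball of radius \<open>R\<close> tends to \<open>0\<close> as \<open>R \<rightarrow> \<infinity>\<close>, although \<open>w\<close> is not known to be integrable.\<close>
lemma mass_nonincreasing:
 fixes w :: "real => 'a::euclidean_space => real"
 assumes ab: "a \<le> b"
  and wc: "continuous_on ({a..b} \<times> UNIV) (\<lambda>(s, x). w s x)"
  and w0: "\<And>s x. s \<in> {a..b} ==> 0 \<le> w s x"
  and Phi: "continuous_on {0..} \<Phi>" "\<And>x y. 0 \<le> x ==> x < y ==> \<Phi> x < \<Phi> y" "\<And>v. 0 \<le> v ==> 0 \<le> \<Phi> v"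
  and B: "0 \<le> B" "\<And>s x. s \<in> {a..b} ==> \<Phi> (w s x) \<le> B * w s x powr \<theta>"
  and th: "0 < \<theta>" "\<theta> < 1" "real DIM('a) * (1 - \<theta>) < 2"
  and dom: "\<And>\<kappa> R t. 0 < \<kappa> ==> a < t ==> t \<le> b ==> difference_bounds \<Phi> w R \<kappa> t"
  and pt: "\<And>t x e. a < t ==> t \<le> b ==> w t x > 0 ==> e > 0 ==> infinitesimal_le \<Phi> w e t x"
  and wa: "integrable lborel (w a)" "(LINT x|lborel. w a x) \<le> m"
 shows "(\<integral>\<^sup>+x. ennreal (w b x) \<partial>lborel) \<le> ennreal m"
proof -
 obtain p :: nat where p: "3 \<le> p" "\<theta> * real p \<le> real p - 2" using ex_bump_exponent[OF th(2)] by blast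
 define d where "d = real DIM('a)"
 \<comment> \<open>The net power of the radius: \<open>R powr - 2\<close> from the Laplacian of the
   weight against \<open>R powr (d (1 - \<theta>))\<close> from the linearisation at level
   \<open>R powr - d\<close>.\<close>
 define \<delta> where "\<delta> = 2 - d * (1 - \<theta>)"
 have del: "\<delta> > 0" using th by (simp add: \<delta>_def d_def)
 define V where "V = unit_ball_vol d"
 have V: "0 \<le> V" by (simp add: V_def d_def)
 define A where "A j = 4 * (real p)^2 * B * (b - a) * real (Suc j) powr - \<delta>" for j
 have Alim: "A \<longlonglongrightarrow> 0"
  unfolding A_def by (rule tendsto_mult_right_zero[OF tendsto_Suc_powr_0[OF del]])
 then obtain N where N: "\<And>j. N \<le> j ==> A j < 1"
  using order_tendstoD(2)[OF Alim, of 1] unfolding eventually_sequentially by auto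
 \<comment> \<open>At this level the part cut off inside the ball of radius \<open>R\<close> has
   mass at most \<open>V\<close>, the volume of the unit ball, whatever the radius. The level tends
   to 0, so the truncation disappears in the limit.\<close>
 define \<kappa> where "\<kappa> j = real (Suc j) powr - d" for j
 have ws: "continuous_on UNIV (w r)" if "r \<in> {a..b}" for r
 proof -
  have "continuous_on UNIV (\<lambda>x::'a. (r, x))" by (intro continuous_intros)
  moreover have "range (\<lambda>x::'a. (r, x)) \<subseteq> {a..b} \<times> UNIV" using that by auto
  ultimately show ?thesis using continuous_on_compose2[OF wc] by fastforce
 qed
 have le: "(LINT x|lborel. max 0 (w b x - \<kappa> j) * bump p (real (Suc j)) x) \<le> (m + 2 * V * A j) / (1 - A j)" if j: "N \<le> j" for j
 proof -
  define R where "R = real (Suc j)"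
  have R: "R > 0" by (simp add: R_def)
  have k: "\<kappa> j > 0" using R by (simp add: \<kappa>_def)
  have kj: "\<kappa> j = R powr - d" by (simp only: \<kappa>_def R_def)
  have kR: "\<kappa> j * R ^ DIM('a) = 1"
   using R unfolding kj by (simp add: d_def powr_realpow[symmetric] powr_add[symmetric])
  have bR: "bump p R x = 0" if "norm x \<ge> R" for x :: 'a using bump_eq_0[OF R _ that, of p] p by simp
  define I where "I t = (LINT x|lborel. max 0 (w t x - \<kappa> j) * bump p R x)" for t
  have Ic: "continuous_on {a..b} I"
   unfolding I_def
  proof (rule continuous_on_integral_support[where R = R])
   have "continuous_on ({a..b} \<times> UNIV) (\<lambda>z. max 0 ((\<lambda>(s, x). w s x) z - \<kappa> j) * bump p R (snd z))"
    by (intro continuous_intros wc continuous_on_compose2[OF continuous_on_bump(1)[OF R, of UNIV p]]) auto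
   then show "continuous_on ({a..b} \<times> UNIV) (\<lambda>(s, x). max 0 (w s x - \<kappa> j) * bump p R x)"
    by (simp add: case_prod_unfold)
  qed (simp add: bR)
  \<comment> \<open>The growth rate involves the localised mass itself. Evaluating at the time where
    that mass is largest gives \<open>Im \<le> I a + A j * (Im + 2 * V)\<close>, and
    \<open>A j < 1\<close> lets the right side be absorbed; this takes the place of a Gronwall
    argument.\<close>
  obtain ts where ts': "ts \<in> {a..b}" "\<And>t. t \<in> {a..b} ==> I t \<le> I ts"
   using continuous_attains_sup[OF compact_Icc _ Ic] ab by auto
  define Im where "Im = I ts"
  have ts: "ts \<in> {a..b}" "\<And>t. t \<in> {a..b} ==> I t \<le> Im" using ts' by (auto simp: Im_def)
  define Q where "Q = 4 * (real p)^2 * B * R powr - \<delta>"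
  have Q: "0 \<le> Q" using B by (simp add: Q_def)
  have J: "(LINT x|lborel. max 0 (\<Phi> (w t x) - \<Phi> (\<kappa> j)) * (\<Sum>i\<in>Basis. bump2 p R i x)) \<le> Q * (Im + 2 * V)"
   if t: "t \<in> {a..b}" for t
  proof -
   have i1: "integrable lborel (\<lambda>x. max 0 (w t x - \<kappa> j) * bump p R x)"
    by (rule integrable_continuous_support[where R = R])
      (auto intro!: continuous_intros ws t continuous_on_bump R bR)
   have [measurable]: "w t \<in> borel_measurable borel" "(bump p R :: 'a => real) \<in> borel_measurable borel"
    by (intro borel_measurable_continuous_onI ws t continuous_on_bump R)+
   have pw: "(if \<kappa> j < w t x then w t x * bump p R x else 0) \<le> max 0 (w t x - \<kappa> j) * bump p R x + \<kappa> j * indicat_real (cball 0 R) x" for x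
   proof (cases "\<kappa> j < w t x \<and> norm x \<le> R")
    case True
    have "\<kappa> j * bump p R x \<le> \<kappa> j * 1" using bump_le_1[OF R, of p x] k by (intro mult_left_mono) auto
    then show ?thesis using True by (simp add: algebra_simps)
   next
    case False
    then show ?thesis using k bR[of x] bump_nonneg[of p R x] by auto
   qed
   have "(LINT x|lborel. (if \<kappa> j < w t x then w t x * bump p R x else 0))
    \<le> (LINT x|lborel. max 0 (w t x - \<kappa> j) * bump p R x + \<kappa> j * indicat_real (cball 0 R) x)"
   proof (rule integral_mono)
    show "integrable lborel (\<lambda>x. max 0 (w t x - \<kappa> j) * bump p R x + \<kappa> j * indicat_real (cball 0 R) x)"
     by (intro Bochner_Integration.integrable_add i1 integrable_mult_right integrable_indicator_cball)
    then show "integrable lborel (\<lambda>x. if \<kappa> j < w t x then w t x * bump p R x else 0)"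
    proof (rule Bochner_Integration.integrable_bound)
     show "AE x in lborel. norm (if \<kappa> j < w t x then w t x * bump p R x else 0)
       \<le> norm (max 0 (w t x - \<kappa> j) * bump p R x + \<kappa> j * indicat_real (cball 0 R) x)"
     proof (rule AE_I2)
      fix x
      have "0 \<le> (if \<kappa> j < w t x then w t x * bump p R x else 0)" using w0[OF t, of x] bump_nonneg[of p R x] by simp
      then show "norm (if \<kappa> j < w t x then w t x * bump p R x else 0)
       \<le> norm (max 0 (w t x - \<kappa> j) * bump p R x + \<kappa> j * indicat_real (cball 0 R) x)"
       using pw[of x] unfolding real_norm_def by linarith
     qed
    qed measurable
   qed (rule pw)
   also have "\<dots> = I t + \<kappa> j * (V * R ^ DIM('a))"
    using Bochner_Integration.integral_add[OF i1 integrable_mult_right[OF integrable_indicator_cball], of "\<kappa> j" R]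
     integral_indicator_cball[of R, where 'a = 'a] R
    by (simp only: integral_mult_right_zero I_def V_def d_def less_imp_le)
   also have "\<dots> = I t + V" using kR by (simp add: mult.left_commute)
   also have "\<dots> \<le> Im + V" using ts(2)[OF t] by simp
   finally have le1: "(LINT x|lborel. (if \<kappa> j < w t x then w t x * bump p R x else 0)) \<le> Im + V" .
   have Rk: "R powr - 2 * \<kappa> j powr (\<theta> - 1) = R powr - \<delta>"
    unfolding kj by (simp add: powr_powr powr_add[symmetric] \<delta>_def algebra_simps)
   have "(LINT x|lborel. max 0 (\<Phi> (w t x) - \<Phi> (\<kappa> j)) * (\<Sum>i\<in>Basis. bump2 p R i x))
    \<le> 4 * (real p)^2 * B * (R powr - 2 * \<kappa> j powr (\<theta> - 1)) *
     ((LINT x|lborel. (if \<kappa> j < w t x then w t x * bump p R x else 0)) + \<kappa> j * (unit_ball_vol (real DIM('a)) * R ^ DIM('a)))"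
    by (rule integral_diffusion_bump2_le[OF ws[OF t] w0[OF t] Phi(1,2) Phi(3) _ B(1) B(2)[OF t] th(1,2) k R p])
      (use k in auto)
   also have "\<kappa> j * (unit_ball_vol (real DIM('a)) * R ^ DIM('a)) = V"
    using kR by (simp add: V_def d_def mult.left_commute)
   also have "4 * (real p)^2 * B * (R powr - 2 * \<kappa> j powr (\<theta> - 1)) *
     ((LINT x|lborel. (if \<kappa> j < w t x then w t x * bump p R x else 0)) + V) \<le> Q * (Im + 2 * V)"
    unfolding Rk Q_def[symmetric] using le1 Q by (intro mult_left_mono) auto
   finally show ?thesis .
  qed
  have "I ts - I a \<le> (\<lambda>t. Q * (Im + 2 * V) * t) ts - (\<lambda>t. Q * (Im + 2 * V) * t) a"
   unfolding I_def[of ts] I_def[of a]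
  proof (rule truncated_mass_growth[where \<Phi> = \<Phi> and R = R and K' = "\<lambda>t. Q * (Im + 2 * V)"])
   show "a \<le> ts" using ts by simp
   show "continuous_on ({a..ts} \<times> UNIV) (\<lambda>(s, x). w s x)" by (rule continuous_on_subset[OF wc]) (use ts in auto)
   show "C12 UNIV (\<lambda>t. bump p R :: 'a => real) (\<lambda>t x. 0) (\<lambda>i t. bump1 p R i) (\<lambda>i t. bump2 p R i)"
    by (rule C12_bump[OF R p(1)])
   show "((\<lambda>t. Q * (Im + 2 * V) * t) has_real_derivative Q * (Im + 2 * V)) (at t within {a..ts})" for t
    by (rule DERIV_cmult_Id)
  qed (use ts w0 Phi k R bR bump_nonneg continuous_on_bump(1) J dom[OF k] pt in auto)
  also have "\<dots> = (Q * (ts - a)) * (Im + 2 * V)" by (simp add: algebra_simps)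
  also have "\<dots> \<le> A j * (Im + 2 * V)"
  proof (rule mult_right_mono)
   show "Q * (ts - a) \<le> A j"
    using mult_left_mono[of "ts - a" "b - a" Q] ts Q by (simp add: A_def Q_def R_def mult_ac)
   have "0 \<le> Im" unfolding I_def Im_def by (intro Bochner_Integration.integral_nonneg) (simp add: bump_nonneg)
   then show "0 \<le> Im + 2 * V" using V by simp
  qed
  finally have 1: "I ts - I a \<le> A j * (Im + 2 * V)" .
  have "I a \<le> (LINT x|lborel. w a x)"
   unfolding I_def
  proof (rule integral_mono)
   show "integrable lborel (\<lambda>x. max 0 (w a x - \<kappa> j) * bump p R x)"
    by (rule integrable_continuous_support[where R = R])
      (use ab in \<open>auto intro!: continuous_intros ws continuous_on_bump R bR\<close>)
   fix x
   have "max 0 (w a x - \<kappa> j) * bump p R x \<le> w a x * 1"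
    using w0[of a x] ab k bump_le_1[OF R, of p x] bump_nonneg[of p R x] by (intro mult_mono) auto
   then show "max 0 (w a x - \<kappa> j) * bump p R x \<le> w a x" by simp
  qed (rule wa)
  then have "Im * (1 - A j) \<le> m + 2 * V * A j" using 1 wa(2) by (simp add: Im_def[symmetric] algebra_simps)
  then have "Im \<le> (m + 2 * V * A j) / (1 - A j)" using N[OF j] by (simp add: field_simps)
  then show ?thesis using ts(2)[of b] ab by (simp add: I_def R_def)
 qed
 have "(\<integral>\<^sup>+x. ennreal (max 0 (w b x - 0)) \<partial>lborel) \<le> ennreal m"
 proof (rule nn_integral_le_of_bump_integrals[OF _ _ p(1) _ le])
  have "d > 0" by (simp add: d_def)
  then show "\<kappa> \<longlonglongrightarrow> 0" unfolding \<kappa>_def by (rule tendsto_Suc_powr_0)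
  have "(\<lambda>j. (m + 2 * V * A j) / (1 - A j)) \<longlonglongrightarrow> (m + 2 * V * 0) / (1 - 0)" by (intro tendsto_intros Alim) simp
  then show "(\<lambda>j. (m + 2 * V * A j) / (1 - A j)) \<longlonglongrightarrow> m" by simp
 qed (use ws w0 ab in auto)
 then show ?thesis using w0[of b] ab by simp
qed

text \<open>The passage from masses to points: the set where the two ordered functions differ is
  open by continuity and null by the integrals, hence empty.\<close>

lemma eq_of_integral_le:
 fixes f g :: "'a::euclidean_space => real"
 assumes f: "continuous_on UNIV f" and g: "continuous_on UNIV g" and le: "\<And>x. 0 \<le> f x" "\<And>x. f x \<le> g x"
  and int: "integrable lborel f" and nn: "(\<integral>\<^sup>+x. ennreal (g x) \<partial>lborel) \<le> ennreal (LINT x|lborel. f x)"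
 shows "g x = f x"
proof (rule ccontr)
 assume ne: "g x \<noteq> f x"
 have [measurable]: "f \<in> borel_measurable borel" "g \<in> borel_measurable borel"
  by (intro borel_measurable_continuous_onI f g)+
 have g0: "0 \<le> g x" for x using le[of x] by linarith
 have "(\<integral>\<^sup>+x. ennreal (g x) \<partial>lborel) < \<infinity>" using nn by (simp add: le_less_trans)
 then have gi: "integrable lborel g"
  by (intro integrableI_bounded) (use g0 in auto)
 have "(LINT x|lborel. g x) \<le> (LINT x|lborel. f x)"
  using nn nn_integral_eq_integral[OF gi] g0 Bochner_Integration.integral_nonneg[of lborel f] le
  by simp
 then have "(LINT x|lborel. g x - f x) \<le> 0" using gi int by simp
 moreover have "0 \<le> (LINT x|lborel. g x - f x)" using le by (intro Bochner_Integration.integral_nonneg) simp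
 ultimately have "(LINT x|lborel. g x - f x) = 0" by simp
 then have "AE x in lborel. g x - f x = 0"
  using integral_nonneg_eq_0_iff_AE[of lborel "\<lambda>x. g x - f x"] gi int le by simp
 then have "{x. g x \<noteq> f x} \<in> null_sets lborel"
  using AE_iff_null[of lborel "\<lambda>x. g x - f x = 0"] by simp
 then have "negligible {x. g x \<noteq> f x}" by (simp add: negligible_iff_null_sets null_sets_completionI)
 moreover have "open {x. g x \<noteq> f x}" by (rule open_Collect_neq[OF g f])
 ultimately show False using ne open_not_negligible[of "{x. g x \<noteq> f x}"] by auto
qed

text \<open>\<open>f\<close> and \<open>h\<close> are the coefficients of the equation for
  \<open>sgn \<gamma> * n powr \<theta>\<close>: \<open>f\<close> is the derivative of the diffusion
  function at the density, and \<open>h\<close> collects the first-order terms produced by the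
  change of variables. \<open>B\<close> and \<open>\<eta>\<close> are what the mass estimate needs
  to control \<open>w\<close> far out. The free parameters are \<open>\<theta>\<close>,
  \<open>c0\<close> and the upper bound \<open>Wmax\<close> on the time window.\<close>

lemma pme_lipschitz:
 fixes n :: "real => 'a::euclidean_space => real"
 defines "d \<equiv> real DIM('a)"
 assumes n: "pme_solution \<gamma> n nt n1 n2" and g: "-1 < \<gamma>" "\<gamma> \<noteq> 0"
  and th: "sgn \<theta> = sgn \<gamma>" and pos: "\<And>t x. \<gamma> < 0 ==> 0 < t ==> 0 < n t x"
  and mass: "\<And>t. 0 < t ==> integrable lborel (n t) \<and> (LINT x|lborel. n t x) = m"
  and t: "0 < t0" "t0 < t1"
  and Wmax: "\<And>t x. t \<in> {t0..t1} ==> sgn \<gamma> * n t x powr \<theta> \<le> Wmax"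
  and kap: "0 < kap" "1 \<le> 2 * c0 * kap^2"
  and f: "f = (\<lambda>q. \<bar>\<gamma>\<bar> * (sgn \<gamma> * q) powr (\<gamma> / \<theta>))"
  and h: "h = (\<lambda>q. \<gamma> * ((\<gamma> + 1) / \<theta> - 1) * (sgn \<gamma> * q) powr (\<gamma> / \<theta> - 1))"
  and key: "\<And>p q. 0 < sgn \<gamma> * p ==> 0 < sgn \<gamma> * q ==> p < q ==> q \<le> Wmax ==>
    (h q - h p) * (q - p) + (d - 1) * (sqrt (f q) - sqrt (f p))^2 \<le> - c0 * (q - p)^2"
  and B: "0 \<le> B" "\<And>v. 0 \<le> v ==> sgn \<gamma> * v powr \<theta> \<le> Wmax ==> diffusion \<gamma> v \<le> B * v powr \<eta>"
  and eta: "0 < \<eta>" "\<eta> < 1" "d * (1 - \<eta>) < 2"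
  and tt: "t0 < t" "t \<le> t1"
 shows "sgn \<gamma> * n t y powr \<theta> - kap * (t - t0) powr (- (1 / 2)) * norm (x - y) \<le> sgn \<gamma> * n t x powr \<theta>"
proof -
 define \<sigma> where "\<sigma> = sgn \<gamma>"
 have ss: "\<sigma> * \<sigma> = 1" "\<sigma> \<noteq> 0" "\<sigma> * (\<sigma> * q) = q" for q using g by (auto simp: \<sigma>_def sgn_if)
 have \<sigma>\<gamma>: "\<sigma> * \<bar>\<gamma>\<bar> = \<gamma>" using g by (auto simp: \<sigma>_def sgn_if)
 have th0: "\<theta> \<noteq> 0" using th g by (auto simp: sgn_if split: if_splits)
 have \<sigma>\<theta>: "0 < \<sigma> * \<theta>" "0 < \<sigma> / \<theta>" using th g by (auto simp: \<sigma>_def sgn_if zero_less_mult_iff zero_less_divide_iff split: if_splits)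
 define I where "I = {q. 0 < \<sigma> * q}"
 have I_cases: "(\<sigma> = 1 \<and> \<theta> > 0 \<and> \<gamma> > 0 \<and> I = {0<..}) \<or> (\<sigma> = -1 \<and> \<theta> < 0 \<and> \<gamma> < 0 \<and> I = {..<0})"
  using g th by (auto simp: \<sigma>_def I_def sgn_if split: if_splits)
 define W W1 W2 where "W v = \<sigma> * v powr \<theta>" and "W1 v = \<sigma> * \<theta> * v powr (\<theta> - 1)"
  and "W2 v = \<sigma> * \<theta> * (\<theta> - 1) * v powr (\<theta> - 2)" for v
 define N N1 where "N q = (\<sigma> * q) powr (1 / \<theta>)" and "N1 q = \<sigma> / \<theta> * (\<sigma> * q) powr (1 / \<theta> - 1)" for q
 define H H1 H2 where "H q = diffusion \<gamma> (N q)" and "H1 q = f q * N1 q" and "H2 q = h q * N1 q" for q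
 let ?P = "{(t, x). 0 < t \<and> 0 < n t x}"
 have NW: "N (W v) = v" if "0 \<le> v" for v using that th0 by (simp add: N_def W_def ss powr_powr)
 have WN: "W (N q) = q" if "0 \<le> \<sigma> * q" for q using that th0 by (simp add: N_def W_def powr_powr ss)
 have dW: "DERIV W v :> W1 v" "DERIV W1 v :> W2 v" if "0 < v" for v
 proof -
  show "DERIV W v :> W1 v"
   unfolding W_def[abs_def] W1_def mult.assoc by (intro DERIV_cmult has_real_derivative_powr that)
  have "DERIV (\<lambda>v. \<sigma> * \<theta> * v powr (\<theta> - 1)) v :> \<sigma> * \<theta> * ((\<theta> - 1) * v powr (\<theta> - 1 - 1))"
   by (intro DERIV_cmult has_real_derivative_powr that)
  moreover have "\<theta> - 1 - 1 = \<theta> - 2" by simp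
  ultimately show "DERIV W1 v :> W2 v"
   unfolding W1_def[abs_def] W2_def by (simp only: mult.assoc)
 qed
 have cW2: "continuous_on {0<..} W2" unfolding W2_def[abs_def] by (auto intro!: continuous_intros)
 have WI: "W v \<in> I" if "0 < v" for v using that by (simp add: W_def I_def ss)
 have Cn: "C12 ?P n nt n1 n2" using n by (simp add: pme_solution_def)
 have n0: "0 \<le> n t x" if "0 < t" for t x using n that by (simp add: pme_solution_def)
 have ncont: "continuous_on ({0<..} \<times> UNIV) (\<lambda>(t, x). n t x)" using n by (simp add: pme_solution_def)
 have CM: "C12 ?P (\<lambda>t x. W (n t x)) (\<lambda>t x. W1 (n t x) * nt t x) (\<lambda>i t x. W1 (n t x) * n1 i t x)
  (\<lambda>i t x. W1 (n t x) * n2 i t x + W2 (n t x) * (n1 i t x)^2)"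
  by (rule C12_compose[OF Cn C12_continuous[OF n], where I = "{0<..}"]) (use dW cW2 in auto)
 have Wcont: "continuous_on ({t0..t1} \<times> UNIV) (\<lambda>(t, x). W (n t x))"
 proof -
  have c: "continuous_on ({t0..t1} \<times> UNIV) (\<lambda>z. n (fst z) (snd z))"
   by (rule continuous_on_subset[OF ncont[unfolded case_prod_unfold]]) (use t in auto)
  have "continuous_on ({t0..t1} \<times> UNIV) (\<lambda>z. n (fst z) (snd z) powr \<theta>)"
   using I_cases
  proof
   assume "\<sigma> = 1 \<and> \<theta> > 0 \<and> \<gamma> > 0 \<and> I = {0<..}"
   then show ?thesis using t n0 by (intro continuous_on_powr' c continuous_on_const) auto
  next
   assume *: "\<sigma> = -1 \<and> \<theta> < 0 \<and> \<gamma> < 0 \<and> I = {..<0}"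
   have "n (fst z) (snd z) \<noteq> 0" if "z \<in> {t0..t1} \<times> UNIV" for z :: "real \<times> 'a"
    using pos[of "fst z" "snd z"] * that t by auto
   then show ?thesis by (intro continuous_on_powr c continuous_on_const) blast
  qed
  then show ?thesis unfolding W_def case_prod_unfold by (rule continuous_on_mult[OF continuous_on_const])
 qed
 have pos_of_I: "0 < n t x" if "0 < t" "W (n t x) \<in> I" for t x
  using that n0[of t x] by (cases "n t x = 0") (auto simp: I_def W_def)
 interpret S: supconv "\<lambda>t x. W (n t x)" "\<lambda>t x. W1 (n t x) * nt t x" "\<lambda>i t x. W1 (n t x) * n1 i t x"
  "\<lambda>i t x. W1 (n t x) * n2 i t x + W2 (n t x) * (n1 i t x)^2" ?P t0 t1 Wmax kap c0 I N N1 H H1 H2 f h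
 proof
  show "t0 < t1" "0 < kap" "1 \<le> 2 * c0 * kap^2" by fact+
  show "continuous_on ({t0..t1} \<times> UNIV) (\<lambda>(t, x). W (n t x))" by (rule Wcont)
  show "W (n t x) \<le> Wmax" if "t \<in> {t0..t1}" for t x using Wmax[OF that] by (simp add: W_def \<sigma>_def)
  show "C12 ?P (\<lambda>t x. W (n t x)) (\<lambda>t x. W1 (n t x) * nt t x) (\<lambda>i t x. W1 (n t x) * n1 i t x)
   (\<lambda>i t x. W1 (n t x) * n2 i t x + W2 (n t x) * (n1 i t x)^2)" by (rule CM)
  show "W (n t x) \<in> I" if "(t, x) \<in> ?P" for t x using that by (auto intro: WI)
  have "continuous_on {0<..} W" by (rule DERIV_continuous_on[where D = W1]) (rule has_field_derivative_at_within, rule dW, simp)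
  from continuous_on_compose2[OF this C12_continuous[OF n]]
  show "continuous_on ?P (\<lambda>(t, x). W (n t x))" by (auto simp: case_prod_unfold)
  show "(t, x) \<in> ?P" if "t \<in> {t0..t1}" "W (n t x) \<in> I" for t x using that t pos_of_I[of t x] by auto
  show "is_interval I" "open I" using I_cases by (auto simp: is_interval_1)
  show "W (n t x) \<in> I" if "t \<in> {t0..t1}" "q \<in> I" "q \<le> W (n t x)" for t x q
   using I_cases
  proof
   assume "\<sigma> = -1 \<and> \<theta> < 0 \<and> \<gamma> < 0 \<and> I = {..<0}"
   then have "0 < n t x" using pos that t by auto
   then show ?thesis by (rule WI)
  qed (use that in auto)
  fix q assume q: "q \<in> I"
  then have sq: "0 < \<sigma> * q" by (simp add: I_def)
  show dN: "DERIV N q :> N1 q"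
   unfolding N_def[abs_def] N1_def using sq by (auto intro!: derivative_eq_intros simp: ss)
  show "0 < N1 q" unfolding N1_def by (rule mult_pos_pos[OF \<sigma>\<theta>(2)]) (use sq in auto)
  show "0 < f q" unfolding f \<sigma>_def[symmetric] by (rule mult_pos_pos) (use sq g in auto)
  have Nq: "0 < N q" unfolding N_def using sq by auto
  have "\<bar>\<gamma>\<bar> * N q powr \<gamma> * N1 q = H1 q"
   using sq by (simp add: H1_def f N_def powr_powr \<sigma>_def)
  with DERIV_chain2[OF diffusion_derivative[OF g(1) Nq] dN]
  show "DERIV H q :> H1 q" by (simp add: H_def[abs_def])
  define e where "e = \<gamma> / \<theta> + 1 / \<theta> - 1"
  have H1': "H1 r = \<gamma> / \<theta> * (\<sigma> * r) powr e" if "0 < \<sigma> * r" for r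
  proof -
   have "H1 r = (\<sigma> * \<bar>\<gamma>\<bar>) / \<theta> * ((\<sigma> * r) powr (\<gamma> / \<theta>) * (\<sigma> * r) powr (1 / \<theta> - 1))"
    by (simp add: H1_def f N1_def \<sigma>_def)
   also have "\<dots> = \<gamma> / \<theta> * (\<sigma> * r) powr e" unfolding \<sigma>\<gamma> powr_add[symmetric] by (simp add: e_def add_diff_eq)
   finally show ?thesis .
  qed
  have "DERIV (\<lambda>r. \<gamma> / \<theta> * (\<sigma> * r) powr e) q :> \<gamma> / \<theta> * (e * (\<sigma> * q) powr (e - 1) * \<sigma>)"
   using sq th0 by (auto intro!: derivative_eq_intros simp: ss)
  moreover have "\<gamma> / \<theta> * (e * (\<sigma> * q) powr (e - 1) * \<sigma>) = H2 q"
  proof -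
   have "H2 q = \<gamma> * e * (\<sigma> / \<theta>) * ((\<sigma> * q) powr (\<gamma> / \<theta> - 1) * (\<sigma> * q) powr (1 / \<theta> - 1))"
    by (simp add: H2_def h N1_def \<sigma>_def[symmetric] e_def add_divide_distrib)
   also have "(\<sigma> * q) powr (\<gamma> / \<theta> - 1) * (\<sigma> * q) powr (1 / \<theta> - 1) = (\<sigma> * q) powr (e - 1)"
    unfolding powr_add[symmetric] by (rule arg_cong[where f = "\<lambda>r. (\<sigma> * q) powr r"]) (simp add: e_def)
   finally show ?thesis by simp
  qed
  ultimately have "DERIV (\<lambda>r. \<gamma> / \<theta> * (\<sigma> * r) powr e) q :> H2 q" by simp
  moreover have "\<forall>\<^sub>F r in nhds q. H1 r = \<gamma> / \<theta> * (\<sigma> * r) powr e"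
  proof -
   have "open {r. 0 < \<sigma> * r}" by (intro open_Collect_less continuous_intros)
   from eventually_nhds_in_open[OF this, of q] sq show ?thesis by (auto elim!: eventually_mono simp: H1')
  qed
  ultimately show "DERIV H1 q :> H2 q"
   using DERIV_cong_ev[OF refl _ refl, of H1 "\<lambda>r. \<gamma> / \<theta> * (\<sigma> * r) powr e" q] by blast
  show "H1 q = f q * N1 q" "H2 q = h q * N1 q" by (simp_all add: H1_def H2_def)
 next
  show "continuous_on I N1" unfolding N1_def[abs_def] by (intro continuous_intros) (auto simp: I_def)
  show "continuous_on I H2" unfolding H2_def[abs_def] h N1_def \<sigma>_def[symmetric] by (intro continuous_intros) (auto simp: I_def)
 next
  fix t x assume tx: "t \<in> {t0..t1}" "W (n t x) \<in> I"
  have t': "0 < t" using tx t by simp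
  have v: "0 < n t x" by (rule pos_of_I[OF t' tx(2)])
  define v where "v = n t x"
  have vp: "0 < v" using v by (simp add: v_def)
  have fW: "f (W v) = \<bar>\<gamma>\<bar> * v powr \<gamma>" using vp th0 by (simp add: f W_def \<sigma>_def[symmetric] ss powr_powr)
  have hW: "h (W v) = \<gamma> * ((\<gamma> + 1) / \<theta> - 1) * v powr (\<gamma> - \<theta>)"
   using vp th0 by (simp add: h W_def \<sigma>_def[symmetric] ss powr_powr right_diff_distrib)
  have c1: "f (W v) * W1 v = W1 v * (\<bar>\<gamma>\<bar> * v powr \<gamma>)" by (simp add: fW)
  \<comment> \<open>This identity determines \<open>h\<close>: it matches the coefficients of the
    squared first derivatives of \<open>n\<close>, while \<open>c1\<close> matches those of the
    second derivatives.\<close>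
  have c2: "f (W v) * W2 v + h (W v) * (W1 v)^2 = W1 v * (\<bar>\<gamma>\<bar> * \<gamma> * v powr (\<gamma> - 1))"
  proof -
   define z where "z = v powr (\<gamma> + \<theta> - 2)"
   have z1: "v powr \<gamma> * v powr (\<theta> - 2) = z" by (simp add: z_def powr_add[symmetric] algebra_simps)
   have z2: "v powr (\<gamma> - \<theta>) * (v powr (\<theta> - 1))^2 = z"
    using vp by (simp add: z_def power2_eq_square powr_add[symmetric] algebra_simps)
   have z3: "v powr (\<theta> - 1) * v powr (\<gamma> - 1) = z" by (simp add: z_def powr_add[symmetric] algebra_simps)
   have "f (W v) * W2 v + h (W v) * (W1 v)^2 = (\<sigma> * \<bar>\<gamma>\<bar>) * \<theta> * (\<theta> - 1) * (v powr \<gamma> * v powr (\<theta> - 2))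
     + \<gamma> * ((\<gamma> + 1) / \<theta> - 1) * (\<sigma> * \<sigma>) * \<theta>^2 * (v powr (\<gamma> - \<theta>) * (v powr (\<theta> - 1))^2)"
    by (simp add: fW hW W2_def W1_def power_mult_distrib power2_eq_square)
   also have "\<dots> = \<gamma> * z * (\<theta> * (\<theta> - 1) + ((\<gamma> + 1) / \<theta> - 1) * \<theta>^2)"
    unfolding z1 z2 \<sigma>\<gamma> ss by (simp add: algebra_simps)
   also have "\<theta> * (\<theta> - 1) + ((\<gamma> + 1) / \<theta> - 1) * \<theta>^2 = \<theta> * \<gamma>"
    using th0 by (simp add: field_simps power2_eq_square)
   also have "\<gamma> * z * (\<theta> * \<gamma>) = (\<sigma> * \<bar>\<gamma>\<bar>) * \<theta> * \<gamma> * (v powr (\<theta> - 1) * v powr (\<gamma> - 1))"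
    unfolding z3 \<sigma>\<gamma> by simp
   also have "\<dots> = W1 v * (\<bar>\<gamma>\<bar> * \<gamma> * v powr (\<gamma> - 1))" by (simp add: W1_def)
   finally show ?thesis .
  qed
  have pde: "nt t x = (\<Sum>i\<in>Basis. \<bar>\<gamma>\<bar> * v powr \<gamma> * n2 i t x + \<bar>\<gamma>\<bar> * \<gamma> * v powr (\<gamma> - 1) * (n1 i t x)^2)"
   using n t' v by (simp add: pme_solution_def v_def)
  have "W1 v * nt t x = (\<Sum>i\<in>Basis. (W1 v * (\<bar>\<gamma>\<bar> * v powr \<gamma>)) * n2 i t x + (W1 v * (\<bar>\<gamma>\<bar> * \<gamma> * v powr (\<gamma> - 1))) * (n1 i t x)^2)"
   unfolding pde sum_distrib_left by (intro sum.cong refl) (simp add: distrib_left mult_ac)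
  also have "\<dots> = (\<Sum>i\<in>Basis. f (W v) * (W1 v * n2 i t x + W2 v * (n1 i t x)^2) + h (W v) * (W1 v * n1 i t x)^2)"
   unfolding c1[symmetric] c2[symmetric] by (intro sum.cong refl) (simp add: algebra_simps power_mult_distrib)
  also have "\<dots> = f (W v) * (\<Sum>i\<in>Basis. W1 v * n2 i t x + W2 v * (n1 i t x)^2) + h (W v) * (\<Sum>i\<in>Basis. (W1 v * n1 i t x)^2)"
   unfolding sum_distrib_left by (rule sum.distrib)
  finally show "W1 (n t x) * nt t x = f (W (n t x)) * (\<Sum>i\<in>Basis. W1 (n t x) * n2 i t x + W2 (n t x) * (n1 i t x)^2)
    + h (W (n t x)) * (\<Sum>i\<in>Basis. (W1 (n t x) * n1 i t x)^2)" by (simp only: v_def)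
 next
  show "(h q - h p) * (q - p) + (real DIM('a) - 1) * (sqrt (f q) - sqrt (f p))^2 \<le> - c0 * (q - p)^2"
   if "p \<in> I" "q \<in> I" "p < q" "q \<le> Wmax" for p q
   using key[of p q] that by (simp add: I_def \<sigma>_def d_def)
 qed
 define w where "w t x = N (S.S t x)" for t x
 have SW: "W (n s x) \<le> S.S s x" if "s \<in> {t0..t1}" for s x by (rule S.M_le_S[OF that])
 have S0: "0 \<le> \<sigma> * S.S s x \<and> (\<gamma> < 0 \<longrightarrow> S.S s x < 0) \<and> S.S s x \<le> Wmax" if s: "s \<in> {t0..t1}" for s x
 proof -
  obtain z where z: "S.S s x = W (n s (x + sqrt (s - t0) *\<^sub>R z)) - kap * norm z" using S.S_attained[OF s] by blast
  then have le: "S.S s x \<le> W (n s (x + sqrt (s - t0) *\<^sub>R z))" using kap by simp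
  have m: "S.S s x \<le> Wmax" using le S.Mmax[OF s] by (rule order_trans)
  show ?thesis using I_cases
  proof
   assume *: "\<sigma> = 1 \<and> \<theta> > 0 \<and> \<gamma> > 0 \<and> I = {0<..}"
   have "0 \<le> W (n s x)" using * by (simp add: W_def)
   then show ?thesis using * SW[OF s, of x] m by simp
  next
   assume *: "\<sigma> = -1 \<and> \<theta> < 0 \<and> \<gamma> < 0 \<and> I = {..<0}"
   have "0 < n s (x + sqrt (s - t0) *\<^sub>R z)" using pos * s t by simp
   then have "S.S s x < 0" using le * WI[of "n s (x + sqrt (s - t0) *\<^sub>R z)"] by simp
   then show ?thesis using * m by simp
  qed
 qed
 \<comment> \<open>For negative \<theta> the function \<open>N\<close> grows without bound as its
   argument increases to 0, whereas \<open>powr\<close> returns 0 at 0. Hence the larger argument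
   has to be kept strictly negative in that case.\<close>
 have Nmono: "N q \<le> N q'" if "q \<le> q'" "0 \<le> \<sigma> * q" "\<gamma> < 0 \<longrightarrow> q' < 0" for q q'
  using I_cases
 proof
  assume "\<sigma> = 1 \<and> \<theta> > 0 \<and> \<gamma> > 0 \<and> I = {0<..}"
  then show ?thesis using that by (auto simp: N_def intro!: powr_mono2)
 next
  assume "\<sigma> = -1 \<and> \<theta> < 0 \<and> \<gamma> < 0 \<and> I = {..<0}"
  then show ?thesis using that by (intro S.N_mono) auto
 qed
 have Phimono: "\<And>x y. 0 \<le> x ==> x < y ==> diffusion \<gamma> x < diffusion \<gamma> y" by (rule diffusion_strict_mono[OF g])
 have tin: "t \<in> {t0..t1}" using tt by simp
 have cS: "continuous_on ({t0..t} \<times> UNIV) (\<lambda>z. S.S (fst z) (snd z))"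
  by (rule continuous_on_subset[OF S.continuous_on_S[unfolded case_prod_unfold]]) (use tt in auto)
 have cw: "continuous_on ({t0..t} \<times> UNIV) (\<lambda>(s, x). w s x)"
 proof -
  have "continuous_on ({t0..t} \<times> UNIV) (\<lambda>z. (\<sigma> * S.S (fst z) (snd z)) powr (1 / \<theta>))"
   using I_cases
  proof
   assume "\<sigma> = 1 \<and> \<theta> > 0 \<and> \<gamma> > 0 \<and> I = {0<..}"
   then show ?thesis using S0 tt by (intro continuous_on_powr' continuous_on_mult cS continuous_on_const) auto
  next
   assume *: "\<sigma> = -1 \<and> \<theta> < 0 \<and> \<gamma> < 0 \<and> I = {..<0}"
   have "\<sigma> * S.S (fst z) (snd z) \<noteq> 0" if "z \<in> {t0..t} \<times> UNIV" for z :: "real \<times> 'a"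
    using S0[of "fst z" "snd z"] * that tt by auto
   then show ?thesis by (intro continuous_on_powr continuous_on_mult cS continuous_on_const) blast
  qed
  then show ?thesis by (simp add: w_def N_def case_prod_unfold)
 qed
 have w0: "0 \<le> w s x" for s x by (simp add: w_def N_def)
 have SI: "S.S s x \<in> I" if "0 < w s x" "s \<in> {t0..t1}" for s x
 proof -
  have "\<sigma> * S.S s x \<noteq> 0" using that(1) by (auto simp: w_def N_def)
  then have "0 < \<sigma> * S.S s x" using S0[OF that(2), of x] by linarith
  then show ?thesis by (simp add: I_def)
 qed
 \<comment> \<open>At time \<open>t0\<close> the radius of the sup-convolution is 0, so
   \<open>w\<close> starts from \<open>n\<close> itself and the comparison of masses starts from
   equality.\<close>
 have wt0: "w t0 x = n t0 x" for x
 proof -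
  have t0in: "t0 \<in> {t0..t1}" using t by simp
  obtain z where "S.S t0 x = W (n t0 (x + sqrt (t0 - t0) *\<^sub>R z)) - kap * norm z" using S.S_attained[OF t0in] by blast
  then have "S.S t0 x \<le> W (n t0 x)" using kap by simp
  then have "S.S t0 x = W (n t0 x)" using SW[OF t0in, of x] by simp
  then show ?thesis using NW n0[OF t(1)] by (simp add: w_def)
 qed
 have dom: "difference_bounds (diffusion \<gamma>) w R \<kappa> s"
  if k: "0 < \<kappa>" and s: "t0 < s" "s \<le> t" for \<kappa> R s
 proof -
  have s1: "s \<le> t1" and sin: "s \<in> {t0..t1}" using s tt by auto
  have "W \<kappa> < S.S s x" if "\<kappa> < w s x" for x
  proof (rule ccontr)
   assume "\<not> W \<kappa> < S.S s x"
   then have "N (S.S s x) \<le> N (W \<kappa>)" using S0[OF sin, of x] WI[OF k] I_cases by (intro Nmono) auto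
   then show False using that NW[of \<kappa>] k by (simp add: w_def)
  qed
  then show ?thesis
   using S.S_difference_bounds[OF s(1) s1 WI[OF k], of R] unfolding w_def H_def by (smt (verit, best))
 qed
 have "(\<integral>\<^sup>+x. ennreal (w t x) \<partial>lborel) \<le> ennreal m"
 proof (rule mass_nonincreasing[OF _ cw w0 continuous_on_diffusion[OF g(1)] Phimono diffusion_nonneg[OF g(1)] B(1) _ eta[unfolded d_def] dom])
  show "t0 \<le> t" using tt by simp
  show "diffusion \<gamma> (w s x) \<le> B * w s x powr \<eta>" if "s \<in> {t0..t}" for s x
  proof (rule B(2)[OF w0])
   have sin: "s \<in> {t0..t1}" using that tt by simp
   have "W (w s x) = S.S s x" using WN S0[OF sin, of x] by (simp add: w_def)
   then show "sgn \<gamma> * w s x powr \<theta> \<le> Wmax" using S0[OF sin, of x] by (simp add: W_def \<sigma>_def)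
  qed
  show "integrable lborel (w t0)" "(LINT x|lborel. w t0 x) \<le> m" using mass[OF t(1)] by (simp_all add: wt0[abs_def])
  fix s x e assume s: "t0 < s" "s \<le> t" and w: "0 < w s x" and e: "(0::real) < e"
  have s1: "s \<le> t1" and sin: "s \<in> {t0..t1}" using s tt by auto
  show "infinitesimal_le (diffusion \<gamma>) w e s x"
   using S.S_infinitesimal[OF s(1) s1 SI[OF w sin] e] by (simp only: w_def H_def)
 qed
 then have nn: "(\<integral>\<^sup>+x. ennreal (w t x) \<partial>lborel) \<le> ennreal (LINT x|lborel. n t x)"
  using mass[of t] tt t by simp
 have slice: "continuous_on UNIV (\<lambda>x. u t x)" if "continuous_on ({t0..t} \<times> UNIV) (\<lambda>(s, x). u s x)" for u :: "real => 'a => real"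
 proof -
  have "continuous_on UNIV (\<lambda>x::'a. (t, x))" by (intro continuous_intros)
  moreover have "range (\<lambda>x::'a. (t, x)) \<subseteq> {t0..t} \<times> UNIV" using tt by auto
  ultimately show ?thesis using continuous_on_compose2[OF that] by fastforce
 qed
 have cn: "continuous_on ({t0..t} \<times> UNIV) (\<lambda>(s, x). n s x)" by (rule continuous_on_subset[OF ncont]) (use t in auto)
 have t': "0 < t" using t tt by simp
 have nw: "n t x \<le> w t x" for x
  unfolding w_def using Nmono[OF SW[OF tin], of x] S0[OF tin, of x] NW[OF n0[OF t'], of x] by (simp add: W_def ss)
 have "w t x = n t x" for x
  by (rule eq_of_integral_le[OF slice[OF cn] slice[OF cw] n0[OF t'] nw _ nn]) (use mass[OF t'] in simp)
 then have "W (n t x) = S.S t x" using WN[of "S.S t x"] S0[OF tin, of x] by (metis w_def)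
 then show ?thesis
  using S.S_ge[OF tt, of y x] by (simp add: W_def \<sigma>_def S.L_def)
qed

text \<open>With \<open>\<theta> = \<gamma> / 2\<close> the coefficients on the negative half-line
  are \<open>f q = |\<gamma>| q^2\<close> and \<open>h q = - (\<gamma> + 2) q\<close>. Then
  \<open>key\<close> holds with equality for \<open>c0 = 2 + d \<gamma>\<close>, positive precisely
  when \<gamma> exceeds \<open>- 2 / d\<close>. No bound on the supremum of \<open>n\<close>
  enters.\<close>

lemma pme_lipschitz_fast:
 fixes n :: "real => 'a::euclidean_space => real"
 assumes n: "pme_solution \<gamma> n nt n1 n2" and g: "\<gamma> < 0" "-2 < real DIM('a) * \<gamma>" "-1 < \<gamma>"
  and pos: "\<And>t x. 0 < t ==> 0 < n t x"
  and mass: "\<And>t. 0 < t ==> integrable lborel (n t) \<and> (LINT x|lborel. n t x) = m"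
  and t: "0 < t"
 shows "n t x powr (\<gamma> / 2) \<le> n t y powr (\<gamma> / 2) + inverse (sqrt ((2 + real DIM('a) * \<gamma>) * t)) * norm (x - y)"
proof -
 define c0 where "c0 = 2 + real DIM('a) * \<gamma>"
 have c0: "0 < c0" using g by (simp add: c0_def)
 define kap where "kap = inverse (sqrt (2 * c0))"
 have sgn: "sgn \<gamma> = -1" using g by simp
 have "sgn \<gamma> * n t y powr (\<gamma> / 2) - kap * (t - t / 2) powr (- (1 / 2)) * norm (x - y) \<le> sgn \<gamma> * n t x powr (\<gamma> / 2)"
 \<comment> \<open>\<open>Wmax = 0\<close> because \<open>- n powr (\<gamma> / 2)\<close> is
   negative. The diffusion function is itself a power, so \<open>\<eta> = \<gamma> + 1\<close> works
   without a bound on \<open>n\<close>, and \<open>d (1 - \<eta>) < 2\<close> is the assumption on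
   \<gamma>. Restarting at \<open>t / 2\<close> leaves the time \<open>t / 2\<close> for the slope
   to become finite; \<open>kap\<close> is the smallest value allowed by \<open>c0\<close>.\<close>
 proof (rule pme_lipschitz[OF n g(3), where ?t1.0 = t and ?t0.0 = "t / 2" and ?c0.0 = c0 and Wmax = 0 and B = "\<bar>\<gamma>\<bar> / (\<gamma> + 1)" and \<eta> = "\<gamma> + 1" and m = m])
  show "0 < kap" "1 \<le> 2 * c0 * kap^2" using c0 by (auto simp: kap_def power_inverse)
  fix p q :: real assume pq: "0 < sgn \<gamma> * p" "0 < sgn \<gamma> * q" "p < q" "q \<le> 0"
  have p: "p < 0" "q < 0" using pq g by auto
  have "\<gamma> * ((\<gamma> + 1) / (\<gamma> / 2) - 1) = \<gamma> + 2" using g by (simp add: field_simps)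
  then have hh: "\<gamma> * ((\<gamma> + 1) / (\<gamma> / 2) - 1) * (sgn \<gamma> * r) powr (\<gamma> / (\<gamma> / 2) - 1) = - (\<gamma> + 2) * r" if "r < 0" for r
   using that g by (simp add: sgn) (simp add: algebra_simps)
  have ff: "sqrt (\<bar>\<gamma>\<bar> * (sgn \<gamma> * r) powr (\<gamma> / (\<gamma> / 2))) = sqrt \<bar>\<gamma>\<bar> * - r" if "r < 0" for r
  proof -
   have "(sgn \<gamma> * r) powr (\<gamma> / (\<gamma> / 2)) = (- r)^2" using that g by (simp add: sgn)
   then show ?thesis using that unfolding real_sqrt_mult by simp
  qed
  have sqd: "(sqrt \<bar>\<gamma>\<bar> * - q - sqrt \<bar>\<gamma>\<bar> * - p)^2 = - \<gamma> * (q - p)^2"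
  proof -
   have "(sqrt \<bar>\<gamma>\<bar> * - q - sqrt \<bar>\<gamma>\<bar> * - p)^2 = (sqrt \<bar>\<gamma>\<bar> * (p - q))^2" by (simp add: algebra_simps)
   then show ?thesis using g by (simp add: power_mult_distrib power2_commute)
  qed
  show "(\<gamma> * ((\<gamma> + 1) / (\<gamma> / 2) - 1) * (sgn \<gamma> * q) powr (\<gamma> / (\<gamma> / 2) - 1) -
     \<gamma> * ((\<gamma> + 1) / (\<gamma> / 2) - 1) * (sgn \<gamma> * p) powr (\<gamma> / (\<gamma> / 2) - 1)) * (q - p) +
    (real DIM('a) - 1) * (sqrt (\<bar>\<gamma>\<bar> * (sgn \<gamma> * q) powr (\<gamma> / (\<gamma> / 2))) - sqrt (\<bar>\<gamma>\<bar> * (sgn \<gamma> * p) powr (\<gamma> / (\<gamma> / 2))))^2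
    \<le> - c0 * (q - p)^2"
   unfolding hh[OF p(1)] hh[OF p(2)] ff[OF p(1)] ff[OF p(2)] sqd
   by (simp add: c0_def power2_eq_square algebra_simps)
 next
  show "diffusion \<gamma> v \<le> \<bar>\<gamma>\<bar> / (\<gamma> + 1) * v powr (\<gamma> + 1)" for v by (simp add: diffusion_def)
  show "0 \<le> \<bar>\<gamma>\<bar> / (\<gamma> + 1)" using g by (intro divide_nonneg_pos) auto
  have "real DIM('a) * (1 - (\<gamma> + 1)) = - (real DIM('a) * \<gamma>)" by simp
  then show "real DIM('a) * (1 - (\<gamma> + 1)) < 2" using g by linarith
 qed (use g t pos mass in \<open>auto simp: sgn\<close>)
 moreover have "kap * (t - t / 2) powr (- (1 / 2)) = inverse (sqrt (c0 * t))"
 proof -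
  have "(t - t / 2) powr (- (1 / 2)) = inverse (sqrt (t / 2))" using t by (simp add: powr_minus powr_half_sqrt)
  then have "kap * (t - t / 2) powr (- (1 / 2)) = inverse (sqrt (2 * c0) * sqrt (t / 2))" by (simp add: kap_def)
  also have "sqrt (2 * c0) * sqrt (t / 2) = sqrt (c0 * t)" unfolding real_sqrt_mult[symmetric] by simp
  finally show ?thesis .
 qed
 ultimately show ?thesis by (simp add: sgn c0_def)
qed

text \<open>Cauchy-Schwarz on the interval from \<open>p\<close> to \<open>q\<close> for the
  integrand \<open>a * s powr (a - 1)\<close> with \<open>a = (1 - e) / 2\<close>, whose square is
  \<open>a^2 * s powr (- e - 1)\<close>. The proof avoids integrals: \<open>F\<close> has the
  perfect square \<open>(l - a * s powr (a - 1))^2\<close> as derivative, where \<open>l\<close> is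
  the mean slope.\<close>

lemma powr_difference_squared_le:
 fixes p q :: real
 assumes pq: "0 < p" "p < q" and e: "0 < e" "e < 1"
 shows "(q powr ((1 - e) / 2) - p powr ((1 - e) / 2))^2 \<le> (q - p) * ((1 - e)^2 / (4 * e) * (p powr - e - q powr - e))"
proof -
 define a where "a = (1 - e) / 2"
 define A where "A = q powr a - p powr a"
 define l where "l = A / (q - p)"
 define F where "F s = l^2 * s - a^2 / e * s powr - e - 2 * l * s powr a" for s
 have "F p \<le> F q"
 proof (rule DERIV_nonneg_imp_nondecreasing[where f = F])
  fix s assume s: "p \<le> s" "s \<le> q"
  then have s0: "0 < s" using pq by simp
  have "DERIV F s :> l^2 - a^2 / e * (- e * s powr (- e - 1)) - 2 * l * (a * s powr (a - 1))"
   unfolding F_def by (intro DERIV_diff DERIV_cmult has_real_derivative_powr s0 DERIV_cmult_Id)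
  moreover have "l^2 - a^2 / e * (- e * s powr (- e - 1)) - 2 * l * (a * s powr (a - 1)) = (l - a * s powr (a - 1))^2"
  proof -
   have "(s powr (a - 1))^2 = s powr (- e - 1)"
   proof -
    have "a - 1 + (a - 1) = - e - 1" by (simp add: a_def)
    then show ?thesis unfolding power2_eq_square powr_add[symmetric] by (rule arg_cong)
   qed
   then show ?thesis using e by (simp add: power2_diff power_mult_distrib)
  qed
  ultimately show "\<exists>y. DERIV F s :> y \<and> 0 \<le> y" by (metis zero_le_power2)
 qed (use pq in simp)
 then have 1: "2 * l * A \<le> l^2 * (q - p) + a^2 / e * (p powr - e - q powr - e)"
  by (simp add: F_def A_def algebra_simps)
 have lq: "l * (q - p) = A" using pq by (simp add: l_def)
 then have "l^2 * (q - p) = l * A" by (simp add: power2_eq_square mult.assoc)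
 with 1 have "l * A \<le> a^2 / e * (p powr - e - q powr - e)" by linarith
 then have "(q - p) * (l * A) \<le> (q - p) * (a^2 / e * (p powr - e - q powr - e))" using pq by (intro mult_left_mono) auto
 moreover have "(q - p) * (l * A) = A^2"
 proof -
  have "(q - p) * (l * A) = (l * (q - p)) * A" by (simp only: mult_ac)
  then show ?thesis unfolding lq by (simp only: power2_eq_square)
 qed
 moreover have "a^2 / e = (1 - e)^2 / (4 * e)" by (simp add: a_def power_divide)
 ultimately show ?thesis unfolding A_def a_def by (simp only:)
qed

text \<open>Convexity of \<open>s powr - e\<close>: the mean slope is steeper than the slope at the
  right end point.\<close>

lemma powr_difference_ge:
 fixes p q :: real
 assumes pq: "0 < p" "p < q" and e: "0 < e"
 shows "e * q powr (- e - 1) * (q - p) \<le> p powr - e - q powr - e"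
proof -
 have "- (p powr - e) - e * q powr (- e - 1) * p \<le> - (q powr - e) - e * q powr (- e - 1) * q"
 proof (rule DERIV_nonneg_imp_nondecreasing[where f = "\<lambda>s. - (s powr - e) - e * q powr (- e - 1) * s"])
  fix s assume s: "p \<le> s" "s \<le> q"
  then have s0: "0 < s" using pq by simp
  have "((\<lambda>s. - (s powr - e) - e * q powr (- e - 1) * s) has_real_derivative
    - (- e * s powr (- e - 1)) - e * q powr (- e - 1)) (at s)"
   by (intro DERIV_diff DERIV_minus has_real_derivative_powr s0 DERIV_cmult_Id)
  moreover have "q powr (- e - 1) \<le> s powr (- e - 1)" using s s0 e by (intro powr_mono2') auto
  then have "0 \<le> - (- e * s powr (- e - 1)) - e * q powr (- e - 1)" using e by simp
  ultimately show "\<exists>y. DERIV (\<lambda>s. - (s powr - e) - e * q powr (- e - 1) * s) s :> y \<and> 0 \<le> y" by blast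
 qed (use pq in simp)
 then show ?thesis by (simp add: algebra_simps)
qed

text \<open>With \<open>\<theta> = \<gamma> + \<mu>\<close> and \<open>e = \<mu> / \<theta>\<close>
  the coefficients are \<open>f q = \<gamma> * q powr (1 - e)\<close> and
  \<open>h q = \<gamma> * (1 - \<mu>) / \<theta> * q powr - e\<close>. After Cauchy-Schwarz both
  terms of \<open>key\<close> are multiples of \<open>p powr - e - q powr - e\<close>, with total
  coefficient \<open>- \<gamma> * \<epsilon> / (\<theta> * \<mu>)\<close>, so the sign of
  \<open>\<epsilon>\<close> decides.\<close>

lemma pme_lipschitz_slow:
 fixes n :: "real => 'a::euclidean_space => real" and \<gamma> \<mu> :: real
 defines "\<epsilon> \<equiv> \<mu> - \<mu>^2 - (real DIM('a) - 1) * \<gamma>^2 / 4"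
 assumes n: "pme_solution \<gamma> n nt n1 n2" and g: "0 < \<gamma>" "0 < \<mu>" "0 < \<epsilon>"
  and mass: "\<And>t. 0 < t ==> integrable lborel (n t) \<and> (LINT x|lborel. n t x) = m"
  and t: "0 < t" and B: "0 < B" "\<And>s x. s \<in> {t / 2..t} ==> n s x \<le> B"
 shows "n t y powr (\<gamma> + \<mu>) \<le> n t x powr (\<gamma> + \<mu>) + (\<gamma> + \<mu>) * sqrt (B powr (\<gamma> + 2 * \<mu>) / (\<gamma> * \<epsilon> * t)) * norm (x - y)"
proof -
 define \<theta> where "\<theta> = \<gamma> + \<mu>"
 define e where "e = \<mu> / \<theta>"
 have th: "0 < \<theta>" using g by (simp add: \<theta>_def)
 have e: "0 < e" "e < 1" using g th by (auto simp: e_def \<theta>_def)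
 have ge: "\<gamma> / \<theta> = 1 - e" using th by (simp add: e_def \<theta>_def field_simps)
 define Wmax where "Wmax = B powr \<theta>"
 \<comment> \<open>The remaining difference of powers is only linear in \<open>q - p\<close>, with
   the slope \<open>e * q powr (- e - 1)\<close> from convexity. Its worst case is the largest value
   \<open>Wmax\<close>, which is how the bound \<open>B\<close> for the density enters the Lipschitz
   constant.\<close>
 define c0 where "c0 = \<gamma> * (\<epsilon> / (\<theta> * \<mu>)) * (e * Wmax powr (- e - 1))"
 have Wp: "0 < Wmax" using B by (simp add: Wmax_def)
 have c0: "0 < c0" unfolding c0_def using g th e Wp by (intro mult_pos_pos divide_pos_pos) auto
 define kap where "kap = inverse (sqrt (2 * c0))"
 have sgn: "sgn \<gamma> = 1" using g by simp
 \<comment> \<open>Here \<open>d (1 - \<eta>) = 1 / 2\<close>. Any exponent below 1 with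
   \<open>d (1 - \<eta>) < 2\<close> would serve: for bounded densities the superlinear diffusion
   function is at most a multiple of \<open>v powr \<eta>\<close>.\<close>
 define \<eta> where "\<eta> = 1 - 1 / (2 * real DIM('a))"
 have D1: "1 \<le> real DIM('a)" using DIM_positive[where 'a = 'a] by linarith
 have "0 < 1 / (2 * real DIM('a))" "1 / (2 * real DIM('a)) \<le> 1 / 2" using D1 by (auto simp: divide_simps)
 then have eta: "0 < \<eta>" "\<eta> < 1" unfolding \<eta>_def by linarith+
 have "sgn \<gamma> * n t y powr \<theta> - kap * (t - t / 2) powr (- (1 / 2)) * norm (x - y) \<le> sgn \<gamma> * n t x powr \<theta>"
 proof (rule pme_lipschitz[OF n, where ?t1.0 = t and ?t0.0 = "t / 2" and ?c0.0 = c0 and Wmax = Wmax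
   and B = "\<gamma> / (\<gamma> + 1) * B powr (\<gamma> + 1 - \<eta>)" and \<eta> = \<eta> and m = m])
  show "0 < kap" "1 \<le> 2 * c0 * kap^2" using c0 by (auto simp: kap_def power_inverse)
  show "sgn \<gamma> * n s x powr \<theta> \<le> Wmax" if "s \<in> {t / 2..t}" for s x
   unfolding Wmax_def using B(2)[OF that] n t that th by (auto simp: sgn pme_solution_def intro!: powr_mono2)
  fix p q :: real assume "0 < sgn \<gamma> * p" "0 < sgn \<gamma> * q" "p < q" "q \<le> Wmax"
  then have pq: "0 < p" "0 < q" "p < q" "q \<le> Wmax" by (auto simp: sgn)
  define X where "X = p powr - e - q powr - e"
  have hh: "\<gamma> * ((\<gamma> + 1) / \<theta> - 1) * (sgn \<gamma> * r) powr (\<gamma> / \<theta> - 1) = \<gamma> * ((1 - \<mu>) / \<theta>) * r powr - e" for r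
  proof -
   have "(\<gamma> + 1) / \<theta> - 1 = (1 - \<mu>) / \<theta>" using th by (simp add: \<theta>_def field_simps)
   then show ?thesis by (simp add: sgn ge)
  qed
  have ff: "sqrt (\<bar>\<gamma>\<bar> * (sgn \<gamma> * r) powr (\<gamma> / \<theta>)) = sqrt \<gamma> * r powr ((1 - e) / 2)" if "0 < r" for r
  proof -
   have "(r powr ((1 - e) / 2))^2 = r powr (1 - e)" using that by (simp add: power2_eq_square powr_add[symmetric])
   then have "sqrt (r powr (1 - e)) = r powr ((1 - e) / 2)" by (intro real_sqrt_unique) auto
   then show ?thesis using g by (simp add: sgn ge real_sqrt_mult)
  qed
  have sq: "(sqrt \<gamma> * q powr ((1 - e) / 2) - sqrt \<gamma> * p powr ((1 - e) / 2))^2 \<le> \<gamma> * ((q - p) * ((1 - e)^2 / (4 * e) * X))"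
  proof -
   have "(sqrt \<gamma> * q powr ((1 - e) / 2) - sqrt \<gamma> * p powr ((1 - e) / 2))^2 = \<gamma> * (q powr ((1 - e) / 2) - p powr ((1 - e) / 2))^2"
    using g unfolding right_diff_distrib[symmetric] by (simp add: power_mult_distrib)
   also have "\<dots> \<le> \<gamma> * ((q - p) * ((1 - e)^2 / (4 * e) * X))"
    unfolding X_def using g by (intro mult_left_mono powr_difference_squared_le pq e) auto
   finally show ?thesis .
  qed
  have coef: "(1 - \<mu>) / \<theta> - (real DIM('a) - 1) * ((1 - e)^2 / (4 * e)) = \<epsilon> / (\<theta> * \<mu>)"
  proof -
   have c: "(1 - e)^2 / (4 * e) = \<gamma>^2 / (4 * \<theta> * \<mu>)"
    unfolding ge[symmetric] using g th by (simp add: e_def power_divide power2_eq_square field_simps)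
   show ?thesis unfolding c \<epsilon>_def using g th by (simp add: field_simps power2_eq_square)
  qed
  have Xge: "e * Wmax powr (- e - 1) * (q - p) \<le> X"
  proof -
   have "e * Wmax powr (- e - 1) * (q - p) \<le> e * q powr (- e - 1) * (q - p)"
    using pq e by (intro mult_right_mono mult_left_mono powr_mono2') auto
   also have "\<dots> \<le> X" unfolding X_def by (rule powr_difference_ge[OF pq(1,3) e(1)])
   finally show ?thesis .
  qed
  have "(\<gamma> * ((1 - \<mu>) / \<theta>) * q powr - e - \<gamma> * ((1 - \<mu>) / \<theta>) * p powr - e) * (q - p)
    + (real DIM('a) - 1) * (sqrt \<gamma> * q powr ((1 - e) / 2) - sqrt \<gamma> * p powr ((1 - e) / 2))^2
   \<le> - (\<gamma> * ((1 - \<mu>) / \<theta>) * X * (q - p)) + (real DIM('a) - 1) * (\<gamma> * ((q - p) * ((1 - e)^2 / (4 * e) * X)))"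
   using mult_left_mono[OF sq, of "real DIM('a) - 1"] D1 by (simp add: X_def algebra_simps)
  also have "\<dots> = - (\<gamma> * ((1 - \<mu>) / \<theta> - (real DIM('a) - 1) * ((1 - e)^2 / (4 * e))) * X * (q - p))"
   by (simp add: algebra_simps)
  also have "\<dots> = - (\<gamma> * (\<epsilon> / (\<theta> * \<mu>)) * (q - p) * X)" unfolding coef by (simp add: mult_ac)
  also have "\<dots> \<le> - (\<gamma> * (\<epsilon> / (\<theta> * \<mu>)) * (q - p) * (e * Wmax powr (- e - 1) * (q - p)))"
   using g th pq by (intro le_imp_neg_le mult_left_mono Xge) auto
  also have "\<dots> = - c0 * (q - p)^2" by (simp add: c0_def power2_eq_square mult_ac)
  finally show "(\<gamma> * ((\<gamma> + 1) / \<theta> - 1) * (sgn \<gamma> * q) powr (\<gamma> / \<theta> - 1) -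
     \<gamma> * ((\<gamma> + 1) / \<theta> - 1) * (sgn \<gamma> * p) powr (\<gamma> / \<theta> - 1)) * (q - p) +
    (real DIM('a) - 1) * (sqrt (\<bar>\<gamma>\<bar> * (sgn \<gamma> * q) powr (\<gamma> / \<theta>)) - sqrt (\<bar>\<gamma>\<bar> * (sgn \<gamma> * p) powr (\<gamma> / \<theta>)))^2
    \<le> - c0 * (q - p)^2"
   unfolding hh ff[OF pq(1)] ff[OF pq(2)] .
 next
  fix v :: real assume v: "0 \<le> v" "sgn \<gamma> * v powr \<theta> \<le> Wmax"
  have vB: "v \<le> B"
  proof (rule ccontr)
   assume "\<not> v \<le> B"
   then have "B powr \<theta> < v powr \<theta>" using B th by (intro powr_less_mono2) auto
   then show False using v by (simp add: sgn Wmax_def)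
  qed
  show "diffusion \<gamma> v \<le> \<gamma> / (\<gamma> + 1) * B powr (\<gamma> + 1 - \<eta>) * v powr \<eta>"
  proof (cases "v = 0")
   case False
   then have "v powr (\<gamma> + 1) = v powr (\<gamma> + 1 - \<eta>) * v powr \<eta>" using v by (simp add: powr_add[symmetric])
   also have "\<dots> \<le> B powr (\<gamma> + 1 - \<eta>) * v powr \<eta>" using v vB eta g by (intro mult_right_mono powr_mono2) auto
   finally have "\<gamma> / (\<gamma> + 1) * v powr (\<gamma> + 1) \<le> \<gamma> / (\<gamma> + 1) * (B powr (\<gamma> + 1 - \<eta>) * v powr \<eta>)"
    using g by (intro mult_left_mono) auto
   then show ?thesis using g by (simp add: diffusion_def)
  qed (use g in \<open>simp add: diffusion_def\<close>)
 next
  show "real DIM('a) * (1 - \<eta>) < 2" using D1 by (simp add: \<eta>_def)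
 qed (use g t mass sgn th eta B in auto)
 moreover have "kap * (t - t / 2) powr (- (1 / 2)) = \<theta> * sqrt (B powr (\<gamma> + 2 * \<mu>) / (\<gamma> * \<epsilon> * t))"
 proof -
  have WB: "Wmax powr (- e - 1) = inverse (B powr (\<gamma> + 2 * \<mu>))"
  proof -
   have ex: "\<theta> * (- e - 1) = - (\<gamma> + 2 * \<mu>)" using th by (simp add: e_def \<theta>_def field_simps)
   show ?thesis unfolding Wmax_def powr_powr ex by (rule powr_minus)
  qed
  have "(t - t / 2) powr (- (1 / 2)) = inverse (sqrt (t / 2))" using t by (simp add: powr_minus powr_half_sqrt)
  then have "kap * (t - t / 2) powr (- (1 / 2)) = inverse (sqrt (2 * c0) * sqrt (t / 2))" by (simp add: kap_def)
  also have "sqrt (2 * c0) * sqrt (t / 2) = sqrt (c0 * t)" unfolding real_sqrt_mult[symmetric] by simp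
  also have "c0 * t = (\<gamma> * \<epsilon> * t / B powr (\<gamma> + 2 * \<mu>)) / \<theta>^2"
   unfolding c0_def WB using g th by (simp add: e_def divide_inverse power2_eq_square mult_ac)
  also have "inverse (sqrt (\<gamma> * \<epsilon> * t / B powr (\<gamma> + 2 * \<mu>) / \<theta>^2)) = \<theta> * sqrt (B powr (\<gamma> + 2 * \<mu>) / (\<gamma> * \<epsilon> * t))"
   using th by (simp add: real_sqrt_divide real_sqrt_mult)
  finally show ?thesis .
 qed
 ultimately show ?thesis by (simp add: sgn \<theta>_def)
qed

section \<open>Smoothing bounds\<close>

text \<open>The hypothesis reads: value times volume of a ball of radius
  \<open>sqrt (t * v powr \<gamma>)\<close> is at most a multiple of the mass. Both smoothing
  arguments end in this form, and solving it for \<open>v\<close> produces the decay exponent of the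
  Barenblatt solutions.\<close>

lemma smoothing_powr_solve:
 fixes v t A m \<gamma> d :: real
 assumes v: "0 \<le> v" and t: "0 < t" and A: "0 < A" and d: "0 < d * \<gamma> + 2"
  and le: "A * v powr (1 + \<gamma> * d / 2) * t powr (d / 2) \<le> m"
 shows "v \<le> (m / A) powr (2 / (d * \<gamma> + 2)) * t powr - (d / (d * \<gamma> + 2))"
proof (cases "v = 0")
 case False
 define s where "s = 2 / (d * \<gamma> + 2)"
 have s: "0 < s" "(1 + \<gamma> * d / 2) * s = 1" using d by (auto simp: s_def field_simps)
 have tp: "0 < t powr (d / 2)" using t by simp
 have "v powr (1 + \<gamma> * d / 2) \<le> m / A * t powr - (d / 2)"
  using le A tp by (simp add: powr_minus field_simps)
 then have "(v powr (1 + \<gamma> * d / 2)) powr s \<le> (m / A * t powr - (d / 2)) powr s"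
  using s by (intro powr_mono2) auto
 moreover have "0 \<le> m" using le A v t by (smt (verit) mult_nonneg_nonneg powr_ge_zero)
 moreover have "(v powr (1 + \<gamma> * d / 2)) powr s = v" using v False by (simp add: powr_powr s)
 moreover have "(m / A * t powr - (d / 2)) powr s = (m / A) powr s * (t powr - (d / 2)) powr s" if "0 \<le> m"
  by (rule powr_mult)
 ultimately have "v \<le> (m / A) powr s * (t powr - (d / 2)) powr s" by simp
 moreover have "- (d / 2) * s = - (d / (d * \<gamma> + 2))" using d by (simp add: s_def field_simps)
 ultimately show ?thesis by (simp only: powr_powr s_def)
qed simp

lemma integral_ball_le:
 fixes f :: "'a::euclidean_space => real"
 assumes f: "integrable lborel f" "\<And>x. 0 \<le> f x" and c: "\<And>x. norm (x - x0) \<le> r ==> c \<le> f x" and r: "0 \<le> r"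
 shows "c * (unit_ball_vol (real DIM('a)) * r ^ DIM('a)) \<le> (LINT x|lborel. f x)"
proof -
 have "integrable lborel (indicat_real (cball x0 r))"
  by (intro integrable_real_indicator) (simp_all add: emeasure_lborel_cball_finite[unfolded infinity_ennreal_def])
 then have "(LINT x|lborel. c * indicat_real (cball x0 r) x) \<le> (LINT x|lborel. f x)"
 proof (intro integral_mono integrable_mult_right)
  show "c * indicat_real (cball x0 r) x \<le> f x" for x
   using f(2)[of x] c[of x] by (simp add: indicator_def dist_norm norm_minus_commute)
 qed (use f in auto)
 then show ?thesis using r by (simp add: content_cball)
qed

text \<open>A high value cannot be concentrated: by the Lipschitz bound the density stays comparable
  to \<open>n t x\<close> on a whole ball, and the mass of that ball is at most
  \<open>m\<close>.\<close>

lemma pme_sup_bound_fast: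
 fixes n :: "real => 'a::euclidean_space => real"
 defines "d \<equiv> real DIM('a)"
 assumes n: "pme_solution \<gamma> n nt n1 n2" and g: "\<gamma> < 0" "-2 < d * \<gamma>" "-1 < \<gamma>"
  and pos: "\<And>t x. 0 < t ==> 0 < n t x"
  and mass: "\<And>t. 0 < t ==> integrable lborel (n t) \<and> (LINT x|lborel. n t x) = m"
 shows "\<exists>C>0. \<forall>t>0. \<forall>x. n t x \<le> C * t powr - (d / (d * \<gamma> + 2))"
proof -
 define c0 where "c0 = 2 + d * \<gamma>"
 have c0: "0 < c0" using g by (simp add: c0_def)
 define V where "V = unit_ball_vol d"
 have V: "0 < V" by (simp add: V_def d_def)
 define A where "A = 2 powr (2 / \<gamma>) * V * c0 powr (d / 2)"
 have A: "0 < A" using V c0 by (simp add: A_def)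
 have "n t x \<le> (m / A) powr (2 / (d * \<gamma> + 2)) * t powr - (d / (d * \<gamma> + 2))" if t: "0 < t" for t x
 proof (rule smoothing_powr_solve[OF _ t A])
  have p: "0 < n t x" by (rule pos[OF t])
  \<comment> \<open>On this ball \<open>n powr (\<gamma> / 2)\<close> at most doubles; since
    \<gamma> is negative, this bounds \<open>n\<close> from below by the factor
    \<open>2 powr (2 / \<gamma>)\<close>.\<close>
  define r where "r = n t x powr (\<gamma> / 2) * sqrt (c0 * t)"
  have r: "0 < r" using p c0 t by (simp add: r_def)
  have low: "2 powr (2 / \<gamma>) * n t x \<le> n t y" if y: "norm (y - x) \<le> r" for y
  proof -
   have "n t y powr (\<gamma> / 2) \<le> n t x powr (\<gamma> / 2) + inverse (sqrt (c0 * t)) * norm (y - x)"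
    unfolding c0_def d_def by (rule pme_lipschitz_fast[OF n g(1) g(2)[unfolded d_def] g(3) pos mass t])
   also have "inverse (sqrt (c0 * t)) * norm (y - x) \<le> inverse (sqrt (c0 * t)) * r"
    using y c0 t by (intro mult_left_mono) auto
   also have "\<dots> = n t x powr (\<gamma> / 2)" using c0 t by (simp add: r_def)
   finally have "n t y powr (\<gamma> / 2) \<le> 2 * n t x powr (\<gamma> / 2)" by simp
   then have "(2 * n t x powr (\<gamma> / 2)) powr (2 / \<gamma>) \<le> (n t y powr (\<gamma> / 2)) powr (2 / \<gamma>)"
    using g pos[OF t, of y] by (intro powr_mono2') (auto simp: divide_nonneg_neg)
   then show ?thesis using g p pos[OF t, of y] by (simp add: powr_mult powr_powr)
  qed
  have "2 powr (2 / \<gamma>) * n t x * (unit_ball_vol (real DIM('a)) * r ^ DIM('a)) \<le> (LINT x|lborel. n t x)"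
   using mass[OF t] pos[OF t] low r by (intro integral_ball_le[where ?x0.0 = x]) (auto intro: less_imp_le)
  also have "\<dots> = m" using mass[OF t] by simp
  finally have 1: "2 powr (2 / \<gamma>) * n t x * (V * r ^ DIM('a)) \<le> m" by (simp add: V_def d_def)
  have rd: "r ^ DIM('a) = n t x powr (\<gamma> * d / 2) * (c0 powr (d / 2) * t powr (d / 2))"
  proof -
   have "r ^ DIM('a) = r powr d" using r by (simp add: d_def powr_realpow)
   also have "\<dots> = n t x powr (\<gamma> * d / 2) * (c0 * t) powr (d / 2)"
    using c0 t by (simp add: r_def powr_mult powr_powr powr_half_sqrt[symmetric])
   finally show ?thesis using c0 t by (simp add: powr_mult)
  qed
  have "n t x powr (1 + \<gamma> * d / 2) = n t x * n t x powr (\<gamma> * d / 2)" using p by (simp add: powr_add)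
  then show "A * n t x powr (1 + \<gamma> * d / 2) * t powr (d / 2) \<le> m" using 1 unfolding rd A_def by (simp add: mult_ac)
  show "0 \<le> n t x" "0 < d * \<gamma> + 2" using p g by auto
 qed
 \<comment> \<open>Enlarging the constant by 1 makes it strictly positive without discussing whether
   \<open>m\<close> vanishes.\<close>
 moreover have "a * b \<le> (a + 1) * b" if "0 \<le> b" for a b :: real using that by (simp add: algebra_simps)
 ultimately show ?thesis
  by (intro exI[of _ "(m / A) powr (2 / (d * \<gamma> + 2)) + 1"]) (smt (verit, best) powr_ge_zero)
qed

text \<open>Time is scaled while space is not, and the amplitude \<open>k\<close> with
  \<open>k powr \<gamma> = l\<close> restores the equation. Because space is untouched, the scaled
  solution can be compared with the original one point by point.\<close>

lemma pme_solution_scale: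
 fixes n :: "real => 'a::euclidean_space => real"
 assumes n: "pme_solution \<gamma> n nt n1 n2" and g: "0 < \<gamma>" and l: "0 < l"
 shows "pme_solution \<gamma> (\<lambda>t x. l powr (1 / \<gamma>) * n (l * t) x) (\<lambda>t x. l powr (1 / \<gamma>) * (l * nt (l * t) x))
  (\<lambda>i t x. l powr (1 / \<gamma>) * n1 i (l * t) x) (\<lambda>i t x. l powr (1 / \<gamma>) * n2 i (l * t) x)"
proof -
 define k where "k = l powr (1 / \<gamma>)"
 have k: "0 < k" using l by (simp add: k_def)
 have kg: "k powr \<gamma> = l" using l g by (simp add: k_def powr_powr)
 define P where "P = {(t, x::'a). 0 < t \<and> 0 < n t x}"
 define Q where "Q = {(t, x::'a). 0 < t \<and> 0 < k * n (l * t) x}"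
 let ?T = "\<lambda>(t::real, x::'a). (l * t, x)"
 have QP: "Q = ?T -` P" using k l by (auto simp: P_def Q_def zero_less_mult_iff)
 have Tc: "continuous_on A ?T" for A by (auto simp: case_prod_unfold intro!: continuous_intros)
 have Cn: "C12 P n nt n1 n2" using n by (simp add: pme_solution_def P_def)
 have comp: "continuous_on Q (\<lambda>(t, x). c * F (l * t) x)" if "continuous_on P (\<lambda>(t, x). F t x)" for c and F :: "real => 'a => real"
 proof -
  have "continuous_on Q (\<lambda>z. (\<lambda>(t, x). F t x) (?T z))"
   by (rule continuous_on_compose2[OF that Tc]) (auto simp: QP)
  then show ?thesis by (auto simp: case_prod_unfold intro!: continuous_intros)
 qed
 have C: "C12 Q (\<lambda>t x. k * n (l * t) x) (\<lambda>t x. k * (l * nt (l * t) x)) (\<lambda>i t x. k * n1 i (l * t) x) (\<lambda>i t x. k * n2 i (l * t) x)"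
  unfolding C12_def
 proof (intro conjI allI impI ballI)
  show "open Q" unfolding QP using Cn Tc by (intro open_vimage) (auto simp: C12_def)
  fix t x assume tx: "(t, x) \<in> Q"
  then have lt: "(l * t, x) \<in> P" by (simp add: QP)
  have "DERIV (\<lambda>s. n s x) (l * t) :> nt (l * t) x" using Cn lt by (simp add: C12_def)
  then have "DERIV (\<lambda>s. n (l * s) x) t :> nt (l * t) x * l"
   by (rule DERIV_chain2) (rule DERIV_cmult_Id)
  from DERIV_cmult[OF this, of k] show "DERIV (\<lambda>s. k * n (l * s) x) t :> k * (l * nt (l * t) x)"
   by (simp add: mult_ac)
  fix i :: 'a assume i: "i \<in> Basis"
  show "DERIV (\<lambda>s. k * n (l * t) (x + s *\<^sub>R i)) 0 :> k * n1 i (l * t) x"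
   "DERIV (\<lambda>s. k * n1 i (l * t) (x + s *\<^sub>R i)) 0 :> k * n2 i (l * t) x"
   using Cn lt i by (auto simp: C12_def intro!: DERIV_cmult)
 next
  show "continuous_on Q (\<lambda>(t, x). k * (l * nt (l * t) x))"
   using comp[of nt "k * l"] Cn by (simp add: C12_def mult.assoc)
  fix i :: 'a assume i: "i \<in> Basis"
  show "continuous_on Q (\<lambda>(t, x). k * n1 i (l * t) x)" "continuous_on Q (\<lambda>(t, x). k * n2 i (l * t) x)"
   using comp Cn i by (auto simp: C12_def)
 qed
 show ?thesis
  unfolding pme_solution_def k_def[symmetric]
 proof (intro conjI allI impI)
  show "continuous_on ({0<..} \<times> UNIV) (\<lambda>(t, x). k * n (l * t) x)"
  proof -
   have "continuous_on ({0<..} \<times> UNIV) (\<lambda>z. (\<lambda>(t, x). n t x) (?T z))"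
    by (rule continuous_on_compose2[of "{0<..} \<times> UNIV", OF _ Tc]) (use n l in \<open>auto simp: pme_solution_def\<close>)
   then show ?thesis by (auto simp: case_prod_unfold intro!: continuous_intros)
  qed
  show "C12 {(t, x). 0 < t \<and> 0 < k * n (l * t) x} (\<lambda>t x. k * n (l * t) x) (\<lambda>t x. k * (l * nt (l * t) x))
   (\<lambda>i t x. k * n1 i (l * t) x) (\<lambda>i t x. k * n2 i (l * t) x)"
   using C by (simp add: Q_def)
  fix t :: real and x :: 'a assume t: "0 < t"
  then have lt: "0 < l * t" using l by simp
  show "0 \<le> k * n (l * t) x" using n k lt by (simp add: pme_solution_def)
  assume "0 < k * n (l * t) x"
  then have p: "0 < n (l * t) x" using k by (simp add: zero_less_mult_iff)
  define v where "v = n (l * t) x"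
  have 1: "(k * v) powr \<gamma> = l * v powr \<gamma>" using k p by (simp add: powr_mult kg v_def)
  have 2: "(k * v) powr (\<gamma> - 1) * k = l * v powr (\<gamma> - 1)" using k p by (simp add: powr_mult powr_diff kg v_def)
  have "k * (l * nt (l * t) x) = k * (l * (\<Sum>i\<in>Basis. \<bar>\<gamma>\<bar> * v powr \<gamma> * n2 i (l * t) x + \<bar>\<gamma>\<bar> * \<gamma> * v powr (\<gamma> - 1) * (n1 i (l * t) x)^2))"
   using n lt p by (simp add: pme_solution_def v_def)
  also have "\<dots> = (\<Sum>i\<in>Basis. \<bar>\<gamma>\<bar> * (l * v powr \<gamma>) * (k * n2 i (l * t) x) + \<bar>\<gamma>\<bar> * \<gamma> * (l * v powr (\<gamma> - 1)) * k * (n1 i (l * t) x)^2)"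
   unfolding sum_distrib_left by (intro sum.cong refl) (simp add: algebra_simps)
  also have "\<dots> = (\<Sum>i\<in>Basis. \<bar>\<gamma>\<bar> * (k * v) powr \<gamma> * (k * n2 i (l * t) x) + \<bar>\<gamma>\<bar> * \<gamma> * (k * v) powr (\<gamma> - 1) * (k * n1 i (l * t) x)^2)"
   unfolding 1[symmetric] 2[symmetric] by (intro sum.cong refl) (simp add: power2_eq_square)
  finally show "k * (l * nt (l * t) x) = (\<Sum>i\<in>Basis. \<bar>\<gamma>\<bar> * (k * n (l * t) x) powr \<gamma> * (k * n2 i (l * t) x) +
    \<bar>\<gamma>\<bar> * \<gamma> * (k * n (l * t) x) powr (\<gamma> - 1) * (k * n1 i (l * t) x)^2)" by (simp only: v_def)
 qed
qed

lemma continuous_on_diffusion_density: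
 assumes "-1 < \<gamma>" "continuous_on ({0<..} \<times> UNIV) (\<lambda>(t, x). n t x)" "\<And>t x. 0 < t ==> 0 \<le> n t x"
 shows "continuous_on ({0<..} \<times> UNIV) (\<lambda>(t, x). diffusion \<gamma> (n t x))"
proof -
 have "continuous_on ({0<..} \<times> UNIV) (\<lambda>z. diffusion \<gamma> ((\<lambda>(t, x). n t x) z))"
  by (rule continuous_on_compose2[OF continuous_on_diffusion[OF assms(1)] assms(2)]) (use assms(3) in auto)
 then show ?thesis by (simp add: case_prod_unfold)
qed

lemma continuous_on_time_slice:
 fixes n :: "real => 'a::euclidean_space => real"
 assumes "pme_solution \<gamma> n nt n1 n2" "0 < t"
 shows "continuous_on UNIV (n t)"
proof -
 have "continuous_on ({0<..} \<times> UNIV) (\<lambda>(t, x). n t x)" using assms by (simp add: pme_solution_def)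
 moreover have "continuous_on UNIV (\<lambda>x::'a. (t, x))" by (intro continuous_intros)
 moreover have "range (\<lambda>x::'a. (t, x)) \<subseteq> {0<..} \<times> UNIV" using assms(2) by auto
 ultimately show ?thesis using continuous_on_compose2[of "{0<..} \<times> UNIV" "\<lambda>(t, x). n t x" UNIV "\<lambda>x. (t, x)"] by simp
qed

lemma continuous_on_diffusion_bump_integral:
 fixes n :: "real => 'a::euclidean_space => real"
 assumes n: "pme_solution \<gamma> n nt n1 n2" and g: "-1 < \<gamma>" and a: "0 < a" and R: "0 < R" and p: "0 < p"
 shows "continuous_on {a..b} (\<lambda>t. LINT x|lborel. diffusion \<gamma> (n t x) * bump p R x)"
proof (rule continuous_on_integral_support[where R = R])
 have "continuous_on ({a..b} \<times> UNIV) (\<lambda>z. n (fst z) (snd z))"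
  by (rule continuous_on_subset[of "{0<..} \<times> UNIV"]) (use n a in \<open>auto simp: pme_solution_def case_prod_unfold\<close>)
 then have "continuous_on ({a..b} \<times> UNIV) (\<lambda>z. diffusion \<gamma> (n (fst z) (snd z)))"
  by (rule continuous_on_compose2[OF continuous_on_diffusion[OF g]]) (use n a in \<open>auto simp: pme_solution_def\<close>)
 moreover have "continuous_on ({a..b} \<times> UNIV) (\<lambda>z::real \<times> 'a. bump p R (snd z))"
  by (rule continuous_on_compose2[OF continuous_on_bump(1)[OF R, of UNIV]]) (auto intro!: continuous_intros)
 ultimately show "continuous_on ({a..b} \<times> UNIV) (\<lambda>(t, x). diffusion \<gamma> (n t x) * bump p R x)"
  unfolding case_prod_unfold by (rule continuous_on_mult)
qed (simp add: bump_eq_0[OF R p])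

text \<open>No bound on the supremum may be used here, as it will be derived from this lemma. For
  \<gamma> > 0 the error at infinity is controlled by the space-time integral of the diffusion
  instead, multiplied by the \<open>R^-2\<close> coming from the Laplacian of the weight.\<close>

lemma pme_max_mass_le:
 fixes n m :: "real => 'a::euclidean_space => real"
 assumes n: "pme_solution \<gamma> n nt n1 n2" and m: "pme_solution \<gamma> m mt m1 m2" and g: "0 < \<gamma>" and ab: "0 < a" "a < b"
  and int: "integrable lborel (n a)" "integrable lborel (m a)"
  and hn: "\<And>R. 0 < R ==> integral {a..b} (\<lambda>t. LINT x|lborel. diffusion \<gamma> (n t x) * bump 3 R x) \<le> En"
  and hm: "\<And>R. 0 < R ==> integral {a..b} (\<lambda>t. LINT x|lborel. diffusion \<gamma> (m t x) * bump 3 R x) \<le> Em"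
 shows "(\<integral>\<^sup>+x. ennreal (max (n b x) (m b x)) \<partial>lborel) \<le> ennreal (LINT x|lborel. max (n a x) (m a x))"
proof -
 have g1: "-1 < \<gamma>" "\<gamma> \<noteq> 0" using g by auto
 define w where "w = (\<lambda>t x. max (n t x) (m t x))"
 have nc: "continuous_on UNIV (n t)" "continuous_on UNIV (m t)" if "0 < t" for t
  by (rule continuous_on_time_slice[OF n that], rule continuous_on_time_slice[OF m that])
 have wc: "continuous_on UNIV (w t)" if "0 < t" for t
  unfolding w_def using nc[OF that] by (intro continuous_intros)
 have nm0: "0 \<le> n t x" "0 \<le> m t x" if "0 < t" for t x using n m that by (auto simp: pme_solution_def)
 then have w0: "0 \<le> w t x" if "0 < t" for t x using that by (auto simp: w_def le_max_iff_disj)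
 define \<kappa> where "\<kappa> j = inverse (real (Suc j))" for j
 have k: "0 < \<kappa> j" for j by (simp add: \<kappa>_def)
 have wa: "integrable lborel (w a)" unfolding w_def by (intro integrable_max int)
 have le: "(LINT x|lborel. max 0 (w b x - \<kappa> j) * bump 5 (real (Suc j)) x)
   \<le> (LINT x|lborel. w a x) + 100 * (En + Em) * (inverse (real (Suc j)))^2" for j
 proof -
  define R where "R = real (Suc j)"
  have R: "0 < R" by (simp add: R_def)
  have R2: "0 \<le> 100 / R^2" by simp
  define Jn Jm where "Jn t = (LINT x|lborel. diffusion \<gamma> (n t x) * bump 3 R x)"
   and "Jm t = (LINT x|lborel. diffusion \<gamma> (m t x) * bump 3 R x)" for t
  have Jc: "continuous_on {a..b} Jn" "continuous_on {a..b} Jm"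
   unfolding Jn_def Jm_def
   by (rule continuous_on_diffusion_bump_integral[OF n g1(1) ab(1) R], simp,
     rule continuous_on_diffusion_bump_integral[OF m g1(1) ab(1) R], simp)
  define J where "J t = 100 / R^2 * (Jn t + Jm t)" for t
  have JJ: "continuous_on {a..b} J" unfolding J_def by (intro continuous_intros Jc)
  define K where "K t = integral {a..t} J" for t
  have "(LINT x|lborel. max 0 (w b x - \<kappa> j) * bump 5 R x) - (LINT x|lborel. max 0 (w a x - \<kappa> j) * bump 5 R x) \<le> K b - K a"
  proof (rule pme_max_mass_growth[OF n m g1 ab(1) less_imp_le[OF ab(2)] k R _ w_def, where K' = J])
   show "(K has_real_derivative J t) (at t within {a..b})" if "t \<in> {a..b}" for t
    unfolding K_def using integral_has_real_derivative[OF JJ that] .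
   fix t assume "t \<in> {a..b}"
   then have t: "0 < t" using ab by simp
   have Phic: "continuous_on UNIV (\<lambda>x. diffusion \<gamma> (u x))" if "continuous_on UNIV u" "\<And>x. 0 \<le> u x" for u :: "'a => real"
    by (rule continuous_on_compose2[OF continuous_on_diffusion[OF g1(1)] that(1)]) (use that(2) in auto)
   have sup: "integrable lborel (\<lambda>x. u x * bump 3 R x)" if "continuous_on UNIV u" for u :: "'a => real"
    by (rule integrable_continuous_support[where R = R])
      (auto intro!: continuous_intros that continuous_on_bump R simp: bump_eq_0[OF R])
   have i1: "integrable lborel (\<lambda>x. diffusion \<gamma> (n t x) * bump 3 R x)" "integrable lborel (\<lambda>x. diffusion \<gamma> (m t x) * bump 3 R x)"
    by (intro sup Phic nc t nm0)+
   have i0: "integrable lborel (\<lambda>x. max 0 (diffusion \<gamma> (w t x) - diffusion \<gamma> (\<kappa> j)) * (\<Sum>i\<in>Basis. bump2 5 R i x))"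
   proof (rule integrable_continuous_support[where R = R])
    show "continuous_on UNIV (\<lambda>x. max 0 (diffusion \<gamma> (w t x) - diffusion \<gamma> (\<kappa> j)) * (\<Sum>i\<in>Basis. bump2 5 R i x))"
     by (intro continuous_intros Phic wc w0 t continuous_on_bump R)
    fix x :: 'a assume "norm x > R"
    then have "(norm x)^2 / R^2 \<ge> 1" using R by (simp add: power_mono)
    then have "max 0 (1 - (norm x)^2 / R^2) = 0" by simp
    then show "max 0 (diffusion \<gamma> (w t x) - diffusion \<gamma> (\<kappa> j)) * (\<Sum>i\<in>Basis. bump2 5 R i x) = 0" by (simp add: bump2_def)
   qed
   have pw: "max 0 (diffusion \<gamma> (w t x) - diffusion \<gamma> (\<kappa> j)) * (\<Sum>i\<in>Basis. bump2 5 R i x)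
    \<le> 100 / R^2 * (diffusion \<gamma> (n t x) * bump 3 R x + diffusion \<gamma> (m t x) * bump 3 R x)" for x
   proof -
    have "diffusion \<gamma> (w t x) \<le> diffusion \<gamma> (n t x) + diffusion \<gamma> (m t x)"
     using diffusion_nonneg[OF g1(1), of "n t x"] diffusion_nonneg[OF g1(1), of "m t x"] by (simp add: w_def max_def)
    then have 1: "max 0 (diffusion \<gamma> (w t x) - diffusion \<gamma> (\<kappa> j)) \<le> diffusion \<gamma> (n t x) + diffusion \<gamma> (m t x)"
     using diffusion_nonneg[OF g1(1), of "\<kappa> j"] diffusion_nonneg[OF g1(1), of "n t x"] diffusion_nonneg[OF g1(1), of "m t x"] by simp
    \<comment> \<open>The weight with exponent 5 has its Laplacian bounded by
      \<open>4 * 5^2 / R^2\<close> times the weight with exponent \<open>5 - 2\<close>, which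
      explains the constant 100 and the weight \<open>bump 3\<close> in the energy
      hypotheses.\<close>
    have 2: "(\<Sum>i\<in>Basis. bump2 5 R i x) \<le> 100 / R^2 * bump 3 R x"
     using sum_bump2_le[OF R, of 5 x] by (simp add: bump_def)
    have "max 0 (diffusion \<gamma> (w t x) - diffusion \<gamma> (\<kappa> j)) * (\<Sum>i\<in>Basis. bump2 5 R i x)
     \<le> max 0 (diffusion \<gamma> (w t x) - diffusion \<gamma> (\<kappa> j)) * (100 / R^2 * bump 3 R x)"
     by (intro mult_left_mono 2) simp
    also have "\<dots> \<le> (diffusion \<gamma> (n t x) + diffusion \<gamma> (m t x)) * (100 / R^2 * bump 3 R x)"
     by (intro mult_right_mono 1 mult_nonneg_nonneg R2 bump_nonneg)
    also have "\<dots> = 100 / R^2 * (diffusion \<gamma> (n t x) * bump 3 R x + diffusion \<gamma> (m t x) * bump 3 R x)"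
     by (simp only: distrib_right distrib_left mult_ac)
    finally show ?thesis .
   qed
   have "(LINT x|lborel. max 0 (diffusion \<gamma> (w t x) - diffusion \<gamma> (\<kappa> j)) * (\<Sum>i\<in>Basis. bump2 5 R i x))
    \<le> (LINT x|lborel. 100 / R^2 * (diffusion \<gamma> (n t x) * bump 3 R x + diffusion \<gamma> (m t x) * bump 3 R x))"
    by (intro integral_mono i0 pw integrable_mult_right Bochner_Integration.integrable_add i1)
   also have "\<dots> = J t"
    unfolding J_def Jn_def Jm_def using Bochner_Integration.integral_add[OF i1] by (simp only: integral_mult_right_zero)
   finally show "(LINT x|lborel. max 0 (diffusion \<gamma> (w t x) - diffusion \<gamma> (\<kappa> j)) * (\<Sum>i\<in>Basis. bump2 5 R i x)) \<le> J t" .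
  qed simp
  also have "K b - K a = 100 / R^2 * (integral {a..b} Jn + integral {a..b} Jm)"
  proof -
   have "integral {a..b} J = 100 / R^2 * integral {a..b} (\<lambda>t. Jn t + Jm t)"
    unfolding J_def by (rule Henstock_Kurzweil_Integration.integral_mult_right)
   then show ?thesis
    using Henstock_Kurzweil_Integration.integral_add[OF integrable_continuous_real[OF Jc(1)] integrable_continuous_real[OF Jc(2)]]
    by (simp add: K_def)
  qed
  also have "\<dots> \<le> 100 / R^2 * (En + Em)"
   unfolding Jn_def Jm_def by (intro mult_left_mono add_mono hn hm R R2)
  finally have 1: "(LINT x|lborel. max 0 (w b x - \<kappa> j) * bump 5 R x) \<le> (LINT x|lborel. max 0 (w a x - \<kappa> j) * bump 5 R x) + 100 / R^2 * (En + Em)"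
   by simp
  have "(LINT x|lborel. max 0 (w a x - \<kappa> j) * bump 5 R x) \<le> (LINT x|lborel. w a x)"
  proof (rule integral_mono)
   show "integrable lborel (\<lambda>x. max 0 (w a x - \<kappa> j) * bump 5 R x)"
    by (rule integrable_continuous_support[where R = R])
      (auto intro!: continuous_intros wc ab continuous_on_bump R simp: bump_eq_0[OF R])
   fix x
   have "max 0 (w a x - \<kappa> j) * bump 5 R x \<le> w a x * 1"
    using w0[OF ab(1), of x] less_imp_le[OF k[of j]] bump_le_1[OF R, of 5 x] bump_nonneg[of 5 R x] by (intro mult_mono) auto
   then show "max 0 (w a x - \<kappa> j) * bump 5 R x \<le> w a x" by simp
  qed (rule wa)
  with 1 have "(LINT x|lborel. max 0 (w b x - \<kappa> j) * bump 5 R x) \<le> (LINT x|lborel. w a x) + 100 / R^2 * (En + Em)" by linarith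
  moreover have "100 / R^2 * (En + Em) = 100 * (En + Em) * (inverse R)^2" by (simp add: divide_inverse power_inverse)
  ultimately show ?thesis unfolding R_def[symmetric] by (simp only:)
 qed
 have "(\<integral>\<^sup>+x. ennreal (max 0 (w b x - 0)) \<partial>lborel) \<le> ennreal (LINT x|lborel. w a x)"
 proof (rule nn_integral_le_of_bump_integrals[OF wc w0 _ _ le])
  show "\<kappa> \<longlonglongrightarrow> 0" unfolding \<kappa>_def by (rule LIMSEQ_inverse_real_of_nat)
  have "(\<lambda>j. (LINT x|lborel. w a x) + 100 * (En + Em) * (inverse (real (Suc j)))^2) \<longlonglongrightarrow> (LINT x|lborel. w a x) + 100 * (En + Em) * 0^2"
   by (intro tendsto_intros LIMSEQ_inverse_real_of_nat)
  then show "(\<lambda>j. (LINT x|lborel. w a x) + 100 * (En + Em) * (inverse (real (Suc j)))^2) \<longlonglongrightarrow> (LINT x|lborel. w a x)" by simp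
 qed (use ab in auto)
 moreover have "max 0 (w b x - 0) = w b x" for x using w0[of b x] ab by simp
 ultimately show ?thesis by (simp add: w_def)
qed

lemma continuous_stretch_integral:
 fixes f :: "real => real"
 assumes l: "0 < l" and ab: "a \<le> b" and f: "continuous_on {l * a..l * b} f"
 shows "integral {a..b} (\<lambda>t. f (l * t)) = inverse l * integral {l * a..l * b} f"
proof -
 have "((\<lambda>t. l *\<^sub>R f (l * t)) has_integral integral {l * a..l * b} f) {a..b}"
  by (rule has_integral_substitution[where c = "l * a" and d = "l * b"])
    (use l ab f in \<open>auto intro!: derivative_eq_intros mult_left_mono\<close>)
 from has_integral_mult_right[OF this, of "inverse l"] l
 have "((\<lambda>t. f (l * t)) has_integral inverse l * integral {l * a..l * b} f) {a..b}"
  by (simp add: mult.assoc[symmetric])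
 then show ?thesis by (rule integral_unique)
qed

text \<open>Comparison of \<open>n\<close> with the rescaled solution \<open>l powr (1 / \<gamma>) * n (l * t)\<close>.\<close>
lemma benilan_crandall:
 fixes n :: "real => 'a::euclidean_space => real"
 assumes n: "pme_solution \<gamma> n nt n1 n2" and g: "0 < \<gamma>"
  and mass: "\<And>t. 0 < t ==> integrable lborel (n t) \<and> (LINT x|lborel. n t x) = M"
  and energy: "\<And>a b. 0 < a ==> a < b ==> \<exists>U. \<forall>R>0. integral {a..b} (\<lambda>t. LINT x|lborel. diffusion \<gamma> (n t x) * bump 3 R x) \<le> U"
  and init: "\<And>l. 1 \<le> l ==> ((\<lambda>a. LINT x|lborel. \<bar>n a x - n (l * a) x\<bar>) \<longlongrightarrow> 0) (at_right 0)"
  and l: "1 \<le> l" and b: "0 < b"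
 shows "n b x \<le> l powr (1 / \<gamma>) * n (l * b) x"
proof -
 define k where "k = l powr (1 / \<gamma>)"
 have k: "1 \<le> k" using l g by (simp add: k_def ge_one_powr_ge_zero)
 define u where "u = (\<lambda>t x. k * n (l * t) x)"
 have u: "pme_solution \<gamma> u (\<lambda>t x. k * (l * nt (l * t) x)) (\<lambda>i t x. k * n1 i (l * t) x) (\<lambda>i t x. k * n2 i (l * t) x)"
  unfolding u_def k_def using pme_solution_scale[OF n g, of l] l by simp
 have lt: "0 < l * t" if "0 < t" for t using that l by simp
 have ui: "integrable lborel (u t)" "(LINT x|lborel. u t x) = k * M" if "0 < t" for t
  using mass[OF lt[OF that]] by (auto simp: u_def)
 have n0: "0 \<le> n t x" if "0 < t" for t x using n that by (simp add: pme_solution_def)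
 \<comment> \<open>Since \<open>k \<ge> 1\<close>, the scaled solution at time \<open>a\<close> is
   at least \<open>n (l * a)\<close>. Hence the maximum exceeds \<open>u a\<close> by at most
   \<open>|n a - n (l * a)|\<close>, and by \<open>init\<close> the integral of this vanishes as
   \<open>a\<close> tends to 0.\<close>
 have bound: "(\<integral>\<^sup>+x. ennreal (max (n b x) (u b x)) \<partial>lborel) \<le> ennreal (k * M + (LINT x|lborel. \<bar>n a x - n (l * a) x\<bar>))"
  if a: "0 < a" "a < b" for a
 proof -
  obtain En where En: "\<And>R. 0 < R ==> integral {a..b} (\<lambda>t. LINT x|lborel. diffusion \<gamma> (n t x) * bump 3 R x) \<le> En"
   using energy[OF a] by blast
  obtain U where U: "\<And>R. 0 < R ==> integral {l * a..l * b} (\<lambda>t. LINT x|lborel. diffusion \<gamma> (n t x) * bump 3 R x) \<le> U"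
   using energy[of "l * a" "l * b"] a l by auto
  define Em where "Em = k powr (\<gamma> + 1) * (inverse l * U)"
  have Em: "integral {a..b} (\<lambda>t. LINT x|lborel. diffusion \<gamma> (u t x) * bump 3 R x) \<le> Em" if R: "0 < R" for R
  proof -
   define f where "f t = (LINT x|lborel. diffusion \<gamma> (n t x) * bump 3 R x)" for t
   have "integral {a..b} (\<lambda>t. LINT x|lborel. diffusion \<gamma> (u t x) * bump 3 R x) = integral {a..b} (\<lambda>t. k powr (\<gamma> + 1) * f (l * t))"
   proof (rule Henstock_Kurzweil_Integration.integral_cong)
    fix t assume "t \<in> {a..b}"
    then have "0 < l * t" using a l by (simp)
    then have "diffusion \<gamma> (u t x) = k powr (\<gamma> + 1) * diffusion \<gamma> (n (l * t) x)" for x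
     using k n0[of "l * t" x] by (simp add: u_def diffusion_def powr_mult)
    then show "(LINT x|lborel. diffusion \<gamma> (u t x) * bump 3 R x) = k powr (\<gamma> + 1) * f (l * t)"
     by (simp add: f_def mult.assoc)
   qed
   also have "\<dots> = k powr (\<gamma> + 1) * integral {a..b} (\<lambda>t. f (l * t))" by simp
   also have "integral {a..b} (\<lambda>t. f (l * t)) = inverse l * integral {l * a..l * b} f"
   proof (rule continuous_stretch_integral)
    show "continuous_on {l * a..l * b} f"
     unfolding f_def by (rule continuous_on_diffusion_bump_integral[OF n]) (use g a l R in auto)
   qed (use a l in auto)
   also have "k powr (\<gamma> + 1) * (inverse l * integral {l * a..l * b} f) \<le> Em"
    unfolding Em_def f_def using U[OF R] l by (intro mult_left_mono) auto
   finally show ?thesis .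
  qed
  have le: "(\<integral>\<^sup>+x. ennreal (max (n b x) (u b x)) \<partial>lborel) \<le> ennreal (LINT x|lborel. max (n a x) (u a x))"
   by (rule pme_max_mass_le[OF n u g a _ ui(1)[OF a(1)] En Em]) (use mass[OF a(1)] in auto)
  have na: "integrable lborel (n a)" "integrable lborel (n (l * a))" using mass a l by auto
  have "(LINT x|lborel. max (n a x) (u a x)) \<le> (LINT x|lborel. u a x + \<bar>n a x - n (l * a) x\<bar>)"
  proof (rule integral_mono)
   show "integrable lborel (\<lambda>x. max (n a x) (u a x))" by (intro integrable_max na ui a)
   show "integrable lborel (\<lambda>x. u a x + \<bar>n a x - n (l * a) x\<bar>)"
    by (intro Bochner_Integration.integrable_add Bochner_Integration.integrable_diff integrable_abs na ui a)
   fix x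
   have "n (l * a) x \<le> u a x" using k n0[OF lt[OF a(1)], of x] by (simp add: u_def mult_le_cancel_right1)
   then show "max (n a x) (u a x) \<le> u a x + \<bar>n a x - n (l * a) x\<bar>" by linarith
  qed
  also have "\<dots> = k * M + (LINT x|lborel. \<bar>n a x - n (l * a) x\<bar>)"
   using ui[OF a(1)] na by simp
  finally show ?thesis using le ennreal_leI order_trans by blast
 qed
 have lim: "((\<lambda>a. ennreal (k * M + (LINT x|lborel. \<bar>n a x - n (l * a) x\<bar>))) \<longlongrightarrow> ennreal (k * M + 0)) (at_right 0)"
  by (intro tendsto_ennrealI tendsto_intros init l)
 have "(\<integral>\<^sup>+x. ennreal (max (n b x) (u b x)) \<partial>lborel) \<le> ennreal (k * M + 0)"
 proof (rule tendsto_lowerbound[OF lim])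
  show "\<forall>\<^sub>F a in at_right 0. (\<integral>\<^sup>+x. ennreal (max (n b x) (u b x)) \<partial>lborel) \<le> ennreal (k * M + (LINT x|lborel. \<bar>n a x - n (l * a) x\<bar>))"
   unfolding eventually_at_right_field using b bound by blast
 qed simp
 then have nn: "(\<integral>\<^sup>+x. ennreal (max (n b x) (u b x)) \<partial>lborel) \<le> ennreal (LINT x|lborel. u b x)"
  using ui[OF b] by simp
 have "max (n b x) (u b x) = u b x"
 proof (rule eq_of_integral_le[OF continuous_on_time_slice[OF u b] _ _ _ ui(1)[OF b] nn])
  show "continuous_on UNIV (\<lambda>x. max (n b x) (u b x))"
   by (intro continuous_intros continuous_on_time_slice[OF n b] continuous_on_time_slice[OF u b])
  show "0 \<le> u b x" for x using u b by (simp add: pme_solution_def)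
 qed simp
 then show ?thesis by (simp add: u_def k_def max_def split: if_splits)
qed

text \<open>As a function of \<open>l \<ge> 1\<close> the right side of \<open>bc\<close> is
  smallest at \<open>l = 1\<close>, so its derivative there is nonnegative; that derivative is
  \<open>n / \<gamma> + t * nt\<close>.\<close>

lemma time_derivative_lower_bound:
 fixes n :: "real => 'a::euclidean_space => real"
 assumes n: "pme_solution \<gamma> n nt n1 n2" and g: "0 < \<gamma>"
  and bc: "\<And>l. 1 \<le> l ==> n t x \<le> l powr (1 / \<gamma>) * n (l * t) x" and t: "0 < t" "0 < n t x"
 shows "- (n t x / (\<gamma> * t)) \<le> nt t x"
proof (rule ccontr)
 assume "\<not> ?thesis"
 then have "nt t x * (\<gamma> * t) < - n t x" using g t by (simp add: field_simps)
 then have neg: "1 / \<gamma> * n t x + t * nt t x < 0" using g by (simp add: field_simps)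
 have "C12 {(t, x). 0 < t \<and> 0 < n t x} n nt n1 n2" using n by (simp add: pme_solution_def)
 then have "DERIV (\<lambda>s. n s x) (1 * t) :> nt t x" using t by (simp add: C12_def)
 then have 1: "DERIV (\<lambda>l. n (l * t) x) 1 :> nt t x * t"
  by (rule DERIV_chain2) (auto intro!: derivative_eq_intros)
 have 2: "DERIV (\<lambda>l. l powr (1 / \<gamma>)) 1 :> 1 / \<gamma>"
  using has_real_derivative_powr[of 1 "1 / \<gamma>"] by simp
 have "DERIV (\<lambda>l. l powr (1 / \<gamma>) * n (l * t) x) 1 :> 1 / \<gamma> * n t x + t * nt t x"
  by (rule DERIV_cong[OF DERIV_mult[OF 2 1]]) (simp add: mult.commute)
 from DERIV_neg_dec_right[OF this neg]
 obtain d where "0 < d" "\<And>h. 0 < h ==> h < d ==> (1 + h) powr (1 / \<gamma>) * n ((1 + h) * t) x < 1 powr (1 / \<gamma>) * n (1 * t) x" by blast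
 then have "(1 + d / 2) powr (1 / \<gamma>) * n ((1 + d / 2) * t) x < n t x" by simp
 moreover have "n t x \<le> (1 + d / 2) powr (1 / \<gamma>) * n ((1 + d / 2) * t) x" using \<open>0 < d\<close> by (intro bc) auto
 ultimately show False by simp
qed

section \<open>A mean value inequality and the supremum bound for slow diffusion\<close>

lemma continuous_on_UNIV_cutoff:
 fixes f :: "'a::topological_space => 'b::{topological_space,zero}"
 assumes "open A" "open B" "A \<union> B = UNIV" "continuous_on A f'" "\<And>x. x \<in> A ==> f x = f' x" "\<And>x. x \<in> B ==> f x = 0"
 shows "continuous_on UNIV f"
proof -
 have "continuous_on A f" using assms by (simp cong: continuous_on_cong)
 moreover have "continuous_on B f" using assms(6) by (simp cong: continuous_on_cong)
 ultimately show ?thesis using continuous_on_open_Un[OF assms(1,2)] assms(3) by metis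
qed

lemma differentiable_line:
 assumes "f differentiable (at z)"
 shows "DERIV (\<lambda>s. f (z + s *\<^sub>R v)) 0 :> frechet_derivative f (at z) v"
proof -
 have D: "(f has_derivative frechet_derivative f (at z)) (at (z + 0 *\<^sub>R v))" using assms by (simp flip: frechet_derivative_works)
 have "((\<lambda>s. z + s *\<^sub>R v) has_derivative (\<lambda>h. h *\<^sub>R v)) (at 0)" by (auto intro!: derivative_eq_intros)
 from has_derivative_compose[OF this D]
 have "((\<lambda>s. f (z + s *\<^sub>R v)) has_derivative (\<lambda>h. frechet_derivative f (at z) (h *\<^sub>R v))) (at 0)" .
 moreover have "(\<lambda>h. frechet_derivative f (at z) (h *\<^sub>R v)) = (*) (frechet_derivative f (at z) v)"
  using linear_scale[OF linear_frechet_derivative[OF assms]] by auto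
 ultimately show ?thesis by (simp add: has_field_derivative_def)
qed

lemma has_derivative_line:
 fixes f :: "'a::euclidean_space => real"
 assumes "f differentiable (at x)" "\<And>i. i \<in> Basis ==> DERIV (\<lambda>s. f (x + s *\<^sub>R i)) 0 :> f1 i"
 shows "(f has_derivative (\<lambda>h. \<Sum>i\<in>Basis. (h \<bullet> i) * f1 i)) (at x)"
proof -
 define D where "D = frechet_derivative f (at x)"
 have D: "(f has_derivative D) (at x)" using assms(1) by (simp add: D_def flip: frechet_derivative_works)
 from differentiable_line[OF assms(1)] assms(2) have i: "D i = f1 i" if "i \<in> Basis" for i
  unfolding D_def using that by (blast intro: DERIV_unique)
 have "D h = (\<Sum>i\<in>Basis. (h \<bullet> i) * f1 i)" for h
 proof -
  have "D h = D (\<Sum>i\<in>Basis. (h \<bullet> i) *\<^sub>R i)" by (simp add: euclidean_representation)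
  also have "\<dots> = (\<Sum>i\<in>Basis. (h \<bullet> i) * f1 i)"
   using has_derivative_linear[OF D] i by (simp add: linear_sum linear_scale)
  finally show ?thesis .
 qed
 then have "D = (\<lambda>h. \<Sum>i\<in>Basis. (h \<bullet> i) * f1 i)" by (rule ext)
 with D show ?thesis by simp
qed

lemma eventually_line:
 fixes z v :: "'a::real_normed_vector"
 assumes "open S" "z \<in> S"
 shows "\<forall>\<^sub>F s in nhds 0. z + s *\<^sub>R v \<in> S"
proof -
 have "((\<lambda>s. z + s *\<^sub>R v) \<longlongrightarrow> z + 0 *\<^sub>R v) (nhds 0)"
  by (rule tendsto_add[OF tendsto_const tendsto_scaleR[OF filterlim_ident tendsto_const]])
 then have "((\<lambda>s. z + s *\<^sub>R v) \<longlongrightarrow> z) (nhds 0)" by (simp only: scaleR_zero_left add_0_right)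
 from topological_tendstoD[OF this assms] show ?thesis .
qed

lemma lborel_integral_eq_cbox:
 fixes f :: "'a::euclidean_space => real"
 assumes f: "continuous_on UNIV f" and R: "\<And>x. norm x > 1 ==> f x = 0"
 shows "(LINT x|lborel. f x) = integral (cbox (- One) One) f"
proof -
 have "norm x > 1" if x: "x \<notin> cbox (- One) One" for x :: 'a
 proof -
  obtain i where "i \<in> Basis" "x \<bullet> i < - 1 \<or> 1 < x \<bullet> i" using x by (auto simp: mem_box not_le)
  then have "i \<in> Basis" "\<bar>x \<bullet> i\<bar> > 1" by auto
  then show ?thesis using Basis_le_norm[of i x] by linarith
 qed
 then have eq: "(\<lambda>x. if x \<in> cbox (- One) One then f x else 0) = f" using R by auto
 have "(LINT x|lborel. f x) = integral UNIV f"
  using integral_lborel[OF integrable_continuous_support[OF f R]] by simp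
 also have "\<dots> = integral (cbox (- One) One) f" using integral_restrict_UNIV[of "cbox (- One) One" f] eq by simp
 finally show ?thesis .
qed

text \<open>A sub-mean-value inequality: the average \<open>A s\<close> of \<open>G\<close> over the ball of radius \<open>s\<close>, with weight
 \<open>bump 2\<close>, has \<open>A' s = s / 6 * \<integral> \<Delta>G (x0 + s y) bump 3 y\<close>.\<close>
lemma bump_mean_value_ge:
 fixes G :: "'a::euclidean_space => real"
 assumes G: "\<And>x. (G has_derivative (\<lambda>v. \<Sum>i\<in>Basis. (v \<bullet> i) * g1 i x)) (at x)"
  and g1: "\<And>i. i \<in> Basis ==> continuous_on UNIV (g1 i)"
  and g2: "\<And>i x. i \<in> Basis ==> DERIV (\<lambda>s. g1 i (x + s *\<^sub>R i)) 0 :> g2 i x"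
   "\<And>i. i \<in> Basis ==> continuous_on UNIV (g2 i)"
  and S: "0 \<le> S" "\<And>x. norm (x - x0) \<le> r ==> - S \<le> (\<Sum>i\<in>Basis. g2 i x)" and r: "0 < r"
 shows "G x0 * (LINT y|lborel. bump 2 1 (y :: 'a)) \<le> (LINT y|lborel. G (x0 + r *\<^sub>R y) * bump 2 1 y) + r^2 / 6 * S * (LINT y|lborel. bump 3 1 (y :: 'a))"
proof -
 have Gc: "continuous_on UNIV G" using G by (intro continuous_at_imp_continuous_on) (auto intro: has_derivative_continuous)
 have bc: "continuous_on A (bump p (1::real))" for p and A :: "'a set" by (rule continuous_on_bump) simp
 have b0: "bump p 1 x = 0" if "norm x \<ge> 1" "0 < p" for p and x :: 'a using bump_eq_0[of 1 p x] that by simp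
 have comp: "continuous_on UNIV (\<lambda>y. f (x0 + s *\<^sub>R y))" if "continuous_on UNIV f" for f :: "'a => real" and s
  by (rule continuous_on_compose2[OF that]) (auto intro!: continuous_intros)
 have comp2: "continuous_on ({0..r} \<times> B) (\<lambda>z. f (x0 + fst z *\<^sub>R snd z))" if "continuous_on UNIV f" for f :: "'a => real" and B
  by (rule continuous_on_compose2[OF that]) (auto intro!: continuous_intros)
 define A where "A s = (LINT y|lborel. G (x0 + s *\<^sub>R y) * bump 2 1 y)" for s
 define A' where "A' s = (LINT y|lborel. (\<Sum>i\<in>Basis. (y \<bullet> i) * g1 i (x0 + s *\<^sub>R y)) * bump 2 1 y)" for s
 define b3 where "b3 = (LINT y|lborel. bump 3 1 (y :: 'a))"
 have b3: "0 \<le> b3" unfolding b3_def by (intro Bochner_Integration.integral_nonneg bump_nonneg)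
 have dA: "(A has_real_derivative A' s) (at s within {0..r})" if s: "s \<in> {0..r}" for s
 proof -
  have "((\<lambda>s. integral (cbox (- One) One) (\<lambda>y. G (x0 + s *\<^sub>R y) * bump 2 1 y)) has_real_derivative
   integral (cbox (- One) One) (\<lambda>y. (\<Sum>i\<in>Basis. (y \<bullet> i) * g1 i (x0 + s *\<^sub>R y)) * bump 2 1 y)) (at s within {0..r})"
  proof (rule leibniz_rule_field_derivative[where fx = "\<lambda>s y. (\<Sum>i\<in>Basis. (y \<bullet> i) * g1 i (x0 + s *\<^sub>R y)) * bump 2 1 y" and U = "{0..r}"])
   fix s and y :: 'a assume "s \<in> {0..r}"
   have "((\<lambda>s. x0 + s *\<^sub>R y) has_derivative (\<lambda>h. h *\<^sub>R y)) (at s)" by (auto intro!: derivative_eq_intros)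
   from has_derivative_compose[OF this G]
   have "((\<lambda>s. G (x0 + s *\<^sub>R y)) has_derivative (\<lambda>h. \<Sum>i\<in>Basis. ((h *\<^sub>R y) \<bullet> i) * g1 i (x0 + s *\<^sub>R y))) (at s)" .
   moreover have "(\<lambda>h. \<Sum>i\<in>Basis. ((h *\<^sub>R y) \<bullet> i) * g1 i (x0 + s *\<^sub>R y)) = (*) (\<Sum>i\<in>Basis. (y \<bullet> i) * g1 i (x0 + s *\<^sub>R y))"
    by (auto simp: sum_distrib_left mult_ac intro!: sum.cong)
   ultimately have "((\<lambda>s. G (x0 + s *\<^sub>R y)) has_real_derivative (\<Sum>i\<in>Basis. (y \<bullet> i) * g1 i (x0 + s *\<^sub>R y))) (at s within {0..r})"
    by (simp add: has_field_derivative_def has_derivative_at_withinI)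
   from DERIV_cmult_right[OF this] show "((\<lambda>s. G (x0 + s *\<^sub>R y) * bump 2 1 y) has_real_derivative
    (\<Sum>i\<in>Basis. (y \<bullet> i) * g1 i (x0 + s *\<^sub>R y)) * bump 2 1 y) (at s within {0..r})" .
  next
   fix s :: real
   show "(\<lambda>y. G (x0 + s *\<^sub>R y) * bump 2 1 y) integrable_on cbox (- One) One"
    by (rule integrable_continuous[OF continuous_on_subset[OF continuous_on_mult[OF comp[OF Gc] bc] subset_UNIV]])
  next
   have c1: "continuous_on ({0..r} \<times> cbox (- One) One) (\<lambda>z::real \<times> 'a. bump 2 1 (snd z))"
    by (rule continuous_on_compose2[OF bc[of UNIV 2] continuous_on_snd[OF continuous_on_id]]) simp
   have c2: "continuous_on ({0..r} \<times> cbox (- One) One) (\<lambda>z::real \<times> 'a. (snd z \<bullet> i) * g1 i (x0 + fst z *\<^sub>R snd z))"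
    if "i \<in> Basis" for i
    by (rule continuous_on_mult[OF continuous_on_inner[OF continuous_on_snd[OF continuous_on_id] continuous_on_const] comp2[OF g1[OF that]]])
   have "continuous_on ({0..r} \<times> cbox (- One) One) (\<lambda>z. (\<Sum>i\<in>Basis. (snd z \<bullet> i) * g1 i (x0 + fst z *\<^sub>R snd z)) * bump 2 1 (snd z))"
    by (rule continuous_on_mult[OF continuous_on_sum[OF c2] c1])
   then show "continuous_on ({0..r} \<times> cbox (- One) One) (\<lambda>(s, y). (\<Sum>i\<in>Basis. (y \<bullet> i) * g1 i (x0 + s *\<^sub>R y)) * bump 2 1 y)"
    by (simp add: case_prod_unfold)
  qed (use s in auto)
  moreover have "A = (\<lambda>s. integral (cbox (- One) One) (\<lambda>y. G (x0 + s *\<^sub>R y) * bump 2 1 y))"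
   unfolding A_def by (intro ext lborel_integral_eq_cbox continuous_on_mult comp Gc bc) (simp add: b0)
  moreover have "A' s = integral (cbox (- One) One) (\<lambda>y. (\<Sum>i\<in>Basis. (y \<bullet> i) * g1 i (x0 + s *\<^sub>R y)) * bump 2 1 y)"
   unfolding A'_def
   by (intro lborel_integral_eq_cbox continuous_on_mult continuous_on_sum comp g1 bc continuous_intros) (simp_all add: b0)
  ultimately show ?thesis by simp
 qed
 have A'ge: "- (r / 6 * S * b3) \<le> A' s" if s: "0 \<le> s" "s \<le> r" for s
 proof -
  have sup: "integrable lborel (\<lambda>y. f y * bump p 1 y)" if "continuous_on UNIV f" "0 < p" for f :: "'a => real" and p
   by (rule integrable_continuous_support[where R = 1]) (use that in \<open>auto intro!: continuous_intros bc simp: b0\<close>)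
  \<comment> \<open>The derivative of the average contains the field \<open>y * bump 2 1 y\<close>,
    which is \<open>- 1 / 6\<close> times the gradient of \<open>bump 3 1\<close>. Integration by
    parts therefore produces the Laplacian of \<open>G\<close> with weight \<open>bump 3 1\<close>,
    and the factor \<open>s\<close> comes from the inner derivative.\<close>
  have ibp: "(LINT y|lborel. ((y \<bullet> i) * g1 i (x0 + s *\<^sub>R y)) * bump 2 1 y) = s / 6 * (LINT y|lborel. g2 i (x0 + s *\<^sub>R y) * bump 3 1 y)"
   if i: "i \<in> Basis" for i
  proof -
   have yi: "continuous_on UNIV (\<lambda>y. (y \<bullet> i) * g1 i (x0 + s *\<^sub>R y))" by (intro continuous_intros comp g1 i)
   have b1: "bump1 3 1 i y = - 6 * (y \<bullet> i) * bump 2 1 y" for y by (simp add: bump1_def bump_def)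
   have "(LINT y|lborel. s * g2 i (x0 + s *\<^sub>R y) * bump 3 1 y + g1 i (x0 + s *\<^sub>R y) * bump1 3 1 i y) = 0"
   proof (rule integral_line_derivative_eq_0[where F = "\<lambda>y. g1 i (x0 + s *\<^sub>R y) * bump 3 1 y" and R = 1 and v = i])
    show "continuous_on UNIV (\<lambda>y. g1 i (x0 + s *\<^sub>R y) * bump 3 1 y)" by (intro continuous_on_mult comp g1 i bc)
    show "continuous_on UNIV (\<lambda>y. s * g2 i (x0 + s *\<^sub>R y) * bump 3 1 y + g1 i (x0 + s *\<^sub>R y) * bump1 3 1 i y)"
     by (intro continuous_on_add continuous_on_mult continuous_on_const comp g1 g2 i bc continuous_on_bump) simp
    fix z
    have "DERIV (\<lambda>u. g1 i ((x0 + s *\<^sub>R z) + (s * u) *\<^sub>R i)) 0 :> g2 i (x0 + s *\<^sub>R z) * s"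
     by (rule DERIV_chain2[where f = "\<lambda>u. g1 i ((x0 + s *\<^sub>R z) + u *\<^sub>R i)" and g = "\<lambda>u. s * u"])
       (use g2(1)[OF i] in \<open>auto intro!: derivative_eq_intros\<close>)
    moreover have "(\<lambda>u. g1 i ((x0 + s *\<^sub>R z) + (s * u) *\<^sub>R i)) = (\<lambda>u. g1 i (x0 + s *\<^sub>R (z + u *\<^sub>R i)))"
     by (simp add: algebra_simps)
    ultimately have 1: "DERIV (\<lambda>u. g1 i (x0 + s *\<^sub>R (z + u *\<^sub>R i))) 0 :> g2 i (x0 + s *\<^sub>R z) * s" by simp
    have 2: "DERIV (\<lambda>u. bump 3 1 (z + u *\<^sub>R i)) 0 :> bump1 3 1 i z"
     by (rule bump_line(1)) (use i in auto)
    show "((\<lambda>u. g1 i (x0 + s *\<^sub>R (z + u *\<^sub>R i)) * bump 3 1 (z + u *\<^sub>R i)) has_real_derivative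
     s * g2 i (x0 + s *\<^sub>R z) * bump 3 1 z + g1 i (x0 + s *\<^sub>R z) * bump1 3 1 i z) (at 0)"
     by (rule DERIV_cong[OF DERIV_mult[OF 1 2]]) (simp add: algebra_simps)
   qed (simp add: b0)
   also have "(\<lambda>y. s * g2 i (x0 + s *\<^sub>R y) * bump 3 1 y + g1 i (x0 + s *\<^sub>R y) * bump1 3 1 i y)
    = (\<lambda>y. s * (g2 i (x0 + s *\<^sub>R y) * bump 3 1 y) - 6 * (((y \<bullet> i) * g1 i (x0 + s *\<^sub>R y)) * bump 2 1 y))"
    by (simp add: b1 algebra_simps)
   also have "(LINT y|lborel. s * (g2 i (x0 + s *\<^sub>R y) * bump 3 1 y) - 6 * (((y \<bullet> i) * g1 i (x0 + s *\<^sub>R y)) * bump 2 1 y))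
    = s * (LINT y|lborel. g2 i (x0 + s *\<^sub>R y) * bump 3 1 y) - 6 * (LINT y|lborel. ((y \<bullet> i) * g1 i (x0 + s *\<^sub>R y)) * bump 2 1 y)"
    using sup[OF comp[OF g2(2)[OF i]], of 3] sup[OF yi, of 2] by simp
   finally show ?thesis by simp
  qed
  have i2: "integrable lborel (\<lambda>y. g2 i (x0 + s *\<^sub>R y) * bump 3 1 y)" if "i \<in> Basis" for i
   by (intro sup comp g2 that) simp
  have i1: "integrable lborel (\<lambda>y. ((y \<bullet> i) * g1 i (x0 + s *\<^sub>R y)) * bump 2 1 y)" if "i \<in> Basis" for i
   by (intro sup continuous_intros comp g1 that) simp
  have "A' s = (\<Sum>i\<in>Basis. LINT y|lborel. ((y \<bullet> i) * g1 i (x0 + s *\<^sub>R y)) * bump 2 1 y)"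
   unfolding A'_def sum_distrib_right by (rule Bochner_Integration.integral_sum[OF i1])
  also have "\<dots> = s / 6 * (LINT y|lborel. (\<Sum>i\<in>Basis. g2 i (x0 + s *\<^sub>R y) * bump 3 1 y))"
   by (simp add: ibp Bochner_Integration.integral_sum[OF i2] sum_distrib_left)
  finally have 1: "A' s = s / 6 * (LINT y|lborel. (\<Sum>i\<in>Basis. g2 i (x0 + s *\<^sub>R y) * bump 3 1 y))" .
  have bi: "integrable lborel (\<lambda>y::'a. bump 3 1 y)"
   using sup[of "\<lambda>y. 1" 3] by (simp add: continuous_on_const)
  have "(LINT y|lborel. - S * bump 3 1 (y :: 'a)) \<le> (LINT y|lborel. (\<Sum>i\<in>Basis. g2 i (x0 + s *\<^sub>R y) * bump 3 1 y))"
  proof (rule integral_mono)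
   show "integrable lborel (\<lambda>y::'a. - S * bump 3 1 y)" using bi by simp
   show "integrable lborel (\<lambda>y. \<Sum>i\<in>Basis. g2 i (x0 + s *\<^sub>R y) * bump 3 1 y)" by (intro Bochner_Integration.integrable_sum i2)
   fix y :: 'a
   show "- S * bump 3 1 y \<le> (\<Sum>i\<in>Basis. g2 i (x0 + s *\<^sub>R y) * bump 3 1 y)"
   proof (cases "norm y < 1")
    case True
    then have "norm ((x0 + s *\<^sub>R y) - x0) \<le> r" using s mult_mono[of s r "norm y" 1] by simp
    from mult_right_mono[OF S(2)[OF this] bump_nonneg[of 3 1 y]] show ?thesis by (simp add: sum_distrib_right)
   qed (simp add: b0)
  qed
  then have "- (S * b3) \<le> (LINT y|lborel. (\<Sum>i\<in>Basis. g2 i (x0 + s *\<^sub>R y) * bump 3 1 y))" by (simp add: b3_def)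
  then have "s / 6 * - (S * b3) \<le> A' s" unfolding 1 using s by (intro mult_left_mono) auto
  moreover have "s / 6 * (S * b3) \<le> r / 6 * (S * b3)" using s S b3 by (intro mult_right_mono) auto
  ultimately show ?thesis by simp
 qed
 obtain z where z: "0 < z" "z < r" "A r - A 0 = A' z * (r - 0)"
 proof (rule mvt[OF r, of A "\<lambda>z h. A' z * h"])
  show "continuous_on {0..r} A" using dA by (intro DERIV_continuous_on) auto
  fix z assume z: "0 < z" "z < r"
  then have "at z within {0..r} = at z" by (intro at_within_Icc_at) auto
  then show "(A has_derivative (\<lambda>h. A' z * h)) (at z)" using dA[of z] z by (simp add: has_field_derivative_def)
 qed (use that in auto)
 have "- (r^2 / 6 * S * b3) = r * - (r / 6 * S * b3)" by (simp add: power2_eq_square)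
 also have "\<dots> \<le> r * A' z" using A'ge[of z] z r by (intro mult_left_mono) auto
 finally have "A 0 \<le> A r + r^2 / 6 * S * b3" using z(3) by (simp add: mult_ac)
 then show ?thesis by (simp add: A_def b3_def)
qed

lemma lborel_integral_scale:
 fixes f :: "'a::euclidean_space => real"
 assumes f: "integrable lborel f" and r: "0 < r"
 shows "integrable lborel (\<lambda>y. f (x0 + r *\<^sub>R y))" "(LINT y|lborel. f (x0 + r *\<^sub>R y)) = (LINT x|lborel. f x) / r ^ DIM('a)"
proof -
 have m: "f \<in> borel_measurable borel" using f by (auto dest: borel_measurable_integrable)
 have r0: "r \<noteq> 0" "0 < r ^ DIM('a)" using r by auto
 have "integrable (density (distr lborel borel (\<lambda>x. x0 + r *\<^sub>R x)) (\<lambda>_. ennreal (r ^ DIM('a)))) f"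
  using lborel_affine[OF r0(1), of x0] f r by (simp add: ennreal_power)
 then show "integrable lborel (\<lambda>y. f (x0 + r *\<^sub>R y))"
  using r m by (simp add: integrable_density integrable_distr_eq)
 have "(LINT x|lborel. f x) = integral\<^sup>L (density (distr lborel borel (\<lambda>x. x0 + r *\<^sub>R x)) (\<lambda>_. ennreal (r ^ DIM('a)))) f"
  using lborel_affine[OF r0(1), of x0] r by (simp add: ennreal_power)
 also have "\<dots> = r ^ DIM('a) * (LINT y|lborel. f (x0 + r *\<^sub>R y))"
  using r m by (simp add: integral_density integral_distr)
 finally show "(LINT y|lborel. f (x0 + r *\<^sub>R y)) = (LINT x|lborel. f x) / r ^ DIM('a)" using r0 by simp
qed

lemma integrable_bump: "integrable lborel (bump p 1 :: 'a::euclidean_space => real)" if "0 < p"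
 by (rule integrable_continuous_support[where R = 1]) (use that in \<open>auto intro!: continuous_on_bump simp: bump_eq_0\<close>)

lemma integral_bump_pos: "0 < (LINT y|lborel. bump 2 1 (y :: 'a::euclidean_space))"
proof -
 have "(3 / 4)^2 * (unit_ball_vol (real DIM('a)) * (1 / 2) ^ DIM('a)) \<le> (LINT y|lborel. bump 2 1 (y :: 'a))"
 proof (rule integral_ball_le[where ?x0.0 = 0])
  fix x :: 'a assume "norm (x - 0) \<le> 1 / 2"
  then have "(norm x)^2 \<le> 1 / 4" using power_mono[of "norm x" "1 / 2" 2] by (simp add: power2_eq_square)
  then have *: "3 / 4 \<le> 1 - (norm x)^2 / 1^2" by simp
  show "(3 / 4)^2 \<le> bump 2 1 x" unfolding bump_def by (rule power_mono[OF max.coboundedI2[OF *]]) simp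
 qed (auto intro: integrable_bump bump_nonneg)
 moreover have "0 < (3 / 4)^2 * (unit_ball_vol (real DIM('a)) * (1 / 2) ^ DIM('a))" by simp
 ultimately show ?thesis by linarith
qed

text \<open>A lower bound on the Laplacian of the diffusion makes it almost subharmonic, so a large
  value at \<open>x0\<close> must be visible in the mean over a ball. Either the mass in the ball is
  large compared with \<open>n x0 * r ^ d\<close>, or the radius is so large that the error
  \<open>r^2 * k\<close> competes with \<open>n x0 powr \<gamma>\<close>. The bound
  \<open>P * n x0\<close> on the ball makes the nonlinear mean comparable with the mass.\<close>

lemma ball_mass_estimate:
 fixes n :: "'a::euclidean_space => real"
 assumes g: "0 < \<gamma>" and nc: "continuous_on UNIV n" and n0: "\<And>x. 0 \<le> n x"
  and d: "\<And>x. 0 < n x ==> ((\<lambda>x. diffusion \<gamma> (n x)) has_derivative (\<lambda>v. \<Sum>i\<in>Basis. (v \<bullet> i) * u1 i x)) (at x)"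
  and u1: "\<And>i. i \<in> Basis ==> continuous_on {x. 0 < n x} (u1 i)"
  and u2: "\<And>i x. i \<in> Basis ==> 0 < n x ==> DERIV (\<lambda>s. u1 i (x + s *\<^sub>R i)) 0 :> u2 i x"
   "\<And>i. i \<in> Basis ==> continuous_on {x. 0 < n x} (u2 i)"
  and lap: "\<And>x. 0 < n x ==> - (k * n x) \<le> (\<Sum>i\<in>Basis. u2 i x)" and k: "0 \<le> k"
  and mass: "integrable lborel n" "(LINT x|lborel. n x) \<le> M"
  and x0: "0 < n x0" and r: "0 < r" and P: "1 \<le> P" and ball: "\<And>y. norm (y - x0) \<le> r ==> n y \<le> P * n x0"
 shows "(LINT y|lborel. bump 2 1 (y::'a)) / 8 \<le> (P powr (\<gamma> + 1))^2 * P powr \<gamma> * M / (n x0 * r ^ DIM('a))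
   + (P powr (\<gamma> + 1))^2 * P * (LINT y|lborel. bump 3 1 (y::'a)) * (\<gamma> + 1) / (2 * \<gamma>) * r^2 * k / n x0 powr \<gamma>"
  (is "?b2 / 8 \<le> _ + _ * _ * ?b3 * _ / _ * _ * _ / _")
proof -
 define c where "c = \<gamma> / (\<gamma> + 1)"
 have c: "0 < c" using g by (simp add: c_def)
 have D: "diffusion \<gamma> v = c * v powr (\<gamma> + 1)" for v using g by (simp add: diffusion_def c_def)
 define u where "u x = diffusion \<gamma> (n x)" for x
 define U where "U = u x0"
 have U: "0 < U" using c x0 by (simp add: U_def u_def D)
 define q where "q = P powr (\<gamma> + 1)"
 have q: "1 \<le> q" using P g by (simp add: q_def ge_one_powr_ge_zero)
 have uc: "continuous_on UNIV u"
  unfolding u_def using g n0 by (intro continuous_on_compose2[OF continuous_on_diffusion nc]) auto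
 have unn: "0 \<le> u x" for x using g by (simp add: u_def diffusion_nonneg)
 have uball: "u y \<le> q * U" if "norm (y - x0) \<le> r" for y
 proof -
  have "n y powr (\<gamma> + 1) \<le> (P * n x0) powr (\<gamma> + 1)" using ball[OF that] n0 g by (intro powr_mono2) auto
  then show ?thesis using c P x0 by (simp add: u_def U_def D q_def powr_mult)
 qed
 define A where "A = {x. 0 < n x}"
 define B where "B = {x. u x < U / 2}"
 have "open A" unfolding A_def using nc by (intro open_Collect_less continuous_on_const) auto
 have "open B" unfolding B_def using uc by (intro open_Collect_less continuous_on_const) auto
 have AB: "A \<union> B = UNIV" using n0 U by (auto simp: A_def B_def u_def D less_le)
 define m where "m x = max 0 (u x - U / 2)" for x
 have mB: "m x = 0" if "x \<in> B" for x using that by (simp add: m_def B_def)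
 have uX: "continuous_on X u" for X by (rule continuous_on_subset[OF uc subset_UNIV])
 have mc: "continuous_on X m" for X unfolding m_def by (intro continuous_intros uX)
 \<comment> \<open>Subtracting half of the central value removes a neighbourhood of the free
   boundary, where \<open>u\<close> has no second derivatives, and the cube makes the truncation
   twice continuously differentiable. The truncation is convex and nondecreasing, so the lower bound
   for the Laplacian survives; the central value becomes \<open>U ^ 3 / 8\<close>.\<close>
 define G where "G x = m x ^ 3" for x
 define g1 where "g1 i x = (if x \<in> A then 3 * (m x)^2 * u1 i x else 0)" for i x
 define g2 where "g2 i x = (if x \<in> A then 3 * (m x)^2 * u2 i x + 6 * m x * (u1 i x)^2 else 0)" for i x
 have zB: "G x = 0" "g1 i x = 0" "g2 i x = 0" if "x \<in> B" for x i
  using mB[OF that] by (simp_all add: G_def g1_def g2_def)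
 have md: "DERIV (\<lambda>s. max 0 (s - U / 2) ^ 3) s :> 3 * (max 0 (s - U / 2))^2"
  "DERIV (\<lambda>s. (max 0 (s - U / 2))^2) s :> 2 * max 0 (s - U / 2)" for s
 proof -
  have "DERIV (\<lambda>s. max 0 (s - U / 2) ^ p) s :> real p * max 0 (s - U / 2) ^ (p - 1) * 1" if "2 \<le> p" for p
   by (rule DERIV_chain2[OF has_real_derivative_max_power[OF that]]) (auto intro!: derivative_eq_intros)
  from this[of 3] this[of 2]
  show "DERIV (\<lambda>s. max 0 (s - U / 2) ^ 3) s :> 3 * (max 0 (s - U / 2))^2"
   "DERIV (\<lambda>s. (max 0 (s - U / 2))^2) s :> 2 * max 0 (s - U / 2)" by simp_all
 qed
 have line: "DERIV (\<lambda>s. u (x + s *\<^sub>R i)) 0 :> u1 i x" if "x \<in> A" "i \<in> Basis" for x i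
 proof -
  have 0: "((\<lambda>s. x + s *\<^sub>R i) has_derivative (\<lambda>h. h *\<^sub>R i)) (at 0)" by (auto intro!: derivative_eq_intros)
  have 1: "(u has_derivative (\<lambda>v. \<Sum>i\<in>Basis. (v \<bullet> i) * u1 i x)) (at (x + 0 *\<^sub>R i))"
   unfolding u_def using d[of x] that by (simp add: A_def)
  have 2: "(\<lambda>h. \<Sum>j\<in>Basis. ((h *\<^sub>R i) \<bullet> j) * u1 j x) = (*) (u1 i x)"
   using that by (intro ext) (simp add: inner_Basis if_distrib if_distribR mult.commute cong: if_cong)
  from has_derivative_compose[OF 0 1] show ?thesis unfolding 2 has_field_derivative_def .
 qed
 define S where "S = 3 * q^2 * U^2 * k * P * n x0"
 have mv: "G x0 * ?b2 \<le> (LINT y|lborel. G (x0 + r *\<^sub>R y) * bump 2 1 y) + r^2 / 6 * S * ?b3"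
 proof (rule bump_mean_value_ge[where ?g1.0 = g1 and ?g2.0 = g2])
  fix x
  show "(G has_derivative (\<lambda>v. \<Sum>i\<in>Basis. (v \<bullet> i) * g1 i x)) (at x)"
  proof (cases "x \<in> B")
   case True
   have "(G has_derivative (\<lambda>v. 0)) (at x)"
    by (rule has_derivative_transform_within_open[OF has_derivative_const \<open>open B\<close> True]) (simp add: zB)
   then show ?thesis by (simp add: zB[OF True])
  next
   case False
   then have "x \<in> A" using AB by auto
   then have "(u has_derivative (\<lambda>v. \<Sum>i\<in>Basis. (v \<bullet> i) * u1 i x)) (at x)" using d unfolding u_def A_def by simp
   from has_derivative_compose[OF this md(1)[unfolded has_field_derivative_def]]
   have "((\<lambda>x. max 0 (u x - U / 2) ^ 3) has_derivative (\<lambda>v. 3 * (max 0 (u x - U / 2))^2 * (\<Sum>i\<in>Basis. (v \<bullet> i) * u1 i x))) (at x)" .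
   moreover have "(\<lambda>v. 3 * (max 0 (u x - U / 2))^2 * (\<Sum>i\<in>Basis. (v \<bullet> i) * u1 i x)) = (\<lambda>v. \<Sum>i\<in>Basis. (v \<bullet> i) * g1 i x)"
    using \<open>x \<in> A\<close> by (simp add: g1_def m_def sum_distrib_left sum_distrib_right mult_ac)
   ultimately show ?thesis unfolding G_def[abs_def] m_def by simp
  qed
 next
  fix i :: 'a assume i: "i \<in> Basis"
  have c1: "continuous_on A (u1 i)" "continuous_on A (u2 i)" using u1 u2(2) i by (simp_all add: A_def)
  show "continuous_on UNIV (g1 i)"
   by (rule continuous_on_UNIV_cutoff[OF \<open>open A\<close> \<open>open B\<close> AB, where f' = "\<lambda>x. 3 * (m x)^2 * u1 i x"]) (auto intro!: continuous_intros mc c1 simp: g1_def mB)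
  show "continuous_on UNIV (g2 i)"
   by (rule continuous_on_UNIV_cutoff[OF \<open>open A\<close> \<open>open B\<close> AB, where f' = "\<lambda>x. 3 * (m x)^2 * u2 i x + 6 * m x * (u1 i x)^2"]) (auto intro!: continuous_intros mc c1 simp: g2_def mB)
  fix x
  show "DERIV (\<lambda>s. g1 i (x + s *\<^sub>R i)) 0 :> g2 i x"
  proof (cases "x \<in> B")
   case True
   have "\<forall>\<^sub>F s in nhds 0. g1 i (x + s *\<^sub>R i) = 0" using eventually_line[OF \<open>open B\<close> True, of i] by eventually_elim (simp add: zB)
   from DERIV_cong_ev[OF refl this refl] show ?thesis by (simp add: zB True)
  next
   case False
   then have xA: "x \<in> A" using AB by auto
   have "DERIV (\<lambda>s. (max 0 (u (x + s *\<^sub>R i) - U / 2))^2) 0 :> 2 * max 0 (u (x + 0 *\<^sub>R i) - U / 2) * u1 i x"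
    by (rule DERIV_chain2[OF md(2) line[OF xA i]])
   from DERIV_mult[OF DERIV_cmult[OF this, of 3] u2(1)[OF i, of x]] xA
   have "DERIV (\<lambda>s. 3 * (m (x + s *\<^sub>R i))^2 * u1 i (x + s *\<^sub>R i)) 0 :> g2 i x"
    by (simp add: A_def g2_def m_def power2_eq_square mult_ac add_ac)
   moreover have "\<forall>\<^sub>F s in nhds 0. g1 i (x + s *\<^sub>R i) = 3 * (m (x + s *\<^sub>R i))^2 * u1 i (x + s *\<^sub>R i)"
    using eventually_line[OF \<open>open A\<close> xA, of i] by eventually_elim (simp add: g1_def)
   ultimately show ?thesis by (subst DERIV_cong_ev[OF refl _ refl])
  qed
 next
  show "0 \<le> S" using q U k P x0 by (simp add: S_def)
  fix x assume x: "norm (x - x0) \<le> r"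
  show "- S \<le> (\<Sum>i\<in>Basis. g2 i x)"
  proof (cases "x \<in> A")
   case True
   have mU: "m x \<le> q * U" using uball[OF x] U q by (simp add: m_def)
   have 1: "(m x)^2 * (k * n x) \<le> (q * U)^2 * (k * (P * n x0))"
    using mU ball[OF x] n0 k by (intro mult_mono power_mono mult_left_mono) (auto simp: m_def)
   have "- S = - 3 * ((q * U)^2 * (k * (P * n x0)))" by (simp add: S_def power_mult_distrib)
   also have "\<dots> \<le> - 3 * ((m x)^2 * (k * n x))" using 1 by (intro mult_left_mono_neg) auto
   also have "\<dots> = 3 * (m x)^2 * - (k * n x)" by simp
   also have "\<dots> \<le> 3 * (m x)^2 * (\<Sum>i\<in>Basis. u2 i x)"
    using lap[of x] True by (intro mult_left_mono) (auto simp: A_def)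
   \<comment> \<open>The terms \<open>6 * m x * (u1 i x)^2\<close> in \<open>g2\<close> are
     nonnegative by convexity of the truncation and are dropped.\<close>
   also have "\<dots> \<le> (\<Sum>i\<in>Basis. g2 i x)"
    using True unfolding sum_distrib_left g2_def by (intro sum_mono) (auto simp: m_def)
   finally show ?thesis .
  qed (use \<open>0 \<le> S\<close> in \<open>simp add: g2_def\<close>)
 qed (rule r)
 have G0: "G x0 = U ^ 3 / 8"
  using U by (simp add: G_def m_def U_def[symmetric] power3_eq_cube)
 have I: "(LINT y|lborel. G (x0 + r *\<^sub>R y) * bump 2 1 y) \<le> q^2 * U ^ 3 * P powr \<gamma> / n x0 * (M / r ^ DIM('a))"
 proof -
  \<comment> \<open>Two of the three factors of \<open>u\<close> are estimated by their maximum on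
    the ball, and in the third all but one power of \<open>n\<close> is. The one power that is kept
    turns the mean into the mass.\<close>
  have pt: "G (x0 + r *\<^sub>R y) * bump 2 1 y \<le> q^2 * U ^ 3 * P powr \<gamma> / n x0 * n (x0 + r *\<^sub>R y)" (is "_ \<le> ?K * _") for y
  proof (cases "norm y < 1")
   case False
   then have "bump 2 1 y = 0" using bump_eq_0[of 1 2 y] by simp
   then show ?thesis using q U x0 n0[of "x0 + r *\<^sub>R y"] by simp
  next
   case True
   let ?x = "x0 + r *\<^sub>R y"
   have x: "norm (?x - x0) \<le> r" using True r by simp
   have "G ?x \<le> u ?x ^ 3" unfolding G_def m_def using unn[of ?x] U by (intro power_mono) auto
   also have "\<dots> = (u ?x)^2 * u ?x" by (simp add: power3_eq_cube power2_eq_square)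
   also have "\<dots> \<le> (q * U)^2 * (P powr \<gamma> * U / n x0 * n ?x)"
   proof (intro mult_mono power_mono uball x)
    have "u ?x = c * (n ?x powr \<gamma> * n ?x)" using n0[of ?x] by (cases "n ?x = 0") (auto simp: u_def D powr_add)
    also have "\<dots> \<le> c * ((P * n x0) powr \<gamma> * n ?x)"
     using c ball[OF x] n0 g by (intro mult_left_mono mult_right_mono powr_mono2) auto
    also have "\<dots> = P powr \<gamma> * U / n x0 * n ?x" using P x0 by (simp add: U_def u_def D powr_mult powr_add)
    finally show "u ?x \<le> P powr \<gamma> * U / n x0 * n ?x" .
   qed (use unn in auto)
   also have "\<dots> = ?K * n ?x" by (simp add: power_mult_distrib power2_eq_square power3_eq_cube mult_ac)
   finally have "G ?x \<le> ?K * n ?x" .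
   moreover have "G ?x * bump 2 1 y \<le> G ?x * 1" by (intro mult_left_mono bump_le_1) (auto simp: G_def m_def)
   ultimately show ?thesis by simp
  qed
  have Gc: "continuous_on UNIV (\<lambda>y. G (x0 + r *\<^sub>R y))"
   unfolding G_def by (intro continuous_intros continuous_on_compose2[OF mc[of UNIV]]) auto
  have "(LINT y|lborel. G (x0 + r *\<^sub>R y) * bump 2 1 y) \<le> (LINT y|lborel. ?K * n (x0 + r *\<^sub>R y))"
  proof (rule integral_mono)
   show "integrable lborel (\<lambda>y. G (x0 + r *\<^sub>R y) * bump 2 1 y)"
    by (rule integrable_continuous_support[where R = 1])
      (auto intro!: continuous_on_mult Gc continuous_on_bump simp: bump_eq_0)
   show "integrable lborel (\<lambda>y. ?K * n (x0 + r *\<^sub>R y))"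
    by (intro integrable_mult_right lborel_integral_scale mass r)
  qed (rule pt)
  also have "\<dots> = ?K * ((LINT x|lborel. n x) / r ^ DIM('a))" by (simp add: lborel_integral_scale[OF mass(1) r])
  also have "\<dots> \<le> ?K * (M / r ^ DIM('a))"
   using q U x0 r mass(2) by (intro mult_left_mono divide_right_mono) auto
  finally show ?thesis .
 qed
 have e1: "r^2 / 6 * S * ?b3 = U ^ 3 * (q^2 * P * ?b3 * r^2 * k * (n x0 / U) / 2)"
 proof -
  have 1: "U^2 * n x0 = U ^ 3 * (n x0 / U)" using U by (simp add: power2_eq_square power3_eq_cube)
  have "r^2 / 6 * S * ?b3 = (U^2 * n x0) * (q^2 * P * ?b3 * r^2 * k / 2)" by (simp add: S_def)
  then show ?thesis unfolding 1 by (simp add: mult_ac)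
 qed
 have e2: "q^2 * U ^ 3 * P powr \<gamma> / n x0 * (M / r ^ DIM('a)) = U ^ 3 * (q^2 * P powr \<gamma> * M / (n x0 * r ^ DIM('a)))" by simp
 have "U ^ 3 * (?b2 / 8) = G x0 * ?b2" by (simp add: G0)
 also have "\<dots> \<le> q^2 * U ^ 3 * P powr \<gamma> / n x0 * (M / r ^ DIM('a)) + r^2 / 6 * S * ?b3"
  by (rule order_trans[OF mv add_right_mono[OF I]])
 also have "\<dots> = U ^ 3 * (q^2 * P powr \<gamma> * M / (n x0 * r ^ DIM('a)) + q^2 * P * ?b3 * r^2 * k * (n x0 / U) / 2)"
  by (simp only: e1 e2 distrib_left)
 also have "n x0 / U = (\<gamma> + 1) / \<gamma> / n x0 powr \<gamma>"
  using x0 g by (simp add: U_def u_def D c_def powr_add)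
 finally have "U ^ 3 * (?b2 / 8) \<le> U ^ 3 * (q^2 * P powr \<gamma> * M / (n x0 * r ^ DIM('a)) + q^2 * P * ?b3 * r^2 * k * ((\<gamma> + 1) / \<gamma> / n x0 powr \<gamma>) / 2)"
  .
 then have "?b2 / 8 \<le> q^2 * P powr \<gamma> * M / (n x0 * r ^ DIM('a)) + q^2 * P * ?b3 * r^2 * k * ((\<gamma> + 1) / \<gamma> / n x0 powr \<gamma>) / 2"
  using U by (subst (asm) mult_le_cancel_left_pos) auto
 also have "q^2 * P * ?b3 * r^2 * k * ((\<gamma> + 1) / \<gamma> / n x0 powr \<gamma>) / 2 = q^2 * P * ?b3 * (\<gamma> + 1) / (2 * \<gamma>) * r^2 * k / n x0 powr \<gamma>"
  by (simp add: mult_ac)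
 finally show ?thesis unfolding q_def .
qed

text \<open>Point picking: \<open>x\<close> maximises \<open>(R - dist x x0) ^ d * n x\<close>.\<close>
lemma point_picking:
 fixes n :: "'a::euclidean_space => real"
 assumes nc: "continuous_on UNIV n" and n0: "\<And>x. 0 \<le> n x" and R: "0 < R" and x0: "0 < n x0" and d: "0 < (d::nat)"
 obtains x r where "0 < r" "n x0 \<le> n x" "n x0 * R ^ d \<le> 2 ^ d * (n x * r ^ d)"
  "\<And>y. norm (y - x) \<le> r ==> n y \<le> 2 ^ d * n x"
proof -
 let ?f = "\<lambda>x. (R - norm (x - x0)) ^ d * n x"
 have "continuous_on (cball x0 R) ?f"
  by (rule continuous_on_mult[OF _ continuous_on_subset[OF nc subset_UNIV]]) (intro continuous_intros)
 then have "\<exists>x\<in>cball x0 R. \<forall>y\<in>cball x0 R. ?f y \<le> ?f x" using R by (intro continuous_attains_sup) auto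
 then obtain x where x: "x \<in> cball x0 R" "\<And>y. y \<in> cball x0 R ==> ?f y \<le> ?f x" by blast
 define \<delta> where "\<delta> = R - norm (x - x0)"
 have \<delta>0: "0 \<le> \<delta>" "\<delta> \<le> R" using x(1) by (auto simp: \<delta>_def dist_norm norm_minus_commute)
 have top: "R ^ d * n x0 \<le> \<delta> ^ d * n x" using x(2)[of x0] R by (simp add: \<delta>_def)
 have "\<delta> \<noteq> 0"
 proof
  assume "\<delta> = 0"
  then have "R ^ d * n x0 \<le> 0" using top d by (simp add: power_0_left)
  moreover have "0 < R ^ d * n x0" using R x0 by simp
  ultimately show False by linarith
 qed
 then have \<delta>: "0 < \<delta>" using \<delta>0 by simp
 show ?thesis
 proof (rule that[of "\<delta> / 2" x])
  have "\<delta> ^ d * n x \<le> R ^ d * n x" using \<delta>0 n0 by (intro mult_right_mono power_mono) auto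
  then have "R ^ d * n x0 \<le> R ^ d * n x" using top by linarith
  then show "n x0 \<le> n x" using R by simp
  show "n x0 * R ^ d \<le> 2 ^ d * (n x * (\<delta> / 2) ^ d)" using top by (simp add: power_divide mult_ac)
  fix y assume y: "norm (y - x) \<le> \<delta> / 2"
  have "norm (y - x0) \<le> norm (y - x) + norm (x - x0)" using norm_triangle_ineq[of "y - x" "x - x0"] by simp
  then have n1: "\<delta> / 2 \<le> R - norm (y - x0)" using y by (simp add: \<delta>_def)
  then have "y \<in> cball x0 R" using \<delta> by (simp add: dist_norm norm_minus_commute)
  from x(2)[OF this] have "(R - norm (y - x0)) ^ d * n y \<le> \<delta> ^ d * n x" by (simp add: \<delta>_def)
  moreover have "(\<delta> / 2) ^ d * n y \<le> (R - norm (y - x0)) ^ d * n y"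
   using n1 \<delta> n0 by (intro mult_right_mono power_mono) auto
  ultimately have "(\<delta> / 2) ^ d * n y \<le> (\<delta> / 2) ^ d * (2 ^ d * n x)" by (simp add: power_divide)
  then show "n y \<le> 2 ^ d * n x" using \<delta> by simp
 qed (use \<delta> in simp)
qed

text \<open>The ball estimate presupposes that \<open>n\<close> is not much larger anywhere on the
  ball than at its centre, and no a priori bound ensures this. Point picking replaces
  \<open>x\<close> by a point \<open>y\<close> with a larger value where it holds. At
  \<open>y\<close> the parabolic radius \<open>\<rho>\<close> makes the error term harmless, and
  what remains bounds \<open>n t y * \<rho> ^ d\<close> by the mass.\<close>

lemma pme_sup_bound_slow:
 fixes n :: "real => 'a::euclidean_space => real"
 defines "d \<equiv> real DIM('a)"
 assumes n: "pme_solution \<gamma> n nt n1 n2" and g: "0 < \<gamma>"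
  and diff: "\<And>t x. 0 < t ==> 0 < n t x ==> n t differentiable (at x)"
  and mass: "\<And>t. 0 < t ==> integrable lborel (n t) \<and> (LINT x|lborel. n t x) = m"
  and nt: "\<And>t x. 0 < t ==> 0 < n t x ==> - (n t x / (\<gamma> * t)) \<le> nt t x"
 shows "\<exists>C>0. \<forall>t>0. \<forall>x. n t x \<le> C * t powr - (d / (d * \<gamma> + 2))"
proof -
 define P :: real where "P = 2 ^ DIM('a)"
 have P: "1 \<le> P" by (simp add: P_def)
 define b2 where "b2 = (LINT y|lborel. bump 2 1 (y::'a))"
 define b3 where "b3 = (LINT y|lborel. bump 3 1 (y::'a))"
 have b2: "0 < b2" unfolding b2_def by (rule integral_bump_pos)
 have b3: "0 \<le> b3" unfolding b3_def by (intro Bochner_Integration.integral_nonneg bump_nonneg)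
 define Q where "Q = (P powr (\<gamma> + 1))^2 * P powr \<gamma>"
 define E where "E = (P powr (\<gamma> + 1))^2 * P * b3 * (\<gamma> + 1) / (2 * \<gamma>) + 1"
 have Q: "0 < Q" using P by (simp add: Q_def)
 have E: "0 < E" "(P powr (\<gamma> + 1))^2 * P * b3 * (\<gamma> + 1) / (2 * \<gamma>) \<le> E"
  using P b3 g by (auto simp: E_def intro!: add_nonneg_pos divide_nonneg_nonneg mult_nonneg_nonneg)
 \<comment> \<open>Chosen so that at the radius \<open>\<rho>\<close>, with
   \<open>\<rho>^2 = \<epsilon> * t * n t y powr \<gamma>\<close>, the second term of
   \<open>est\<close> equals \<open>b2 / 16\<close>, half of the left side.\<close>
 define \<epsilon> where "\<epsilon> = b2 / (16 * E) * \<gamma>"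
 have \<epsilon>: "0 < \<epsilon>" using b2 E g by (simp add: \<epsilon>_def)
 define C3 where "C3 = 16 * Q / b2"
 have C3: "0 < C3" using Q b2 by (simp add: C3_def)
 define A where "A = \<epsilon> powr (d / 2) / C3"
 have A: "0 < A" using \<epsilon> C3 by (simp add: A_def)
 have dg: "0 < d * \<gamma> + 2" using g by (simp add: d_def add_pos_pos)
 have "n t x \<le> (m / A) powr (2 / (d * \<gamma> + 2)) * t powr - (d / (d * \<gamma> + 2))" if t: "0 < t" for t x
 proof (cases "n t x = 0")
  case False
  have nn: "0 \<le> n t y" for y using n t by (simp add: pme_solution_def)
  with False have v: "0 < n t x" by (simp add: less_le)
  have nc: "continuous_on UNIV (n t)" by (rule continuous_on_time_slice[OF n t])
  have Cu: "C12 {(t, x). 0 < t \<and> 0 < n t x} (\<lambda>t x. diffusion \<gamma> (n t x))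
   (\<lambda>t x. \<bar>\<gamma>\<bar> * n t x powr \<gamma> * nt t x) (\<lambda>i t x. \<bar>\<gamma>\<bar> * n t x powr \<gamma> * n1 i t x)
   (\<lambda>i t x. diffusion2 \<gamma> (n t x) (n1 i t x) (n2 i t x))"
   (is "C12 _ _ _ ?u1 ?u2") by (rule C12_diffusion[OF n]) (use g in simp)
  have slice: "continuous_on {x. 0 < n t x} (F t)" if "continuous_on {(t, x). 0 < t \<and> 0 < n t x} (\<lambda>(t, x). F t x)" for F :: "real => 'a => real"
  proof -
   have "continuous_on {x. 0 < n t x} (\<lambda>x. (\<lambda>(t, x). F t x) (t, x))"
    by (rule continuous_on_compose2[OF that]) (auto intro!: continuous_intros simp: t)
   then show ?thesis by simp
  qed
  have est: "b2 / 8 \<le> Q * m / (n t y * r ^ DIM('a)) + E * r^2 * (1 / (\<gamma> * t)) / n t y powr \<gamma>"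
   if y: "0 < n t y" and r: "0 < r" and ball: "\<And>z. norm (z - y) \<le> r ==> n t z \<le> P * n t y" for y r
  proof -
   have "b2 / 8 \<le> (P powr (\<gamma> + 1))^2 * P powr \<gamma> * m / (n t y * r ^ DIM('a))
    + (P powr (\<gamma> + 1))^2 * P * b3 * (\<gamma> + 1) / (2 * \<gamma>) * r^2 * (1 / (\<gamma> * t)) / n t y powr \<gamma>"
    unfolding b2_def b3_def
   proof (rule ball_mass_estimate[where ?u1.0 = "\<lambda>i. ?u1 i t" and ?u2.0 = "\<lambda>i. ?u2 i t"])
    fix x assume x: "0 < n t x"
    have "diffusion \<gamma> differentiable (at (n t x))"
     using diffusion_derivative[of \<gamma> "n t x"] x g by (auto simp: differentiable_def has_field_derivative_def)
    then have "(\<lambda>x. diffusion \<gamma> (n t x)) differentiable (at x)"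
     using differentiable_chain_at[OF diff[OF t x]] by (simp add: o_def)
    then show "((\<lambda>x. diffusion \<gamma> (n t x)) has_derivative (\<lambda>v. \<Sum>i\<in>Basis. (v \<bullet> i) * ?u1 i t x)) (at x)"
     by (rule has_derivative_line) (use Cu t x in \<open>auto simp: C12_def\<close>)
    show "- ((1 / (\<gamma> * t)) * n t x) \<le> (\<Sum>i\<in>Basis. ?u2 i t x)"
     using nt[OF t x] n t x by (simp add: pme_solution_def)
   next
    fix i :: 'a assume i: "i \<in> Basis"
    show "continuous_on {x. 0 < n t x} (?u1 i t)" "continuous_on {x. 0 < n t x} (?u2 i t)"
     using Cu i by (intro slice; simp add: C12_def)+
    fix x assume "0 < n t x"
    then show "DERIV (\<lambda>s. ?u1 i t (x + s *\<^sub>R i)) 0 :> ?u2 i t x"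
     using Cu i t by (auto simp: C12_def)
   qed (use g nc nn t mass[OF t] y r P ball in auto)
   also have "\<dots> \<le> Q * m / (n t y * r ^ DIM('a)) + E * r^2 * (1 / (\<gamma> * t)) / n t y powr \<gamma>"
    unfolding Q_def using E(2) g t by (intro add_left_mono divide_right_mono mult_right_mono) auto
   finally show ?thesis .
  qed
  have m0: "0 \<le> m" using mass[OF t] nn Bochner_Integration.integral_nonneg[of lborel "n t"] by auto
  \<comment> \<open>The search radius is so large that the ball delivered by point picking contains
    more than the mass bound allows for radii up to \<open>\<rho>\<close>: if
    \<open>\<delta> \<le> \<rho>\<close>, then \<open>key\<close> at radius \<open>\<delta>\<close>
    would contradict \<open>RR\<close>. Hence \<open>\<rho> < \<delta>\<close>, and
    \<open>key\<close> may be used at \<open>\<rho>\<close>.\<close>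
  define R where "R = (P * C3 * m / n t x + 1)"
  have R: "1 \<le> R" using P C3 m0 v by (simp add: R_def)
  have RR: "P * C3 * m < n t x * R ^ DIM('a)"
  proof -
   have "P * C3 * m < n t x * R" using v by (simp add: R_def field_simps)
   also have "\<dots> \<le> n t x * R ^ DIM('a)" using R v by (intro mult_left_mono self_le_power) auto
   finally show ?thesis .
  qed
  obtain y \<delta> where y: "0 < \<delta>" "n t x \<le> n t y" "n t x * R ^ DIM('a) \<le> P * (n t y * \<delta> ^ DIM('a))"
   "\<And>z. norm (z - y) \<le> \<delta> ==> n t z \<le> P * n t y"
   unfolding P_def by (rule point_picking[OF nc nn _ v, of R "DIM('a)"]) (use R in auto)
  have yp: "0 < n t y" using v y by simp
  define \<rho> where "\<rho> = sqrt (\<epsilon> * t * n t y powr \<gamma>)"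
  have \<rho>: "0 < \<rho>" using \<epsilon> t yp by (simp add: \<rho>_def)
  have \<rho>2: "\<rho>^2 = \<epsilon> * t * n t y powr \<gamma>" using \<epsilon> t by (simp add: \<rho>_def)
  have key: "n t y * r ^ DIM('a) \<le> C3 * m" if r: "0 < r" "r \<le> \<delta>" "r \<le> \<rho>" for r
  proof -
   have "E * r^2 * (1 / (\<gamma> * t)) / n t y powr \<gamma> \<le> E * \<rho>^2 * (1 / (\<gamma> * t)) / n t y powr \<gamma>"
    using r E g t by (intro divide_right_mono mult_right_mono mult_left_mono power_mono) auto
   also have "\<dots> = b2 / 16" unfolding \<rho>2 \<epsilon>_def using E(1) g t yp by simp
   finally have 1: "E * r^2 * (1 / (\<gamma> * t)) / n t y powr \<gamma> \<le> b2 / 16" .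
   have "n t z \<le> P * n t y" if "norm (z - y) \<le> r" for z using that r by (intro y(4)) auto
   from est[OF yp r(1) this] 1 have "b2 / 8 \<le> Q * m / (n t y * r ^ DIM('a)) + b2 / 16" by linarith
   then have "b2 / 16 \<le> Q * m / (n t y * r ^ DIM('a))" by linarith
   then show ?thesis using yp r b2 by (simp add: C3_def field_simps)
  qed
  have "\<rho> < \<delta>"
  proof (rule ccontr)
   assume "\<not> \<rho> < \<delta>"
   then have "n t y * \<delta> ^ DIM('a) \<le> C3 * m" using y(1) by (intro key) auto
   then have "P * (n t y * \<delta> ^ DIM('a)) \<le> P * (C3 * m)" using P by (intro mult_left_mono) auto
   then show False using RR y(3) by (simp add: mult_ac)
  qed
  then have k: "n t y * \<rho> ^ DIM('a) \<le> C3 * m" using \<rho> by (intro key) auto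
  have "(\<rho>^2) powr (d / 2) = (\<rho> powr 2) powr (d / 2)" using \<rho> by simp
  also have "\<dots> = \<rho> ^ DIM('a)" unfolding powr_powr using \<rho> by (simp add: d_def powr_realpow)
  finally have "\<rho> ^ DIM('a) = (\<rho>^2) powr (d / 2)" ..
  also have "\<dots> = \<epsilon> powr (d / 2) * t powr (d / 2) * n t y powr (\<gamma> * d / 2)"
   unfolding \<rho>2 using \<epsilon> t by (simp add: powr_mult powr_powr)
  finally have r: "\<rho> ^ DIM('a) = \<epsilon> powr (d / 2) * t powr (d / 2) * n t y powr (\<gamma> * d / 2)" .
  have "n t x powr (1 + \<gamma> * d / 2) \<le> n t y powr (1 + \<gamma> * d / 2)"
   using y(2) v g by (intro powr_mono2) (auto simp: d_def)
  then have "A * n t x powr (1 + \<gamma> * d / 2) * t powr (d / 2) \<le> A * n t y powr (1 + \<gamma> * d / 2) * t powr (d / 2)"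
   using A by (intro mult_right_mono mult_left_mono) auto
  also have "\<dots> = n t y * \<rho> ^ DIM('a) / C3" using yp by (simp add: r A_def powr_add)
  also have "\<dots> \<le> m" using k C3 by (simp add: field_simps)
  finally show ?thesis using v by (intro smoothing_powr_solve[OF _ t A dg]) auto
 qed simp
 moreover have "a * b \<le> (a + 1) * b" if "0 \<le> b" for a b :: real using that by (simp add: algebra_simps)
 ultimately show ?thesis
  by (intro exI[of _ "(m / A) powr (2 / (d * \<gamma> + 2)) + 1"]) (smt (verit, best) powr_ge_zero)
qed

section \<open>Smooth test functions\<close>

lemma C_k_on_SucD: "C_k_on k S f" if "C_k_on (Suc k) S f"
 using that
proof (induction k arbitrary: f)
 case 0
 then show ?case
  by (auto intro!: continuous_at_imp_continuous_on intro: differentiable_imp_continuous_within)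
next
 case (Suc k)
 then show ?case by (metis C_k_on.simps(2))
qed

lemma C_k_on_SucI:
 assumes "\<And>x. (f has_derivative D x) (at x)" "\<And>v. C_k_on k UNIV (\<lambda>x. D x v)"
 shows "C_k_on (Suc k) UNIV f"
proof -
 have "frechet_derivative f (at x) = D x" for x using frechet_derivative_at[OF assms(1)] by simp
 then show ?thesis using assms by (auto simp: differentiable_def)
qed

lemma C_k_on_SucE:
 assumes "C_k_on (Suc k) UNIV f"
 obtains D where "\<And>x. (f has_derivative D x) (at x)" "\<And>v. C_k_on k UNIV (\<lambda>x. D x v)"
 by (rule that[of "\<lambda>x. frechet_derivative f (at x)"]) (use assms in \<open>auto simp flip: frechet_derivative_works\<close>)

lemma C_k_on_const: "C_k_on k UNIV (\<lambda>x. c)"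
proof (induction k arbitrary: c)
 case (Suc k)
 show ?case by (rule C_k_on_SucI[OF has_derivative_const Suc])
qed simp

lemma C_k_on_bounded_linear: "C_k_on k UNIV f" if "bounded_linear f"
proof (cases k)
 case (Suc j)
 then show ?thesis using C_k_on_SucI[OF bounded_linear_imp_has_derivative[OF that] C_k_on_const] by simp
qed (use that in \<open>simp add: linear_continuous_on\<close>)

lemma C_k_on_add: "C_k_on k UNIV (\<lambda>x. f x + g x)" if "C_k_on k UNIV f" "C_k_on k UNIV g"
 using that
proof (induction k arbitrary: f g)
 case (Suc k)
 obtain D E where "\<And>x. (f has_derivative D x) (at x)" "\<And>v. C_k_on k UNIV (\<lambda>x. D x v)"
  "\<And>x. (g has_derivative E x) (at x)" "\<And>v. C_k_on k UNIV (\<lambda>x. E x v)"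
  using Suc.prems by (metis C_k_on_SucE)
 then show ?case by (intro C_k_on_SucI[OF has_derivative_add] Suc.IH) auto
qed (simp add: continuous_on_add)

lemma C_k_on_mult: "C_k_on k UNIV (\<lambda>x. f x * g x)" if "C_k_on k UNIV f" "C_k_on k UNIV g"
 using that
proof (induction k arbitrary: f g)
 case (Suc k)
 obtain D where D: "\<And>x. (f has_derivative D x) (at x)" "\<And>v. C_k_on k UNIV (\<lambda>x. D x v)"
  using Suc.prems by (metis C_k_on_SucE)
 obtain E where E: "\<And>x. (g has_derivative E x) (at x)" "\<And>v. C_k_on k UNIV (\<lambda>x. E x v)"
  using Suc.prems by (metis C_k_on_SucE)
 show ?case
  by (rule C_k_on_SucI[OF has_derivative_mult[OF D(1) E(1)]])
    (intro C_k_on_add Suc.IH D E C_k_on_SucD[OF Suc.prems(1)] C_k_on_SucD[OF Suc.prems(2)])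
qed (simp add: continuous_on_mult)

text \<open>Listing all derivatives of the outer function in one sequence turns the chain rule into
  a shift of the index, which fits an induction over all \<open>j\<close>.\<close>

lemma C_k_on_compose:
 fixes h :: "nat => real => real"
 assumes h: "\<And>j s. (h j has_real_derivative h (Suc j) s) (at s)" and f: "C_k_on k UNIV f"
 shows "C_k_on k UNIV (\<lambda>x. h j (f x))"
 using f
proof (induction k arbitrary: j)
 case 0
 have "continuous_on UNIV (h j)" using h by (intro DERIV_continuous_on) (auto intro: DERIV_subset)
 then show ?case using 0 by (auto intro: continuous_on_compose2)
next
 case (Suc k)
 obtain D where D: "\<And>x. (f has_derivative D x) (at x)" "\<And>v. C_k_on k UNIV (\<lambda>x. D x v)"
  using Suc.prems by (metis C_k_on_SucE)
 show ?case
  by (rule C_k_on_SucI[OF has_derivative_compose[OF D(1) h[unfolded has_field_derivative_def]]])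
    (intro C_k_on_mult D(2) Suc.IH[OF C_k_on_SucD[OF Suc.prems]])
qed

lemma C_k_on_inner_self: "C_k_on k UNIV (\<lambda>x::'a::real_inner. x \<bullet> x)"
proof (cases k)
 case (Suc j)
 show ?thesis unfolding Suc
  by (rule C_k_on_SucI[OF has_derivative_inner[OF has_derivative_ident has_derivative_ident]])
    (intro C_k_on_add C_k_on_bounded_linear bounded_linear_inner_left bounded_linear_inner_right)
qed (simp add: continuous_intros)

lemma C_k_on_compose_bounded_linear: "C_k_on k UNIV (\<lambda>x. f (L x))" if L: "bounded_linear L" and f: "C_k_on k UNIV f"
 using f
proof (induction k arbitrary: f)
 case 0
 then show ?case using L by (auto intro: continuous_on_compose2 linear_continuous_on)
next
 case (Suc k)
 obtain D where D: "\<And>x. (f has_derivative D x) (at x)" "\<And>v. C_k_on k UNIV (\<lambda>x. D x v)"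
  using Suc.prems by (metis C_k_on_SucE)
 show ?case
  by (rule C_k_on_SucI[OF has_derivative_compose[OF bounded_linear_imp_has_derivative[OF L] D(1)]]) (rule Suc.IH[OF D(2)])
qed

lemma C_k_on_antiderivative: "C_k_on k UNIV f"
 if f: "\<And>s::real. DERIV f s :> f' s" and f': "\<And>k. C_k_on k UNIV f'"
proof (cases k)
 case 0
 then show ?thesis using f by (auto intro!: DERIV_continuous_on intro: DERIV_subset)
next
 case (Suc j)
 show ?thesis unfolding Suc
  by (rule C_k_on_SucI[OF f[unfolded has_field_derivative_def]]) (intro C_k_on_mult f' C_k_on_const)
qed

text \<open>With \<open>p\<close> ranging over the polynomials this family of smooth functions, flat at \<open>0\<close>, is closed
 under differentiation.\<close>
definition flat :: "real poly => real => real" where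
 "flat p s = (if s > 0 then poly p (1 / s) * exp (- 1 / s) else 0)"

text \<open>Differentiating \<open>p(y) exp(-y)\<close> along \<open>y = 1 / s\<close>: the inner
  derivative is \<open>- y^2\<close>, and the outer one is \<open>(p' - p) exp(-y)\<close>.\<close>

definition flat_deriv :: "real poly => real poly" where
 "flat_deriv p = monom 1 2 * (p - pderiv p)"

lemma poly_times_exp_tendsto_0: "((\<lambda>y. poly p y * exp (- y)) \<longlongrightarrow> (0::real)) at_top"
proof -
 have "((\<lambda>y. \<Sum>i\<le>degree p. coeff p i * (y ^ i / exp y)) \<longlongrightarrow> (\<Sum>i\<le>degree p. coeff p i * 0)) at_top"
  by (intro tendsto_intros tendsto_power_div_exp_0)
 moreover have "(\<lambda>y. \<Sum>i\<le>degree p. coeff p i * (y ^ i / exp y)) = (\<lambda>y. poly p y * exp (- y))"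
  by (simp add: poly_altdef sum_distrib_right exp_minus divide_inverse mult.assoc)
 ultimately show ?thesis by simp
qed

lemma flat_has_real_derivative: "(flat p has_real_derivative flat (flat_deriv p) s) (at s)"
proof (cases s "0::real" rule: linorder_cases)
 case less
 then have "\<forall>\<^sub>F y in nhds s. flat p y = 0"
  using order_tendstoD(2)[OF filterlim_ident less] by (auto simp: flat_def elim: eventually_mono)
 from DERIV_cong_ev[OF refl this refl] less show ?thesis by (simp add: flat_def[of "flat_deriv p"])
next
 case greater
 then have ev: "\<forall>\<^sub>F y in nhds s. flat p y = poly p (1 / y) * exp (- 1 / y)"
  using order_tendstoD(1)[OF filterlim_ident greater] by (auto simp: flat_def elim: eventually_mono)
 have 1: "DERIV (\<lambda>y. 1 / y) s :> - 1 / s^2" "DERIV (\<lambda>y. - 1 / y) s :> 1 / s^2"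
  using greater by (auto intro!: derivative_eq_intros simp: power2_eq_square)
 have "DERIV (\<lambda>y. poly p (1 / y) * exp (- 1 / y)) s :> flat (flat_deriv p) s"
  by (rule DERIV_cong[OF DERIV_mult[OF DERIV_chain2[OF poly_DERIV 1(1)] DERIV_chain2[OF DERIV_exp 1(2)]]])
    (use greater in \<open>simp add: flat_def flat_deriv_def poly_monom field_simps\<close>)
 then show ?thesis by (subst DERIV_cong_ev[OF refl ev refl])
next
 case equal
 have "((\<lambda>h. flat p h / h) \<longlongrightarrow> 0) (at_right 0)"
 proof -
  have "((\<lambda>h. poly (monom 1 1 * p) (inverse h) * exp (- inverse h)) \<longlongrightarrow> 0) (at_right (0::real))"
   by (rule filterlim_compose[OF poly_times_exp_tendsto_0 filterlim_inverse_at_top_right])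
  then show ?thesis
   by (rule Lim_transform_eventually) (auto simp: eventually_at_filter flat_def poly_monom field_simps)
 qed
 moreover have "((\<lambda>h. flat p h / h) \<longlongrightarrow> 0) (at_left 0)"
  by (rule Lim_transform_eventually[OF tendsto_const]) (auto simp: eventually_at_filter flat_def)
 ultimately have "((\<lambda>h. flat p h / h) \<longlongrightarrow> 0) (at 0)" by (simp add: filterlim_at_split)
 then show ?thesis by (simp add: DERIV_def equal flat_def)
qed

lemma flat_nonneg: "0 \<le> flat 1 s" and flat_pos_iff: "0 < flat 1 s \<longleftrightarrow> 0 < s" and flat_eq_0: "s \<le> 0 ==> flat p s = 0"
 by (auto simp: flat_def)

lemma flat_1_mono: "flat 1 s \<le> flat 1 t" if "s \<le> t"
 using that by (auto simp: flat_def divide_le_cancel frac_le)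

lemma continuous_on_flat: "continuous_on A (flat p)"
 by (rule DERIV_continuous_on[OF has_field_derivative_at_within[OF flat_has_real_derivative]])

lemma C_k_on_flat: "C_k_on k UNIV (\<lambda>x. flat p (f x))" if "C_k_on k UNIV f"
 using C_k_on_compose[of "\<lambda>j. flat ((flat_deriv ^^ j) p)", OF _ that, of 0] by (simp add: flat_has_real_derivative)

lemma flat_line:
 fixes z z0 v :: "'a::euclidean_space"
 shows "((\<lambda>s. flat p (c - k * (norm (z + s *\<^sub>R v - z0))^2)) has_real_derivative
  - 2 * k * ((z - z0) \<bullet> v) * flat (flat_deriv p) (c - k * (norm (z - z0))^2)) (at 0)"
proof -
 have "DERIV (\<lambda>s. c - k * ((z + s *\<^sub>R v - z0) \<bullet> (z + s *\<^sub>R v - z0))) 0 :> - 2 * k * ((z - z0) \<bullet> v)"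
  unfolding has_field_derivative_def by (auto intro!: derivative_eq_intros simp: inner_commute algebra_simps)
 from DERIV_chain2[OF flat_has_real_derivative this]
 show ?thesis by (simp add: power2_norm_eq_inner mult_ac)
qed

section \<open>From strong to classical solutions\<close>

lemma grad_eq: "grad f x = D" if "GDERIV f x :> D"
 unfolding grad_def
proof (rule the_equality)
 show "GDERIV f x :> D" by (rule that)
 fix D' assume "GDERIV f x :> D'"
 then have "(\<lambda>h. h \<bullet> D') = (\<lambda>h. h \<bullet> D)" using that has_derivative_unique unfolding gderiv_def by blast
 then have "(D' - D) \<bullet> D' = (D' - D) \<bullet> D" by metis
 then have "(D' - D) \<bullet> (D' - D) = 0" by (simp add: inner_diff_right)
 then show "D' = D" by simp
qed

lemma GDERIV_line:
 assumes "f differentiable (at x)" "\<And>i. i \<in> Basis ==> DERIV (\<lambda>s. f (x + s *\<^sub>R i)) 0 :> f1 i"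
 shows "GDERIV f x :> (\<Sum>i\<in>Basis. f1 i *\<^sub>R i)"
 using has_derivative_line[OF assms] by (simp add: gderiv_def inner_sum_right mult.commute)

lemma regular_density_open:
 assumes "regular_density \<gamma> n"
 shows "open {(t, x). 0 < t \<and> 0 < n t x}"
proof -
 have "open (({0<..} \<times> UNIV) \<inter> (\<lambda>(t, x). n t x) -` {0<..})"
  using assms by (intro continuous_open_preimage open_Times) (auto simp: regular_density_def)
 also have "({0<..} \<times> UNIV) \<inter> (\<lambda>(t, x). n t x) -` {0<..} = {(t, x). 0 < t \<and> 0 < n t x}" by auto
 finally show ?thesis .
qed

lemma smooth_on_C12:
 fixes n :: "real => 'a::euclidean_space => real"
 assumes "open P" and s: "smooth_on P (\<lambda>(t, x). n t x)"
 defines "D \<equiv> \<lambda>z. frechet_derivative (\<lambda>(t, x). n t x) (at z)"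
 shows "C12 P n (\<lambda>t x. D (t, x) (1, 0)) (\<lambda>i t x. D (t, x) (0, i)) (\<lambda>i t x. frechet_derivative (\<lambda>z. D z (0, i)) (at (t, x)) (0, i))"
  "\<And>t x. (t, x) \<in> P ==> n t differentiable (at x)"
proof -
 have s1: "C_k_on (Suc (Suc 0)) P (\<lambda>(t, x). n t x)" using s unfolding smooth_on_def by blast
 from C_k_on_SucD[OF s1] have d: "(\<lambda>(t, x). n t x) differentiable (at z)" if "z \<in> P" for z using that by simp
 from C_k_on_SucD[OF s1] have c: "continuous_on P (\<lambda>z. D z v)" for v unfolding C_k_on.simps D_def by blast
 from s1 have d2: "(\<lambda>z. D z v) differentiable (at z)" if "z \<in> P" for z v
  using that unfolding C_k_on.simps D_def by blast
 from s1 have c2: "continuous_on P (\<lambda>z. frechet_derivative (\<lambda>z. D z v) (at z) w)" for v w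
  unfolding C_k_on.simps D_def by blast
 show "C12 P n (\<lambda>t x. D (t, x) (1, 0)) (\<lambda>i t x. D (t, x) (0, i)) (\<lambda>i t x. frechet_derivative (\<lambda>z. D z (0, i)) (at (t, x)) (0, i))"
  unfolding C12_def
 proof (intro conjI allI impI ballI)
  fix t x assume z: "(t, x) \<in> P"
  have "DERIV (\<lambda>s. n (t + s) x) 0 :> D (t, x) (1, 0)"
   using differentiable_line[OF d[OF z], of "(1, 0)"] by (simp add: D_def)
  then show "DERIV (\<lambda>s. n s x) t :> D (t, x) (1, 0)"
   using DERIV_shift[of "\<lambda>s. n s x" _ 0 t] by (simp add: add.commute)
  fix i :: 'a
  show "DERIV (\<lambda>s. n t (x + s *\<^sub>R i)) 0 :> D (t, x) (0, i)"
   using differentiable_line[OF d[OF z], of "(0, i)"] by (simp add: D_def)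
  show "DERIV (\<lambda>s. D (t, x + s *\<^sub>R i) (0, i)) 0 :> frechet_derivative (\<lambda>z. D z (0, i)) (at (t, x)) (0, i)"
   using differentiable_line[OF d2[OF z], of "(0, i)" "(0, i)"] by simp
 qed (use \<open>open P\<close> c c2 in \<open>simp_all add: case_prod_unfold\<close>)
 fix t x assume "(t, x) \<in> P"
 then obtain D' where D': "((\<lambda>(t, x). n t x) has_derivative D') (at (t, x))" using d by (auto simp: differentiable_def)
 have "((\<lambda>y. (t, y)) has_derivative (\<lambda>h. (0, h))) (at x)" by (auto intro!: derivative_eq_intros)
 from has_derivative_compose[OF this D'] show "n t differentiable (at x)" by (auto simp: differentiable_def)
qed

lemma flux_eq:
 fixes n :: "real => real^'d => real"
 assumes d: "n t differentiable (at x)" and n1: "\<And>i. i \<in> Basis ==> DERIV (\<lambda>s. n t (x + s *\<^sub>R i)) 0 :> n1 i"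
  and pos: "0 < n t x"
 shows "GDERIV (pressure \<gamma> n t) x :> (\<Sum>i\<in>Basis. (\<bar>\<gamma>\<bar> * n t x powr (\<gamma> - 1) * n1 i) *\<^sub>R i)"
  "grad (pressure \<gamma> n t) x = (\<Sum>i\<in>Basis. (\<bar>\<gamma>\<bar> * n t x powr (\<gamma> - 1) * n1 i) *\<^sub>R i)"
  "flux \<gamma> n t x = (\<Sum>i\<in>Basis. (\<bar>\<gamma>\<bar> * n t x powr \<gamma> * n1 i) *\<^sub>R i)"
proof -
 have p: "DERIV (\<lambda>v. sgn \<gamma> * v powr \<gamma>) (n t x) :> \<bar>\<gamma>\<bar> * n t x powr (\<gamma> - 1)"
  using pos by (auto intro!: derivative_eq_intros simp: abs_sgn)
 show g: "GDERIV (pressure \<gamma> n t) x :> (\<Sum>i\<in>Basis. (\<bar>\<gamma>\<bar> * n t x powr (\<gamma> - 1) * n1 i) *\<^sub>R i)"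
 proof (rule GDERIV_line)
  have "(\<lambda>v. sgn \<gamma> * v powr \<gamma>) differentiable (at (n t x))" using p by (auto simp: differentiable_def has_field_derivative_def)
  from differentiable_chain_at[OF d this] show "pressure \<gamma> n t differentiable (at x)" by (simp add: pressure_def[abs_def] o_def)
  fix i :: "real^'d" assume "i \<in> Basis"
  from DERIV_chain2[OF _ n1[OF this], of "\<lambda>v. sgn \<gamma> * v powr \<gamma>"] p
  show "DERIV (\<lambda>s. pressure \<gamma> n t (x + s *\<^sub>R i)) 0 :> \<bar>\<gamma>\<bar> * n t x powr (\<gamma> - 1) * n1 i"
   by (simp add: pressure_def)
 qed
 show e: "grad (pressure \<gamma> n t) x = (\<Sum>i\<in>Basis. (\<bar>\<gamma>\<bar> * n t x powr (\<gamma> - 1) * n1 i) *\<^sub>R i)" by (rule grad_eq[OF g])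
 have "n t x * n t x powr (\<gamma> - 1) = n t x powr \<gamma>" using pos powr_add[of "n t x" 1 "\<gamma> - 1"] by simp
 then show "flux \<gamma> n t x = (\<Sum>i\<in>Basis. (\<bar>\<gamma>\<bar> * n t x powr \<gamma> * n1 i) *\<^sub>R i)"
  unfolding flux_def e scaleR_sum_right
  by (intro sum.cong refl) (metis (no_types, opaque_lifting) mult.assoc mult.commute scaleR_scaleR)
qed

lemma test_function_differentiable: "(\<lambda>y. \<phi> (t, y)) differentiable (at x)" if "test_function \<phi>"
proof -
 have "C_k_on (Suc 0) UNIV \<phi>" using that by (auto simp: test_function_def smooth_on_def)
 then have "\<phi> differentiable (at (t, x))" by simp
 moreover have "(\<lambda>y. (t, y)) differentiable (at x)" by (auto intro!: derivative_intros)
 ultimately show ?thesis using differentiable_chain_at[of "\<lambda>y. (t, y)" x \<phi>] by (simp add: o_def)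
qed

lemma strong_solution_weak:
 assumes "strong_solution \<gamma> n0 n" "test_function \<phi>"
 shows "(LINT (t, x)|lborel. n t x * deriv (\<lambda>s. \<phi> (s, x)) t) = (LINT (t, x)|lborel. flux \<gamma> n t x \<bullet> grad (\<lambda>y. \<phi> (t, y)) x)"
 using assms by (auto simp: strong_solution_def weak_time_derivative_def weak_divergence_def)

text \<open>If the classical equation failed at a point of positivity, the defect \<open>h\<close>
  would keep its sign on a small ball. Testing the distributional identity with a nonnegative smooth
  function supported there contradicts this after classical integration by parts inside the
  positivity set.\<close>

lemma strong_solution_pme:
 fixes n :: "real => real^'d => real"
 assumes sol: "strong_solution \<gamma> n0 n" and reg: "regular_density \<gamma> n" and g: "-1 < \<gamma>" "\<gamma> \<noteq> 0"
 obtains nt n1 n2 where "pme_solution \<gamma> n nt n1 n2" "\<And>t x. 0 < t ==> 0 < n t x ==> n t differentiable (at x)"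
proof -
 define P where "P = {(t, x). 0 < t \<and> 0 < n t x}"
 have "open P" unfolding P_def by (rule regular_density_open[OF reg])
 have nc: "continuous_on ({0<..} \<times> UNIV) (\<lambda>(t, x). n t x)" using reg by (simp add: regular_density_def)
 have nn: "0 \<le> n t x" if "0 < t" for t x using sol that by (simp add: strong_solution_def)
 have "smooth_on P (\<lambda>(t, x). n t x)" using reg by (simp add: regular_density_def P_def)
 from smooth_on_C12[OF \<open>open P\<close> this] obtain nt n1 n2 where C: "C12 P n nt n1 n2"
  and diff: "\<And>t x. (t, x) \<in> P ==> n t differentiable (at x)" by blast
 define c where "c v = \<bar>\<gamma>\<bar> * v powr \<gamma>" for v :: real
 define F1 where "F1 i t x = \<bar>\<gamma>\<bar> * n t x powr \<gamma> * n1 i t x" for i t x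
 define F2 where "F2 i t x = diffusion2 \<gamma> (n t x) (n1 i t x) (n2 i t x)" for i t x
 have CF: "C12 P (\<lambda>t x. diffusion \<gamma> (n t x)) (\<lambda>t x. \<bar>\<gamma>\<bar> * n t x powr \<gamma> * nt t x) F1 F2"
  unfolding F1_def F2_def
  by (rule C12_compose[OF C continuous_on_subset[OF nc], where I = "{0<..}"])
    (use g in \<open>auto simp: P_def intro!: diffusion_derivative diffusion_derivative2 continuous_intros\<close>)
 have pde: "nt t0 x0 = (\<Sum>i\<in>Basis. F2 i t0 x0)" if z0: "(t0, x0) \<in> P" for t0 x0
 proof (rule ccontr)
  define h where "h = (\<lambda>(t, x). nt t x - (\<Sum>i\<in>Basis. F2 i t x))"
  have hc: "continuous_on P h"
   using C CF unfolding h_def C12_def case_prod_unfold by (auto intro!: continuous_intros)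
  define s where "s = sgn (h (t0, x0))"
  assume "nt t0 x0 \<noteq> (\<Sum>i\<in>Basis. F2 i t0 x0)"
  then have s: "0 < s * h (t0, x0)" by (auto simp: h_def s_def sgn_if)
  have "open (P \<inter> (\<lambda>z. s * h z) -` {0<..})"
   using hc \<open>open P\<close> by (intro continuous_open_preimage) (auto intro!: continuous_intros)
  then obtain r where r: "0 < r" "cball (t0, x0) r \<subseteq> P \<inter> (\<lambda>z. s * h z) -` {0<..}"
   using s z0 open_contains_cball by blast
  define q where "q z = r^2 - 1 * (norm (z - (t0, x0)))^2" for z
  define \<phi> where "\<phi> z = flat 1 (q z)" for z
  define \<phi>1 where "\<phi>1 v z = - 2 * 1 * ((z - (t0, x0)) \<bullet> v) * flat (flat_deriv 1) (q z)" for v z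
  have line: "DERIV (\<lambda>s. \<phi> (z + s *\<^sub>R v)) 0 :> \<phi>1 v z" for z v
   unfolding \<phi>_def \<phi>1_def q_def by (rule flat_line)
  have q0: "q z \<le> 0" if "z \<notin> ball (t0, x0) r" for z
   using that power_mono[of r "norm (z - (t0, x0))" 2] r by (simp add: q_def dist_norm norm_minus_commute)
  have zero: "\<phi> z = 0" "\<phi>1 v z = 0" if "z \<notin> ball (t0, x0) r" for z v
   using q0[OF that] by (simp_all add: \<phi>_def \<phi>1_def flat_eq_0)
  have \<phi>c: "continuous_on A \<phi>" "continuous_on A (\<phi>1 v)" for A v
   unfolding \<phi>_def \<phi>1_def q_def
   by (intro continuous_intros continuous_on_compose2[OF continuous_on_flat[of UNIV]]; simp)+
  have cb: "cball (t0, x0) r \<subseteq> P" using r by auto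
  have cover: "open (- cball (t0, x0) r)" "P \<union> - cball (t0, x0) r = UNIV" using cb by auto
  \<comment> \<open>Extension by zero outside the positivity set. Multiplied by a function supported
    in the small ball it is continuous on the whole space, so global integration by parts applies to
    functions that are regular only on \<open>P\<close>.\<close>
  define cut where "cut f z = (if z \<in> P then f z else 0)" for f :: "real \<times> (real^'d) => real" and z
  have cutc: "continuous_on UNIV (\<lambda>z. cut f z * \<psi> z)" if "continuous_on P f" "\<psi> = \<phi> \<or> \<psi> = \<phi>1 v" for f \<psi> v
  proof (rule continuous_on_UNIV_cutoff[OF \<open>open P\<close> cover])
   have "continuous_on P \<psi>" using that(2) \<phi>c by metis
   then show "continuous_on P (\<lambda>z. f z * \<psi> z)" using that(1) by (rule continuous_on_mult[rotated])
   fix z assume "z \<in> - cball (t0, x0) r"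
   then have "z \<notin> ball (t0, x0) r" by auto
   then have "\<psi> z = 0" using that(2) zero[of z] by metis
   then show "cut f z * \<psi> z = 0" by simp
  qed (simp add: cut_def)
  have sup: "\<psi> z = 0" if "norm z > norm (t0, x0) + r" "\<psi> = \<phi> \<or> \<psi> = \<phi>1 v" for z \<psi> v
  proof -
   have "z \<notin> ball (t0, x0) r"
    using that(1) norm_triangle_ineq[of "z - (t0, x0)" "(t0, x0)"] by (auto simp: dist_norm norm_minus_commute)
   then show ?thesis using zero[of z] that(2) by metis
  qed
  have cuti: "integrable lborel (\<lambda>z. cut f z * \<psi> z)" if "continuous_on P f" "\<psi> = \<phi> \<or> \<psi> = \<phi>1 v" for f \<psi> v
   by (rule integrable_continuous_support[OF cutc[OF that], of "norm (t0, x0) + r"]) (use sup that(2) in auto)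
  have ibp: "(LINT z|lborel. cut f' z * \<phi> z) = - (LINT z|lborel. cut f z * \<phi>1 v z)"
   if f: "continuous_on P f" "continuous_on P f'" "\<And>z. z \<in> P ==> DERIV (\<lambda>s. f (z + s *\<^sub>R v)) 0 :> f' z" for f f' v
  proof -
   have "(LINT z|lborel. cut f' z * \<phi> z + cut f z * \<phi>1 v z) = 0"
   proof (rule integral_line_derivative_eq_0[where F = "\<lambda>z. cut f z * \<phi> z" and R = "norm (t0, x0) + r" and v = v])
    show "continuous_on UNIV (\<lambda>z. cut f z * \<phi> z)" using f by (intro cutc) auto
    show "continuous_on UNIV (\<lambda>z. cut f' z * \<phi> z + cut f z * \<phi>1 v z)"
     using f by (intro continuous_on_add cutc[of _ _ v]) auto
    fix z
    show "DERIV (\<lambda>s. cut f (z + s *\<^sub>R v) * \<phi> (z + s *\<^sub>R v)) 0 :> cut f' z * \<phi> z + cut f z * \<phi>1 v z"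
    proof (cases "z \<in> P")
     case True
     have ev: "\<forall>\<^sub>F s in nhds 0. cut f (z + s *\<^sub>R v) * \<phi> (z + s *\<^sub>R v) = f (z + s *\<^sub>R v) * \<phi> (z + s *\<^sub>R v)"
      using eventually_line[OF \<open>open P\<close> True, of v]
      by eventually_elim (simp add: cut_def)
     show ?thesis
      by (subst DERIV_cong_ev[OF refl ev refl], rule DERIV_cong[OF DERIV_mult[OF f(3)[OF True] line]])
        (use True in \<open>simp add: cut_def\<close>)
    next
     case False
     then have zc: "z \<in> - cball (t0, x0) r" using cb by auto
     have ev: "\<forall>\<^sub>F s in nhds 0. cut f (z + s *\<^sub>R v) * \<phi> (z + s *\<^sub>R v) = 0"
      using eventually_line[OF cover(1) zc, of v]
      by eventually_elim (simp add: zero)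
     show ?thesis
      by (subst DERIV_cong_ev[OF refl ev refl]) (use False in \<open>simp add: cut_def\<close>)
    qed
   qed (use sup in auto)
   then show ?thesis using cuti[OF f(2), of \<phi> v] cuti[OF f(1), of "\<phi>1 v" v] by simp
  qed
  have test: "test_function \<phi>"
  proof -
   have "C_k_on k UNIV \<phi>" for k
   proof -
    have "C_k_on k UNIV (\<lambda>z. r^2 - (norm (t0, x0))^2 + ((z \<bullet> z) * (- 1) + 2 * ((t0, x0) \<bullet> z)))"
     by (intro C_k_on_add C_k_on_mult C_k_on_const C_k_on_inner_self C_k_on_bounded_linear bounded_linear_inner_right)
    moreover have "(\<lambda>z. r^2 - (norm (t0, x0))^2 + ((z \<bullet> z) * (- 1) + 2 * ((t0, x0) \<bullet> z))) = q"
     unfolding q_def power2_norm_eq_inner inner_diff_left inner_diff_right by (auto simp: inner_commute)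
    ultimately show ?thesis unfolding \<phi>_def by (intro C_k_on_flat) simp
   qed
   moreover have "cball (t0, x0) r \<subseteq> {0<..} \<times> UNIV" using cb by (auto simp: P_def)
   ultimately show ?thesis
    unfolding test_function_def smooth_on_def using zero
    by (intro conjI allI exI[of _ "cball (t0, x0) r"]) auto
  qed
  have dt: "deriv (\<lambda>s. \<phi> (s, x)) t = \<phi>1 (1, 0) (t, x)" for t x
  proof (rule DERIV_imp_deriv)
   have "DERIV (\<lambda>s. \<phi> (t + s, x)) 0 :> \<phi>1 (1, 0) (t, x)" using line[of "(t, x)" "(1, 0)"] by simp
   then show "DERIV (\<lambda>s. \<phi> (s, x)) t :> \<phi>1 (1, 0) (t, x)"
    using DERIV_shift[of "\<lambda>s. \<phi> (s, x)" _ 0 t] by (simp add: add.commute)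
  qed
  have dx: "grad (\<lambda>y. \<phi> (t, y)) x = (\<Sum>i\<in>Basis. \<phi>1 (0, i) (t, x) *\<^sub>R i)" for t x
  proof -
   have 1: "(\<lambda>y. \<phi> (t, y)) differentiable (at x)" by (rule test_function_differentiable[OF test])
   have 2: "DERIV (\<lambda>s. \<phi> (t, x + s *\<^sub>R i)) 0 :> \<phi>1 (0, i) (t, x)" for i
    using line[of "(t, x)" "(0, i)"] by simp
   show ?thesis by (rule grad_eq[OF GDERIV_line[OF 1 2]])
  qed
  have Fc: "continuous_on P (\<lambda>(t, x). n t x)" "continuous_on P (\<lambda>(t, x). nt t x)"
   "\<And>i. i \<in> Basis ==> continuous_on P (\<lambda>(t, x). F1 i t x)" "\<And>i. i \<in> Basis ==> continuous_on P (\<lambda>(t, x). F2 i t x)"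
   using C CF continuous_on_subset[OF nc, of P] by (auto simp: C12_def P_def)
  have "(LINT (t, x)|lborel. n t x * deriv (\<lambda>s. \<phi> (s, x)) t) = (LINT z|lborel. cut (\<lambda>(t, x). n t x) z * \<phi>1 (1, 0) z)"
  proof (intro Bochner_Integration.integral_cong refl)
   fix z
   have "\<phi>1 (1, 0) z = 0" if "z \<notin> P"
    using that cb ball_subset_cball[of "(t0, x0)" r] by (intro zero(2)) blast
   then show "(case z of (t, x) => n t x * deriv (\<lambda>s. \<phi> (s, x)) t) = cut (\<lambda>(t, x). n t x) z * \<phi>1 (1, 0) z"
    by (cases z) (auto simp: dt cut_def)
  qed
  also have "\<dots> = - (LINT z|lborel. cut (\<lambda>(t, x). nt t x) z * \<phi> z)"
   using ibp[OF Fc(1,2), of "(1, 0)"] C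
  proof -
   have "((\<lambda>s. (\<lambda>(t, x). n t x) (z + s *\<^sub>R (1, 0))) has_real_derivative (\<lambda>(t, x). nt t x) z) (at 0)" if "z \<in> P" for z
   proof -
    obtain t x where z: "z = (t, x)" by force
    have "DERIV (\<lambda>s. n s x) t :> nt t x" using C that by (simp add: C12_def z)
    then have "DERIV (\<lambda>s. n (s + t) x) 0 :> nt t x" using DERIV_shift[of "\<lambda>s. n s x" _ 0 t] by simp
    then show ?thesis by (simp add: z add.commute)
   qed
   from ibp[OF Fc(1,2) this] show ?thesis by simp
  qed
  finally have L: "(LINT (t, x)|lborel. n t x * deriv (\<lambda>s. \<phi> (s, x)) t) = - (LINT z|lborel. cut (\<lambda>(t, x). nt t x) z * \<phi> z)" .
  have "flux \<gamma> n t x \<bullet> grad (\<lambda>y. \<phi> (t, y)) x = (\<Sum>i\<in>Basis. cut (\<lambda>(t, x). F1 i t x) (t, x) * \<phi>1 (0, i) (t, x))" for t x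
  proof (cases "(t, x) \<in> P")
   case True
   have "flux \<gamma> n t x = (\<Sum>i\<in>Basis. F1 i t x *\<^sub>R i)"
    unfolding F1_def using True C by (intro flux_eq(3) diff) (auto simp: C12_def P_def)
   then show ?thesis using True unfolding dx by (simp add: cut_def inner_sum_left inner_sum_right inner_Basis if_distrib mult.commute cong: if_cong)
  next
   case False
   then have "(t, x) \<notin> ball (t0, x0) r" using cb ball_subset_cball[of "(t0, x0)" r] by blast
   then show ?thesis by (simp add: dx zero)
  qed
  then have "(LINT (t, x)|lborel. flux \<gamma> n t x \<bullet> grad (\<lambda>y. \<phi> (t, y)) x)
   = (LINT z|lborel. (\<Sum>i\<in>Basis. cut (\<lambda>(t, x). F1 i t x) z * \<phi>1 (0, i) z))"
   by (simp add: case_prod_unfold)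
  also have "\<dots> = (\<Sum>i\<in>Basis. LINT z|lborel. cut (\<lambda>(t, x). F1 i t x) z * \<phi>1 (0, i) z)"
   by (rule Bochner_Integration.integral_sum[OF cuti[OF Fc(3)]]) auto
  also have "\<dots> = (\<Sum>i\<in>Basis. - (LINT z|lborel. cut (\<lambda>(t, x). F2 i t x) z * \<phi> z))"
  proof (rule sum.cong[OF refl])
   fix i :: "real^'d" assume i: "i \<in> Basis"
   have "((\<lambda>s. (\<lambda>(t, x). F1 i t x) (z + s *\<^sub>R (0, i))) has_real_derivative (\<lambda>(t, x). F2 i t x) z) (at 0)" if "z \<in> P" for z
    using CF i that by (cases z) (simp add: C12_def)
   from ibp[OF Fc(3)[OF i] Fc(4)[OF i] this]
   show "(LINT z|lborel. cut (\<lambda>(t, x). F1 i t x) z * \<phi>1 (0, i) z) = - (LINT z|lborel. cut (\<lambda>(t, x). F2 i t x) z * \<phi> z)" by simp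
  qed
  finally have R: "(LINT (t, x)|lborel. flux \<gamma> n t x \<bullet> grad (\<lambda>y. \<phi> (t, y)) x) = (\<Sum>i\<in>Basis. - (LINT z|lborel. cut (\<lambda>(t, x). F2 i t x) z * \<phi> z))" .
  have "(LINT z|lborel. cut h z * \<phi> z) = (LINT z|lborel. cut (\<lambda>(t, x). nt t x) z * \<phi> z - (\<Sum>i\<in>Basis. cut (\<lambda>(t, x). F2 i t x) z * \<phi> z))"
   by (intro Bochner_Integration.integral_cong) (auto simp: cut_def h_def left_diff_distrib sum_distrib_right)
  also have "\<dots> = (LINT z|lborel. cut (\<lambda>(t, x). nt t x) z * \<phi> z) - (\<Sum>i\<in>Basis. LINT z|lborel. cut (\<lambda>(t, x). F2 i t x) z * \<phi> z)"
   using cuti[OF Fc(2), of \<phi>] cuti[OF Fc(4), of _ \<phi>] by simp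
  also have "\<dots> = 0" using strong_solution_weak[OF sol test] unfolding L R by (simp add: sum_negf)
  finally have int0: "(LINT z|lborel. cut h z * \<phi> z) = 0" .
  \<comment> \<open>The comparison of a nonnegative continuous function with the zero function: its
    integral vanishes by \<open>int0\<close>, so it vanishes at the centre, where the test function
    is positive.\<close>
  have "s * (cut h (t0, x0) * \<phi> (t0, x0)) = (\<lambda>z. 0) (t0, x0)"
  proof (rule eq_of_integral_le[where g = "\<lambda>z. s * (cut h z * \<phi> z)"])
   have i: "integrable lborel (\<lambda>z. s * (cut h z * \<phi> z))" using cuti[OF hc, of \<phi>] by simp
   show nn: "0 \<le> s * (cut h z * \<phi> z)" for z
   proof (cases "z \<in> ball (t0, x0) r")
    case True
    then have "z \<in> P \<inter> (\<lambda>z. s * h z) -` {0<..}" using r(2) ball_subset_cball by blast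
    then have "z \<in> P" "0 \<le> (s * h z) * \<phi> z" using flat_nonneg[of "q z"] by (auto simp: \<phi>_def)
    then show ?thesis by (simp add: cut_def mult.assoc)
   qed (simp add: zero)
   show "(\<integral>\<^sup>+ z. ennreal (s * (cut h z * \<phi> z)) \<partial>lborel) \<le> ennreal (LINT z|(lborel::(real \<times> (real^'d)) measure). 0)"
    using int0 by (subst nn_integral_eq_integral[OF i]) (use nn in auto)
   show "continuous_on UNIV (\<lambda>z. s * (cut h z * \<phi> z))" by (intro continuous_on_mult continuous_on_const cutc[OF hc]) auto
  qed auto
  moreover have "0 < \<phi> (t0, x0)" using r by (simp add: \<phi>_def q_def flat_pos_iff)
  ultimately show False using s z0 by (auto simp: cut_def)
 qed
 have "pme_solution \<gamma> n nt n1 n2"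
  unfolding pme_solution_def using nc nn C pde by (simp add: P_def F2_def)
 then show ?thesis using diff by (intro that) (auto simp: P_def)
qed

section \<open>Conservation of mass\<close>

lemma integrable_mult_continuous_support:
 fixes f \<psi> :: "'a::euclidean_space => real"
 assumes f: "integrable lborel (\<lambda>z. indicator K z * f z)" and K: "compact K"
  and \<psi>: "continuous_on UNIV \<psi>" "\<And>z. z \<notin> K ==> \<psi> z = 0"
 shows "integrable lborel (\<lambda>z. f z * \<psi> z)"
proof -
 have "bounded (\<psi> ` K)" using compact_continuous_image[OF continuous_on_subset[OF \<psi>(1)] K] by (auto intro: compact_imp_bounded)
 then obtain M where M: "\<And>z. z \<in> K ==> \<bar>\<psi> z\<bar> \<le> M" unfolding bounded_iff by auto
 have e: "(\<lambda>z. f z * \<psi> z) = (\<lambda>z. (indicator K z * f z) * \<psi> z)"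
  using \<psi>(2) by (intro ext) (auto simp: indicator_def)
 show ?thesis
  unfolding e
 proof (rule Bochner_Integration.integrable_bound[OF integrable_mult_left[OF f, of M]])
  show "(\<lambda>z. (indicator K z * f z) * \<psi> z) \<in> borel_measurable lborel"
   by (rule borel_measurable_times[OF borel_measurable_integrable[OF f]]) (simp add: borel_measurable_continuous_onI[OF \<psi>(1)])
  have "norm ((indicator K z * f z) * \<psi> z) \<le> norm ((indicator K z * f z) * M)" for z
   using M[of z] by (auto simp: indicator_def abs_mult intro!: mult_left_mono)
  then show "AE z in lborel. norm ((indicator K z * f z) * \<psi> z) \<le> norm ((indicator K z * f z) * M)" by simp
 qed
qed

text \<open>With \<open>q = max 0 (s - \<delta>) / s\<close> the derivative is
  \<open>2 q - q^2\<close>. It lies between 0 and 1 and tends to 1 as \<delta> decreases to 0, so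
  the truncated fluxes are dominated by the flux itself.\<close>

lemma truncation_derivative:
 fixes s \<delta> :: real
 assumes "0 < s" "0 < \<delta>"
 shows "DERIV (\<lambda>s. (max 0 (s - \<delta>))^2 / s) s :> 2 * (max 0 (s - \<delta>) / s) - (max 0 (s - \<delta>) / s)^2"
proof -
 have "DERIV (\<lambda>s. (max 0 (s - \<delta>))^2) s :> real 2 * max 0 (s - \<delta>) ^ (2 - 1) * 1"
  by (rule DERIV_chain2[OF has_real_derivative_max_power]) (auto intro!: derivative_eq_intros)
 from DERIV_divide[OF this DERIV_ident] show ?thesis
  by (rule DERIV_cong) (use assms in \<open>simp_all add: field_simps power2_eq_square\<close>)
qed

text \<open>\<open>diffusion \<gamma> (n t x)\<close> need not be differentiable where \<open>n\<close> vanishes; it is replaced by the functions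
 \<open>(max 0 (u - \<delta>))\<^sup>2 / u\<close>, which vanish near these points.\<close>
lemma flux_integral_by_parts:
 fixes n :: "real => real^'d => real"
 assumes n: "pme_solution \<gamma> n nt n1 n2" and g: "-1 < \<gamma>" "\<gamma> \<noteq> 0"
  and diff: "\<And>t x. 0 < t ==> 0 < n t x ==> n t differentiable (at x)"
  and K: "compact K" "K \<subseteq> {0<..} \<times> UNIV" and flux: "set_integrable lborel K (\<lambda>(t, x). flux \<gamma> n t x)"
  and \<psi>: "continuous_on UNIV \<psi>" "continuous_on UNIV \<psi>'" "\<And>z. DERIV (\<lambda>s. \<psi> (z + s *\<^sub>R (0, i))) 0 :> \<psi>' z"
   "\<And>z. z \<notin> K ==> \<psi> z = 0" "\<And>z. z \<notin> K ==> \<psi>' z = 0" and i: "i \<in> Basis"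
 shows "integrable lborel (\<lambda>(t, x). (flux \<gamma> n t x \<bullet> i) * \<psi> (t, x))" "integrable lborel (\<lambda>(t, x). diffusion \<gamma> (n t x) * \<psi>' (t, x))"
  "(LINT (t, x)|lborel. (flux \<gamma> n t x \<bullet> i) * \<psi> (t, x)) = - (LINT (t, x)|lborel. diffusion \<gamma> (n t x) * \<psi>' (t, x))"
proof -
 define J where "J = (\<lambda>(t, x). flux \<gamma> n t x \<bullet> i)"
 define u where "u = (\<lambda>(t, x). diffusion \<gamma> (n t x))"
 define F where "F = (\<lambda>(t, x). \<bar>\<gamma>\<bar> * n t x powr \<gamma> * n1 i t x)"
 define A where "A = {(t, x). 0 < t \<and> 0 < n t x}"
 have nc: "continuous_on ({0<..} \<times> UNIV) (\<lambda>(t, x). n t x)" and nn: "\<And>t x. 0 < t ==> 0 \<le> n t x"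
  using n by (auto simp: pme_solution_def)
 have Cn: "C12 A n nt n1 n2" using n by (simp add: pme_solution_def A_def)
 have CF: "C12 A (\<lambda>t x. diffusion \<gamma> (n t x)) (\<lambda>t x. \<bar>\<gamma>\<bar> * n t x powr \<gamma> * nt t x) (\<lambda>i t x. \<bar>\<gamma>\<bar> * n t x powr \<gamma> * n1 i t x)
  (\<lambda>i t x. diffusion2 \<gamma> (n t x) (n1 i t x) (n2 i t x))"
  unfolding A_def by (rule C12_diffusion[OF n g(1)])
 have "open A" using Cn by (simp add: C12_def)
 have Fc: "continuous_on A F" using CF i unfolding F_def by (simp add: C12_def)
 have uline: "DERIV (\<lambda>s. u (z + s *\<^sub>R (0, i))) 0 :> F z" if "z \<in> A" for z
  using CF i that by (cases z) (simp add: C12_def u_def F_def)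
 have uc: "continuous_on ({0<..} \<times> UNIV) u"
  unfolding u_def by (rule continuous_on_diffusion_density[OF g(1) nc nn])
 have u0: "0 \<le> u z" for z using g by (simp add: u_def diffusion_nonneg split: prod.split)
 have upos: "0 < u z" if "z \<in> A" for z
  using that g by (auto simp: u_def A_def diffusion_def)
 have JA: "J z = F z" if "z \<in> A" for z
 proof -
  obtain t x where z: "z = (t, x)" by force
  have "flux \<gamma> n t x = (\<Sum>i\<in>Basis. (\<bar>\<gamma>\<bar> * n t x powr \<gamma> * n1 i t x) *\<^sub>R i)"
   using that Cn by (intro flux_eq(3) diff) (auto simp: C12_def A_def z)
  then show ?thesis using i by (simp add: J_def F_def z inner_sum_left inner_Basis if_distrib cong: if_cong)
 qed
 have uJ0: "J z = 0" "u z = 0" if "z \<notin> A" "0 < fst z" for z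
 proof -
  have "n (fst z) (snd z) = 0" using nn[OF that(2), of "snd z"] that by (auto simp: A_def case_prod_unfold less_le)
  then show "J z = 0" "u z = 0" using g by (auto simp: J_def u_def flux_def diffusion_def case_prod_unfold)
 qed
 define a where "a z = J z * \<psi> z" for z
 define b where "b z = u z * \<psi>' z" for z
 have ai: "integrable lborel a"
  unfolding a_def[abs_def]
 proof (rule integrable_mult_continuous_support[OF _ K(1) \<psi>(1,4)])
  have "integrable lborel (\<lambda>z. (indicator K z *\<^sub>R (case z of (t, x) => flux \<gamma> n t x)) \<bullet> i)"
   using flux unfolding set_integrable_def by (intro integrable_inner_left)
  then show "integrable lborel (\<lambda>z. indicator K z * J z)" by (simp add: J_def case_prod_unfold)
 qed
 have "open (- K)" using K by (simp add: compact_imp_closed open_Compl)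
 have "bounded K" using K by (simp add: compact_imp_bounded)
 then obtain R where R: "\<And>z. z \<in> K ==> norm z \<le> R" unfolding bounded_iff by auto
 have bi: "integrable lborel b"
 proof (rule integrable_continuous_support)
  show "continuous_on UNIV b"
  proof (rule continuous_on_UNIV_cutoff[of "{0<..} \<times> UNIV" "- K"])
   show "continuous_on ({0<..} \<times> UNIV) (\<lambda>z. u z * \<psi>' z)"
    by (intro continuous_on_mult uc continuous_on_subset[OF \<psi>(2)]) auto
  qed (use K \<open>open (- K)\<close> \<psi> in \<open>auto simp: b_def open_Times\<close>)
  show "b z = 0" if "R < norm z" for z using R[of z] that \<psi>(5)[of z] by (auto simp: b_def)
 qed
 define q where "q \<delta> z = max 0 (u z - \<delta>) / u z" for \<delta> z
 have q01: "0 \<le> q \<delta> z" "q \<delta> z \<le> 1" if "0 < \<delta>" for \<delta> z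
  using that u0[of z] by (auto simp: q_def divide_le_eq_1 less_le)
 \<comment> \<open>The derivative of \<open>(q \<delta>)^2 * u * \<psi>\<close>, where
   \<open>(q \<delta>)^2 * u\<close> is the truncated diffusion: the first term is the truncated
   flux against \<open>\<psi>\<close>, the second the truncated diffusion against
   \<open>\<psi>'\<close>. As \<delta> tends to 0 it becomes \<open>a + b\<close>.\<close>
 define F' where "F' \<delta> z = (2 * q \<delta> z - (q \<delta> z)^2) * a z + (q \<delta> z)^2 * b z" for \<delta> z
 have step: "continuous_on UNIV (F' \<delta>)" "(LINT z|lborel. F' \<delta> z) = 0" if \<delta>: "0 < \<delta>" for \<delta>
 proof -
  \<comment> \<open>On this open set either the truncation or the test function vanishes, so
    everything can be continued by zero. Together with the positivity set it covers the whole space,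
    because at vacuum points of \<open>K\<close> the diffusion is 0 and hence below
    \<delta>.\<close>
  define B where "B = (({0<..} \<times> UNIV) \<inter> u -` {..<\<delta>}) \<union> - K"
  have "open B" unfolding B_def using \<open>open (- K)\<close> uc by (intro open_Un continuous_open_preimage open_Times) auto
  have AB: "A \<union> B = UNIV"
  proof -
   have "z \<in> B" if "z \<notin> A" for z using that K(2) uJ0[of z] \<delta> by (cases "z \<in> K") (auto simp: B_def)
   then show ?thesis by auto
  qed
  have B0: "q \<delta> z = 0 \<or> (\<psi> z = 0 \<and> \<psi>' z = 0)" if "z \<in> B" for z
   using that \<psi>(4,5)[of z] by (auto simp: B_def q_def)
  have qc: "continuous_on A (q \<delta>)"
   unfolding q_def using upos by (intro continuous_intros continuous_on_subset[OF uc]) (auto simp: A_def less_le)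
  define G where "G z = (q \<delta> z)^2 * u z * \<psi> z" for z
  show F'c: "continuous_on UNIV (F' \<delta>)"
  proof (rule continuous_on_UNIV_cutoff[OF \<open>open A\<close> \<open>open B\<close> AB])
   have "continuous_on A u" "continuous_on A \<psi>" "continuous_on A \<psi>'"
    using uc \<psi>(1,2) by (auto simp: A_def elim: continuous_on_subset)
   then show "continuous_on A (\<lambda>z. (2 * q \<delta> z - (q \<delta> z)^2) * (F z * \<psi> z) + (q \<delta> z)^2 * (u z * \<psi>' z))"
    by (intro continuous_intros qc Fc)
   show "F' \<delta> z = 0" if "z \<in> B" for z using B0[OF that] by (auto simp: F'_def a_def b_def)
  qed (simp add: F'_def a_def b_def JA)
  have Gc: "continuous_on UNIV G"
  proof (rule continuous_on_UNIV_cutoff[OF \<open>open A\<close> \<open>open B\<close> AB])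
   have "continuous_on A u" "continuous_on A \<psi>" using uc \<psi>(1) by (auto simp: A_def elim: continuous_on_subset)
   then show "continuous_on A (\<lambda>z. (q \<delta> z)^2 * u z * \<psi> z)" by (intro continuous_intros qc)
   show "G z = 0" if "z \<in> B" for z using B0[OF that] by (auto simp: G_def)
  qed (simp add: G_def)
  show "(LINT z|lborel. F' \<delta> z) = 0"
  proof (rule integral_line_derivative_eq_0[OF Gc F'c, where R = R and v = "(0, i)"])
   fix z :: "real \<times> (real^'d)"
   show "DERIV (\<lambda>s. G (z + s *\<^sub>R (0, i))) 0 :> F' \<delta> z"
   proof (cases "z \<in> A")
    case True
    from eventually_line[OF \<open>open A\<close> True, of "(0, i)"] have ev: "\<forall>\<^sub>F s in nhds 0. G (z + s *\<^sub>R (0, i)) = (max 0 (u (z + s *\<^sub>R (0, i)) - \<delta>))^2 / u (z + s *\<^sub>R (0, i)) * \<psi> (z + s *\<^sub>R (0, i))"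
     by eventually_elim (use upos in \<open>simp add: G_def q_def power2_eq_square less_le\<close>)
    have "0 < u (z + 0 *\<^sub>R (0, i))" using upos[OF True] by (simp only: scaleR_zero_left add_0_right)
    from DERIV_mult[OF DERIV_chain2[OF truncation_derivative[OF this \<delta>] uline[OF True]] \<psi>(3)]
    have "DERIV (\<lambda>s. (max 0 (u (z + s *\<^sub>R (0, i)) - \<delta>))^2 / u (z + s *\<^sub>R (0, i)) * \<psi> (z + s *\<^sub>R (0, i))) 0 :> F' \<delta> z"
     unfolding scaleR_zero_left add_0_right
     by (rule DERIV_cong) (use upos[OF True] in \<open>simp add: F'_def a_def b_def JA[OF True] q_def power2_eq_square mult_ac less_le\<close>)
    then show ?thesis by (subst DERIV_cong_ev[OF refl ev refl])
   next
    case False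
    then have zB: "z \<in> B" using AB by auto
    from eventually_line[OF \<open>open B\<close> zB, of "(0, i)"] have ev: "\<forall>\<^sub>F s in nhds 0. G (z + s *\<^sub>R (0, i)) = 0"
     by eventually_elim (use B0[of "z + _"] in \<open>auto simp: G_def\<close>)
    show ?thesis
     by (subst DERIV_cong_ev[OF refl ev refl]) (use B0[OF zB] in \<open>auto simp: F'_def a_def b_def\<close>)
   qed
  next
   show "G z = 0" if "R < norm z" for z using R[of z] that \<psi>(4)[of z] by (auto simp: G_def)
  qed
 qed
 have "(\<lambda>k. LINT z|lborel. F' (1 / real (Suc k)) z) \<longlonglongrightarrow> (LINT z|lborel. a z + b z)"
 proof (rule integral_dominated_convergence[where w = "\<lambda>z. \<bar>a z\<bar> + \<bar>b z\<bar>"])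
  show "AE z in lborel. (\<lambda>k. F' (1 / real (Suc k)) z) \<longlonglongrightarrow> a z + b z"
  proof (rule AE_I2)
   fix z :: "real \<times> (real^'d)"
   show "(\<lambda>k. F' (1 / real (Suc k)) z) \<longlonglongrightarrow> a z + b z"
   proof (cases "z \<in> A")
    case True
    have "(\<lambda>k. 1 / real (Suc k)) \<longlonglongrightarrow> 0" by (rule LIMSEQ_Suc[OF lim_1_over_n])
    then have "(\<lambda>k. q (1 / real (Suc k)) z) \<longlonglongrightarrow> max 0 (u z - 0) / u z"
     unfolding q_def using upos[OF True] by (intro tendsto_intros) auto
    then have "(\<lambda>k. q (1 / real (Suc k)) z) \<longlonglongrightarrow> 1" using upos[OF True] by simp
    then have "(\<lambda>k. F' (1 / real (Suc k)) z) \<longlonglongrightarrow> (2 * 1 - 1^2) * a z + 1^2 * b z"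
     unfolding F'_def by (intro tendsto_intros)
    then show ?thesis by simp
   next
    case False
    then have "a z = 0 \<and> b z = 0"
     using K(2) \<psi>(4,5)[of z] uJ0[of z] by (cases "z \<in> K") (auto simp: a_def b_def)
    then show ?thesis by (simp add: F'_def)
   qed
  qed
  show "AE z in lborel. norm (F' (1 / real (Suc k)) z) \<le> \<bar>a z\<bar> + \<bar>b z\<bar>" for k
  proof (rule AE_I2)
   fix z :: "real \<times> (real^'d)"
   let ?q = "q (1 / real (Suc k)) z"
   have q: "0 \<le> ?q" "?q \<le> 1" by (auto intro!: q01)
   have "0 \<le> 2 * ?q - ?q^2" "2 * ?q - ?q^2 \<le> 1"
    using q mult_left_mono[of ?q 2 ?q] zero_le_power2[of "1 - ?q"] by (auto simp: power2_eq_square algebra_simps)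
   then have "\<bar>(2 * ?q - ?q^2) * a z\<bar> \<le> \<bar>a z\<bar>" by (simp add: abs_mult mult_left_le_one_le)
   moreover have "\<bar>?q^2 * b z\<bar> \<le> \<bar>b z\<bar>" using q by (simp add: abs_mult mult_left_le_one_le power_le_one)
   ultimately show "norm (F' (1 / real (Suc k)) z) \<le> \<bar>a z\<bar> + \<bar>b z\<bar>" unfolding F'_def by simp
  qed
  show "F' (1 / real (Suc k)) \<in> borel_measurable lborel" for k
   using borel_measurable_continuous_onI[OF step(1), of "1 / real (Suc k)"] by simp
 qed (use ai bi in \<open>auto intro: borel_measurable_integrable\<close>)
 then have "(LINT z|lborel. a z + b z) = 0" using step(2) by (simp add: LIMSEQ_const_iff)
 then have "(LINT z|lborel. a z) = - (LINT z|lborel. b z)" using ai bi by simp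
 then show "(LINT (t, x)|lborel. (flux \<gamma> n t x \<bullet> i) * \<psi> (t, x)) = - (LINT (t, x)|lborel. diffusion \<gamma> (n t x) * \<psi>' (t, x))"
  by (simp add: a_def b_def J_def u_def case_prod_unfold)
 show "integrable lborel (\<lambda>(t, x). (flux \<gamma> n t x \<bullet> i) * \<psi> (t, x))" "integrable lborel (\<lambda>(t, x). diffusion \<gamma> (n t x) * \<psi>' (t, x))"
  using ai bi by (simp_all add: a_def[abs_def] b_def[abs_def] J_def u_def case_prod_unfold)
qed

text \<open>The primitive of a smooth bump is constant on both sides of the unit interval.
  Differences of two translates, with supports of the bumps moved to different times, are the time
  cutoffs in the proof of mass conservation.\<close>

lemma ex_step_function:
 obtains B :: "real => real" and c where
  "\<And>s. DERIV B s :> flat 1 s * flat 1 (1 - s)" "\<And>s. s \<le> 0 ==> B s = 0" "\<And>s. 1 \<le> s ==> B s = c"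
proof -
 define b where "b s = flat 1 s * flat 1 (1 - s)" for s
 have bc: "continuous_on X b" for X
  unfolding b_def
  by (rule continuous_on_mult[OF continuous_on_flat continuous_on_compose2[OF continuous_on_flat[of UNIV]]])
    (auto intro!: continuous_intros)
 have b0: "b s = 0" if "s \<le> 0 \<or> 1 \<le> s" for s using that by (auto simp: b_def flat_eq_0)
 \<comment> \<open>Integration starts at -1 rather than at 0, so that every nonnegative
   \<open>s\<close> is an interior point of the interval and the derivative is two-sided
   there.\<close>
 define B where "B s = integral {-1..s} b" for s
 have B0: "B s = 0" if "s \<le> 0" for s
  unfolding B_def using that by (intro integral_unique has_integral_is_0 b0) simp
 have B1: "B s = B 1" if "1 \<le> s" for s
 proof -
  have "integral {-1..1} b + integral {1..s} b = integral {-1..s} b"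
   using that by (intro Henstock_Kurzweil_Integration.integral_combine integrable_continuous_real bc) auto
  moreover have "integral {1..s} b = 0" by (intro integral_unique has_integral_is_0 b0) simp
  ultimately show ?thesis by (simp add: B_def)
 qed
 have dB: "DERIV B s :> b s" for s
 proof (cases "s < 0")
  case True
  have "\<forall>\<^sub>F y in nhds s. B y = 0"
   using order_tendstoD(2)[OF filterlim_ident True] by eventually_elim (simp add: B0)
  from DERIV_cong_ev[OF refl this refl] show ?thesis using True by (simp add: b0)
 next
  case False
  have "(B has_real_derivative b s) (at s within {-1..s + 1})"
   unfolding B_def using False by (intro integral_has_real_derivative bc) auto
  then show ?thesis using False at_within_Icc_at[of "-1" s "s + 1"] by simp
 qed
 show ?thesis by (rule that[OF dB[unfolded b_def] B0 B1])
qed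

text \<open>\<open>k\<close> stands for the inverse square of the radius of the support. The value
  at the origin is \<open>exp (- 1)\<close>; the function is not normalised.\<close>

definition cutoff :: "real => 'a::euclidean_space => real" where
 "cutoff k x = flat 1 (1 - k * (norm x)^2)"

definition cutoff1 :: "real => 'a::euclidean_space => 'a => real" where
 "cutoff1 k i x = - 2 * k * (x \<bullet> i) * flat (flat_deriv 1) (1 - k * (norm x)^2)"

definition cutoff2 :: "real => 'a::euclidean_space => 'a => real" where
 "cutoff2 k i x = 4 * k^2 * (x \<bullet> i)^2 * flat (flat_deriv (flat_deriv 1)) (1 - k * (norm x)^2) - 2 * k * flat (flat_deriv 1) (1 - k * (norm x)^2)"

lemma cutoff_line:
 shows "DERIV (\<lambda>s. cutoff k (x + s *\<^sub>R i)) 0 :> cutoff1 k i x"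
  and "i \<in> Basis ==> DERIV (\<lambda>s. cutoff1 k i (x + s *\<^sub>R i)) 0 :> cutoff2 k i x"
proof -
 have fl: "((\<lambda>s. flat p (1 - k * (norm (x + s *\<^sub>R i))^2)) has_real_derivative
  - 2 * k * (x \<bullet> i) * flat (flat_deriv p) (1 - k * (norm x)^2)) (at 0)" for p
  using flat_line[of p 1 k x i 0] by simp
 from fl[of 1] show "DERIV (\<lambda>s. cutoff k (x + s *\<^sub>R i)) 0 :> cutoff1 k i x"
  by (simp add: cutoff_def cutoff1_def)
 assume i: "i \<in> Basis"
 have "DERIV (\<lambda>s. - 2 * k * ((x + s *\<^sub>R i) \<bullet> i)) 0 :> - 2 * k"
  using i by (auto intro!: derivative_eq_intros simp: inner_add_left)
 from DERIV_mult[OF this fl[of "flat_deriv 1"]]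
 show "DERIV (\<lambda>s. cutoff1 k i (x + s *\<^sub>R i)) 0 :> cutoff2 k i x"
  by (simp add: cutoff1_def cutoff2_def power2_eq_square algebra_simps)
qed

lemma continuous_on_cutoff: "continuous_on A (cutoff k)" "continuous_on A (cutoff1 k i)" "continuous_on A (cutoff2 k i)"
proof -
 have "continuous_on A (\<lambda>x. flat p (1 - k * (norm x)^2))" for p
  by (rule continuous_on_compose2[OF continuous_on_flat[of UNIV]]) (auto intro!: continuous_intros)
 then show "continuous_on A (cutoff k)" "continuous_on A (cutoff1 k i)" "continuous_on A (cutoff2 k i)"
  unfolding cutoff_def[abs_def] cutoff1_def[abs_def] cutoff2_def[abs_def] by (auto intro!: continuous_intros)
qed

lemma cutoff_eq_0:
 assumes "1 \<le> k * (norm x)^2"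
 shows "cutoff k x = 0" "cutoff1 k i x = 0" "cutoff2 k i x = 0"
 using assms by (simp_all add: cutoff_def cutoff1_def cutoff2_def flat_eq_0)

text \<open>Inside the support \<open>k * (x \<bullet> i)^2\<close> is at most 1, so the factor
  \<open>k^2\<close> in the first summand of \<open>cutoff2\<close> costs only one power of
  \<open>k\<close>.\<close>

lemma cutoff2_bound: "\<exists>C. \<forall>k x. \<forall>i\<in>Basis. 0 \<le> k \<longrightarrow> \<bar>cutoff2 k i (x::'a::euclidean_space)\<bar> \<le> C * k"
proof -
 have "\<exists>M. \<forall>s\<le>1. \<bar>flat p s\<bar> \<le> M" for p
 proof -
  have "bounded (flat p ` {0..1})"
   by (intro compact_imp_bounded compact_continuous_image continuous_on_flat) simp
  then obtain M where "\<forall>s\<in>{0..1}. \<bar>flat p s\<bar> \<le> M" by (auto simp: bounded_iff)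
  then have M: "\<bar>flat p s\<bar> \<le> M" if "s \<in> {0..1}" for s using that by blast
  have "\<bar>flat p s\<bar> \<le> M" if "s \<le> 1" for s
   using M[of s] M[of 0] that by (cases "0 \<le> s") (auto simp: flat_eq_0)
  then show ?thesis by blast
 qed
 then obtain M1 M2 where M: "\<And>s. s \<le> 1 ==> \<bar>flat (flat_deriv 1) s\<bar> \<le> M1" "\<And>s. s \<le> 1 ==> \<bar>flat (flat_deriv (flat_deriv 1)) s\<bar> \<le> M2"
  by metis
 have "\<bar>cutoff2 k i x\<bar> \<le> (4 * M2 + 2 * M1) * k" if k: "0 \<le> k" and i: "i \<in> Basis" for k i and x :: 'a
 proof (cases "1 \<le> k * (norm x)^2")
  case True
  have "0 \<le> M1" "0 \<le> M2" using M[of 0] by (auto simp: flat_eq_0)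
  then show ?thesis using True k by (simp add: cutoff_eq_0)
 next
  case False
  let ?s = "1 - k * (norm x)^2"
  have s: "?s \<le> 1" using k by simp
  have "\<bar>x \<bullet> i\<bar>^2 \<le> (norm x)^2" using i Basis_le_norm[of i x] by (intro power_mono) auto
  then have "k * (x \<bullet> i)^2 \<le> 1" using False k mult_left_mono[of "(x \<bullet> i)^2" "(norm x)^2" k] by simp
  then have "k * (k * (x \<bullet> i)^2) * \<bar>flat (flat_deriv (flat_deriv 1)) ?s\<bar> \<le> k * 1 * M2"
   using M(2)[OF s] k by (intro mult_mono mult_left_mono) auto
  moreover have "k * \<bar>flat (flat_deriv 1) ?s\<bar> \<le> k * M1" using M(1)[OF s] k by (intro mult_left_mono)
  moreover have "\<bar>cutoff2 k i x\<bar> \<le> \<bar>4 * k^2 * (x \<bullet> i)^2 * flat (flat_deriv (flat_deriv 1)) ?s\<bar> + \<bar>2 * k * flat (flat_deriv 1) ?s\<bar>"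
   unfolding cutoff2_def by (rule abs_triangle_ineq4)
  ultimately show ?thesis using k by (simp add: abs_mult power2_eq_square algebra_simps)
 qed
 then show ?thesis by blast
qed

lemma test_function_product:
 fixes \<tau> :: "real => real"
 assumes \<tau>: "\<And>j. C_k_on j UNIV \<tau>" and ab: "0 < a" "\<And>t. t \<notin> {a..b} ==> \<tau> t = 0" and R: "0 < R"
 shows "test_function (\<lambda>z::real \<times> (real^'d). \<tau> (fst z) * cutoff (1 / R^2) (snd z))"
proof -
 have "C_k_on j UNIV (\<lambda>z::real \<times> (real^'d). \<tau> (fst z) * cutoff (1 / R^2) (snd z))" for j
 proof -
  have "C_k_on j UNIV (\<lambda>x::real^'d. 1 + (- (1 / R^2)) * (x \<bullet> x))"
   by (intro C_k_on_add C_k_on_mult C_k_on_const C_k_on_inner_self)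
  then have "C_k_on j UNIV (cutoff (1 / R^2) :: real^'d => real)"
   unfolding cutoff_def[abs_def] by (intro C_k_on_flat) (simp add: power2_norm_eq_inner)
  then show ?thesis
   by (intro C_k_on_mult C_k_on_compose_bounded_linear[OF bounded_linear_fst] C_k_on_compose_bounded_linear[OF bounded_linear_snd] \<tau>)
 qed
 moreover have "cutoff (1 / R^2) x = 0" if "x \<notin> cball 0 R" for x :: "real^'d"
 proof (rule cutoff_eq_0(1))
  have "R^2 \<le> (norm x)^2" using that R by (intro power_mono) auto
  then show "1 \<le> 1 / R^2 * (norm x)^2" using R by simp
 qed
 moreover have "\<tau> (fst z) * cutoff (1 / R^2) (snd z) = 0" if "z \<notin> {a..b} \<times> cball 0 R" for z :: "real \<times> (real^'d)"
  using that ab(2)[of "fst z"] calculation(2)[of "snd z"] by (auto simp: mem_Times_iff)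
 moreover have "compact ({a..b} \<times> cball (0::real^'d) R)" "{a..b} \<times> cball (0::real^'d) R \<subseteq> {0<..} \<times> UNIV"
  using ab(1) by (auto intro!: compact_Times)
 ultimately show ?thesis unfolding test_function_def smooth_on_def by blast
qed

section \<open>Integrability on time strips and the flux through large spheres\<close>

lemma strip_integrable:
 fixes n :: "real => 'a::euclidean_space => real"
 assumes nc: "continuous_on ({0<..} \<times> UNIV) (\<lambda>(t, x). n t x)" and nn: "\<And>t x. 0 < t ==> 0 \<le> n t x" and a: "0 < a"
  and int: "\<And>t. 0 < t ==> integrable lborel (n t)" and M: "\<And>t. t \<in> {a..b} ==> (LINT x|lborel. n t x) \<le> M"
 shows "integrable lborel (\<lambda>z. indicator ({a..b} \<times> UNIV) z * (\<lambda>(t, x). n t x) z)"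
proof -
 define f where "f z = indicator ({a..b} \<times> UNIV) z * (\<lambda>(t, x). n t x) z" for z
 have S: "{a..b} \<times> (UNIV::'a set) \<in> sets borel" by (intro borel_closed closed_Times) auto
 have "continuous_on ({a..b} \<times> UNIV) (\<lambda>(t, x). n t x)" using nc a by (auto elim: continuous_on_subset)
 from borel_measurable_continuous_on_indicator[OF S this]
 have fm: "f \<in> borel_measurable borel" by (simp add: f_def[abs_def])
 have f0: "0 \<le> f z" for z using nn a by (auto simp: f_def indicator_def split: prod.split)
 have "(\<integral>\<^sup>+z. ennreal (f z) \<partial>lborel) = (\<integral>\<^sup>+t. \<integral>\<^sup>+x. ennreal (f (t, x)) \<partial>lborel \<partial>lborel)"
  using fm by (subst lborel.nn_integral_fst) (simp_all add: lborel_prod)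
 also have "\<dots> \<le> (\<integral>\<^sup>+t. ennreal (max 0 M) * indicator {a..b} t \<partial>lborel)"
 proof (rule nn_integral_mono)
  fix t :: real
  show "(\<integral>\<^sup>+x. ennreal (f (t, x)) \<partial>lborel) \<le> ennreal (max 0 M) * indicator {a..b} t"
  proof (cases "t \<in> {a..b}")
   case True
   then have "(\<integral>\<^sup>+x. ennreal (f (t, x)) \<partial>lborel) = ennreal (LINT x|lborel. n t x)"
    using a nn int[of t] by (subst nn_integral_eq_integral[symmetric]) (auto simp: f_def)
   then show ?thesis using True M[OF True] by (auto intro: ennreal_leI)
  qed (simp add: f_def)
 qed
 also have "\<dots> < \<infinity>" by (cases "a \<le> b") (simp_all add: nn_integral_cmult_indicator ennreal_mult_less_top)
 finally show ?thesis unfolding f_def[symmetric] by (intro integrableI_nonneg) (use fm f0 in auto)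
qed

lemma strong_solution_lborel:
 fixes n :: "real => real^'d => real"
 assumes sol: "strong_solution \<gamma> n0 n" and reg: "regular_density \<gamma> n" and t: "0 < t"
 shows "continuous_on UNIV (n t)" "integrable lborel (n t)"
  "0 < s ==> (LINT x|lebesgue. \<bar>n t x - n s x\<bar>) = (LINT x|lborel. \<bar>n t x - n s x\<bar>)"
proof -
 have c: "continuous_on UNIV (n t)" if "0 < t" for t
 proof -
  have "continuous_on UNIV (\<lambda>x. (\<lambda>(t, x). n t x) (t, x))"
   by (rule continuous_on_compose2[of "{0<..} \<times> UNIV"])
     (use reg that in \<open>auto simp: regular_density_def intro!: continuous_intros\<close>)
  then show ?thesis by simp
 qed
 show "continuous_on UNIV (n t)" by (rule c[OF t])
 have m: "n t \<in> borel_measurable lborel" if "0 < t" for t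
  using borel_measurable_continuous_onI[OF c[OF that]] by simp
 have "integrable lebesgue (n t)" using sol t by (simp add: strong_solution_def)
 then show "integrable lborel (n t)" using integrable_completion[OF m[OF t]] by simp
 show "(LINT x|lebesgue. \<bar>n t x - n s x\<bar>) = (LINT x|lborel. \<bar>n t x - n s x\<bar>)" if "0 < s"
  using m[OF t] m[OF that] by (intro integral_completion) simp
qed

lemma strong_solution_mass_continuous:
 fixes n :: "real => real^'d => real"
 assumes sol: "strong_solution \<gamma> n0 n" and reg: "regular_density \<gamma> n"
 shows "continuous_on {0<..} (\<lambda>t. LINT x|lborel. n t x)"
 unfolding continuous_on_def
proof
 fix s :: real assume s: "s \<in> {0<..}"
 note int = strong_solution_lborel(2)[OF sol reg]
 have "((\<lambda>t. (LINT x|lborel. n t x) - (LINT x|lborel. n s x)) \<longlongrightarrow> 0) (at s within {0<..})"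
 proof (rule Lim_null_comparison)
  have "((\<lambda>t. LINT x|lebesgue. \<bar>n t x - n s x\<bar>) \<longlongrightarrow> 0) (at s within {0..})"
   using sol s by (simp add: strong_solution_def)
  then show "((\<lambda>t. LINT x|lebesgue. \<bar>n t x - n s x\<bar>) \<longlongrightarrow> 0) (at s within {0<..})"
   by (rule tendsto_within_subset) auto
  have "norm ((LINT x|lborel. n t x) - (LINT x|lborel. n s x)) \<le> (LINT x|lebesgue. \<bar>n t x - n s x\<bar>)" if "0 < t" for t
  proof -
   have "norm ((LINT x|lborel. n t x) - (LINT x|lborel. n s x)) = \<bar>LINT x|lborel. n t x - n s x\<bar>"
    using int[OF that] int[of s] s by simp
   also have "\<dots> \<le> (LINT x|lborel. \<bar>n t x - n s x\<bar>)" by (rule integral_abs_bound)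
   finally show ?thesis using s by (simp add: strong_solution_lborel(3)[OF sol reg that])
  qed
  then show "\<forall>\<^sub>F t in at s within {0<..}. norm ((LINT x|lborel. n t x) - (LINT x|lborel. n s x)) \<le> (LINT x|lebesgue. \<bar>n t x - n s x\<bar>)"
   by (auto simp: eventually_at_filter)
 qed
 then show "((\<lambda>t. LINT x|lborel. n t x) \<longlongrightarrow> (LINT x|lborel. n s x)) (at s within {0<..})" by (rule LIM_zero_cancel)
qed

lemma strong_solution_strip_integrable:
 fixes n :: "real => real^'d => real"
 assumes sol: "strong_solution \<gamma> n0 n" and reg: "regular_density \<gamma> n" and a: "0 < a"
 shows "integrable lborel (\<lambda>z. indicator ({a..b} \<times> UNIV) z * (\<lambda>(t, x). n t x) z)"
proof -
 have "continuous_on {a..b} (\<lambda>t. LINT x|lborel. n t x)"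
  by (rule continuous_on_subset[OF strong_solution_mass_continuous[OF sol reg]]) (use a in auto)
 then have "bounded ((\<lambda>t. LINT x|lborel. n t x) ` {a..b})" by (intro compact_imp_bounded compact_continuous_image) auto
 then obtain M where "\<forall>t\<in>{a..b}. \<bar>LINT x|lborel. n t x\<bar> \<le> M" by (auto simp: bounded_iff)
 then have M: "(LINT x|lborel. n t x) \<le> M" if "t \<in> {a..b}" for t using that by (auto dest!: bspec)
 show ?thesis
  by (rule strip_integrable[OF _ _ a strong_solution_lborel(2)[OF sol reg] M])
    (use sol reg in \<open>auto simp: strong_solution_def regular_density_def\<close>)
qed

abbreviation (input) ball_diffusion :: "real => (real => 'a::euclidean_space => real) => real => real => nat => real \<times> 'a => real" where
 "ball_diffusion \<gamma> n a b k z \<equiv> indicator ({a..b} \<times> cball 0 (real (Suc k))) z * (\<lambda>(t, x). diffusion \<gamma> (n t x)) z"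

text \<open>The diffusion on a ball of radius \<open>R\<close> grows more slowly than
  \<open>R^2\<close>, the factor lost by two derivatives of a cutoff. For \<gamma> > 0 its integral
  over the strip is finite. For \<gamma> < 0 the sublinear power is linearised at the level
  \<open>R powr - d\<close>, which gives growth like \<open>R powr (- d * \<gamma>)\<close> with
  \<open>- d * \<gamma> < 2\<close>.\<close>

lemma diffusion_strip_growth:
 fixes n :: "real => real^'d => real"
 assumes sol: "strong_solution \<gamma> n0 n" and reg: "regular_density \<gamma> n" and g: "-1 < \<gamma>" "\<gamma> \<noteq> 0" "-2 < real CARD('d) * \<gamma>"
  and ab: "0 < a" "a < b"
 obtains e where "e \<longlonglongrightarrow> 0"
  "\<And>k. integrable lborel (\<lambda>z. ball_diffusion \<gamma> n a b k z)"
  "\<And>k. (LINT z|lborel. ball_diffusion \<gamma> n a b k z) \<le> (real (Suc k))^2 * e k"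
proof -
 define u where "u = (\<lambda>(t, x). diffusion \<gamma> (n t x))"
 have nc: "continuous_on ({0<..} \<times> UNIV) (\<lambda>(t, x). n t x)" using reg by (simp add: regular_density_def)
 have nn: "\<And>t x. 0 < t ==> 0 \<le> n t x" using sol by (simp add: strong_solution_def)
 have uc: "continuous_on ({0<..} \<times> UNIV) u"
  unfolding u_def by (rule continuous_on_diffusion_density[OF g(1) nc nn])
 have u0: "0 \<le> u z" for z using g by (simp add: u_def diffusion_nonneg split: prod.split)
 define Q where "Q k = {a..b} \<times> cball (0::real^'d) (real (Suc k))" for k
 have Q: "compact (Q k)" "Q k \<subseteq> {0<..} \<times> UNIV" for k using ab by (auto simp: Q_def intro!: compact_Times)
 have int: "integrable lborel (\<lambda>z. indicator (Q k) z * u z)" for k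
  using borel_integrable_compact[OF Q(1) continuous_on_subset[OF uc Q(2)]] by simp
 show ?thesis
 proof (cases "0 < \<gamma>")
  case True
  have "set_integrable lborel ({a..b} \<times> UNIV) (\<lambda>(t, x). n t x powr (\<gamma> + 1))" using sol True ab by (simp add: strong_solution_def)
  then have "integrable lborel (\<lambda>z. \<gamma> / (\<gamma> + 1) * (indicator ({a..b} \<times> UNIV) z *\<^sub>R (\<lambda>(t, x). n t x powr (\<gamma> + 1)) z))"
   unfolding set_integrable_def by (rule integrable_mult_right)
  then have iu: "integrable lborel (\<lambda>z. indicator ({a..b} \<times> UNIV) z * u z)"
   using True by (simp add: u_def diffusion_def case_prod_unfold mult_ac)
  define U where "U = (LINT z|lborel. indicator ({a..b} \<times> UNIV) z * u z)"
  show ?thesis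
  proof (rule that[of "\<lambda>k. U * real (Suc k) powr - 2"])
   show "(\<lambda>k. U * real (Suc k) powr - 2) \<longlonglongrightarrow> 0" using tendsto_mult[OF tendsto_const tendsto_Suc_powr_0[of 2], of U] by simp
   fix k
   have "(LINT z|lborel. indicator (Q k) z * u z) \<le> U"
    unfolding U_def by (rule integral_mono[OF int iu]) (use u0 in \<open>auto simp: Q_def indicator_def\<close>)
   also have "U = (real (Suc k))^2 * (U * real (Suc k) powr - 2)" by (simp add: powr_minus divide_simps)
   finally show "(LINT z|lborel. ball_diffusion \<gamma> n a b k z)
    \<le> (real (Suc k))^2 * (U * real (Suc k) powr - 2)" by (simp add: Q_def u_def)
  qed (use int in \<open>simp add: Q_def u_def\<close>)
 next
  case False
  define d where "d = real CARD('d)"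
  note i_n = strong_solution_strip_integrable[OF sol reg ab(1), of b]
  define N where "N = (LINT z|lborel. indicator ({a..b} \<times> UNIV) z * (\<lambda>(t, x). n t x) z)"
  define V where "V = (b - a) * unit_ball_vol d"
  define c where "c = \<bar>\<gamma>\<bar> / (\<gamma> + 1)"
  have c: "0 < c" using g by (simp add: c_def)
  have eQ: "emeasure lborel (Q k) = ennreal (V * real (Suc k) powr d)" for k
  proof -
   have "emeasure (lborel \<Otimes>\<^sub>M lborel) ({a..b} \<times> cball (0::real^'d) (real (Suc k))) = emeasure lborel {a..b} * emeasure lborel (cball (0::real^'d) (real (Suc k)))"
    by (intro lborel.emeasure_pair_measure_Times) auto
   also have "\<dots> = ennreal (V * real (Suc k) powr d)"
    using ab by (simp add: emeasure_cball V_def d_def powr_realpow ennreal_mult[symmetric])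
   finally show ?thesis by (simp add: Q_def lborel_prod)
  qed
  have iQ: "integrable lborel (indicat_real (Q k))" "(LINT z|lborel. indicat_real (Q k) z) = V * real (Suc k) powr d" for k
   using eQ[of k] Q(1)[of k] ab by (auto intro!: integrable_real_indicator simp: compact_imp_closed borel_closed measure_def V_def d_def)
  show ?thesis
  proof (rule that[of "\<lambda>k. c * (N + V) * real (Suc k) powr - (2 + d * \<gamma>)"])
   show "(\<lambda>k. c * (N + V) * real (Suc k) powr - (2 + d * \<gamma>)) \<longlonglongrightarrow> 0"
    using tendsto_mult[OF tendsto_const tendsto_Suc_powr_0[of "2 + d * \<gamma>"], of "c * (N + V)"] g by (simp add: d_def)
   fix k
   define l where "l = real (Suc k) powr - d"
   have l: "0 < l" by (simp add: l_def)
   have "(LINT z|lborel. indicator (Q k) z * u z)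
    \<le> (LINT z|lborel. c * l powr \<gamma> * (indicator ({a..b} \<times> UNIV) z * (\<lambda>(t, x). n t x) z + l * indicator (Q k) z))"
   proof (rule integral_mono[OF int])
    show "integrable lborel (\<lambda>z. c * l powr \<gamma> * (indicator ({a..b} \<times> UNIV) z * (\<lambda>(t, x). n t x) z + l * indicator (Q k) z))"
     by (intro integrable_mult_right Bochner_Integration.integrable_add i_n iQ)
    fix z :: "real \<times> (real^'d)"
    obtain t x where z: "z = (t, x)" by force
    show "indicator (Q k) z * u z \<le> c * l powr \<gamma> * (indicator ({a..b} \<times> UNIV) z * (\<lambda>(t, x). n t x) z + l * indicator (Q k) z)"
    proof (cases "z \<in> Q k")
     case True
     then have t: "t \<in> {a..b}" "0 < t" using ab by (auto simp: Q_def z)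
     have "n t x powr (\<gamma> + 1) \<le> l powr ((\<gamma> + 1) - 1) * (n t x + l)"
      using nn[OF t(2)] l g False by (intro powr_le_affine) auto
     then have "c * n t x powr (\<gamma> + 1) \<le> c * (l powr \<gamma> * (n t x + l))" using c by (intro mult_left_mono) auto
     then show ?thesis using True t by (simp add: z u_def diffusion_def c_def)
    next
     case False
     then show ?thesis using c nn ab by (auto simp: z indicator_def intro!: mult_nonneg_nonneg)
    qed
   qed
   also have "\<dots> = c * l powr \<gamma> * (N + l * (V * real (Suc k) powr d))"
    using i_n iQ by (simp add: N_def)
   also have "l * (V * real (Suc k) powr d) = V" by (simp add: l_def powr_minus divide_simps)
   also have "c * l powr \<gamma> * (N + V) = (real (Suc k))^2 * (c * (N + V) * real (Suc k) powr - (2 + d * \<gamma>))"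
   proof -
    have "(real (Suc k))^2 * real (Suc k) powr - (2 + d * \<gamma>) = real (Suc k) powr (2 + - (2 + d * \<gamma>))"
     by (subst powr_add) simp
    also have "\<dots> = l powr \<gamma>" by (simp add: l_def powr_powr)
    finally show ?thesis by (simp add: mult_ac)
   qed
   finally show "(LINT z|lborel. ball_diffusion \<gamma> n a b k z)
    \<le> (real (Suc k))^2 * (c * (N + V) * real (Suc k) powr - (2 + d * \<gamma>))" by (simp add: Q_def u_def)
  qed (use int in \<open>simp add: Q_def u_def\<close>)
 qed
qed


text \<open>The distributional equation is tested with a time cutoff times a spatial cutoff of
  radius \<open>R\<close>. After one more integration by parts, two derivatives fall on the spatial
  cutoff and contribute \<open>R^-2\<close>, so the flux term is bounded by a multiple of
  \<open>e k\<close> and disappears in the limit.\<close>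

lemma mass_conservation_weak:
 fixes n :: "real => real^'d => real"
 assumes sol: "strong_solution \<gamma> n0 n" and reg: "regular_density \<gamma> n" and g: "-1 < \<gamma>" "\<gamma> \<noteq> 0" "-2 < real CARD('d) * \<gamma>"
  and \<tau>: "\<And>j. C_k_on j UNIV \<tau>" "\<And>t. DERIV \<tau> t :> \<tau>' t" "continuous_on UNIV \<tau>'"
  and ab: "0 < a" "a < b" "\<And>t. t \<notin> {a..b} ==> \<tau> t = 0" "\<And>t. t \<notin> {a..b} ==> \<tau>' t = 0"
 shows "(LINT t|lborel. \<tau>' t * (LINT x|lborel. n t x)) = 0"
proof -
 obtain nt n1 n2 where pme: "pme_solution \<gamma> n nt n1 n2"
  and diff: "\<And>t x. 0 < t ==> 0 < n t x ==> n t differentiable (at x)"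
  by (rule strong_solution_pme[OF sol reg g(1,2)]) blast
 obtain e where e: "e \<longlonglongrightarrow> 0"
  "\<And>k. integrable lborel (\<lambda>z. ball_diffusion \<gamma> n a b k z)"
  "\<And>k. (LINT z|lborel. ball_diffusion \<gamma> n a b k z) \<le> (real (Suc k))^2 * e k"
  by (rule diffusion_strip_growth[OF sol reg g ab(1,2)]) blast
 obtain C where C: "\<And>k x i. i \<in> Basis ==> 0 \<le> k ==> \<bar>cutoff2 k i (x::real^'d)\<bar> \<le> C * k" using cutoff2_bound by blast
 have \<tau>c: "continuous_on UNIV \<tau>" using \<tau>(1)[of 0] by simp
 have "bounded (\<tau> ` {a..b})" "bounded (\<tau>' ` {a..b})"
  by (intro compact_imp_bounded compact_continuous_image continuous_on_subset[OF \<tau>c] continuous_on_subset[OF \<tau>(3)]; simp)+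
 then obtain T T' where "\<forall>t\<in>{a..b}. \<bar>\<tau> t\<bar> \<le> T" "\<forall>t\<in>{a..b}. \<bar>\<tau>' t\<bar> \<le> T'" by (auto simp: bounded_iff)
 then have T: "\<bar>\<tau> t\<bar> \<le> T" "\<bar>\<tau>' t\<bar> \<le> T'" if "t \<in> {a..b}" for t using that by auto
 have T0: "0 \<le> T" using T(1)[of a] ab by auto
 define f where "f z = (\<lambda>(t, x). n t x) z * \<tau>' (fst z)" for z
 define L where "L k = (LINT z|lborel. f z * cutoff (1 / (real (Suc k))^2) (snd z))" for k
 have small: "\<bar>L k\<bar> \<le> real CARD('d) * T * C * e k" for k
 proof -
  define R where "R = real (Suc k)"
  define \<kappa> where "\<kappa> = 1 / R^2"
  have R: "0 < R" "0 < \<kappa>" "\<kappa> * R^2 = 1" by (simp_all add: R_def \<kappa>_def)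
  define K where "K = {a..b} \<times> cball (0::real^'d) R"
  have K: "compact K" "K \<subseteq> {0<..} \<times> UNIV" using ab by (auto simp: K_def intro!: compact_Times)
  define \<phi> where "\<phi> z = \<tau> (fst z) * cutoff \<kappa> (snd z)" for z :: "real \<times> (real^'d)"
  define \<psi> where "\<psi> i z = \<tau> (fst z) * cutoff1 \<kappa> i (snd z)" for i and z :: "real \<times> (real^'d)"
  define \<psi>' where "\<psi>' i z = \<tau> (fst z) * cutoff2 \<kappa> i (snd z)" for i and z :: "real \<times> (real^'d)"
  have test: "test_function \<phi>"
   unfolding \<phi>_def \<kappa>_def by (rule test_function_product[OF \<tau>(1) ab(1,3) R(1)])
  have out: "1 \<le> \<kappa> * (norm x)^2" if "x \<notin> cball 0 R" for x :: "real^'d"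
  proof -
   have "R^2 \<le> (norm x)^2" using that R by (intro power_mono) auto
   then have "\<kappa> * R^2 \<le> \<kappa> * (norm x)^2" using R by (intro mult_left_mono) auto
   then show ?thesis using R by simp
  qed
  have \<psi>0: "\<psi> i z = 0" "\<psi>' i z = 0" if "z \<notin> K" for i z
   using that ab(3)[of "fst z"] cutoff_eq_0(2,3)[OF out[of "snd z"]] by (auto simp: K_def mem_Times_iff \<psi>_def \<psi>'_def)
  have \<psi>c: "continuous_on UNIV (\<psi> i)" "continuous_on UNIV (\<psi>' i)" for i
  proof -
   have 1: "continuous_on UNIV (\<lambda>z::real \<times> (real^'d). \<tau> (fst z))"
    by (rule continuous_on_compose2[OF \<tau>c]) (auto intro!: continuous_intros)
   have 2: "continuous_on UNIV (\<lambda>z::real \<times> (real^'d). h (snd z))" if "continuous_on UNIV h" for h :: "real^'d => real"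
    by (rule continuous_on_compose2[OF that]) (auto intro!: continuous_intros)
   show "continuous_on UNIV (\<psi> i)" "continuous_on UNIV (\<psi>' i)"
    unfolding \<psi>_def[abs_def] \<psi>'_def[abs_def] by (intro continuous_on_mult 1 2 continuous_on_cutoff)+
  qed
  have \<psi>line: "DERIV (\<lambda>s. \<psi> i (z + s *\<^sub>R (0, i))) 0 :> \<psi>' i z" if "i \<in> Basis" for i z
   using DERIV_cmult[OF cutoff_line(2)[OF that], of "\<tau> (fst z)" \<kappa> "snd z"] by (simp add: \<psi>_def \<psi>'_def)
  have flux: "set_integrable lborel K (\<lambda>(t, x). flux \<gamma> n t x)" using sol K by (simp add: strong_solution_def)
  note ibp = flux_integral_by_parts[OF pme g(1,2) diff K flux \<psi>c \<psi>line \<psi>0]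
  have dt: "deriv (\<lambda>s. \<phi> (s, x)) t = \<tau>' t * cutoff \<kappa> x" for t x
   unfolding \<phi>_def by (rule DERIV_imp_deriv) (simp add: DERIV_cmult_right[OF \<tau>(2)])
  have dx: "grad (\<lambda>y. \<phi> (t, y)) x = (\<Sum>i\<in>Basis. \<psi> i (t, x) *\<^sub>R i)" for t x
  proof -
   have 1: "(\<lambda>y. \<phi> (t, y)) differentiable (at x)" by (rule test_function_differentiable[OF test])
   have 2: "DERIV (\<lambda>s. \<phi> (t, x + s *\<^sub>R i)) 0 :> \<psi> i (t, x)" for i
    using DERIV_cmult[OF cutoff_line(1)] by (simp add: \<phi>_def \<psi>_def)
   show ?thesis by (rule grad_eq[OF GDERIV_line[OF 1 2]])
  qed
  have "L k = (LINT (t, x)|lborel. n t x * deriv (\<lambda>s. \<phi> (s, x)) t)"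
   unfolding L_def f_def dt by (simp add: \<kappa>_def R_def case_prod_unfold mult_ac)
  also have "\<dots> = (LINT (t, x)|lborel. flux \<gamma> n t x \<bullet> grad (\<lambda>y. \<phi> (t, y)) x)" by (rule strong_solution_weak[OF sol test])
  also have "\<dots> = (LINT z|lborel. (\<Sum>i\<in>Basis. (\<lambda>(t, x). (flux \<gamma> n t x \<bullet> i) * \<psi> i (t, x)) z))"
   unfolding dx by (simp add: inner_sum_right case_prod_unfold mult.commute)
  also have "\<dots> = (\<Sum>i\<in>Basis. LINT (t, x)|lborel. (flux \<gamma> n t x \<bullet> i) * \<psi> i (t, x))"
   by (rule Bochner_Integration.integral_sum) (rule ibp(1))
  also have "\<dots> = (\<Sum>i\<in>Basis. - (LINT (t, x)|lborel. diffusion \<gamma> (n t x) * \<psi>' i (t, x)))"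
   by (intro sum.cong refl ibp(3))
  finally have "\<bar>L k\<bar> \<le> (\<Sum>i\<in>(Basis::(real^'d) set). \<bar>LINT (t, x)|lborel. diffusion \<gamma> (n t x) * \<psi>' i (t, x)\<bar>)"
   using sum_abs[of "\<lambda>i. - (LINT (t, x)|lborel. diffusion \<gamma> (n t x) * \<psi>' i (t, x))" Basis] by simp
  also have "\<dots> \<le> (\<Sum>i\<in>(Basis::(real^'d) set). T * C * e k)"
  proof (rule sum_mono)
   fix i :: "real^'d" assume i: "i \<in> Basis"
   have C0: "0 \<le> C * \<kappa>" using C[OF i, of \<kappa> 0] R by auto
   have "\<bar>LINT (t, x)|lborel. diffusion \<gamma> (n t x) * \<psi>' i (t, x)\<bar> \<le> (LINT z|lborel. \<bar>(\<lambda>(t, x). diffusion \<gamma> (n t x) * \<psi>' i (t, x)) z\<bar>)"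
    by (rule integral_abs_bound)
   also have "\<dots> \<le> (LINT z|lborel. T * (C * \<kappa>) * (ball_diffusion \<gamma> n a b k z))"
   proof (rule integral_mono)
    show "integrable lborel (\<lambda>z. \<bar>(\<lambda>(t, x). diffusion \<gamma> (n t x) * \<psi>' i (t, x)) z\<bar>)" by (intro integrable_abs ibp(2) i)
    show "integrable lborel (\<lambda>z. T * (C * \<kappa>) * (ball_diffusion \<gamma> n a b k z))"
     by (intro integrable_mult_right e)
    fix z :: "real \<times> (real^'d)"
    obtain t x where z: "z = (t, x)" by force
    have u0: "0 \<le> diffusion \<gamma> (n t x)" using g by (simp add: diffusion_nonneg)
    show "\<bar>(\<lambda>(t, x). diffusion \<gamma> (n t x) * \<psi>' i (t, x)) z\<bar>
     \<le> T * (C * \<kappa>) * (ball_diffusion \<gamma> n a b k z)"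
    proof (cases "z \<in> K")
     case True
     then have "\<bar>\<psi>' i (t, x)\<bar> \<le> T * (C * \<kappa>)"
      using T(1)[of t] C[OF i, of \<kappa> x] R T0 by (auto simp: K_def z \<psi>'_def abs_mult intro!: mult_mono)
     from mult_left_mono[OF this u0] show ?thesis using True u0 by (simp add: z K_def R_def abs_mult mult_ac)
    next
     case False
     then show ?thesis using \<psi>0[OF False] T0 C0 u0 by (auto simp: z indicator_def)
    qed
   qed
   also have "\<dots> = T * (C * \<kappa>) * (LINT z|lborel. ball_diffusion \<gamma> n a b k z)" by simp
   also have "\<dots> \<le> T * (C * \<kappa>) * ((real (Suc k))^2 * e k)" using T0 C0 by (intro mult_left_mono e) auto
   also have "\<dots> = T * C * e k" by (simp add: \<kappa>_def R_def)
   finally show "\<bar>LINT (t, x)|lborel. diffusion \<gamma> (n t x) * \<psi>' i (t, x)\<bar> \<le> T * C * e k" .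
  qed
  finally show ?thesis by (simp add: mult_ac)
 qed
 have "(\<lambda>k. real CARD('d) * T * C * e k) \<longlonglongrightarrow> real CARD('d) * T * C * 0" by (intro tendsto_intros e)
 then have L0: "L \<longlonglongrightarrow> 0" using small by (intro Lim_null_comparison[of L "\<lambda>k. real CARD('d) * T * C * e k"]) auto
 define s where "s z = indicator ({a..b} \<times> UNIV) z * (\<lambda>(t, x). n t x) z" for z
 have si: "integrable lborel s"
  unfolding s_def by (rule strong_solution_strip_integrable[OF sol reg ab(1)])
 have fs: "f z = s z * \<tau>' (fst z)" for z
  using ab(4)[of "fst z"] by (cases z) (auto simp: f_def s_def indicator_def)
 have fsta: "(\<lambda>z::real \<times> (real^'d). \<tau>' (fst z)) \<in> borel_measurable lborel"
  using borel_measurable_continuous_onI[OF continuous_on_compose2[OF \<tau>(3) continuous_on_fst[OF continuous_on_id[of UNIV]]]] by simp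
 have bound: "\<bar>f z\<bar> \<le> T' * \<bar>s z\<bar>" for z
  using T(2)[of "fst z"] by (cases z) (auto simp: fs s_def indicator_def abs_mult mult.commute intro!: mult_right_mono)
 have fi: "integrable lborel f"
 proof (rule Bochner_Integration.integrable_bound[OF integrable_mult_right[OF integrable_abs[OF si], of T']])
  show "f \<in> borel_measurable lborel" unfolding fs[abs_def] using si fsta by (intro borel_measurable_times) auto
  have "norm (f z) \<le> norm (T' * \<bar>s z\<bar>)" for z using bound[of z] by simp
  then show "AE z in lborel. norm (f z) \<le> norm (T' * \<bar>s z\<bar>)" by (intro AE_I2)
 qed
 \<comment> \<open>The spatial cutoffs converge to their central value \<open>flat 1 1\<close>
   rather than to 1. This positive factor is divided out once the limit is known to be 0.\<close>
 have "L \<longlonglongrightarrow> (LINT z|lborel. f z * flat 1 1)"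
  unfolding L_def
 proof (rule integral_dominated_convergence[where w = "\<lambda>z. \<bar>f z\<bar> * flat 1 1"])
  have cm: "(\<lambda>z::real \<times> (real^'d). cutoff k (snd z)) \<in> borel_measurable lborel" for k
   using borel_measurable_continuous_onI[OF continuous_on_compose2[OF continuous_on_cutoff(1)[of UNIV] continuous_on_snd[OF continuous_on_id[of UNIV]]]] by simp
  show "(\<lambda>z. f z * cutoff (1 / (real (Suc k))^2) (snd z)) \<in> borel_measurable lborel" for k
   using fi cm by (intro borel_measurable_times) auto
  show "AE z in lborel. (\<lambda>k. f z * cutoff (1 / (real (Suc k))^2) (snd z)) \<longlonglongrightarrow> f z * flat 1 1"
  proof (intro AE_I2 tendsto_mult tendsto_const)
   fix z :: "real \<times> (real^'d)"
   have "(\<lambda>k. real (Suc k) powr - 2) \<longlonglongrightarrow> 0" by (rule tendsto_Suc_powr_0) simp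
   then have "(\<lambda>k. 1 / (real (Suc k))^2) \<longlonglongrightarrow> 0" by (simp add: powr_minus divide_inverse)
   then have "(\<lambda>k. 1 - 1 / (real (Suc k))^2 * (norm (snd z))^2) \<longlonglongrightarrow> 1 - 0 * (norm (snd z))^2" by (intro tendsto_intros)
   then have "(\<lambda>k. flat 1 (1 - 1 / (real (Suc k))^2 * (norm (snd z))^2)) \<longlonglongrightarrow> flat 1 (1 - 0 * (norm (snd z))^2)"
    by (rule continuous_on_tendsto_compose[OF continuous_on_flat[of UNIV]]) auto
   then show "(\<lambda>k. cutoff (1 / (real (Suc k))^2) (snd z)) \<longlonglongrightarrow> flat 1 1" by (simp add: cutoff_def)
  qed
  show "AE z in lborel. norm (f z * cutoff (1 / (real (Suc k))^2) (snd z)) \<le> \<bar>f z\<bar> * flat 1 1" for k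
   by (auto simp: abs_mult cutoff_def flat_nonneg intro!: mult_left_mono flat_1_mono AE_I2)
 qed (use fi in \<open>auto intro!: integrable_mult_left\<close>)
 then have "(LINT z|lborel. f z * flat 1 1) = 0" using L0 LIMSEQ_unique by blast
 then have "(LINT z|lborel. f z) = 0" using flat_pos_iff[of 1] by simp
 also have "(LINT z|lborel. f z) = (LINT t|lborel. LINT x|lborel. f (t, x))"
  using lborel_pair.integral_fst'[of f] fi by (simp add: lborel_prod)
 finally show ?thesis by (simp add: f_def mult.commute)
qed

text \<open>The argument of du Bois-Reymond: with \<open>\<tau>'\<close> the difference of two
  mollifiers concentrated just after \<open>t1\<close> and \<open>t2\<close>, the weak statement
  says that two local averages of the mass coincide, and continuity of the mass lets the averages
  shrink to point values.\<close>

lemma mass_conservation: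
 fixes n :: "real => real^'d => real"
 assumes sol: "strong_solution \<gamma> n0 n" and reg: "regular_density \<gamma> n" and g: "-1 < \<gamma>" "\<gamma> \<noteq> 0" "-2 < real CARD('d) * \<gamma>"
 shows "\<exists>m. \<forall>t>0. integrable lborel (n t) \<and> (LINT x|lborel. n t x) = m"
proof -
 define I where "I t = (LINT x|lborel. n t x)" for t
 have Ic: "continuous_on {0<..} I" unfolding I_def by (rule strong_solution_mass_continuous[OF sol reg])
 have const: "I t1 = I t2" if t: "0 < t1" "t1 < t2" for t1 t2
 proof -
  define b where "b s = flat 1 s * flat 1 (1 - s)" for s
  have bc: "continuous_on X b" for X
   unfolding b_def
   by (rule continuous_on_mult[OF continuous_on_flat continuous_on_compose2[OF continuous_on_flat[of UNIV]]])
     (auto intro!: continuous_intros)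
  have b0: "b s = 0" if "s \<notin> {0..1}" for s using that by (auto simp: b_def flat_eq_0)
  have bnn: "0 \<le> b s" for s by (simp add: b_def flat_nonneg)
  obtain B c where B: "\<And>s. DERIV B s :> b s" "\<And>s. s \<le> 0 ==> B s = 0" "\<And>s. 1 \<le> s ==> B s = c"
   unfolding b_def by (rule ex_step_function) blast
  have close: "\<exists>e>0. \<forall>t. s \<le> t \<longrightarrow> t \<le> s + e \<longrightarrow> \<bar>I t - I s\<bar> \<le> \<epsilon>" if "0 < s" "0 < \<epsilon>" for s \<epsilon>
  proof -
   have "\<exists>d>0. \<forall>t\<in>{0<..}. dist t s < d \<longrightarrow> dist (I t) (I s) < \<epsilon>"
    using Ic that unfolding continuous_on_iff by auto
   then obtain d where "d > 0" "\<And>t. 0 < t ==> \<bar>t - s\<bar> < d ==> \<bar>I t - I s\<bar> < \<epsilon>" by (auto simp: dist_real_def)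
   then show ?thesis using that by (intro exI[of _ "d / 2"]) (auto intro!: less_imp_le)
  qed
  have est: "\<bar>I t1 - I t2\<bar> \<le> 2 * \<epsilon>" if \<epsilon>: "0 < \<epsilon>" for \<epsilon>
  proof -
   obtain e1 e2 where e: "0 < e1" "\<And>t. t1 \<le> t ==> t \<le> t1 + e1 ==> \<bar>I t - I t1\<bar> \<le> \<epsilon>"
    "0 < e2" "\<And>t. t2 \<le> t ==> t \<le> t2 + e2 ==> \<bar>I t - I t2\<bar> \<le> \<epsilon>"
    using close[OF t(1) \<epsilon>] close[OF _ \<epsilon>, of t2] t by auto
   \<comment> \<open>The bound by 1 keeps both mollifiers inside the interval from \<open>t1\<close>
     to \<open>t2 + 1\<close>; the bounds \<open>e1\<close> and \<open>e2\<close> make the mass vary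
     by at most \<epsilon> on their supports.\<close>
   define \<eta> where "\<eta> = Min {1, e1, e2}"
   have \<eta>: "0 < \<eta>" "\<eta> \<le> 1" "\<eta> \<le> e1" "\<eta> \<le> e2" using e by (auto simp: \<eta>_def)
   define \<beta> where "\<beta> s t = b ((t - s) / \<eta>)" for s t
   have \<beta>0: "\<beta> s t = 0" if "t \<notin> {s..s + \<eta>}" for s t
    using that \<eta> by (auto simp: \<beta>_def field_simps intro!: b0)
   have \<beta>c: "continuous_on UNIV (\<beta> s)" for s
    unfolding \<beta>_def by (rule continuous_on_compose2[OF bc]) (use \<eta>(1) in \<open>auto intro!: continuous_intros\<close>)
   have \<beta>nn: "0 \<le> \<beta> s t" for s t by (simp add: \<beta>_def bnn)
   have \<beta>i: "integrable lborel (\<beta> s)" for s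
    by (rule integrable_continuous_support[OF \<beta>c, of "\<bar>s\<bar> + 1"]) (use \<eta> in \<open>auto intro!: \<beta>0\<close>)
   define S where "S = (LINT t|lborel. \<beta> 0 t)"
   have S: "(LINT t|lborel. \<beta> s t) = S" for s
    using lborel_integral_translate[of "\<beta> 0" "- s"] borel_measurable_continuous_onI[OF \<beta>c[of 0]] by (simp add: S_def \<beta>_def)
   have S0: "0 < S"
   proof (rule ccontr)
    assume "\<not> 0 < S"
    moreover have "0 \<le> S" unfolding S_def by (intro Bochner_Integration.integral_nonneg \<beta>nn)
    ultimately have "S = 0" by simp
    have "\<beta> 0 (\<eta> / 2) = (\<lambda>_. 0) (\<eta> / 2)"
    proof (rule eq_of_integral_le[where g = "\<beta> 0"])
     show "(\<integral>\<^sup>+ x. ennreal (\<beta> 0 x) \<partial>lborel) \<le> ennreal (LINT x|(lborel :: real measure). 0)"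
      using \<open>S = 0\<close> nn_integral_eq_integral[OF \<beta>i[of 0]] \<beta>nn by (simp add: S_def)
    qed (use \<beta>c \<beta>nn in auto)
    moreover have "0 < b (1 / 2)" by (simp add: b_def flat_pos_iff)
    ultimately show False using \<eta> by (simp add: \<beta>_def)
   qed
   \<comment> \<open>Both mollifiers have the same integral, so the primitive \<open>\<tau>\<close>
     returns to 0 after \<open>t2 + \<eta>\<close> and has compact support in positive
     times.\<close>
   define \<tau>' where "\<tau>' t = \<beta> t1 t - \<beta> t2 t" for t
   define \<tau> where "\<tau> t = \<eta> * (B ((t - t1) / \<eta>) - B ((t - t2) / \<eta>))" for t
   have d\<tau>: "DERIV \<tau> t :> \<tau>' t" for t
   proof -
    have "DERIV (\<lambda>t. B ((t - s) / \<eta>)) t :> \<beta> s t * (1 / \<eta>)" for s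
     unfolding \<beta>_def by (rule DERIV_chain2[OF B(1)]) (use \<eta> in \<open>auto intro!: derivative_eq_intros\<close>)
    from DERIV_cmult[OF DERIV_diff[OF this[of t1] this[of t2]], of \<eta>] show ?thesis
     unfolding \<tau>_def \<tau>'_def by (rule DERIV_cong) (use \<eta>(1) in \<open>simp add: field_simps\<close>)
   qed
   have \<beta>C: "C_k_on k UNIV (\<beta> s)" for k s
   proof -
    have l: "C_k_on k UNIV (\<lambda>t. u + (1 / v) * t)" for u v :: real
     by (intro C_k_on_add C_k_on_mult C_k_on_const C_k_on_bounded_linear bounded_linear_ident)
    have "C_k_on k UNIV (\<lambda>t. flat 1 (- s / \<eta> + (1 / \<eta>) * t) * flat 1 ((1 + s / \<eta>) + (1 / (- \<eta>)) * t))"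
     by (intro C_k_on_mult C_k_on_flat l)
    moreover have "(\<lambda>t. flat 1 (- s / \<eta> + (1 / \<eta>) * t) * flat 1 ((1 + s / \<eta>) + (1 / (- \<eta>)) * t)) = \<beta> s"
     by (simp add: \<beta>_def[abs_def] b_def diff_divide_distrib algebra_simps)
    ultimately show ?thesis by simp
   qed
   have \<tau>'C: "C_k_on k UNIV \<tau>'" for k
   proof -
    have "C_k_on k UNIV (\<lambda>t. \<beta> t1 t + (- 1) * \<beta> t2 t)" by (intro C_k_on_add C_k_on_mult C_k_on_const \<beta>C)
    then show ?thesis by (simp add: \<tau>'_def[abs_def])
   qed
   have "(LINT t|lborel. \<tau>' t * I t) = 0"
    unfolding I_def
   proof (rule mass_conservation_weak[OF sol reg g C_k_on_antiderivative[OF d\<tau> \<tau>'C] d\<tau>, of t1 "t2 + 1"])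
    show "continuous_on UNIV \<tau>'" using \<tau>'C[of 0] by simp
    fix r assume r: "r \<notin> {t1..t2 + 1}"
    then have "\<beta> t1 r = 0" "\<beta> t2 r = 0" using t \<eta> by (auto intro!: \<beta>0)
    then show "\<tau>' r = 0" by (simp add: \<tau>'_def)
    consider "r < t1" | "t2 + 1 < r" using r by fastforce
    then show "\<tau> r = 0"
    proof cases
     case 1
     then show ?thesis using t \<eta> by (simp add: \<tau>_def B(2) divide_le_0_iff)
    next
     case 2
     then show ?thesis using t \<eta> by (simp add: \<tau>_def B(3) le_divide_eq)
    qed
   qed (use t in auto)
   have \<beta>I: "integrable lborel (\<lambda>t. \<beta> s t * I t)" "\<bar>(LINT t|lborel. \<beta> s t * I t) - S * I s\<bar> \<le> \<epsilon> * S"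
    if s: "0 < s" "\<And>t. s \<le> t ==> t \<le> s + \<eta> ==> \<bar>I t - I s\<bar> \<le> \<epsilon>" for s
   proof -
    have "continuous_on UNIV (\<lambda>t. \<beta> s t * I t)"
    proof (rule continuous_on_UNIV_cutoff[of "{0<..}" "{..<s}"])
     show "continuous_on {0<..} (\<lambda>t. \<beta> s t * I t)" by (intro continuous_on_mult Ic continuous_on_subset[OF \<beta>c]) auto
    qed (use s \<beta>0 in auto)
    then show i: "integrable lborel (\<lambda>t. \<beta> s t * I t)"
     by (rule integrable_continuous_support[of _ "\<bar>s\<bar> + 1"]) (use \<eta> in \<open>auto intro!: \<beta>0\<close>)
    have "(LINT t|lborel. \<beta> s t * I t) - S * I s = (LINT t|lborel. \<beta> s t * I t - \<beta> s t * I s)"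
     using i \<beta>i by (simp add: S)
    also have "\<bar>\<dots>\<bar> \<le> (LINT t|lborel. \<bar>\<beta> s t * I t - \<beta> s t * I s\<bar>)" by (rule integral_abs_bound)
    also have "\<dots> \<le> (LINT t|lborel. \<epsilon> * \<beta> s t)"
    proof (rule integral_mono)
     show "integrable lborel (\<lambda>t. \<bar>\<beta> s t * I t - \<beta> s t * I s\<bar>)" using i \<beta>i by simp
     show "integrable lborel (\<lambda>t. \<epsilon> * \<beta> s t)" using \<beta>i by simp
     fix t
     show "\<bar>\<beta> s t * I t - \<beta> s t * I s\<bar> \<le> \<epsilon> * \<beta> s t"
     proof (cases "t \<in> {s..s + \<eta>}")
      case True
      then have "\<beta> s t * \<bar>I t - I s\<bar> \<le> \<beta> s t * \<epsilon>" using s \<beta>nn by (intro mult_left_mono) auto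
      moreover have "\<bar>\<beta> s t * I t - \<beta> s t * I s\<bar> = \<beta> s t * \<bar>I t - I s\<bar>"
       using \<beta>nn[of s t] by (simp only: right_diff_distrib[symmetric] abs_mult)
      ultimately show ?thesis by (simp add: mult.commute)
     qed (simp add: \<beta>0)
    qed
    finally show "\<bar>(LINT t|lborel. \<beta> s t * I t) - S * I s\<bar> \<le> \<epsilon> * S" by (simp add: S)
   qed
   have c1: "\<bar>I t - I t1\<bar> \<le> \<epsilon>" if "t1 \<le> t" "t \<le> t1 + \<eta>" for t using that \<eta> by (intro e(2)) auto
   have c2: "\<bar>I t - I t2\<bar> \<le> \<epsilon>" if "t2 \<le> t" "t \<le> t2 + \<eta>" for t using that \<eta> by (intro e(4)) auto
   have t2: "0 < t2" using t by simp
   have "(LINT t|lborel. \<beta> t1 t * I t) - (LINT t|lborel. \<beta> t2 t * I t) = (LINT t|lborel. \<tau>' t * I t)"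
    using \<beta>I(1)[OF t(1) c1] \<beta>I(1)[OF t2 c2] by (simp add: \<tau>'_def left_diff_distrib)
   then have "(LINT t|lborel. \<beta> t1 t * I t) = (LINT t|lborel. \<beta> t2 t * I t)"
    using \<open>(LINT t|lborel. \<tau>' t * I t) = 0\<close> by simp
   then have "\<bar>S * I t1 - S * I t2\<bar> \<le> 2 * (\<epsilon> * S)" using \<beta>I(2)[OF t(1) c1] \<beta>I(2)[OF t2 c2] by linarith
   moreover have "\<bar>S * I t1 - S * I t2\<bar> = S * \<bar>I t1 - I t2\<bar>"
    using S0 by (simp only: right_diff_distrib[symmetric] abs_mult)
   ultimately have "S * \<bar>I t1 - I t2\<bar> \<le> S * (2 * \<epsilon>)" by (simp add: mult_ac)
   then show ?thesis using S0 by simp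
  qed
  show ?thesis
  proof (rule ccontr)
   assume "I t1 \<noteq> I t2"
   then show False using est[of "\<bar>I t1 - I t2\<bar> / 4"] by simp
  qed
 qed
 have "I t = I 1" if "0 < t" for t using const that by (metis linorder_cases zero_less_one)
 then show ?thesis using strong_solution_lborel(2)[OF sol reg] unfolding I_def by blast
qed

section \<open>Bounds for strong solutions\<close>

text \<open>Comparison with the constant solution \<open>K\<close>: the mass of the part of
  \<open>n\<close> above \<open>K\<close> does not increase, and it tends to 0 at the initial time.
  The error at infinity is handled as in the mass estimate, but the truncation level is now fixed
  and the total mass is already known.\<close>

lemma pme_le_of_initial_le:
 fixes n :: "real => 'a::euclidean_space => real"
 assumes n: "pme_solution \<gamma> n nt n1 n2" and g: "-1 < \<gamma>" "\<gamma> \<noteq> 0"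
  and th: "0 < \<theta>" "\<theta> < 1" "real DIM('a) * (1 - \<theta>) < 2"
  and B: "\<And>a. 0 < a ==> \<exists>B\<ge>0. \<forall>t\<ge>a. \<forall>x. diffusion \<gamma> (n t x) \<le> B * n t x powr \<theta>"
  and mass: "\<And>t. 0 < t ==> integrable lborel (n t) \<and> (LINT x|lborel. n t x) = M"
  and K: "0 < K" and init: "((\<lambda>a. LINT x|lborel. max 0 (n a x - K)) \<longlongrightarrow> 0) (at_right 0)" and b: "0 < b"
 shows "n b x \<le> K"
proof -
 let ?d = "real DIM('a)"
 have nn: "\<And>t x. 0 < t ==> 0 \<le> n t x" using n by (simp add: pme_solution_def)
 have nc: "continuous_on UNIV (n t)" if "0 < t" for t by (rule continuous_on_time_slice[OF n that])
 obtain p :: nat where p: "3 \<le> p" "\<theta> * real p \<le> real p - 2" using ex_bump_exponent[OF th(2)] by blast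
 have ti: "integrable lborel (\<lambda>x. max 0 (n t x - K))" if "0 < t" for t
 proof (rule Bochner_Integration.integrable_bound[of lborel "n t"])
  show "(\<lambda>x. max 0 (n t x - K)) \<in> borel_measurable lborel"
   using borel_measurable_continuous_onI[OF nc[OF that]] by measurable
  have "norm (max 0 (n t x - K)) \<le> norm (n t x)" for x using nn[OF that, of x] K by (simp add: max_def)
  then show "AE x in lborel. norm (max 0 (n t x - K)) \<le> norm (n t x)" by simp
 qed (use mass that in simp)
 have le: "(\<integral>\<^sup>+x. ennreal (max 0 (n b x - K)) \<partial>lborel) \<le> ennreal (LINT x|lborel. max 0 (n a x - K))" if a: "0 < a" "a < b" for a
 proof -
  obtain B where B: "0 \<le> B" "\<And>t x. a \<le> t ==> diffusion \<gamma> (n t x) \<le> B * n t x powr \<theta>" using B[OF a(1)] by blast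
  define V where "V = unit_ball_vol ?d"
  define E where "E R = 4 * (real p)^2 * B * (M + V) * R powr - (2 - ?d * (1 - \<theta>))" for R
  have step: "(LINT x|lborel. max 0 (n b x - K) * bump p R x) \<le> (LINT x|lborel. max 0 (n a x - K)) + (b - a) * E R" if R: "0 < R" for R
  proof -
   have "(LINT x|lborel. max 0 (n b x - K) * bump p R x) - (LINT x|lborel. max 0 (n a x - K) * bump p R x) \<le> E R * b - E R * a"
   \<comment> \<open>Used with the same solution twice, so that the maximum is \<open>n\<close>
     itself.\<close>
   proof (rule pme_max_mass_growth[OF n n g a(1) less_imp_le[OF a(2)] K R p(1), where w = n and K' = "\<lambda>_. E R"])
    show "((\<lambda>t. E R * t) has_real_derivative E R) (at t within {a..b})" for t
     by (auto intro!: derivative_eq_intros)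
    fix t assume t: "t \<in> {a..b}"
    then have t0: "0 < t" using a by simp
    \<comment> \<open>The linearisation level for which \<open>l\<close> times the volume of the
      ball of radius \<open>R\<close> is the constant \<open>V\<close>. The resulting power of
      \<open>R\<close> is \<open>- (2 - d (1 - \<theta>))\<close>, which tends to 0.\<close>
    define l where "l = R powr - ?d"
    have l: "0 < l" using R by (simp add: l_def)
    have "(LINT x|lborel. max 0 (diffusion \<gamma> (n t x) - diffusion \<gamma> K) * (\<Sum>i\<in>Basis. bump2 p R i x))
     \<le> 4 * (real p)^2 * B * (R powr - 2 * l powr (\<theta> - 1)) *
      ((LINT x|lborel. (if K < n t x then n t x * bump p R x else 0)) + l * (unit_ball_vol ?d * R ^ DIM('a)))"
     by (rule integral_diffusion_bump2_le[OF nc[OF t0] nn[OF t0] continuous_on_diffusion[OF g(1)] diffusion_strict_mono[OF g]])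
       (use g K B t th l R p in \<open>auto simp: diffusion_nonneg\<close>)
    also have "\<dots> \<le> 4 * (real p)^2 * B * (R powr - 2 * l powr (\<theta> - 1)) * (M + V)"
    proof (intro mult_left_mono add_mono)
     have "(LINT x|lborel. (if K < n t x then n t x * bump p R x else 0)) \<le> (LINT x|lborel. n t x)"
     proof (rule integral_mono')
      fix x
      have "n t x * bump p R x \<le> n t x * 1" using nn[OF t0] bump_le_1 R by (intro mult_left_mono) auto
      then show "(if K < n t x then n t x * bump p R x else 0) \<le> n t x" using nn[OF t0] by simp
     qed (use mass t0 nn in auto)
     then show "(LINT x|lborel. (if K < n t x then n t x * bump p R x else 0)) \<le> M" using mass t0 by simp
     have "l * R ^ DIM('a) = 1" using R by (simp add: l_def powr_minus powr_realpow)
     then have "l * (unit_ball_vol ?d * R ^ DIM('a)) = V" by (simp add: V_def mult.left_commute)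
     then show "l * (unit_ball_vol ?d * R ^ DIM('a)) \<le> V" by simp
    qed (use B in auto)
    also have "R powr - 2 * l powr (\<theta> - 1) = R powr - (2 - ?d * (1 - \<theta>))"
     by (simp add: l_def powr_powr powr_add[symmetric] algebra_simps)
    finally show "(LINT x|lborel. max 0 (diffusion \<gamma> (n t x) - diffusion \<gamma> K) * (\<Sum>i\<in>Basis. bump2 p R i x)) \<le> E R"
     by (simp add: E_def mult_ac)
   qed auto
   moreover have "(LINT x|lborel. max 0 (n a x - K) * bump p R x) \<le> (LINT x|lborel. max 0 (n a x - K))"
   proof (rule integral_mono'[OF ti[OF a(1)]])
    show "max 0 (n a x - K) * bump p R x \<le> max 0 (n a x - K)" for x
     using mult_left_mono[OF bump_le_1[of R p x], of "max 0 (n a x - K)"] R by simp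
   qed simp
   ultimately show ?thesis by (simp add: algebra_simps)
  qed
  show ?thesis
  proof (rule nn_integral_le_of_bump_integrals[OF nc[OF b] nn[OF b] p(1), where N = 0 and \<kappa> = "\<lambda>_. K"])
   show "(LINT x|lborel. max 0 (n b x - K) * bump p (real (Suc j)) x) \<le> (LINT x|lborel. max 0 (n a x - K)) + (b - a) * E (real (Suc j))" for j
    by (rule step) simp
   have "(\<lambda>j. real (Suc j) powr - (2 - ?d * (1 - \<theta>))) \<longlonglongrightarrow> 0" using th by (intro tendsto_Suc_powr_0) simp
   then have "(\<lambda>j. (LINT x|lborel. max 0 (n a x - K)) + (b - a) * E (real (Suc j))) \<longlonglongrightarrow> (LINT x|lborel. max 0 (n a x - K)) + (b - a) * (4 * (real p)^2 * B * (M + V) * 0)"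
    unfolding E_def by (intro tendsto_intros)
   then show "(\<lambda>j. (LINT x|lborel. max 0 (n a x - K)) + (b - a) * E (real (Suc j))) \<longlonglongrightarrow> (LINT x|lborel. max 0 (n a x - K))" by simp
  qed auto
 qed
 have "((\<lambda>a. ennreal (LINT x|lborel. max 0 (n a x - K))) \<longlongrightarrow> ennreal 0) (at_right 0)" by (intro tendsto_intros init)
 moreover have "\<forall>\<^sub>F a in at_right 0. (\<integral>\<^sup>+x. ennreal (max 0 (n b x - K)) \<partial>lborel) \<le> ennreal (LINT x|lborel. max 0 (n a x - K))"
  using eventually_at_right_less[of "0::real"] eventually_at_right_real[OF b]
  by eventually_elim (use le in auto)
 ultimately have "(\<integral>\<^sup>+x. ennreal (max 0 (n b x - K)) \<partial>lborel) \<le> ennreal (LINT x|(lborel::'a measure). 0)"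
  by (intro tendsto_lowerbound[of "\<lambda>a. ennreal (LINT x|lborel. max 0 (n a x - K))"]) auto
 then have "max 0 (n b x - K) = (\<lambda>_. 0) x"
  by (intro eq_of_integral_le) (auto intro!: continuous_intros nc b)
 then show ?thesis by simp
qed

lemma strong_solution_energy:
 fixes n :: "real => real^'d => real"
 assumes sol: "strong_solution \<gamma> n0 n" and pme: "pme_solution \<gamma> n nt n1 n2" and g: "0 < \<gamma>" and ab: "0 < a" "a < b"
 shows "\<exists>U. \<forall>R>0. integral {a..b} (\<lambda>t. LINT x|lborel. diffusion \<gamma> (n t x) * bump 3 R x) \<le> U"
proof -
 define s where "s z = indicator ({a..b} \<times> UNIV) z * (\<lambda>(t, x). diffusion \<gamma> (n t x)) z" for z
 have "set_integrable lborel ({a..b} \<times> UNIV) (\<lambda>(t, x). n t x powr (\<gamma> + 1))" using sol g ab by (simp add: strong_solution_def)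
 then have "integrable lborel (\<lambda>z. \<gamma> / (\<gamma> + 1) * (indicator ({a..b} \<times> UNIV) z *\<^sub>R (\<lambda>(t, x). n t x powr (\<gamma> + 1)) z))"
  unfolding set_integrable_def by (rule integrable_mult_right)
 then have si: "integrable lborel s"
  using g by (simp add: s_def[abs_def] diffusion_def case_prod_unfold mult_ac)
 have s0: "0 \<le> s z" for z using g by (auto simp: s_def diffusion_nonneg split: prod.split)
 have "integral {a..b} (\<lambda>t. LINT x|lborel. diffusion \<gamma> (n t x) * bump 3 R x) \<le> (LINT z|lborel. s z)" if R: "0 < R" for R
 proof -
  have bm: "(\<lambda>z::real \<times> (real^'d). bump 3 R (snd z)) \<in> borel_measurable lborel"
   using borel_measurable_continuous_onI[OF continuous_on_compose2[OF continuous_on_bump(1)[OF R, of UNIV 3] continuous_on_snd[OF continuous_on_id[of UNIV]]]] by simp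
  have le: "s z * bump 3 R (snd z) \<le> s z" for z
   using mult_left_mono[OF bump_le_1[of R 3 "snd z"] s0[of z]] R by simp
  have hi: "integrable lborel (\<lambda>z. s z * bump 3 R (snd z))"
  proof (rule Bochner_Integration.integrable_bound[OF si])
   show "(\<lambda>z. s z * bump 3 R (snd z)) \<in> borel_measurable lborel" using si bm by (intro borel_measurable_times) auto
   have "norm (s z * bump 3 R (snd z)) \<le> norm (s z)" for z
    using le[of z] s0[of z] bump_nonneg[of 3 R "snd z"] by simp
   then show "AE z in lborel. norm (s z * bump 3 R (snd z)) \<le> norm (s z)" by (intro AE_I2)
  qed
  have c: "continuous_on {a..b} (\<lambda>t. LINT x|lborel. diffusion \<gamma> (n t x) * bump 3 R x)"
   using g by (intro continuous_on_diffusion_bump_integral[OF pme] ab R) auto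
  have "integral {a..b} (\<lambda>t. LINT x|lborel. diffusion \<gamma> (n t x) * bump 3 R x)
   = (LINT t|lborel. indicator {a..b} t *\<^sub>R (LINT x|lborel. diffusion \<gamma> (n t x) * bump 3 R x))"
   using set_borel_integral_eq_integral(2)[OF borel_integrable_atLeastAtMost'[OF c]] by (simp add: set_lebesgue_integral_def)
  also have "\<dots> = (LINT t|lborel. LINT x|lborel. s (t, x) * bump 3 R (snd (t, x)))"
   by (intro Bochner_Integration.integral_cong refl) (simp add: s_def indicator_times mult.assoc)
  also have "\<dots> = (LINT z|lborel. s z * bump 3 R (snd z))"
   using lborel_pair.integral_fst'[of "\<lambda>z. s z * bump 3 R (snd z)"] hi by (simp add: lborel_prod)
  also have "\<dots> \<le> (LINT z|lborel. s z)" by (rule integral_mono[OF hi si le])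
  finally show ?thesis .
 qed
 then show ?thesis by blast
qed

lemma strong_solution_initial:
 fixes n :: "real => real^'d => real"
 assumes sol: "strong_solution \<gamma> n0 n"
 shows "((\<lambda>a. LINT x|lebesgue. \<bar>n a x - n 0 x\<bar>) \<longlongrightarrow> 0) (at_right 0)"
 by (rule tendsto_within_subset[of _ _ _ "{0..}"]) (use sol in \<open>auto simp: strong_solution_def\<close>)

lemma strong_solution_difference_tendsto_0:
 fixes n :: "real => real^'d => real"
 assumes sol: "strong_solution \<gamma> n0 n" and reg: "regular_density \<gamma> n" and l: "1 \<le> l"
 shows "((\<lambda>a. LINT x|lborel. \<bar>n a x - n (l * a) x\<bar>) \<longlongrightarrow> 0) (at_right 0)"
proof (rule Lim_null_comparison)
 define D where "D a = (LINT x|lebesgue. \<bar>n a x - n 0 x\<bar>)" for a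
 have D: "(D \<longlongrightarrow> 0) (at_right 0)" unfolding D_def by (rule strong_solution_initial[OF sol])
 have "filterlim (\<lambda>a. l * a) (at_right 0) (at_right 0)"
  using l by (auto simp: filterlim_at eventually_at_filter intro!: tendsto_eq_intros)
 from filterlim_compose[OF D this] have "((\<lambda>a. D (l * a)) \<longlongrightarrow> 0) (at_right 0)" .
 from tendsto_add[OF D this] show "((\<lambda>a. D a + D (l * a)) \<longlongrightarrow> 0) (at_right 0)" by simp
 have int: "integrable lebesgue (n t)" if "0 \<le> t" for t using sol that by (simp add: strong_solution_def)
 have "norm (LINT x|lborel. \<bar>n a x - n (l * a) x\<bar>) \<le> D a + D (l * a)" if a: "0 < a" for a
 proof -
  have la: "0 < l * a" using l a by simp
  have "(LINT x|lborel. \<bar>n a x - n (l * a) x\<bar>) = (LINT x|lebesgue. \<bar>n a x - n (l * a) x\<bar>)"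
   by (rule strong_solution_lborel(3)[OF sol reg a la, symmetric])
  also have "\<dots> \<le> (LINT x|lebesgue. \<bar>n a x - n 0 x\<bar> + \<bar>n (l * a) x - n 0 x\<bar>)"
   using int[of a] int[of "l * a"] int[of 0] a la by (intro integral_mono) auto
  also have "\<dots> = D a + D (l * a)" unfolding D_def
   using int[of a] int[of "l * a"] int[of 0] a la by (intro Bochner_Integration.integral_add) auto
  finally show ?thesis by simp
 qed
 then show "\<forall>\<^sub>F a in at_right 0. norm (LINT x|lborel. \<bar>n a x - n (l * a) x\<bar>) \<le> D a + D (l * a)"
  by (auto simp: eventually_at_filter)
qed

lemma strong_solution_sup_bound:
 fixes n :: "real => real^'d => real"
 defines "d \<equiv> real CARD('d)"
 assumes sol: "strong_solution \<gamma> n0 n" and reg: "regular_density \<gamma> n" and g: "-1 < \<gamma>" "\<gamma> \<noteq> 0" "-2 < d * \<gamma>"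
 shows "\<exists>C>0. \<forall>t>0. \<forall>x. n t x \<le> C * t powr - (d / (d * \<gamma> + 2))"
proof -
 obtain nt n1 n2 where pme: "pme_solution \<gamma> n nt n1 n2"
  and diff: "\<And>t x. 0 < t ==> 0 < n t x ==> n t differentiable (at x)"
  by (rule strong_solution_pme[OF sol reg g(1,2)]) blast
 obtain m where m: "\<And>t. 0 < t ==> integrable lborel (n t) \<and> (LINT x|lborel. n t x) = m"
  using mass_conservation[OF sol reg g(1,2)] g(3) by (auto simp: d_def)
 show ?thesis
 proof (cases "\<gamma> < 0")
  case True
  have pos: "0 < n t x" if "0 < t" for t x using reg True that by (simp add: regular_density_def)
  show ?thesis using pme_sup_bound_fast[OF pme True _ g(1) pos m] g(3) by (simp add: d_def)
 next
  case False
  then have g0: "0 < \<gamma>" using g by simp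
  have bc: "n b x \<le> l powr (1 / \<gamma>) * n (l * b) x" if "1 \<le> l" "0 < b" for l b x
   by (rule benilan_crandall[OF pme g0 m strong_solution_energy[OF sol pme g0] strong_solution_difference_tendsto_0[OF sol reg] that])
  have "- (n t x / (\<gamma> * t)) \<le> nt t x" if "0 < t" "0 < n t x" for t x
   by (rule time_derivative_lower_bound[OF pme g0 bc that]) (use that in auto)
  from pme_sup_bound_slow[OF pme g0 diff m this] show ?thesis by (simp add: d_def)
 qed
qed

lemma strong_solution_le_initial:
 fixes n :: "real => real^'d => real"
 defines "d \<equiv> real CARD('d)"
 assumes sol: "strong_solution \<gamma> n0 n" and reg: "regular_density \<gamma> n" and g: "-1 < \<gamma>" "\<gamma> \<noteq> 0" "-2 < d * \<gamma>" and d: "2 \<le> d"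
  and K: "0 < K" "AE x in lebesgue. n0 x \<le> K" and t: "0 < t"
 shows "n t x \<le> K"
proof -
 obtain nt n1 n2 where pme: "pme_solution \<gamma> n nt n1 n2"
  by (rule strong_solution_pme[OF sol reg g(1,2)]) blast
 have nn: "\<And>t x. 0 < t ==> 0 \<le> n t x" using sol by (simp add: strong_solution_def)
 obtain m where m: "\<And>t. 0 < t ==> integrable lborel (n t) \<and> (LINT x|lborel. n t x) = m"
  using mass_conservation[OF sol reg g(1,2)] g(3) by (auto simp: d_def)
 obtain C where C: "0 < C" "\<And>t x. 0 < t ==> n t x \<le> C * t powr - (d / (d * \<gamma> + 2))"
  using strong_solution_sup_bound[OF sol reg g(1,2)] g(3) unfolding d_def by blast
 have init: "((\<lambda>a. LINT x|lborel. max 0 (n a x - K)) \<longlongrightarrow> 0) (at_right 0)"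
 \<comment> \<open>Since the datum is at most \<open>K\<close> almost everywhere, the excess of
   \<open>n a\<close> over \<open>K\<close> is at most the distance to the datum.\<close>
 proof (rule Lim_null_comparison[OF _ strong_solution_initial[OF sol]])
  have int: "integrable lebesgue (n t)" if "0 \<le> t" for t using sol that by (simp add: strong_solution_def)
  have "norm (LINT x|lborel. max 0 (n a x - K)) \<le> (LINT x|lebesgue. \<bar>n a x - n 0 x\<bar>)" if a: "0 < a" for a
  proof -
   have na: "n a \<in> borel_measurable borel" using strong_solution_lborel(1)[OF sol reg a] by (rule borel_measurable_continuous_onI)
   then have "(\<lambda>x. max 0 (n a x - K)) \<in> borel_measurable lborel" by measurable
   from integral_completion[OF this]
   have "(LINT x|lborel. max 0 (n a x - K)) = (LINT x|lebesgue. max 0 (n a x - K))" by simp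
   also have "\<dots> \<le> (LINT x|lebesgue. \<bar>n a x - n 0 x\<bar>)"
   proof (rule integral_mono_AE')
    show "integrable lebesgue (\<lambda>x. \<bar>n a x - n 0 x\<bar>)" using int[of a] int[of 0] a by simp
    have "AE x in lebesgue. n 0 x = n0 x" using sol by (simp add: strong_solution_def)
    then show "AE x in lebesgue. max 0 (n a x - K) \<le> \<bar>n a x - n 0 x\<bar>" using K(2) by eventually_elim auto
   qed auto
   finally show ?thesis by simp
  qed
  then show "\<forall>\<^sub>F a in at_right 0. norm (LINT x|lborel. max 0 (n a x - K)) \<le> (LINT x|lebesgue. \<bar>n a x - n 0 x\<bar>)"
   by (auto simp: eventually_at_filter)
 qed
 \<comment> \<open>For \<gamma> < 0 this is the exponent of the diffusion function itself. For
   \<gamma> > 0 it is \<open>1 - 1 / (2 d)\<close>, and the surplus power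
   \<open>\<gamma> + 1 - \<theta>\<close> is bounded by the smoothing estimate on every interval
   bounded away from time 0.\<close>
 define \<theta> where "\<theta> = (if \<gamma> < 0 then \<gamma> + 1 else 1 / 2 + (1 - 1 / d) / 2)"
 have th: "0 < \<theta>" "\<theta> < 1" "d * (1 - \<theta>) < 2" "\<theta> \<le> \<gamma> + 1"
  using g d by (auto simp: \<theta>_def field_simps add_pos_pos)
 show ?thesis
 proof (rule pme_le_of_initial_le[OF pme g(1,2) th(1,2) _ _ m K(1) init t])
  show "real DIM(real^'d) * (1 - \<theta>) < 2" using th by (simp add: d_def)
  fix a :: real assume a: "0 < a"
  define c where "c = \<bar>\<gamma>\<bar> / (\<gamma> + 1)"
  have c: "0 < c" using g by (simp add: c_def)
  define N where "N = C * a powr - (d / (d * \<gamma> + 2))"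
  have "diffusion \<gamma> (n t x) \<le> c * N powr (\<gamma> + 1 - \<theta>) * n t x powr \<theta>" if t: "a \<le> t" for t x
  proof -
   have "t powr - (d / (d * \<gamma> + 2)) \<le> a powr - (d / (d * \<gamma> + 2))" using a t g d by (intro powr_mono2') auto
   then have "n t x \<le> N" using C(2)[of t x] C(1) a t unfolding N_def by (meson less_le_trans mult_le_cancel_left_pos order_trans)
   then have "n t x powr (\<gamma> + 1 - \<theta>) \<le> N powr (\<gamma> + 1 - \<theta>)" using nn[of t x] a t th by (intro powr_mono2) auto
   then have "c * (n t x powr (\<gamma> + 1 - \<theta>) * n t x powr \<theta>) \<le> c * (N powr (\<gamma> + 1 - \<theta>) * n t x powr \<theta>)"
    using c by (intro mult_left_mono mult_right_mono) auto
   then show ?thesis by (simp add: powr_add[symmetric] diffusion_def c_def)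
  qed
  moreover have "0 \<le> c * N powr (\<gamma> + 1 - \<theta>)" using c by simp
  ultimately show "\<exists>B\<ge>0. \<forall>t\<ge>a. \<forall>x. diffusion \<gamma> (n t x) \<le> B * n t x powr \<theta>" by blast
 qed
qed

text \<open>Differentiating \<open>n powr \<theta>\<close> along the gradient \<open>v\<close> of
  \<open>n\<close> gives \<open>\<theta> * n powr (\<theta> - 1) * |v|^2\<close>, bounded by
  \<open>L * |v|\<close>. The pressure gradient differs from the gradient of
  \<open>n powr \<theta>\<close> by a power of \<open>n\<close>, and the exponent
  \<open>\<gamma> * b + 2 * \<gamma> - 2 * \<theta>\<close> collects that power together with the
  factor \<open>|p|^b\<close>.\<close>

lemma pressure_gradient_le:
 fixes n :: "real => real^'d => real"
 assumes d: "n t differentiable (at x)" and pos: "0 < n t x" and th: "\<theta> \<noteq> 0" and L: "0 \<le> L"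
  and lip: "\<And>x y. n t y powr \<theta> \<le> n t x powr \<theta> + L * norm (x - y)"
 shows "\<bar>pressure \<gamma> n t x\<bar> powr b * (norm (grad (pressure \<gamma> n t) x))^2 \<le> (\<gamma> / \<theta>)^2 * n t x powr (\<gamma> * b + 2 * \<gamma> - 2 * \<theta>) * L^2"
proof (cases "\<gamma> = 0")
 case True
 then show ?thesis by (simp add: pressure_def)
next
 case False
 define n1 where "n1 i = frechet_derivative (n t) (at x) i" for i
 have n1: "DERIV (\<lambda>s. n t (x + s *\<^sub>R i)) 0 :> n1 i" for i
  unfolding n1_def by (rule differentiable_line[OF d])
 define v where "v = (\<Sum>i\<in>Basis. n1 i *\<^sub>R i)"
 have gr: "grad (pressure \<gamma> n t) x = (\<bar>\<gamma>\<bar> * n t x powr (\<gamma> - 1)) *\<^sub>R v"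
 proof -
  have "grad (pressure \<gamma> n t) x = (\<Sum>i\<in>Basis. (\<bar>\<gamma>\<bar> * n t x powr (\<gamma> - 1) * n1 i) *\<^sub>R i)"
   by (intro flux_eq(2) d n1 pos)
  then show ?thesis by (simp add: v_def scaleR_sum_right)
 qed
 have n1v: "n1 v = v \<bullet> v"
 proof -
  have "n1 v = v \<bullet> (\<Sum>i\<in>Basis. n1 i *\<^sub>R i)"
   using fun_cong[OF frechet_derivative_at[OF has_derivative_line[OF d n1]], of v]
   by (simp add: n1_def inner_sum_right mult.commute)
  then show ?thesis by (simp only: v_def[symmetric])
 qed
 have "DERIV (\<lambda>s. n t (x + s *\<^sub>R v) powr \<theta>) 0 :> \<theta> * n t x powr (\<theta> - 1) * (v \<bullet> v)"
 proof -
  have "DERIV (\<lambda>w. w powr \<theta>) (n t (x + 0 *\<^sub>R v)) :> \<theta> * n t x powr (\<theta> - 1)"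
   using has_real_derivative_powr[OF pos] by simp
  from DERIV_chain2[OF this n1[of v]] show ?thesis by (simp add: n1v)
 qed
 then have "((\<lambda>h. \<bar>(n t (x + h *\<^sub>R v) powr \<theta> - n t x powr \<theta>) / h\<bar>) \<longlongrightarrow> \<bar>\<theta> * n t x powr (\<theta> - 1) * (v \<bullet> v)\<bar>) (at 0)"
  by (intro tendsto_rabs) (simp add: DERIV_def)
 moreover have "\<bar>(n t (x + h *\<^sub>R v) powr \<theta> - n t x powr \<theta>) / h\<bar> \<le> L * norm v" if "h \<noteq> 0" for h
  using lip[of x "x + h *\<^sub>R v"] lip[of "x + h *\<^sub>R v" x] that by (simp add: abs_le_iff field_simps abs_divide)
 ultimately have "\<bar>\<theta> * n t x powr (\<theta> - 1) * (v \<bullet> v)\<bar> \<le> L * norm v"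
  by (intro tendsto_upperbound[of _ _ "at (0::real)"]) (auto simp: eventually_at_filter)
 then have "\<bar>\<theta>\<bar> * n t x powr (\<theta> - 1) * norm v * norm v \<le> L * norm v"
  by (simp add: abs_mult dot_square_norm power2_eq_square mult_ac)
 then have vL: "\<bar>\<theta>\<bar> * n t x powr (\<theta> - 1) * norm v \<le> L" using L by (cases "v = 0") auto
 then have sq: "(\<bar>\<theta>\<bar> * n t x powr (\<theta> - 1) * norm v)^2 \<le> L^2" by (intro power_mono) auto
 have "\<bar>pressure \<gamma> n t x\<bar> powr b * (norm (grad (pressure \<gamma> n t) x))^2
  = n t x powr (\<gamma> * b) * (\<gamma>^2 * (n t x powr (\<gamma> - 1))^2 * (norm v)^2)"
  using False by (simp add: gr pressure_def abs_mult powr_powr power_mult_distrib)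
 also have "\<dots> = (\<gamma> / \<theta>)^2 * n t x powr (\<gamma> * b + 2 * \<gamma> - 2 * \<theta>) * (\<bar>\<theta>\<bar> * n t x powr (\<theta> - 1) * norm v)^2"
 proof -
  have "n t x powr (\<gamma> * b) * (n t x powr (\<gamma> - 1))^2 = n t x powr (\<gamma> * b + 2 * \<gamma> - 2 * \<theta>) * (n t x powr (\<theta> - 1))^2"
   by (simp add: power2_eq_square powr_add[symmetric])
  then show ?thesis using th by (simp add: power_mult_distrib power_divide)
 qed
 also have "\<dots> \<le> (\<gamma> / \<theta>)^2 * n t x powr (\<gamma> * b + 2 * \<gamma> - 2 * \<theta>) * L^2" using sq by (intro mult_left_mono) auto
 finally show ?thesis .
qed

text \<open>The gradient bound in terms of the supremum over the time window from
  \<open>t / 2\<close> to \<open>t\<close>. Both time decay rates of the theorem follow from it by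
  inserting different bounds \<open>B\<close>; in both cases the power of \<open>B\<close> is
  \<open>\<gamma> * (b + 1)\<close>.\<close>

lemma max_pressure_gradient_le:
 fixes n :: "real => real^'d => real" and \<gamma> b :: real
 defines "d \<equiv> real CARD('d)"
 defines "C \<equiv> (if \<gamma> > 0 then 4 * \<gamma> / (2 * \<gamma> * b - (\<gamma> * b)^2 - (d - 1) * \<gamma>^2) else 4 / (2 + d * \<gamma>))"
 assumes sol: "strong_solution \<gamma> n0 n" and reg: "regular_density \<gamma> n"
  and g: "-1 < \<gamma>" "\<gamma> \<noteq> 0" "-2 < d * \<gamma>"
  and slow: "0 < \<gamma> ==> 0 < b \<and> 0 < 2 * \<gamma> * b - (\<gamma> * b)^2 - (d - 1) * \<gamma>^2" and fast: "\<gamma> < 0 ==> b < - 1"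
  and t: "0 < t" and B: "0 < B" "\<And>s x. s \<in> {t / 2..t} ==> n s x \<le> B"
 shows "max_pressure_gradient \<gamma> b n t \<le> ennreal (C * B powr (\<gamma> * (b + 1)) / t)"
proof -
 obtain nt n1 n2 where pme: "pme_solution \<gamma> n nt n1 n2"
  and diff: "\<And>t x. 0 < t ==> 0 < n t x ==> n t differentiable (at x)"
  by (rule strong_solution_pme[OF sol reg g(1,2)]) blast
 obtain m where m: "\<And>t. 0 < t ==> integrable lborel (n t) \<and> (LINT x|lborel. n t x) = m"
  using mass_conservation[OF sol reg g(1,2)] g(3) by (auto simp: d_def)
 have "\<bar>pressure \<gamma> n t x\<bar> powr b * (norm (grad (pressure \<gamma> n t) x))^2 \<le> C * B powr (\<gamma> * (b + 1)) / t"
  if x: "\<gamma> > 0 \<longrightarrow> n t x > 0" for x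
 proof (cases "0 < \<gamma>")
  case True
  \<comment> \<open>This choice makes the exponent of \<open>n\<close> in
    \<open>pressure_gradient_le\<close> vanish, so the quantity stays bounded up to the free
    boundary. Moreover \<open>4 * \<epsilon>\<close> is then the quadratic polynomial in
    \<open>\<gamma> * b\<close> that \<open>slow\<close> assumes to be positive.\<close>
  define \<mu> where "\<mu> = \<gamma> * b / 2"
  define \<epsilon> where "\<epsilon> = \<mu> - \<mu>^2 - (d - 1) * \<gamma>^2 / 4"
  have e4: "4 * \<epsilon> = 2 * \<gamma> * b - (\<gamma> * b)^2 - (d - 1) * \<gamma>^2"
   by (simp add: \<epsilon>_def \<mu>_def power2_eq_square field_simps)
  then have e: "0 < \<epsilon>" "C = \<gamma> / \<epsilon>" using slow[OF True] True unfolding C_def e4[symmetric] by auto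
  have mu: "0 < \<mu>" using True slow by (simp add: \<mu>_def)
  define L where "L = (\<gamma> + \<mu>) * sqrt (B powr (\<gamma> + 2 * \<mu>) / (\<gamma> * \<epsilon> * t))"
  have lip: "n t y powr (\<gamma> + \<mu>) \<le> n t x powr (\<gamma> + \<mu>) + L * norm (x - y)" for x y
   unfolding L_def \<epsilon>_def d_def
   using pme_lipschitz_slow[OF pme True mu _ m t B, of y x] e(1) by (simp add: \<epsilon>_def d_def)
  have pos: "0 < n t x" using x True by simp
  have "\<bar>pressure \<gamma> n t x\<bar> powr b * (norm (grad (pressure \<gamma> n t) x))^2
   \<le> (\<gamma> / (\<gamma> + \<mu>))^2 * n t x powr (\<gamma> * b + 2 * \<gamma> - 2 * (\<gamma> + \<mu>)) * L^2"
   using True mu e t by (intro pressure_gradient_le diff t pos lip) (auto simp: L_def)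
  also have "\<gamma> * b + 2 * \<gamma> - 2 * (\<gamma> + \<mu>) = 0" by (simp add: \<mu>_def)
  also have "(\<gamma> / (\<gamma> + \<mu>))^2 * n t x powr 0 * L^2 = \<gamma>^2 * (B powr (\<gamma> + 2 * \<mu>) / (\<gamma> * \<epsilon> * t))"
   using True mu e t pos by (simp add: L_def power_mult_distrib power_divide)
  also have "\<dots> = C * B powr (\<gamma> + 2 * \<mu>) / t" using True e(1) by (simp add: e(2) power2_eq_square)
  also have "\<gamma> + 2 * \<mu> = \<gamma> * (b + 1)" by (simp add: \<mu>_def algebra_simps)
  finally show ?thesis .
 next
  case False
  then have g0: "\<gamma> < 0" using g by simp
  have pos: "0 < n t x" if "0 < t" for t x using reg g0 that by (simp add: regular_density_def)
  define L where "L = inverse (sqrt ((2 + d * \<gamma>) * t))"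
  have lip: "n t y powr (\<gamma> / 2) \<le> n t x powr (\<gamma> / 2) + L * norm (x - y)" for x y
   using pme_lipschitz_fast[OF pme g0 _ g(1) pos m t, of y x] g(3) by (simp add: L_def d_def norm_minus_commute)
  have L2: "L^2 = 1 / ((2 + d * \<gamma>) * t)" using g t by (simp add: L_def power_inverse divide_inverse)
  have "\<bar>pressure \<gamma> n t x\<bar> powr b * (norm (grad (pressure \<gamma> n t) x))^2
   \<le> (\<gamma> / (\<gamma> / 2))^2 * n t x powr (\<gamma> * b + 2 * \<gamma> - 2 * (\<gamma> / 2)) * L^2"
   using g g0 t by (intro pressure_gradient_le diff t pos lip) (auto simp: L_def)
  also have "\<gamma> * b + 2 * \<gamma> - 2 * (\<gamma> / 2) = \<gamma> * (b + 1)" by (simp add: algebra_simps)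
  also have "(\<gamma> / (\<gamma> / 2))^2 = 4" using g0 by simp
  also have "4 * n t x powr (\<gamma> * (b + 1)) * L^2 = C * n t x powr (\<gamma> * (b + 1)) / t" using g0 by (simp add: L2 C_def)
  \<comment> \<open>Here \<open>b < - 1\<close> enters: as \<gamma> is negative too, the exponent
    \<open>\<gamma> * (b + 1)\<close> is positive and the density may be replaced by its upper
    bound.\<close>
  also have "\<dots> \<le> C * B powr (\<gamma> * (b + 1)) / t"
  proof (intro divide_right_mono mult_left_mono powr_mono2)
   show "0 \<le> \<gamma> * (b + 1)" using fast[OF g0] g0 by (intro mult_nonpos_nonpos) auto
   show "n t x \<le> B" using t by (intro B) auto
   show "0 \<le> C" using g g0 by (simp add: C_def)
  qed (use pos[OF t] t in \<open>auto intro: less_imp_le\<close>)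
  finally show ?thesis .
 qed
 then show ?thesis unfolding max_pressure_gradient_def by (intro SUP_least ennreal_leI) auto
qed

section \<open>Barenblatt solutions\<close>

text \<open>On the positivity set the pressure is a quadratic function of the similarity variable
  times a power of \<open>t\<close>. Hence the quantity factors into a power of \<open>t\<close> and
  a function \<open>G\<close> of the similarity variable alone, and the constant is the supremum of
  \<open>G\<close>; what has to be checked is that it is finite and positive.\<close>

lemma barenblatt_max_pressure_gradient:
 fixes \<gamma> b K :: real
 defines "d \<equiv> real CARD('d::finite)"
 defines "\<alpha> \<equiv> 1 / (d * \<gamma> + 2)"
 assumes g: "(0 < \<gamma> \<and> 0 < b) \<or> (\<gamma> < 0 \<and> b < - 1)" "-2 < d * \<gamma>" and K: "0 < K"
 shows "\<exists>C>0. \<forall>t>0. max_pressure_gradient \<gamma> b (barenblatt \<gamma> K :: real => real^'d => real) t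
  = ennreal (C * t powr (-1 - \<gamma> * d * (b + 1) * \<alpha>))"
proof -
 have \<alpha>: "0 < \<alpha>" "\<alpha> * (d * \<gamma> + 2) = 1" using g by (auto simp: \<alpha>_def)
 have sim: "similarity_exponent CARD('d) \<gamma> = \<alpha>" by (simp add: similarity_exponent_def \<alpha>_def d_def)
 define s where "s = sgn \<gamma>"
 have s: "s * s = 1" using g by (auto simp: s_def)
 define h where "h \<xi> = K - s * \<alpha> * (norm \<xi>)^2 / 2" for \<xi> :: "real^'d"
 define \<Omega> where "\<Omega> = {\<xi>. 0 < h \<xi>}"
 define G where "G \<xi> = h \<xi> powr b * (\<alpha>^2 * (norm \<xi>)^2)" for \<xi>
 have hneg: "K \<le> h \<xi>" if "\<gamma> < 0" for \<xi> using that \<alpha> by (simp add: h_def s_def)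
 have prof: "barenblatt_profile \<gamma> K \<xi> = max 0 (h \<xi>) powr (1 / \<gamma>)" for \<xi> :: "real^'d"
  using g K hneg[of \<xi>] by (auto simp: barenblatt_profile_def Let_def sim h_def s_def)
 have bar: "barenblatt \<gamma> K t x = t powr (- \<alpha> * d) * max 0 (h (t powr (- \<alpha>) *\<^sub>R x)) powr (1 / \<gamma>)" for t and x :: "real^'d"
  by (simp add: barenblatt_def Let_def sim prof d_def)
 have open_h: "open {x. 0 < h (c *\<^sub>R x)}" for c
  unfolding h_def by (intro open_Collect_less) (auto intro!: continuous_intros)
 have val: "\<bar>pressure \<gamma> (barenblatt \<gamma> K) t x\<bar> powr b * (norm (grad (pressure \<gamma> (barenblatt \<gamma> K) t) x))^2
  = t powr (-1 - \<gamma> * d * (b + 1) * \<alpha>) * G (t powr (- \<alpha>) *\<^sub>R x)"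
  if t: "0 < t" and x: "0 < h (t powr (- \<alpha>) *\<^sub>R x)" for t and x :: "real^'d"
 proof -
  define c where "c = t powr (- \<alpha>)"
  define k where "k = t powr (- \<alpha> * d * \<gamma>)"
  have c: "0 < c" and k: "0 < k" using t by (auto simp: c_def k_def)
  have p: "pressure \<gamma> (barenblatt \<gamma> K) t y = s * k * h (c *\<^sub>R y)" if "0 < h (c *\<^sub>R y)" for y :: "real^'d"
   using that g t by (auto simp: pressure_def bar c_def k_def s_def powr_mult powr_powr)
  have "((\<lambda>y. s * k * (K - s * \<alpha> * (c^2 * (y \<bullet> y)) / 2)) has_derivative (\<lambda>v. v \<bullet> ((- (k * \<alpha> * c^2)) *\<^sub>R x))) (at x)"
  proof -
   have "((\<lambda>y. s * k * (K - s * \<alpha> * (c^2 * (y \<bullet> y)) / 2)) has_derivative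
    (\<lambda>v. s * k * (0 - s * \<alpha> * (c^2 * (x \<bullet> v + v \<bullet> x)) / 2))) (at x)"
    by (auto intro!: derivative_eq_intros)
   moreover have "s * k * (0 - s * \<alpha> * (c^2 * (x \<bullet> v + v \<bullet> x)) / 2) = v \<bullet> ((- (k * \<alpha> * c^2)) *\<^sub>R x)" for v
   proof -
    have "s * k * (0 - s * \<alpha> * (c^2 * (x \<bullet> v + v \<bullet> x)) / 2) = - ((s * s) * (k * \<alpha> * c^2 * (v \<bullet> x)))"
     by (simp add: inner_commute[of x v])
    then show ?thesis using s by simp
   qed
   ultimately show ?thesis by (simp only:)
  qed
  then have "GDERIV (pressure \<gamma> (barenblatt \<gamma> K) t) x :> (- (k * \<alpha> * c^2)) *\<^sub>R x"
   unfolding gderiv_def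
  proof (rule has_derivative_transform_within_open[OF _ open_h[of c]])
   show "x \<in> {x. 0 < h (c *\<^sub>R x)}" using x by (simp add: c_def)
   show "s * k * (K - s * \<alpha> * (c^2 * (y \<bullet> y)) / 2) = pressure \<gamma> (barenblatt \<gamma> K) t y" if "y \<in> {x. 0 < h (c *\<^sub>R x)}" for y
    using that p[of y] by (simp add: h_def power_mult_distrib power2_norm_eq_inner)
  qed
  then have gr: "grad (pressure \<gamma> (barenblatt \<gamma> K) t) x = (- (k * \<alpha> * c^2)) *\<^sub>R x" by (rule grad_eq)
  have "\<bar>s\<bar> = 1" using g by (auto simp: s_def)
  then have "\<bar>pressure \<gamma> (barenblatt \<gamma> K) t x\<bar> powr b = k powr b * h (c *\<^sub>R x) powr b"
   using p[of x] x k by (simp add: c_def abs_mult powr_mult)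
  moreover have "(norm (grad (pressure \<gamma> (barenblatt \<gamma> K) t) x))^2 = k^2 * c^2 * (\<alpha>^2 * (norm (c *\<^sub>R x))^2)"
   unfolding gr by (simp add: power_mult_distrib power2_eq_square)
  moreover have "k powr b * (k^2 * c^2) = t powr (-1 - \<gamma> * d * (b + 1) * \<alpha>)"
  proof -
   have "k powr b * (k^2 * c^2) = t powr (- \<alpha> * d * \<gamma> * b + (- \<alpha> * d * \<gamma> + - \<alpha> * d * \<gamma> + (- \<alpha> + - \<alpha>)))"
    by (simp only: k_def c_def power2_eq_square powr_add powr_powr)
   also have "- \<alpha> * d * \<gamma> * b + (- \<alpha> * d * \<gamma> + - \<alpha> * d * \<gamma> + (- \<alpha> + - \<alpha>)) = - (\<alpha> * (d * \<gamma> + 2)) - \<gamma> * d * (b + 1) * \<alpha>"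
    by (simp add: algebra_simps)
   finally show ?thesis using \<alpha>(2) by simp
  qed
  ultimately show ?thesis by (simp add: G_def c_def mult_ac)
 qed
 define S where "S = (SUP \<xi>\<in>\<Omega>. ennreal (G \<xi>))"
 \<comment> \<open>For \<gamma> > 0, positivity of \<open>h\<close> bounds both \<open>h\<close> and
   \<open>\<alpha> * (norm \<xi>)^2 / 2\<close> by \<open>K\<close>. For \<gamma> < 0 the latter is
   at most \<open>h\<close>, so \<open>G\<close> is bounded by a multiple of
   \<open>h powr (b + 1)\<close>, which decreases in \<open>h\<close> and is largest at
   \<open>h = K\<close>.\<close>
 have "G \<xi> \<le> 2 * \<alpha> * K powr (b + 1)" if "\<xi> \<in> \<Omega>" for \<xi>
 proof -
  have h: "0 < h \<xi>" using that by (simp add: \<Omega>_def)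
  have al: "\<alpha>^2 * (norm \<xi>)^2 = 2 * \<alpha> * (\<alpha> * (norm \<xi>)^2 / 2)" by (simp add: power2_eq_square)
  show ?thesis
  proof (cases "0 < \<gamma>")
   case True
   then have hK: "h \<xi> = K - \<alpha> * (norm \<xi>)^2 / 2" by (simp add: h_def s_def)
   have "h \<xi> \<le> K" unfolding hK using \<alpha> by simp
   then have "G \<xi> \<le> K powr b * (2 * \<alpha> * K)"
    unfolding G_def al using h hK \<alpha> g True K by (intro mult_mono powr_mono2 mult_left_mono) auto
   also have "\<dots> = 2 * \<alpha> * K powr (b + 1)" using K by (simp add: powr_add)
   finally show ?thesis .
  next
   case False
   then have g0: "\<gamma> < 0" "b < -1" using g by auto
   then have "\<alpha> * (norm \<xi>)^2 / 2 \<le> h \<xi>" using K by (simp add: h_def s_def)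
   then have "G \<xi> \<le> h \<xi> powr b * (2 * \<alpha> * h \<xi>)"
    unfolding G_def al using \<alpha> by (intro mult_left_mono) auto
   also have "\<dots> = 2 * \<alpha> * h \<xi> powr (b + 1)" using h by (simp add: powr_add)
   also have "\<dots> \<le> 2 * \<alpha> * K powr (b + 1)"
    using \<alpha> K hneg[OF g0(1)] g0 by (intro mult_left_mono powr_mono2') auto
   finally show ?thesis .
  qed
 qed
 then have "S \<le> ennreal (2 * \<alpha> * K powr (b + 1))" unfolding S_def by (intro SUP_least ennreal_leI)
 then have Sfin: "S < top" by (rule le_less_trans) simp
 have Spos: "0 < S"
 proof -
  obtain i :: "real^'d" where i: "i \<in> Basis" using nonempty_Basis by blast
  \<comment> \<open>At this distance from the origin \<open>\<alpha> * (norm \<xi>)^2 / 2\<close>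
    equals \<open>K / 2\<close>, so \<open>h\<close> is \<open>K / 2\<close> or
    \<open>3 * K / 2\<close> according to the sign of \<gamma>. The origin itself would not do,
    because the gradient vanishes there.\<close>
  define \<xi> where "\<xi> = sqrt (K / \<alpha>) *\<^sub>R i"
  have n2: "(norm \<xi>)^2 = K / \<alpha>" using i K \<alpha> by (simp add: \<xi>_def power_mult_distrib)
  have "0 < h \<xi>" using g K \<alpha> by (auto simp: h_def n2 s_def)
  moreover have "0 < \<alpha>^2 * (norm \<xi>)^2" using K \<alpha> by (simp add: n2)
  ultimately have "\<xi> \<in> \<Omega>" "0 < ennreal (G \<xi>)" by (auto simp: \<Omega>_def G_def)
  then show ?thesis unfolding S_def by (intro less_le_trans[OF _ SUP_upper[of \<xi>]]) auto
 qed
 define C where "C = enn2real S"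
 have C: "0 < C" "S = ennreal C" using Sfin Spos by (auto simp: C_def enn2real_positive_iff)
 have "max_pressure_gradient \<gamma> b (barenblatt \<gamma> K :: real => real^'d => real) t = ennreal (C * t powr (-1 - \<gamma> * d * (b + 1) * \<alpha>))"
  if t: "0 < t" for t
 proof -
  define T where "T = t powr (-1 - \<gamma> * d * (b + 1) * \<alpha>)"
  have sc: "t powr (- \<alpha>) *\<^sub>R (t powr \<alpha> *\<^sub>R \<xi>) = \<xi>" "t powr \<alpha> *\<^sub>R (t powr (- \<alpha>) *\<^sub>R \<xi>) = \<xi>" for \<xi> :: "real^'d"
   using t by (simp_all add: powr_minus)
  have "{x::real^'d. \<gamma> > 0 \<longrightarrow> barenblatt \<gamma> K t x > 0} = {x. 0 < h (t powr (- \<alpha>) *\<^sub>R x)}"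
  proof (cases "0 < \<gamma>")
   case True
   then show ?thesis using t by (auto simp: bar zero_less_mult_iff max_def)
  next
   case False
   then have "\<gamma> < 0" using g by auto
   then show ?thesis using hneg K False by (auto intro: less_le_trans)
  qed
  also have "\<dots> = (\<lambda>\<xi>. t powr \<alpha> *\<^sub>R \<xi>) ` \<Omega>"
  proof (intro equalityI subsetI)
   fix x assume "x \<in> {x. 0 < h (t powr (- \<alpha>) *\<^sub>R x)}"
   then show "x \<in> (\<lambda>\<xi>. t powr \<alpha> *\<^sub>R \<xi>) ` \<Omega>"
    by (intro image_eqI[of _ _ "t powr (- \<alpha>) *\<^sub>R x"]) (simp_all only: sc \<Omega>_def mem_Collect_eq)
  qed (auto simp only: sc \<Omega>_def mem_Collect_eq)
  finally have A: "{x::real^'d. \<gamma> > 0 \<longrightarrow> barenblatt \<gamma> K t x > 0} = (\<lambda>\<xi>. t powr \<alpha> *\<^sub>R \<xi>) ` \<Omega>" .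
  have "max_pressure_gradient \<gamma> b (barenblatt \<gamma> K :: real => real^'d => real) t = (SUP \<xi>\<in>\<Omega>. ennreal T * ennreal (G \<xi>))"
   unfolding max_pressure_gradient_def A image_image
  proof (rule SUP_cong[OF refl])
   fix \<xi> assume "\<xi> \<in> \<Omega>"
   then have "0 < h (t powr (- \<alpha>) *\<^sub>R (t powr \<alpha> *\<^sub>R \<xi>))" by (simp only: sc \<Omega>_def mem_Collect_eq)
   from val[OF t this] show "ennreal (\<bar>pressure \<gamma> (barenblatt \<gamma> K) t (t powr \<alpha> *\<^sub>R \<xi>)\<bar> powr b *
     (norm (grad (pressure \<gamma> (barenblatt \<gamma> K) t) (t powr \<alpha> *\<^sub>R \<xi>)))^2) = ennreal T * ennreal (G \<xi>)"
    unfolding sc T_def by (simp add: ennreal_mult G_def)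
  qed
  also have "\<dots> = ennreal T * S" unfolding S_def by (rule SUP_mult_left_ennreal[symmetric])
  also have "\<dots> = ennreal (C * T)" using C by (simp add: ennreal_mult[symmetric] T_def mult.commute)
  finally show ?thesis by (simp add: T_def)
 qed
 then show ?thesis using C(1) by blast
qed

theorem theorem1p12:
  fixes \<gamma> b \<alpha> :: real
  assumes dim: "CARD('d::finite) \<ge> 2"
    and params: "(\<gamma> > 0 \<and> b > 0 \<and> \<gamma> < 1 / sqrt (real CARD('d) - 1)) \<or>
                 (\<gamma> < 0 \<and> b < -1 \<and> \<bar>\<gamma>\<bar> < 2 / real CARD('d))"
    and lower: "1 - sqrt (1 - \<gamma>\<^sup>2 * (real CARD('d) - 1)) < \<gamma> * b"
    and upper: "\<gamma> * b < 1 + sqrt (1 - \<gamma>\<^sup>2 * (real CARD('d) - 1))"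
    and alpha: "\<alpha> = similarity_exponent CARD('d) \<gamma>"
  shows "(\<forall>(n0 :: real^'d \<Rightarrow> real) n.
            admissible_datum \<gamma> n0 \<and> strong_solution \<gamma> n0 n \<and> regular_density \<gamma> n \<longrightarrow>
            (\<exists>C>0. \<forall>t>0. max_pressure_gradient \<gamma> b n t
               \<le> ennreal (C * t powr (-1 - \<gamma> * real CARD('d) * (b + 1) * \<alpha>)))) \<and>
         (\<forall>K>0. \<exists>C>0. \<forall>t>0.
            max_pressure_gradient \<gamma> b (barenblatt \<gamma> K :: real \<Rightarrow> real^'d \<Rightarrow> real) t
               = ennreal (C * t powr (-1 - \<gamma> * real CARD('d) * (b + 1) * \<alpha>))) \<and>
         (\<forall>(n0 :: real^'d \<Rightarrow> real) n.
            admissible_datum \<gamma> n0 \<and> ess_bounded n0 \<and>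
            strong_solution \<gamma> n0 n \<and> regular_density \<gamma> n \<longrightarrow>
            (\<exists>C>0. \<forall>t>0. max_pressure_gradient \<gamma> b n t \<le> ennreal (C * t powr (-1))))"
proof -
 define d where "d = real CARD('d)"
 have d: "2 \<le> d" using dim by (simp add: d_def)
 have g: "-1 < \<gamma>" "\<gamma> \<noteq> 0" "-2 < d * \<gamma>" and fast: "\<gamma> < 0 ==> b < - 1"
 proof -
  show "\<gamma> \<noteq> 0" "\<gamma> < 0 ==> b < - 1" using params by auto
  show g2: "-2 < d * \<gamma>"
  proof (cases "0 < \<gamma>")
   case True
   then have "0 < d * \<gamma>" using d by simp
   then show ?thesis by simp
  qed (use params d in \<open>auto simp: d_def[symmetric] field_simps\<close>)
  show "-1 < \<gamma>"
  proof (rule ccontr)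
   assume "\<not> -1 < \<gamma>"
   then have "d * \<gamma> \<le> d * - 1" using d by (intro mult_left_mono) auto
   then show False using g2 d by simp
  qed
 qed
 have dg: "0 < d * \<gamma> + 2" using g by simp
 have sg: "0 < \<gamma> \<and> 0 < b \<or> \<gamma> < 0 \<and> b < - 1" using params by auto
 have slow: "0 < b \<and> 0 < 2 * \<gamma> * b - (\<gamma> * b)^2 - (d - 1) * \<gamma>^2" if "0 < \<gamma>"
 proof -
  \<comment> \<open>The two-sided condition on \<open>\<gamma> * b\<close> is a bound for the
    distance to 1. Squaring it gives the positivity of the quadratic polynomial on which the slow
    Lipschitz bound rests.\<close>
  have lu: "\<bar>\<gamma> * b - 1\<bar> < sqrt (1 - \<gamma>^2 * (d - 1))" using lower upper by (simp add: d_def abs_less_iff)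
  then have "0 < sqrt (1 - \<gamma>^2 * (d - 1))" by linarith
  then have "(\<gamma> * b - 1)^2 < 1 - \<gamma>^2 * (d - 1)"
   using power_strict_mono[OF lu, of 2] by simp
  then show ?thesis using sg that by (simp add: power2_diff algebra_simps)
 qed
 have \<alpha>: "\<alpha> = 1 / (d * \<gamma> + 2)" by (simp add: alpha similarity_exponent_def d_def)
 define c where "c = (if \<gamma> > 0 then 4 * \<gamma> / (2 * \<gamma> * b - (\<gamma> * b)^2 - (d - 1) * \<gamma>^2) else 4 / (2 + d * \<gamma>))"
 have c: "0 < c" using slow dg by (auto simp: c_def)
 have bound: "max_pressure_gradient \<gamma> b n t \<le> ennreal (c * B powr (\<gamma> * (b + 1)) / t)"
  if "strong_solution \<gamma> n0 n" "regular_density \<gamma> n" "0 < t" "0 < B" "\<And>s x. s \<in> {t / 2..t} ==> n s x \<le> B"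
  for n0 and n :: "real => real^'d => real" and t B :: real
  unfolding c_def d_def by (rule max_pressure_gradient_le) (use that g slow fast in \<open>auto simp: d_def\<close>)
 have part1: "\<exists>C>0. \<forall>t>0. max_pressure_gradient \<gamma> b n t \<le> ennreal (C * t powr (-1 - \<gamma> * d * (b + 1) * \<alpha>))"
  if sol: "strong_solution \<gamma> n0 n" and reg: "regular_density \<gamma> n" for n0 and n :: "real => real^'d => real"
 proof -
  obtain C where C: "0 < C" "\<And>t x. 0 < t ==> n t x \<le> C * t powr - (d / (d * \<gamma> + 2))"
   using strong_solution_sup_bound[OF sol reg g(1,2)] g(3) unfolding d_def by blast
  \<comment> \<open>The factor with \<open>1 / 2\<close> arises because the decay of the supremum is
    evaluated at \<open>t / 2\<close>, the start of the window over which the gradient bound needs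
    it.\<close>
  define A where "A = c * (C * (1 / 2) powr - (d * \<alpha>)) powr (\<gamma> * (b + 1))"
  have "max_pressure_gradient \<gamma> b n t \<le> ennreal (A * t powr (-1 - \<gamma> * d * (b + 1) * \<alpha>))" if t: "0 < t" for t
  proof -
   have "max_pressure_gradient \<gamma> b n t \<le> ennreal (c * (C * (t / 2) powr - (d * \<alpha>)) powr (\<gamma> * (b + 1)) / t)"
   proof (rule bound[OF sol reg t])
    fix s x assume s: "s \<in> {t / 2..t}"
    have "n s x \<le> C * s powr - (d * \<alpha>)" using C(2)[of s x] s t by (simp add: \<alpha>)
    also have "\<dots> \<le> C * (t / 2) powr - (d * \<alpha>)"
     using C s t d dg by (intro mult_left_mono powr_mono2') (auto simp: \<alpha>)
    finally show "n s x \<le> C * (t / 2) powr - (d * \<alpha>)" .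
   qed (use C t in auto)
   also have "c * (C * (t / 2) powr - (d * \<alpha>)) powr (\<gamma> * (b + 1)) / t = A * t powr (-1 - \<gamma> * d * (b + 1) * \<alpha>)"
   proof -
    have "(t / 2) powr - (d * \<alpha>) = (1 / 2) powr - (d * \<alpha>) * t powr - (d * \<alpha>)"
     using t powr_mult[of "1 / 2" t "- (d * \<alpha>)"] by simp
    then have "(C * (t / 2) powr - (d * \<alpha>)) powr (\<gamma> * (b + 1)) = (C * (1 / 2) powr - (d * \<alpha>)) powr (\<gamma> * (b + 1)) * t powr (- (d * \<alpha>) * (\<gamma> * (b + 1)))"
     using C t by (simp add: powr_mult powr_powr)
    moreover have "t powr (- (d * \<alpha>) * (\<gamma> * (b + 1))) / t = t powr (- (d * \<alpha>) * (\<gamma> * (b + 1)) - 1)"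
     using t by (simp add: powr_diff)
    moreover have "- (d * \<alpha>) * (\<gamma> * (b + 1)) - 1 = -1 - \<gamma> * d * (b + 1) * \<alpha>" by (simp add: algebra_simps)
    ultimately show ?thesis by (metis A_def mult.assoc times_divide_eq_right)
   qed
   finally show ?thesis .
  qed
  moreover have "0 < A" using c C by (simp add: A_def)
  ultimately show ?thesis by blast
 qed
 have part3: "\<exists>C>0. \<forall>t>0. max_pressure_gradient \<gamma> b n t \<le> ennreal (C * t powr (-1))"
  if sol: "strong_solution \<gamma> n0 n" and reg: "regular_density \<gamma> n" and bdd: "ess_bounded n0" for n0 and n :: "real => real^'d => real"
 proof -
  obtain M where M: "AE x in lebesgue. \<bar>n0 x\<bar> \<le> M" using bdd by (auto simp: ess_bounded_def)
  \<comment> \<open>The essential bound may be 0, while the comparison level has to be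
    positive.\<close>
  define K where "K = max 1 M"
  have K: "0 < K" by (simp add: K_def)
  have "AE x in lebesgue. n0 x \<le> K" using M by eventually_elim (auto simp: K_def)
  from strong_solution_le_initial[OF sol reg g(1,2) _ _ K this]
  have le: "n t x \<le> K" if "0 < t" for t x using g(3) d that by (simp add: d_def)
  have "max_pressure_gradient \<gamma> b n t \<le> ennreal (c * K powr (\<gamma> * (b + 1)) * t powr (-1))" if t: "0 < t" for t
  proof -
   have "max_pressure_gradient \<gamma> b n t \<le> ennreal (c * K powr (\<gamma> * (b + 1)) / t)"
    by (rule bound[OF sol reg t K]) (use t le in auto)
   then show ?thesis using t by (simp add: powr_minus divide_inverse)
  qed
  then show ?thesis using c K by (intro exI[of _ "c * K powr (\<gamma> * (b + 1))"]) auto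
 qed
 have part2: "\<exists>C>0. \<forall>t>0. max_pressure_gradient \<gamma> b (barenblatt \<gamma> K :: real => real^'d => real) t
   = ennreal (C * t powr (-1 - \<gamma> * d * (b + 1) * \<alpha>))" if "0 < K" for K
  unfolding \<alpha> d_def by (rule barenblatt_max_pressure_gradient[OF sg _ that]) (use g in \<open>simp add: d_def\<close>)
 show ?thesis using part1 part2 part3 unfolding d_def by blast
qed

end
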